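(* Suppose that $\Omega \subset \mathbb{R}^2$ is a smooth, bounded and simply connected open set. Then there exists $B_0=B_0(\Omega)>0$ such that for all $B \in (0,B_0)$, $$\lambda_1^N(B,\Omega) \leq \lambda_1^N(B, D(0,R_\Omega)).$$
   Context: For a smooth, bounded, connected open set $\Omega\subset\mathbb{R}^2$, $A(\Omega)$ denotes its area and $R_\Omega>0$ is defined by $\pi R_\Omega^2 = A(\Omega)$; $D(0,R)$ is the open disc of radius $R$ centered at $0$. Let $\mathbf{A}(x)=\frac12(-x_2,x_1)$, so that $\operatorname{curl}\mathbf{A}=1$. For $B\geq 0$, $\lambda_1^N(B,\Omega)$ denotes the lowest eigenvalue of the magnetic Neumann Laplacian $(-i\nabla + B\mathbf{A})^2$ in $L^2(\Omega)$, i.e. the self-adjoint operator associated with the quadratic form $u\mapsto \int_\Omega |(-i\nabla + B\mathbf{A})u|^2\,dx$ with form domain $H^1(\Omega)$. "Simply connected" includes connected. *)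

theory Defs
  imports "HOL-Analysis.Analysis"
begin

primrec Ck_on :: "nat \<Rightarrow> 'a::euclidean_space set \<Rightarrow> ('a \<Rightarrow> 'b::real_normed_vector) \<Rightarrow> bool" where
  "Ck_on 0 U f \<longleftrightarrow> continuous_on U f"
| "Ck_on (Suc k) U f \<longleftrightarrow>
     (\<forall>x\<in>U. f differentiable (at x)) \<and>
     (\<forall>b\<in>Basis. Ck_on k U (\<lambda>x. frechet_derivative f (at x) b))"

definition smooth_on :: "'a::euclidean_space set \<Rightarrow> ('a \<Rightarrow> 'b::real_normed_vector) \<Rightarrow> bool" where
  "smooth_on U f \<longleftrightarrow> (\<forall>k. Ck_on k U f)"

(* Near each boundary point the set is one side of a regular level set of a smooth function;
   by the implicit function theorem this is the usual condition that the set is locally the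
   region below the graph of a smooth function. *)
definition smooth_boundary :: "'a::euclidean_space set \<Rightarrow> bool" where
  "smooth_boundary \<Omega> \<longleftrightarrow>
     (\<forall>p\<in>frontier \<Omega>. \<exists>U (f :: 'a \<Rightarrow> real).
        open U \<and> p \<in> U \<and> smooth_on U f \<and>
        (\<forall>x\<in>U. frechet_derivative f (at x) \<noteq> (\<lambda>v. 0)) \<and>
        \<Omega> \<inter> U = {x\<in>U. f x < 0})"

definition area :: "(real^2) set \<Rightarrow> real" where
  "area \<Omega> = measure lebesgue \<Omega>"

definition eq_radius :: "(real^2) set \<Rightarrow> real" where
  "eq_radius \<Omega> = sqrt (area \<Omega> / pi)"

lemma eq_radius_props:
  assumes "open \<Omega>" "bounded \<Omega>" "\<Omega> \<noteq> {}"
  shows "eq_radius \<Omega> > 0" and "pi * (eq_radius \<Omega>)\<^sup>2 = area \<Omega>"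
proof -
  have "\<Omega> \<in> lmeasurable"
    using assms by (intro bounded_set_imp_lmeasurable) auto
  moreover have "\<not> negligible \<Omega>"
    using assms open_not_negligible by blast
  ultimately have "area \<Omega> > 0"
    by (simp add: area_def negligible_iff_measure zero_less_measure_iff)
  then show "eq_radius \<Omega> > 0" and "pi * (eq_radius \<Omega>)\<^sup>2 = area \<Omega>"
    by (simp_all add: eq_radius_def)
qed

(* Elements of the function spaces below are representatives, not classes modulo null sets;
   their values outside \<Omega> are irrelevant. *)
definition L2 :: "(real^2) set \<Rightarrow> (real^2 \<Rightarrow> complex) set" where
  "L2 \<Omega> = {u. u \<in> borel_measurable (lebesgue_on \<Omega>) \<and>
              integrable (lebesgue_on \<Omega>) (\<lambda>x. (cmod (u x))\<^sup>2)}"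

definition L2_inner :: "(real^2) set \<Rightarrow> (real^2 \<Rightarrow> complex) \<Rightarrow> (real^2 \<Rightarrow> complex) \<Rightarrow> complex" where
  "L2_inner \<Omega> u v = (LINT x|lebesgue_on \<Omega>. u x * cnj (v x))"

definition test_function :: "(real^2) set \<Rightarrow> (real^2 \<Rightarrow> real) \<Rightarrow> bool" where
  "test_function \<Omega> \<phi> \<longleftrightarrow>
     smooth_on UNIV \<phi> \<and> compact (closure {x. \<phi> x \<noteq> 0}) \<and> closure {x. \<phi> x \<noteq> 0} \<subseteq> \<Omega>"

definition locally_integrable :: "(real^2) set \<Rightarrow> (real^2 \<Rightarrow> complex) \<Rightarrow> bool" where
  "locally_integrable \<Omega> u \<longleftrightarrow> (\<forall>K. compact K \<and> K \<subseteq> \<Omega> \<longrightarrow> integrable (lebesgue_on K) u)"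

(* Real-valued test functions suffice, by linearity. *)
definition has_weak_partial ::
    "(real^2) set \<Rightarrow> 2 \<Rightarrow> (real^2 \<Rightarrow> complex) \<Rightarrow> (real^2 \<Rightarrow> complex) \<Rightarrow> bool" where
  "has_weak_partial \<Omega> j u g \<longleftrightarrow>
     locally_integrable \<Omega> u \<and> locally_integrable \<Omega> g \<and>
     (\<forall>\<phi>. test_function \<Omega> \<phi> \<longrightarrow>
        (LINT x|lebesgue_on \<Omega>. of_real (frechet_derivative \<phi> (at x) (axis j 1)) * u x) =
        - (LINT x|lebesgue_on \<Omega>. of_real (\<phi> x) * g x))"

definition H1 :: "(real^2) set \<Rightarrow> (real^2 \<Rightarrow> complex) set" where
  "H1 \<Omega> = {u \<in> L2 \<Omega>. \<forall>j. \<exists>g \<in> L2 \<Omega>. has_weak_partial \<Omega> j u g}"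

(* A weak derivative is unique up to a null set, so the choice of representative does not
   affect any of the integrals below. *)
definition weak_partial :: "(real^2) set \<Rightarrow> 2 \<Rightarrow> (real^2 \<Rightarrow> complex) \<Rightarrow> real^2 \<Rightarrow> complex" where
  "weak_partial \<Omega> j u = (SOME g. g \<in> L2 \<Omega> \<and> has_weak_partial \<Omega> j u g)"

definition vec_potential :: "real^2 \<Rightarrow> real^2" where
  "vec_potential x = (1/2) *\<^sub>R vector [- (x $ 2), x $ 1]"

definition magnetic_partial ::
    "real \<Rightarrow> (real^2) set \<Rightarrow> 2 \<Rightarrow> (real^2 \<Rightarrow> complex) \<Rightarrow> real^2 \<Rightarrow> complex" where
  "magnetic_partial B \<Omega> j u x =
     - \<i> * weak_partial \<Omega> j u x + of_real (B * vec_potential x $ j) * u x"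

(* The sesquilinear form obtained by polarizing the quadratic form, linear in the first argument. *)
definition magnetic_form ::
    "real \<Rightarrow> (real^2) set \<Rightarrow> (real^2 \<Rightarrow> complex) \<Rightarrow> (real^2 \<Rightarrow> complex) \<Rightarrow> complex" where
  "magnetic_form B \<Omega> u v =
     (LINT x|lebesgue_on \<Omega>. (\<Sum>j\<in>UNIV. magnetic_partial B \<Omega> j u x * cnj (magnetic_partial B \<Omega> j v x)))"

(* The graph of the self-adjoint operator associated with the form with domain H1: u lies in
   the operator domain and is mapped to f. *)
definition magnetic_neumann ::
    "real \<Rightarrow> (real^2) set \<Rightarrow> (real^2 \<Rightarrow> complex) \<Rightarrow> (real^2 \<Rightarrow> complex) \<Rightarrow> bool" where
  "magnetic_neumann B \<Omega> u f \<longleftrightarrow>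
     u \<in> H1 \<Omega> \<and> f \<in> L2 \<Omega> \<and> (\<forall>v\<in>H1 \<Omega>. magnetic_form B \<Omega> u v = L2_inner \<Omega> f v)"

(* Eigenvalues are taken to be real because the operator is self-adjoint. *)
definition neumann_eigenvalue :: "real \<Rightarrow> (real^2) set \<Rightarrow> real \<Rightarrow> bool" where
  "neumann_eigenvalue B \<Omega> \<mu> \<longleftrightarrow>
     (\<exists>u. \<not> (AE x in lebesgue_on \<Omega>. u x = 0) \<and>
          magnetic_neumann B \<Omega> u (\<lambda>x. of_real \<mu> * u x))"

definition lambda1N :: "real \<Rightarrow> (real^2) set \<Rightarrow> real" where
  "lambda1N B \<Omega> = (LEAST \<mu>. neumann_eigenvalue B \<Omega> \<mu>)"

end

theory Submission
  imports Defs "HOL-Complex_Analysis.Complex_Analysis"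
begin

text \<open>
  For small \<open>B\<close> the comparison is decided by the quadratic coefficient of \<open>\<lambda>\<^sub>1(B,\<Omega>)\<close>. At \<open>B = 0\<close>
  the ground state is constant. Multiplying it by a phase of size \<open>B\<close> subtracts a gradient from the
  vector potential, so that to order \<open>B\<^sup>2\<close> the eigenvalue is the mean over \<open>\<Omega>\<close> of the square of the part of
  \<open>A\<close> that is orthogonal to gradients, which is essentially the torsional rigidity of
  \<open>\<Omega>\<close>. Among simply connected domains of given area the disc maximizes the torsional rigidity, and it is the only maximizer.

  Both sides of the comparison rest on \<open>lambda1N_minimum\<close>: for small \<open>B\<close> the lowest eigenvalue is the attained
  minimum of the Rayleigh quotient. Weak gradients being closed in the mean, a minimizing
  sequence converges as soon as the means of its members do, by the parallelogram law and the Poincare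
  inequality, so that compactness is needed for one complex number only. The Poincare inequality is obtained from the estimate
  \<open>difference_inequality\<close> of a translate: it gives the inequality on convex sets, carries it to the part of \<open>\<Omega>\<close> near a boundary
  point by pushing that part inwards, and a finite chain of overlapping sets covers \<open>\<Omega>\<close>.

  On the disc \<open>A\<close> itself is orthogonal to all gradients, and \<open>disc_lower_bound\<close> gives
  \<open>\<lambda>\<^sub>1 \<ge> B\<^sup>2 V / (8 \<pi>) - K B\<^sup>3\<close>, where \<open>V\<close> is the area. On \<open>\<Omega>\<close> take a Riemann map \<open>f\<close> of the unit disc onto \<open>\<Omega>\<close>. For a
  polynomial \<open>q\<close>, the phase built from a primitive of \<open>q\<close> has energy \<open>B\<^sup>2/4\<close> times the squared
  norm of \<open>cnj f \<cdot> f' - q\<close> on the unit disc (\<open>conformal_trial_function\<close>), and \<open>\<lambda>\<^sub>1\<close> is at most this energy divided by \<open>V\<close>.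
  The comparison therefore holds when some \<open>q\<close> makes the squared norm smaller than \<open>V\<^sup>2/(2 \<pi>)\<close>.

  For a polynomial \<open>f\<close> with coefficients \<open>a\<^sub>n\<close> the best \<open>q\<close> is the Bergman projection of \<open>cnj f \<cdot> f'\<close>, and the squared norm of the remainder is \<open>\<pi>/2\<close> times
  a sum over \<open>s \<ge> 1\<close> and \<open>n\<close> of the squares of \<open>\<Sum> a\<^sub>p a\<^sub>l\<close> over \<open>p + l = n\<close> and \<open>p, l \<ge> s\<close>. Cauchy-Schwarz in each of these sums bounds the total by
  \<open>(\<Sum> n \<bar>a\<^sub>n\<bar>\<^sup>2)\<^sup>2\<close>, with a loss that controls \<open>a\<^sub>1 a\<^sub>n\<^sub>-\<^sub>1 - a\<^sub>2 a\<^sub>n\<^sub>-\<^sub>2\<close> (\<open>polynomial_torsion_bound\<close>). Taylor polynomials of the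
  dilations of \<open>f\<close> carry this to the Riemann map. So either the inequality is strict, or
  the Taylor coefficients form a geometric sequence. In the latter case \<open>f\<close> is a Moebius map and \<open>\<Omega>\<close> is a disc
  (\<open>geometric_taylor_imp_disc\<close>), which translation and a gauge transformation move to the origin (\<open>lambda1N_translated_disc\<close>).
\<close>

section \<open>Smooth functions of compact support\<close>

text \<open>Smoothness without computing higher derivatives: it is enough to exhibit a family of functions that contains all its partial derivatives.\<close>
lemma Ck_on_closed_family:
  fixes F :: "('a::euclidean_space \<Rightarrow> real) set"
  assumes diff: "\<And>f x. f \<in> F \<Longrightarrow> f differentiable (at x)"
    and der: "\<And>f b. f \<in> F \<Longrightarrow> b \<in> Basis \<Longrightarrow> (\<lambda>x. frechet_derivative f (at x) b) \<in> F"
    and "f \<in> F"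
  shows "Ck_on k UNIV f"
  using \<open>f \<in> F\<close>
proof (induction k arbitrary: f)
  case 0
  then show ?case
    by (auto intro!: differentiable_imp_continuous_on simp: differentiable_on_def diff)
next
  case (Suc k)
  then show ?case by (auto simp: diff der)
qed

text \<open>The case \<open>m = 0\<close> is the classical flat function. Dividing by powers of \<open>t\<close> makes the family closed under differentiation up to sums and multiples.\<close>
definition flat :: "nat \<Rightarrow> real \<Rightarrow> real" where
  "flat m t = (if t > 0 then exp (- (1/t)) / t ^ m else 0)"

lemma flat_has_derivative:
  "(flat m has_real_derivative (flat (m+2) t - of_nat m * flat (m+1) t)) (at t)"
proof (cases t "0::real" rule: linorder_cases)
  case less
  have "((\<lambda>t. 0::real) has_real_derivative 0) (at t)" by simp
  moreover have "\<forall>\<^sub>F s in nhds t. flat m s = 0"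
    using eventually_nhds_in_open[of "{..<0}" t] less
    by (auto elim!: eventually_mono simp: flat_def)
  ultimately show ?thesis
    using less by (subst DERIV_cong_ev[where g="\<lambda>_. 0" and y=t]) (auto simp: flat_def)
next
  case greater
  have "((\<lambda>t. exp (- (1/t)) / t ^ m) has_real_derivative (flat (m+2) t - of_nat m * flat (m+1) t)) (at t)"
    using greater
    apply (auto intro!: derivative_eq_intros simp: flat_def field_simps power2_eq_square)
    apply (cases m; simp add: field_simps)
    done
  moreover have "\<forall>\<^sub>F s in nhds t. flat m s = exp (- (1/s)) / s ^ m"
    using eventually_nhds_in_open[of "{0<..}" t] greater
    by (auto elim!: eventually_mono simp: flat_def)
  ultimately show ?thesis
    by (subst DERIV_cong_ev[where g="\<lambda>t. exp (- (1/t)) / t ^ m" and y=t]) auto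
next
  case equal
  have lim: "((\<lambda>s. flat m s / s) \<longlongrightarrow> 0) (at 0)"
  proof -
    have r: "((\<lambda>s. flat m s / s) \<longlongrightarrow> 0) (at_right 0)"
    proof -
      have "((\<lambda>x::real. x ^ (m+1) / exp x) \<longlongrightarrow> 0) at_top"
        by (rule tendsto_power_div_exp_0)
      then have "((\<lambda>s::real. inverse s ^ (m+1) / exp (inverse s)) \<longlongrightarrow> 0) (at_right 0)"
        using filterlim_compose filterlim_inverse_at_top_right by blast
      then show ?thesis
        by (rule Lim_transform_eventually)
          (auto simp: eventually_at_right_field flat_def field_simps exp_minus intro!: exI[of _ 1])
    qed
    have l: "((\<lambda>s. flat m s / s) \<longlongrightarrow> 0) (at_left 0)"
      by (rule Lim_transform_eventually[of "\<lambda>_. 0"])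
        (auto simp: eventually_at_left_field flat_def intro!: exI[of _ "-1"])
    show ?thesis using r l by (simp add: filterlim_split_at)
  qed
  have "(flat m has_real_derivative 0) (at 0)"
    unfolding has_field_derivative_iff using lim by (simp add: flat_def)
  then show ?thesis using equal by (simp add: flat_def)
qed

text \<open>A set of smooth functions that is closed under partial derivatives and contains the cut-offs that are used below.\<close>
inductive_set bump_ring :: "('a::euclidean_space \<Rightarrow> real) set" where
  const: "(\<lambda>_. c) \<in> bump_ring"
| coord: "(\<lambda>x. x \<bullet> b) \<in> bump_ring"
| flat: "(\<lambda>x. flat m (\<alpha> - \<beta> * (norm (x - a))\<^sup>2)) \<in> bump_ring"
| add: "f \<in> bump_ring \<Longrightarrow> g \<in> bump_ring \<Longrightarrow> (\<lambda>x. f x + g x) \<in> bump_ring"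
| mult: "f \<in> bump_ring \<Longrightarrow> g \<in> bump_ring \<Longrightarrow> (\<lambda>x. f x * g x) \<in> bump_ring"

lemma bump_ring_derivative:
  assumes "f \<in> bump_ring"
  obtains f' where "\<And>x. (f has_derivative f' x) (at x)" "\<And>v. (\<lambda>x. f' x v) \<in> bump_ring"
  using assms
proof (induction arbitrary: thesis)
  case (const c)
  show ?case by (rule const[of "\<lambda>x v. 0"]) (auto intro: bump_ring.const)
next
  case (coord b)
  show ?case by (rule coord[of "\<lambda>x v. v \<bullet> b"]) (auto intro!: bump_ring.const derivative_eq_intros)
next
  case (flat m \<alpha> \<beta> a)
  define D where "D x = flat (m+2) (\<alpha> - \<beta> * (norm (x - a))\<^sup>2)
     + (- of_nat m) * flat (m+1) (\<alpha> - \<beta> * (norm (x - a))\<^sup>2)" for x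
  show ?case
  proof (rule flat[of "\<lambda>x v. D x * ((-2*\<beta>) * (x \<bullet> v + - (a \<bullet> v)))"])
    show "((\<lambda>x. flat m (\<alpha> - \<beta> * (norm (x - a))\<^sup>2)) has_derivative
         (\<lambda>v. D x * ((-2*\<beta>) * (x \<bullet> v + - (a \<bullet> v))))) (at x)" for x
    proof -
      have 1: "((\<lambda>x. \<alpha> - \<beta> * (norm (x - a))\<^sup>2) has_derivative (\<lambda>v. (-2*\<beta>) * (x \<bullet> v + - (a \<bullet> v)))) (at x)"
        unfolding power2_norm_eq_inner
        by (auto intro!: derivative_eq_intros simp: algebra_simps inner_commute)
      have 2: "(flat m has_derivative (\<lambda>t. D x * t)) (at (\<alpha> - \<beta> * (norm (x - a))\<^sup>2))"
        using flat_has_derivative[of m "\<alpha> - \<beta> * (norm (x - a))\<^sup>2"]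
        by (simp add: has_field_derivative_def D_def)
      show ?thesis using diff_chain_at[OF 1 2] by (simp add: o_def)
    qed
    show "(\<lambda>x. D x * ((-2*\<beta>) * (x \<bullet> v + - (a \<bullet> v)))) \<in> bump_ring" for v
      unfolding D_def by (intro bump_ring.intros)
  qed
next
  case (add f g)
  obtain f' where "\<And>x. (f has_derivative f' x) (at x)" "\<And>v. (\<lambda>x. f' x v) \<in> bump_ring"
    using add by blast
  moreover obtain g' where "\<And>x. (g has_derivative g' x) (at x)" "\<And>v. (\<lambda>x. g' x v) \<in> bump_ring"
    using add by blast
  ultimately show ?case
    by (intro add.prems[of "\<lambda>x v. f' x v + g' x v"])
      (auto intro: bump_ring.add derivative_eq_intros)
next
  case (mult f g)
  obtain f' where "\<And>x. (f has_derivative f' x) (at x)" "\<And>v. (\<lambda>x. f' x v) \<in> bump_ring"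
    using mult by blast
  moreover obtain g' where "\<And>x. (g has_derivative g' x) (at x)" "\<And>v. (\<lambda>x. g' x v) \<in> bump_ring"
    using mult by blast
  ultimately show ?case using mult.hyps
  proof (intro mult.prems[of "\<lambda>x v. f x * g' x v + f' x v * g x"])
    fix v assume "\<And>v. (\<lambda>x. f' x v) \<in> bump_ring" "\<And>v. (\<lambda>x. g' x v) \<in> bump_ring"
    then show "(\<lambda>x. f x * g' x v + f' x v * g x) \<in> bump_ring"
      using mult.hyps by (intro bump_ring.add bump_ring.mult) auto
  qed (auto intro: derivative_eq_intros)
qed

lemma bump_ring_smooth:
  assumes "f \<in> bump_ring"
  shows "smooth_on UNIV f"
  unfolding smooth_on_def
proof (intro allI Ck_on_closed_family[OF _ _ assms])
  fix f :: "'a \<Rightarrow> real" and x b assume "f \<in> bump_ring"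
  then obtain f' where f': "\<And>x. (f has_derivative f' x) (at x)" "\<And>v. (\<lambda>x. f' x v) \<in> bump_ring"
    using bump_ring_derivative by blast
  then show "f differentiable at x" by (auto simp: differentiable_def)
  have "frechet_derivative f (at x) = f' x" for x
    using f'(1) frechet_derivative_at by metis
  then show "(\<lambda>x. frechet_derivative f (at x) b) \<in> bump_ring"
    using f' by simp
qed

lemma bump_ring_differentiable:
  assumes "f \<in> bump_ring"
  shows "(f has_derivative frechet_derivative f (at x)) (at x)"
    and "(\<lambda>x. frechet_derivative f (at x) v) \<in> bump_ring"
    and "continuous_on S f"
proof -
  obtain f' where f': "\<And>x. (f has_derivative f' x) (at x)" "\<And>v. (\<lambda>x. f' x v) \<in> bump_ring"
    using bump_ring_derivative assms by blast
  have *: "frechet_derivative f (at x) = f' x" for x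
    using f'(1) frechet_derivative_at by metis
  show "(f has_derivative frechet_derivative f (at x)) (at x)" using f' * by simp
  show "(\<lambda>x. frechet_derivative f (at x) v) \<in> bump_ring" using f' * by simp
  show "continuous_on S f"
    using f'(1) has_derivative_continuous continuous_at_imp_continuous_on by blast
qed

lemma bump_ring_test_function:
  assumes "f \<in> bump_ring" "{x. f x \<noteq> 0} \<subseteq> K" "compact K" "K \<subseteq> \<Omega>"
  shows "test_function \<Omega> f"
proof -
  have "closure {x. f x \<noteq> 0} \<subseteq> K"
    using assms by (simp add: closure_minimal compact_imp_closed)
  moreover have "compact (closure {x. f x \<noteq> 0})"
    using assms bounded_subset compact_imp_bounded by (metis compact_closure)
  ultimately show ?thesis
    unfolding test_function_def using assms bump_ring_smooth by auto
qed

lemma flat_nonneg: "0 \<le> flat m t"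
  by (simp add: flat_def)

lemma flat0_le_1: "flat 0 t \<le> 1"
  by (simp add: flat_def)

text \<open>A radial bump function on the unit disc of integral one; the kernel of the mollification.\<close>
definition mol :: "real^2 \<Rightarrow> real" where
  "mol x = flat 0 (1 - (norm x)\<^sup>2) / (LBINT y. flat 0 (1 - (norm (y::real^2))\<^sup>2))"

lemma flat_unit_ring: "(\<lambda>x::real^2. flat 0 (1 - (norm x)\<^sup>2)) \<in> bump_ring"
  using bump_ring.flat[of 0 1 1 "0::real^2"] by simp

lemma flat_unit_integral:
  "integrable lborel (\<lambda>y::real^2. flat 0 (1 - (norm y)\<^sup>2))"
  "(LBINT y. flat 0 (1 - (norm (y::real^2))\<^sup>2)) > 0"
proof -
  let ?f = "\<lambda>y::real^2. flat 0 (1 - (norm y)\<^sup>2)"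
  have c: "continuous_on UNIV ?f" using bump_ring_differentiable flat_unit_ring by blast
  then have m: "?f \<in> borel_measurable borel" by (rule borel_measurable_continuous_onI)
  have 0: "?f y = 0" if "norm y \<ge> 1" for y
  proof -
    have "1 \<le> (norm y)\<^sup>2" using that by (rule one_le_power)
    then show ?thesis by (simp add: flat_def)
  qed
  have "integrable lborel (\<lambda>y::real^2. indicator (cball 0 1) y *\<^sub>R (?f y))"
    using borel_integrable_compact[of "cball (0::real^2) 1" ?f] c continuous_on_subset
    by (auto simp: set_integrable_def)
  moreover have "(\<lambda>y::real^2. indicator (cball 0 1) y *\<^sub>R (?f y)) = ?f"
    using 0 by (auto simp: indicator_def fun_eq_iff)
  ultimately show i: "integrable lborel ?f" by simp
  have "(LBINT y. ?f y) \<ge> (LBINT y. exp (-2) * indicator (ball (0::real^2) (1/2)) y)"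
  proof (rule integral_mono[OF _ i])
    show "integrable lborel (\<lambda>y::real^2. exp (-2) * indicator (ball 0 (1/2)) y :: real)"
      by (intro integrable_mult_right integrable_real_indicator) (auto simp: emeasure_ball)
    fix y :: "real^2"
    show "exp (-2) * indicator (ball 0 (1/2)) y \<le> ?f y"
    proof (cases "norm y < 1/2")
      case True
      then have "(norm y)\<^sup>2 \<le> (1/2)\<^sup>2" by (intro power_mono) auto
      then have "1 - (norm y)\<^sup>2 \<ge> 1/2" by (simp add: power2_eq_square)
      moreover from this have "1 / (1 - (norm y)\<^sup>2) \<le> 2" by (simp add: field_simps)
      ultimately show ?thesis using True by (simp add: flat_def)
    qed (simp add: flat_def)
  qed
  moreover have "(LBINT y. exp (-2) * indicator (ball (0::real^2) (1/2)) y) > (0::real)"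
    by (simp add: content_ball)
  ultimately show "(LBINT y. ?f y) > 0" by linarith
qed

lemma mol_nonneg: "0 \<le> mol x"
  unfolding mol_def using flat_unit_integral by (simp add: flat_nonneg less_imp_le)

lemma mol_eq_0: "norm x \<ge> 1 \<Longrightarrow> mol x = 0"
proof -
  assume "1 \<le> norm x"
  then have "1 \<le> (norm x)\<^sup>2" by (rule one_le_power)
  then have "flat 0 (1 - (norm x)\<^sup>2) = 0" by (simp add: flat_def)
  then show ?thesis by (simp add: mol_def)
qed

lemma mol_integral: "integrable lborel mol" "(LBINT x. mol x) = 1"
  unfolding mol_def[abs_def] using flat_unit_integral by auto

lemma mol_shift_ring: "(\<lambda>w. mol (c *\<^sub>R (x - w))) \<in> bump_ring"
proof -
  have "(\<lambda>w. flat 0 (1 - c\<^sup>2 * (norm (w - x))\<^sup>2) * inverse (LBINT y. flat 0 (1 - (norm (y::real^2))\<^sup>2))) \<in> bump_ring"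
    by (intro bump_ring.mult bump_ring.flat bump_ring.const)
  moreover have "(norm (c *\<^sub>R (x - w)))\<^sup>2 = c\<^sup>2 * (norm (w - x))\<^sup>2" for w
    by (simp add: power_mult_distrib norm_minus_commute)
  ultimately show ?thesis by (simp only: mol_def divide_inverse)
qed

lemma mol_ring: "mol \<in> bump_ring"
  using mol_shift_ring[of "-1" 0] by simp

lemma mol_continuous: "continuous_on S mol"
  using bump_ring_differentiable mol_ring by blast

lemma mol_measurable [measurable]: "mol \<in> borel_measurable borel"
  using mol_continuous by (rule borel_measurable_continuous_onI)

lemma mol_test_function:
  assumes "n > 0" "cball x (1/n) \<subseteq> \<Omega>"
  shows "test_function \<Omega> (\<lambda>w. mol (n *\<^sub>R (x - w)))"
proof (rule bump_ring_test_function[OF mol_shift_ring _ _ assms(2)])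
  show "{w. mol (n *\<^sub>R (x - w)) \<noteq> 0} \<subseteq> cball x (1/n)"
  proof
    fix w assume "w \<in> {w. mol (n *\<^sub>R (x - w)) \<noteq> 0}"
    then have "norm (n *\<^sub>R (x - w)) < 1" using mol_eq_0 by (metis mem_Collect_eq not_le)
    then have "n * norm (x - w) < 1" using assms by (simp del: scaleR_diff_right add: scaleR_right_diff_distrib[symmetric])
    then show "w \<in> cball x (1/n)" using assms by (simp add: dist_norm field_simps)
  qed
qed auto

section \<open>Square integrable functions\<close>

lemma cnj_measurable [measurable]: "cnj \<in> borel_measurable borel"
  by (intro borel_measurable_continuous_onI continuous_intros)

text \<open>The square of the norm is easier to handle than the norm: it is a quadratic polynomial along lines, and integrals of it need no square roots.\<close>
definition nrm2 :: "(real^2) set \<Rightarrow> (real^2 \<Rightarrow> complex) \<Rightarrow> real" where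
  "nrm2 \<Omega> u = (LINT x|lebesgue_on \<Omega>. (cmod (u x))\<^sup>2)"

lemma L2_measurable: "u \<in> L2 \<Omega> \<Longrightarrow> u \<in> borel_measurable (lebesgue_on \<Omega>)"
  by (simp add: L2_def)

lemma L2_integrable_sq: "u \<in> L2 \<Omega> \<Longrightarrow> integrable (lebesgue_on \<Omega>) (\<lambda>x. (cmod (u x))\<^sup>2)"
  by (simp add: L2_def)

lemma nrm2_nonneg [simp]: "0 \<le> nrm2 \<Omega> u"
  by (simp add: nrm2_def)

lemma L2_dominated:
  assumes "f \<in> borel_measurable (lebesgue_on \<Omega>)" "integrable (lebesgue_on \<Omega>) g"
    "\<And>x. (cmod (f x))\<^sup>2 \<le> g x"
  shows "f \<in> L2 \<Omega>"
proof -
  have "integrable (lebesgue_on \<Omega>) (\<lambda>x. (cmod (f x))\<^sup>2)"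
  proof (rule Bochner_Integration.integrable_bound[OF assms(2)])
    have "norm ((cmod (f x))\<^sup>2) \<le> norm (g x)" for x using assms(3)[of x] by simp
    then show "AE x in lebesgue_on \<Omega>. norm ((cmod (f x))\<^sup>2) \<le> norm (g x)" by simp
  qed (use assms(1) in measurable)
  then show ?thesis using assms by (simp add: L2_def)
qed

lemma norm_add_sq_le: "(norm (a + b :: 'a::real_normed_vector))\<^sup>2 \<le> 2 * (norm a)\<^sup>2 + 2 * (norm b)\<^sup>2"
proof -
  have "(norm (a + b))\<^sup>2 \<le> (norm a + norm b)\<^sup>2"
    by (intro power_mono norm_triangle_ineq) auto
  also have "\<dots> \<le> 2 * (norm a)\<^sup>2 + 2 * (norm b)\<^sup>2"
    using zero_le_power2[of "norm a - norm b"] by (simp add: power2_eq_square algebra_simps)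
  finally show ?thesis .
qed

lemma L2_add:
  assumes "f \<in> L2 \<Omega>" "g \<in> L2 \<Omega>" shows "(\<lambda>x. f x + g x) \<in> L2 \<Omega>"
  using assms
  by (intro L2_dominated[where g="\<lambda>x. 2 * (cmod (f x))\<^sup>2 + 2 * (cmod (g x))\<^sup>2"])
    (auto simp: L2_def norm_add_sq_le)

lemma L2_bounded_mult:
  assumes "f \<in> L2 \<Omega>" "a \<in> borel_measurable (lebesgue_on \<Omega>)" "\<And>x. x \<in> \<Omega> \<Longrightarrow> cmod (a x) \<le> K"
  shows "(\<lambda>x. a x * f x) \<in> L2 \<Omega>"
proof -
  have "integrable (lebesgue_on \<Omega>) (\<lambda>x. K\<^sup>2 * (cmod (f x))\<^sup>2)"
    using assms by (auto simp: L2_def)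
  then have "integrable (lebesgue_on \<Omega>) (\<lambda>x. (cmod (a x * f x))\<^sup>2)"
  proof (rule Bochner_Integration.integrable_bound)
    show "AE x in lebesgue_on \<Omega>. norm ((cmod (a x * f x))\<^sup>2) \<le> norm (K\<^sup>2 * (cmod (f x))\<^sup>2)"
      using assms(3)
      by (intro AE_I2) (auto simp: space_restrict_space norm_mult power_mult_distrib intro!: mult_right_mono power_mono)
  qed (use assms in \<open>auto simp: L2_def\<close>)
  then show ?thesis using assms by (auto simp: L2_def)
qed

lemma L2_cmult: "f \<in> L2 \<Omega> \<Longrightarrow> (\<lambda>x. c * f x) \<in> L2 \<Omega>"
  by (rule L2_bounded_mult[where K="cmod c"]) auto

lemma L2_uminus: "f \<in> L2 \<Omega> \<Longrightarrow> (\<lambda>x. - f x) \<in> L2 \<Omega>"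
  using L2_cmult[of f \<Omega> "-1"] by simp

lemma L2_diff: "f \<in> L2 \<Omega> \<Longrightarrow> g \<in> L2 \<Omega> \<Longrightarrow> (\<lambda>x. f x - g x) \<in> L2 \<Omega>"
  using L2_add[of f \<Omega> "\<lambda>x. - g x"] L2_uminus by simp

lemma L2_zero: "(\<lambda>x. 0) \<in> L2 \<Omega>"
  by (simp add: L2_def)

lemma L2_sum: "(\<And>i. i \<in> I \<Longrightarrow> f i \<in> L2 \<Omega>) \<Longrightarrow> (\<lambda>x. \<Sum>i\<in>I. f i x) \<in> L2 \<Omega>"
  by (induction I rule: infinite_finite_induct) (auto intro: L2_add L2_zero)

lemma L2_prod_integrable:
  assumes "f \<in> L2 \<Omega>" "g \<in> L2 \<Omega>"
  shows "integrable (lebesgue_on \<Omega>) (\<lambda>x. f x * cnj (g x))"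
proof (rule Bochner_Integration.integrable_bound)
  show "integrable (lebesgue_on \<Omega>) (\<lambda>x. (cmod (f x))\<^sup>2 + (cmod (g x))\<^sup>2)"
    using assms by (auto simp: L2_def)
  show "AE x in lebesgue_on \<Omega>. norm (f x * cnj (g x)) \<le> norm ((cmod (f x))\<^sup>2 + (cmod (g x))\<^sup>2)"
  proof (rule AE_I2)
    fix x
    have "2 * (cmod (f x) * cmod (g x)) \<le> (cmod (f x))\<^sup>2 + (cmod (g x))\<^sup>2"
      using zero_le_power2[of "cmod (f x) - cmod (g x)"] by (simp add: power2_eq_square algebra_simps)
    moreover have "0 \<le> cmod (f x) * cmod (g x)" by simp
    ultimately have "cmod (f x) * cmod (g x) \<le> (cmod (f x))\<^sup>2 + (cmod (g x))\<^sup>2" by linarith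
    then show "norm (f x * cnj (g x)) \<le> norm ((cmod (f x))\<^sup>2 + (cmod (g x))\<^sup>2)"
      by (simp add: norm_mult)
  qed
qed (use assms in \<open>auto simp: L2_def\<close>)

lemma L2_inner_add_left:
  "f \<in> L2 \<Omega> \<Longrightarrow> f' \<in> L2 \<Omega> \<Longrightarrow> g \<in> L2 \<Omega> \<Longrightarrow>
   L2_inner \<Omega> (\<lambda>x. f x + f' x) g = L2_inner \<Omega> f g + L2_inner \<Omega> f' g"
  by (simp add: L2_inner_def distrib_right L2_prod_integrable)

lemma L2_inner_cmult_left: "L2_inner \<Omega> (\<lambda>x. c * f x) g = c * L2_inner \<Omega> f g"
  by (simp add: L2_inner_def mult.assoc)

lemma L2_inner_commute: "L2_inner \<Omega> g f = cnj (L2_inner \<Omega> f g)"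
  unfolding L2_inner_def by (subst Bochner_Integration.integral_cnj[symmetric]) (simp add: mult.commute)

lemma L2_inner_add_right:
  "f \<in> L2 \<Omega> \<Longrightarrow> g' \<in> L2 \<Omega> \<Longrightarrow> g \<in> L2 \<Omega> \<Longrightarrow>
   L2_inner \<Omega> f (\<lambda>x. g x + g' x) = L2_inner \<Omega> f g + L2_inner \<Omega> f g'"
  by (simp add: L2_inner_def distrib_left L2_prod_integrable)

lemma L2_inner_cmult_right: "L2_inner \<Omega> f (\<lambda>x. c * g x) = cnj c * L2_inner \<Omega> f g"
  by (subst (1 2) L2_inner_commute) (simp add: L2_inner_cmult_left)

lemma L2_inner_self: "L2_inner \<Omega> f f = of_real (nrm2 \<Omega> f)"
proof -
  have *: "L2_inner \<Omega> f f = (LINT x|lebesgue_on \<Omega>. complex_of_real ((cmod (f x))\<^sup>2))"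
    unfolding L2_inner_def by (rule Bochner_Integration.integral_cong) (auto simp: complex_norm_square of_real_power simp del: of_real_power)
  show ?thesis unfolding * nrm2_def by (rule integral_complex_of_real)
qed

lemma nrm2_add:
  assumes "f \<in> L2 \<Omega>" "g \<in> L2 \<Omega>"
  shows "nrm2 \<Omega> (\<lambda>x. f x + g x) = nrm2 \<Omega> f + 2 * Re (L2_inner \<Omega> f g) + nrm2 \<Omega> g"
proof -
  have "complex_of_real (nrm2 \<Omega> (\<lambda>x. f x + g x)) =
    L2_inner \<Omega> f f + L2_inner \<Omega> f g + L2_inner \<Omega> g f + L2_inner \<Omega> g g"
    unfolding L2_inner_self[symmetric]
    using assms by (simp add: L2_inner_add_left L2_inner_add_right L2_add)
  then have "Re (complex_of_real (nrm2 \<Omega> (\<lambda>x. f x + g x))) =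
    Re (L2_inner \<Omega> f f + L2_inner \<Omega> f g + L2_inner \<Omega> g f + L2_inner \<Omega> g g)" by simp
  then show ?thesis using L2_inner_commute[of \<Omega> g f] by (simp add: L2_inner_self)
qed

lemma nrm2_cmult: "nrm2 \<Omega> (\<lambda>x. c * f x) = (cmod c)\<^sup>2 * nrm2 \<Omega> f"
  by (simp add: nrm2_def norm_mult power_mult_distrib)

lemma nrm2_uminus [simp]: "nrm2 \<Omega> (\<lambda>x. - f x) = nrm2 \<Omega> f"
  by (simp add: nrm2_def)

lemma nrm2_diff_commute: "nrm2 \<Omega> (\<lambda>x. f x - g x) = nrm2 \<Omega> (\<lambda>x. g x - f x)"
  by (simp add: nrm2_def norm_minus_commute)

lemma nrm2_add_le:
  assumes "f \<in> L2 \<Omega>" "g \<in> L2 \<Omega>"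
  shows "nrm2 \<Omega> (\<lambda>x. f x + g x) \<le> 2 * nrm2 \<Omega> f + 2 * nrm2 \<Omega> g"
proof -
  have "nrm2 \<Omega> (\<lambda>x. f x + g x) \<le> (LINT x|lebesgue_on \<Omega>. 2 * (cmod (f x))\<^sup>2 + 2 * (cmod (g x))\<^sup>2)"
    unfolding nrm2_def using L2_add[OF assms] assms
    by (intro integral_mono) (auto simp: L2_def norm_add_sq_le)
  then show ?thesis using assms by (simp add: nrm2_def L2_def)
qed

lemma nrm2_cong_AE:
  assumes "f \<in> L2 \<Omega>" "g \<in> L2 \<Omega>" "AE x in lebesgue_on \<Omega>. f x = g x"
  shows "nrm2 \<Omega> f = nrm2 \<Omega> g"
  unfolding nrm2_def using assms
  by (intro integral_cong_AE) (auto simp: L2_def)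

lemma nrm2_bounded_mult:
  assumes "f \<in> L2 \<Omega>" "a \<in> borel_measurable (lebesgue_on \<Omega>)" "\<And>x. x \<in> \<Omega> \<Longrightarrow> cmod (a x) \<le> K"
  shows "nrm2 \<Omega> (\<lambda>x. a x * f x) \<le> K\<^sup>2 * nrm2 \<Omega> f"
proof -
  have "nrm2 \<Omega> (\<lambda>x. a x * f x) \<le> (LINT x|lebesgue_on \<Omega>. K\<^sup>2 * (cmod (f x))\<^sup>2)"
    unfolding nrm2_def using L2_bounded_mult[OF assms] assms
    by (intro integral_mono) (auto simp: L2_def space_restrict_space norm_mult power_mult_distrib
        intro!: mult_right_mono power_mono)
  then show ?thesis by (simp add: nrm2_def)
qed

lemma nrm2_eq_0_AE:
  assumes "f \<in> L2 \<Omega>" "nrm2 \<Omega> f = 0"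
  shows "AE x in lebesgue_on \<Omega>. f x = 0"
  using assms unfolding nrm2_def
  by (subst (asm) integral_nonneg_eq_0_iff_AE) (auto simp: L2_def)

lemma L2_Cauchy_Schwarz:
  assumes "f \<in> L2 \<Omega>" "g \<in> L2 \<Omega>"
  shows "(cmod (L2_inner \<Omega> f g))\<^sup>2 \<le> nrm2 \<Omega> f * nrm2 \<Omega> g"
proof (cases "nrm2 \<Omega> g = 0")
  case True
  then have "AE x in lebesgue_on \<Omega>. g x = 0" using nrm2_eq_0_AE assms by blast
  then have "L2_inner \<Omega> f g = (LINT x|lebesgue_on \<Omega>. 0)"
    unfolding L2_inner_def using assms by (intro integral_cong_AE) (auto simp: L2_def)
  then show ?thesis by simp
next
  case False
  define c where "c = - L2_inner \<Omega> f g / of_real (nrm2 \<Omega> g)"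
  have "0 \<le> nrm2 \<Omega> (\<lambda>x. f x + c * g x)" by simp
  also have "\<dots> = nrm2 \<Omega> f + 2 * Re (cnj c * L2_inner \<Omega> f g) + (cmod c)\<^sup>2 * nrm2 \<Omega> g"
    using assms by (simp add: nrm2_add L2_cmult L2_inner_cmult_right nrm2_cmult)
  also have "cnj c * L2_inner \<Omega> f g = - of_real ((cmod (L2_inner \<Omega> f g))\<^sup>2 / nrm2 \<Omega> g)"
    using complex_norm_square[of "L2_inner \<Omega> f g"] by (simp add: c_def mult.commute)
  also have "(cmod c)\<^sup>2 * nrm2 \<Omega> g = (cmod (L2_inner \<Omega> f g))\<^sup>2 / nrm2 \<Omega> g"
    using False by (simp add: c_def norm_divide power_divide power2_eq_square)
  finally have "(cmod (L2_inner \<Omega> f g))\<^sup>2 / nrm2 \<Omega> g \<le> nrm2 \<Omega> f" by simp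
  moreover have "nrm2 \<Omega> g > 0" using False nrm2_nonneg[of \<Omega> g] by linarith
  ultimately show ?thesis by (simp add: field_simps)
qed

lemma nrm2_nn_integral:
  assumes "f \<in> L2 \<Omega>"
  shows "ennreal (nrm2 \<Omega> f) = (\<integral>\<^sup>+x. ennreal ((cmod (f x))\<^sup>2) \<partial>lebesgue_on \<Omega>)"
  unfolding nrm2_def using assms
  by (subst nn_integral_eq_integral) (auto simp: L2_def)

lemma L2_nn_integralI:
  assumes "f \<in> borel_measurable (lebesgue_on \<Omega>)"
    "(\<integral>\<^sup>+x. ennreal ((cmod (f x))\<^sup>2) \<partial>lebesgue_on \<Omega>) \<le> ennreal C" "0 \<le> C"
  shows "f \<in> L2 \<Omega>" "nrm2 \<Omega> f \<le> C"
proof -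
  show 1: "f \<in> L2 \<Omega>"
    unfolding L2_def using assms le_less_trans[OF assms(2), of \<infinity>]
    by (auto intro!: integrableI_bounded)
  show "nrm2 \<Omega> f \<le> C"
    using assms(2,3) nrm2_nn_integral[OF 1] by (metis ennreal_le_iff)
qed

lemma bounded_open_finite_measure:
  assumes "open \<Omega>" "bounded \<Omega>"
  shows "\<Omega> \<in> lmeasurable"
  using assms by (intro bounded_set_imp_lmeasurable) auto

lemma L2_const:
  assumes "\<Omega> \<in> lmeasurable"
  shows "(\<lambda>x. c) \<in> L2 \<Omega>" "nrm2 \<Omega> (\<lambda>x. c) = (cmod c)\<^sup>2 * measure lebesgue \<Omega>"
proof -
  interpret finite_measure "lebesgue_on \<Omega>" by (rule finite_measure_lebesgue_on[OF assms])
  show "(\<lambda>x. c) \<in> L2 \<Omega>" by (simp add: L2_def)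
  have "\<Omega> \<in> sets lebesgue" using assms by auto
  then show "nrm2 \<Omega> (\<lambda>x. c) = (cmod c)\<^sup>2 * measure lebesgue \<Omega>"
    by (simp add: nrm2_def measure_restrict_space space_restrict_space)
qed

lemma L2_integrable:
  assumes "\<Omega> \<in> lmeasurable" "f \<in> L2 \<Omega>"
  shows "integrable (lebesgue_on \<Omega>) f"
  using L2_prod_integrable[OF assms(2) L2_const(1)[OF assms(1), of 1]] by simp

text \<open>A sequence that is Cauchy in the mean has a subsequence with summable distances. That subsequence converges almost everywhere, and Fatou's lemma turns this into convergence in the mean.\<close>
lemma L2_complete:
  assumes fin: "\<Omega> \<in> lmeasurable" and f: "\<And>n. f n \<in> L2 \<Omega>"
    and Cauchy: "\<And>e. e > 0 \<Longrightarrow> \<exists>N. \<forall>m\<ge>N. \<forall>n\<ge>N. nrm2 \<Omega> (\<lambda>x. f m x - f n x) < e"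
  obtains g where "g \<in> L2 \<Omega>" "(\<lambda>n. nrm2 \<Omega> (\<lambda>x. f n x - g x)) \<longlonglongrightarrow> 0"
proof -
  let ?M = "lebesgue_on \<Omega>"
  have [measurable]: "f n \<in> borel_measurable ?M" for n using f by (simp add: L2_def)
  have "\<forall>k. \<exists>N. \<forall>m\<ge>N. \<forall>n\<ge>N. nrm2 \<Omega> (\<lambda>x. f m x - f n x) < (1/4)^k"
    using Cauchy by simp
  then obtain N where N: "\<And>k m n. m \<ge> N k \<Longrightarrow> n \<ge> N k \<Longrightarrow> nrm2 \<Omega> (\<lambda>x. f m x - f n x) < (1/4)^k"
    by metis
  define r where "r k = k + (\<Sum>i\<le>k. N i)" for k
  have r: "r k \<ge> N k" "r (Suc k) \<ge> N k" "r k \<ge> k" for k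
    using member_le_sum[of k "{..k}" N] by (auto simp: r_def)
  define V where "V = measure lebesgue \<Omega>"
  define d where "d k x = f (r (Suc k)) x - f (r k) x" for k x
  have dL: "d k \<in> L2 \<Omega>" for k unfolding d_def using f by (intro L2_diff)
  have [measurable]: "d k \<in> borel_measurable ?M" for k using dL by (simp add: L2_def)
  have dn: "nrm2 \<Omega> (d k) \<le> (1/4)^k" for k
    using N[of k "r (Suc k)" "r k"] r by (simp add: d_def[abs_def] less_imp_le)
  have d1: "(\<integral>\<^sup>+x. ennreal (cmod (d k x)) \<partial>?M) \<le> ennreal (sqrt V * (1/2)^k)" for k
  proof -
    have "(\<integral>\<^sup>+x. ennreal (cmod (d k x)) \<partial>?M) = ennreal (LINT x|?M. cmod (d k x))"
      using L2_integrable[OF fin dL] by (intro nn_integral_eq_integral) auto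
    also have "(LINT x|?M. cmod (d k x)) \<le> sqrt V * (1/2)^k"
    proof -
      have L: "(\<lambda>x. complex_of_real (cmod (d k x))) \<in> L2 \<Omega>"
        using dL[of k] by (simp add: L2_def)
      have "L2_inner \<Omega> (\<lambda>x. of_real (cmod (d k x))) (\<lambda>x. 1) = of_real (LINT x|?M. cmod (d k x))"
        by (simp add: L2_inner_def)
      then have "(LINT x|?M. cmod (d k x))\<^sup>2 \<le> nrm2 \<Omega> (d k) * V"
        using L2_Cauchy_Schwarz[OF L L2_const(1)[OF fin, of 1]] L2_const(2)[OF fin, of 1]
        by (simp add: V_def nrm2_def)
      also have "\<dots> \<le> (1/4)^k * V" using dn by (intro mult_right_mono) (auto simp: V_def)
      also have "\<dots> = (sqrt V * (1/2)^k)\<^sup>2"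
        by (simp add: power_mult_distrib V_def flip: power_mult) (simp add: power_mult mult.commute power2_eq_square power_divide flip: power_mult_distrib)
      finally show ?thesis by (rule power2_le_imp_le) (simp add: V_def)
    qed
    finally show ?thesis by (simp add: ennreal_leI)
  qed
  have "(\<integral>\<^sup>+x. (\<Sum>k. ennreal (cmod (d k x))) \<partial>?M) = (\<Sum>k. \<integral>\<^sup>+x. ennreal (cmod (d k x)) \<partial>?M)"
    by (intro nn_integral_suminf) auto
  also have "\<dots> \<le> (\<Sum>k. ennreal (sqrt V * (1/2)^k))"
    by (intro suminf_le d1) auto
  also have "\<dots> < \<infinity>"
  proof -
    have "summable (\<lambda>k. sqrt V * (1/2)^k)" by (intro summable_mult summable_geometric) auto
    then have "(\<Sum>k. ennreal (sqrt V * (1/2)^k)) = ennreal (\<Sum>k. sqrt V * (1/2)^k)"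
      by (intro suminf_ennreal2) (auto simp: V_def)
    then show ?thesis by simp
  qed
  finally have "AE x in ?M. (\<Sum>k. ennreal (cmod (d k x))) \<noteq> \<infinity>"
    by (intro nn_integral_PInf_AE) auto
  then have conv: "AE x in ?M. convergent (\<lambda>k. f (r k) x)"
  proof (eventually_elim)
    case (elim x)
    then have "summable (\<lambda>k. cmod (d k x))"
      by (intro summable_suminf_not_top) auto
    then have "summable (\<lambda>k. d k x)" by (rule summable_norm_cancel)
    then have "(\<lambda>n. \<Sum>k<n. d k x) \<longlonglongrightarrow> (\<Sum>k. d k x)" by (rule summable_LIMSEQ)
    moreover have "(\<Sum>k<n. d k x) = f (r n) x - f (r 0) x" for n
      unfolding d_def by (rule sum_lessThan_telescope)
    ultimately have "(\<lambda>n. f (r n) x - f (r 0) x + f (r 0) x) \<longlonglongrightarrow> (\<Sum>k. d k x) + f (r 0) x"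
      by (intro tendsto_add) auto
    then show ?case by (auto simp: convergent_def)
  qed
  define g where "g x = lim (\<lambda>k. f (r k) x)" for x
  have [measurable]: "g \<in> borel_measurable ?M" unfolding g_def by measurable
  have lim: "AE x in ?M. (\<lambda>k. f (r k) x) \<longlonglongrightarrow> g x"
    using conv by eventually_elim (simp add: g_def convergent_LIMSEQ_iff)
  have bd: "(\<integral>\<^sup>+x. ennreal ((cmod (f n x - g x))\<^sup>2) \<partial>?M) \<le> ennreal ((1/4)^k)" if "n \<ge> N k" for n k
  proof -
    have "(\<integral>\<^sup>+x. ennreal ((cmod (f n x - g x))\<^sup>2) \<partial>?M)
       = (\<integral>\<^sup>+x. liminf (\<lambda>j. ennreal ((cmod (f n x - f (r j) x))\<^sup>2)) \<partial>?M)"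
    proof (rule nn_integral_cong_AE, use lim in eventually_elim)
      case (elim x)
      then have "(\<lambda>j. ennreal ((cmod (f n x - f (r j) x))\<^sup>2)) \<longlonglongrightarrow> ennreal ((cmod (f n x - g x))\<^sup>2)"
        by (intro tendsto_intros)
      then show ?case by (metis lim_imp_Liminf sequentially_bot)
    qed
    also have "\<dots> \<le> liminf (\<lambda>j. \<integral>\<^sup>+x. ennreal ((cmod (f n x - f (r j) x))\<^sup>2) \<partial>?M)"
      by (intro nn_integral_liminf) auto
    also have "\<dots> \<le> ennreal ((1/4)^k)"
    proof (rule Liminf_le)
      show "\<forall>\<^sub>F j in sequentially. (\<integral>\<^sup>+x. ennreal ((cmod (f n x - f (r j) x))\<^sup>2) \<partial>?M) \<le> ennreal ((1/4)^k)"
        using eventually_ge_at_top[of "N k"]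
      proof eventually_elim
        case (elim j)
        then have "r j \<ge> N k" using r(3)[of j] by linarith
        then show ?case
          using N[of k n "r j"] that nrm2_nn_integral[OF L2_diff[OF f[of n] f[of "r j"]]]
          by (metis ennreal_leI less_imp_le)
      qed
    qed simp
    finally show ?thesis .
  qed
  have fg: "(\<lambda>x. f n x - g x) \<in> L2 \<Omega>" "nrm2 \<Omega> (\<lambda>x. f n x - g x) \<le> (1/4)^k" if "n \<ge> N k" for n k
    using L2_nn_integralI[OF _ bd[OF that]] by auto
  have "g \<in> L2 \<Omega>"
    using L2_diff[OF f[of "N 0"] fg(1)[of 0 "N 0"]] by simp
  moreover have "(\<lambda>n. nrm2 \<Omega> (\<lambda>x. f n x - g x)) \<longlonglongrightarrow> 0"
  proof (rule LIMSEQ_I)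
    fix e :: real assume "e > 0"
    then obtain k where k: "(1/4::real)^k < e" using real_arch_pow_inv[of e "1/4"] by auto
    show "\<exists>no. \<forall>n\<ge>no. norm (nrm2 \<Omega> (\<lambda>x. f n x - g x) - 0) < e"
    proof (intro exI[of _ "N k"] allI impI)
      fix n assume "n \<ge> N k"
      then show "norm (nrm2 \<Omega> (\<lambda>x. f n x - g x) - 0) < e"
        using fg(2)[of k n] k by simp
    qed
  qed
  ultimately show ?thesis using that by blast
qed

section \<open>Borel representatives and translations\<close>

text \<open>Elements of \<open>L\<^sup>2(\<Omega>)\<close> are only Lebesgue measurable and arbitrary outside \<open>\<Omega>\<close>. Translations and Fubini's theorem need Borel functions on the whole plane; they are applied to this extension by zero.\<close>
definition borel_rep :: "(real^2) set \<Rightarrow> (real^2 \<Rightarrow> complex) \<Rightarrow> (real^2 \<Rightarrow> complex) \<Rightarrow> bool" where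
  "borel_rep \<Omega> u u' \<longleftrightarrow> u' \<in> borel_measurable borel \<and> (\<forall>x. x \<notin> \<Omega> \<longrightarrow> u' x = 0) \<and>
     (AE x in lborel. x \<in> \<Omega> \<longrightarrow> u x = u' x)"

lemma borel_rep_exists:
  assumes "open \<Omega>" "u \<in> borel_measurable (lebesgue_on \<Omega>)"
  obtains u' where "borel_rep \<Omega> u u'"
proof -
  have [measurable]: "\<Omega> \<in> sets borel" using assms by auto
  have m: "(\<lambda>x. indicator \<Omega> x *\<^sub>R u x) \<in> borel_measurable lebesgue"
    using assms borel_measurable_restrict_space_iff[of \<Omega> lebesgue u] by auto
  have "Re \<in> borel_measurable borel" "Im \<in> borel_measurable borel"
    by (intro borel_measurable_continuous_onI continuous_intros)+
  then have "(\<lambda>x. Re (indicator \<Omega> x *\<^sub>R u x)) \<in> borel_measurable lebesgue"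
    "(\<lambda>x. Im (indicator \<Omega> x *\<^sub>R u x)) \<in> borel_measurable lebesgue"
    using measurable_compose[OF m] by blast+
  then obtain a b where a: "a \<in> borel_measurable lborel" "AE x in lborel. Re (indicator \<Omega> x *\<^sub>R u x) = a x"
    and b: "b \<in> borel_measurable lborel" "AE x in lborel. Im (indicator \<Omega> x *\<^sub>R u x) = b x"
    using completion_ex_borel_measurable_real by blast
  define u' where "u' x = (if x \<in> \<Omega> then Complex (a x) (b x) else 0)" for x
  have [measurable]: "a \<in> borel_measurable borel" "b \<in> borel_measurable borel" using a b by auto
  have "(\<lambda>x. Complex (a x) (b x)) \<in> borel_measurable borel"
    unfolding Complex_eq by measurable
  then have "u' \<in> borel_measurable borel" unfolding u'_def[abs_def] by measurable
  moreover have "AE x in lborel. x \<in> \<Omega> \<longrightarrow> u x = u' x"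
    using a(2) b(2) by eventually_elim (auto simp: u'_def complex_eq_iff)
  moreover have "\<forall>x. x \<notin> \<Omega> \<longrightarrow> u' x = 0" by (simp add: u'_def)
  ultimately have "borel_rep \<Omega> u u'" unfolding borel_rep_def by blast
  then show ?thesis by (rule that)
qed

lemma AE_lebesgue_on_iff:
  assumes "\<Omega> \<in> sets borel"
  shows "(AE x in lebesgue_on \<Omega>. P x) \<longleftrightarrow> (AE x in lebesgue. x \<in> \<Omega> \<longrightarrow> P x)"
  using assms by (subst AE_restrict_space_iff) auto

lemma LINT_eq_LBINT:
  assumes "\<Omega> \<in> sets borel" "h \<in> borel_measurable (lebesgue_on \<Omega>)" "borel_rep \<Omega> h h'"
  shows "(LINT x|lebesgue_on \<Omega>. h x) = (LINT x|lborel. h' x)"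
    and "integrable (lebesgue_on \<Omega>) h \<longleftrightarrow> integrable lborel h'"
proof -
  have [measurable]: "h' \<in> borel_measurable borel" using assms by (simp add: borel_rep_def)
  have 1: "(\<lambda>x. indicator \<Omega> x *\<^sub>R h x) \<in> borel_measurable lebesgue"
    using assms borel_measurable_restrict_space_iff[of \<Omega> lebesgue h] by auto
  have "AE x in lebesgue. x \<in> \<Omega> \<longrightarrow> h x = h' x"
    using assms(3) by (intro AE_completion) (simp add: borel_rep_def)
  then have 2: "AE x in lebesgue. indicator \<Omega> x *\<^sub>R h x = h' x"
    by eventually_elim (use assms(3) in \<open>auto simp: borel_rep_def indicator_def\<close>)
  have h': "h' \<in> borel_measurable lebesgue" by (simp add: measurable_completion)
  have "(LINT x|lebesgue_on \<Omega>. h x) = (LINT x|lebesgue. indicator \<Omega> x *\<^sub>R h x)"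
    using assms by (intro integral_restrict_space) auto
  also have "\<dots> = (LINT x|lebesgue. h' x)"
    using 1 2 h' by (intro integral_cong_AE) auto
  also have "\<dots> = (LINT x|lborel. h' x)" by (intro integral_completion) auto
  finally show "(LINT x|lebesgue_on \<Omega>. h x) = (LINT x|lborel. h' x)" .
  have "integrable (lebesgue_on \<Omega>) h \<longleftrightarrow> integrable lebesgue (\<lambda>x. indicator \<Omega> x *\<^sub>R h x)"
    using assms by (intro integrable_restrict_space) auto
  also have "\<dots> \<longleftrightarrow> integrable lebesgue h'"
    using 1 2 h' by (intro integrable_cong_AE) auto
  also have "\<dots> \<longleftrightarrow> integrable lborel h'" by (intro integrable_completion) auto
  finally show "integrable (lebesgue_on \<Omega>) h \<longleftrightarrow> integrable lborel h'" .
qed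

lemma borel_rep_mult:
  assumes "borel_rep \<Omega> u u'" "a \<in> borel_measurable borel"
  shows "borel_rep \<Omega> (\<lambda>x. a x * u x) (\<lambda>x. a x * u' x)"
  using assms unfolding borel_rep_def by (auto elim!: eventually_mono)

lemma borel_rep_add:
  assumes "borel_rep \<Omega> u u'" "borel_rep \<Omega> v v'"
  shows "borel_rep \<Omega> (\<lambda>x. u x + v x) (\<lambda>x. u' x + v' x)"
  using assms unfolding borel_rep_def by auto

lemma borel_rep_nrm2:
  assumes "open \<Omega>" "u \<in> L2 \<Omega>" "borel_rep \<Omega> u u'"
  shows "ennreal (nrm2 \<Omega> u) = (\<integral>\<^sup>+x. ennreal ((cmod (u' x))\<^sup>2) \<partial>lborel)"
proof -
  have "ennreal (nrm2 \<Omega> u) = (\<integral>\<^sup>+x. ennreal ((cmod (u x))\<^sup>2) \<partial>lebesgue_on \<Omega>)"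
    by (rule nrm2_nn_integral[OF assms(2)])
  also have "\<dots> = (\<integral>\<^sup>+x. ennreal ((cmod (u x))\<^sup>2) * indicator \<Omega> x \<partial>lebesgue)"
    using assms by (intro nn_integral_restrict_space) auto
  also have "\<dots> = (\<integral>\<^sup>+x. ennreal ((cmod (u' x))\<^sup>2) \<partial>lebesgue)"
  proof (rule nn_integral_cong_AE)
    have "AE x in lebesgue. x \<in> \<Omega> \<longrightarrow> u x = u' x"
      using assms(3) by (intro AE_completion) (simp add: borel_rep_def)
    then show "AE x in lebesgue. ennreal ((cmod (u x))\<^sup>2) * indicator \<Omega> x = ennreal ((cmod (u' x))\<^sup>2)"
      by eventually_elim (use assms(3) in \<open>auto simp: borel_rep_def indicator_def\<close>)
  qed
  finally show ?thesis by (simp add: nn_integral_completion)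
qed

lemma lborel_integral_affine:
  fixes h :: "real^2 \<Rightarrow> 'b::{banach, second_countable_topology}"
  assumes [measurable]: "h \<in> borel_measurable borel" and "c \<noteq> 0"
  shows "(LBINT w. h w) = c\<^sup>2 *\<^sub>R (LBINT y. h (t + c *\<^sub>R y))"
    "integrable lborel h \<longleftrightarrow> integrable lborel (\<lambda>y. h (t + c *\<^sub>R y))"
proof -
  have *: "(lborel :: (real^2) measure) = density (distr lborel borel (\<lambda>x. t + c *\<^sub>R x)) (\<lambda>_. ennreal (\<bar>c\<bar>^2))"
    using lborel_affine[OF assms(2), of t] by simp
  have "(LBINT w. h w) = integral\<^sup>L (density (distr lborel borel (\<lambda>x. t + c *\<^sub>R x)) (\<lambda>_. ennreal (\<bar>c\<bar>^2))) h"
    by (subst *) simp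
  then show "(LBINT w. h w) = c\<^sup>2 *\<^sub>R (LBINT y. h (t + c *\<^sub>R y))"
    by (simp add: integral_density integral_distr)
  have "integrable lborel h \<longleftrightarrow> integrable (density (distr lborel borel (\<lambda>x. t + c *\<^sub>R x)) (\<lambda>_. ennreal (\<bar>c\<bar>^2))) h"
    by (subst *) simp
  moreover have "integrable lborel (\<lambda>x. c\<^sup>2 *\<^sub>R h (t + c *\<^sub>R x)) \<longleftrightarrow> integrable lborel (\<lambda>y. h (t + c *\<^sub>R y))"
    using assms(2) integrable_scaleR_right[of "inverse (c\<^sup>2)" lborel "\<lambda>x. c\<^sup>2 *\<^sub>R h (t + c *\<^sub>R x)"] by auto
  ultimately show "integrable lborel h \<longleftrightarrow> integrable lborel (\<lambda>y. h (t + c *\<^sub>R y))"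
    by (simp add: integrable_density integrable_distr_eq)
qed

lemma nn_integral_translate:
  fixes h :: "real^2 \<Rightarrow> ennreal"
  assumes [measurable]: "h \<in> borel_measurable borel"
  shows "(\<integral>\<^sup>+x. h (x + z) \<partial>lborel) = (\<integral>\<^sup>+x. h x \<partial>lborel)"
proof -
  have "(\<integral>\<^sup>+x. h x \<partial>lborel) = (\<integral>\<^sup>+x. h x \<partial>distr lborel borel ((+) z))"
    by (simp add: lborel_distr_plus)
  also have "\<dots> = (\<integral>\<^sup>+x. h (z + x) \<partial>lborel)" by (intro nn_integral_distr) auto
  finally show ?thesis by (simp add: add.commute)
qed

lemma integrable_translate:
  fixes u :: "real^2 \<Rightarrow> 'b::{banach, second_countable_topology}"
  assumes "u \<in> borel_measurable borel" "integrable lborel u"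
  shows "integrable lborel (\<lambda>x. u (x + z))" "(LBINT x. u (x + z)) = (LBINT x. u x)"
  using lborel_integral_affine[OF assms(1), of 1 z] assms(2) by (auto simp: add.commute)

lemma L1_translation_triangle:
  fixes u v :: "real^2 \<Rightarrow> complex"
  assumes u: "integrable lborel u" and v: "integrable lborel v"
  shows "(LBINT x. norm (u (x + z) - u x)) \<le>
     (LBINT x. norm (v (x + z) - v x)) + 2 * (LBINT x. norm (u x - v x))"
proof -
  have [measurable]: "u \<in> borel_measurable borel" "v \<in> borel_measurable borel" using assms by auto
  note i = integrable_translate[of u z] integrable_translate[of v z] assms
  have d: "integrable lborel (\<lambda>x. norm (u x - v x))" using assms by auto
  have dz: "integrable lborel (\<lambda>x. norm (u (x+z) - v (x+z)))"
    "(LBINT x. norm (u (x+z) - v (x+z))) = (LBINT x. norm (u x - v x))"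
    using integrable_translate[of "\<lambda>x. norm (u x - v x)" z] d by auto
  have "(LBINT x. norm (u (x + z) - u x)) \<le>
     (LBINT x. norm (v (x + z) - v x) + (norm (u x - v x) + norm (u (x+z) - v (x+z))))"
  proof (rule integral_mono)
    fix x
    have "u (x + z) - u x = (v (x + z) - v x) + (u (x+z) - v (x+z)) - (u x - v x)" by simp
    then show "norm (u (x + z) - u x) \<le> norm (v (x + z) - v x) + (norm (u x - v x) + norm (u (x+z) - v (x+z)))"
      by (smt (verit) norm_triangle_ineq norm_triangle_ineq4)
  qed (use i d dz in auto)
  also have "\<dots> = (LBINT x. norm (v (x + z) - v x)) + 2 * (LBINT x. norm (u x - v x))"
    using i d dz by simp
  finally show ?thesis .
qed

lemma L1_translation_indicator_open:
  fixes U :: "(real^2) set"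
  assumes "open U" "emeasure lborel U < \<infinity>" "z \<longlonglongrightarrow> 0"
  shows "(\<lambda>n. LBINT x. norm (indicator U (x + z n) *\<^sub>R c - indicator U x *\<^sub>R (c::complex))) \<longlonglongrightarrow> 0"
proof -
  have [measurable]: "U \<in> sets borel" using assms by auto
  let ?f = "\<lambda>x. indicator U x :: real"
  have i: "integrable lborel ?f" using assms by (intro integrable_real_indicator) auto
  have ip: "integrable lborel (\<lambda>x. ?f x * ?f (x + z n))" for n
    by (rule Bochner_Integration.integrable_bound[OF i]) (auto simp: indicator_def)
  have "(\<lambda>n. LBINT x. ?f x - ?f x * ?f (x + z n)) \<longlonglongrightarrow> (LBINT (x::real^2). 0::real)"
  proof (rule integral_dominated_convergence[OF _ _ i])
    show "AE x in lborel. (\<lambda>n. ?f x - ?f x * ?f (x + z n)) \<longlonglongrightarrow> 0"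
    proof (rule AE_I2)
      fix x
      show "(\<lambda>n. ?f x - ?f x * ?f (x + z n)) \<longlonglongrightarrow> 0"
      proof (cases "x \<in> U")
        case True
        have "(\<lambda>n. x + z n) \<longlonglongrightarrow> x + 0" using assms by (intro tendsto_intros)
        then have "\<forall>\<^sub>F n in sequentially. x + z n \<in> U"
          using assms(1) True by (intro topological_tendstoD) auto
        then have "\<forall>\<^sub>F n in sequentially. ?f x - ?f x * ?f (x + z n) = 0"
          by eventually_elim (use True in auto)
        then show ?thesis by (rule tendsto_eventually)
      qed auto
    qed
  qed (auto simp: indicator_def)
  then have "(\<lambda>n. 2 * cmod c * (LBINT x. ?f x - ?f x * ?f (x + z n))) \<longlonglongrightarrow> 2 * cmod c * 0"
    by (intro tendsto_intros) auto
  moreover have "(LBINT x. norm (?f (x + z n) *\<^sub>R c - ?f x *\<^sub>R c)) =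
     2 * cmod c * (LBINT x. ?f x - ?f x * ?f (x + z n))" for n
  proof -
    have "(LBINT x. norm (?f (x + z n) *\<^sub>R c - ?f x *\<^sub>R c)) =
      (LBINT x. cmod c * (?f x + ?f (x + z n) - 2 * (?f x * ?f (x + z n))))"
      by (intro Bochner_Integration.integral_cong) (auto simp: indicator_def)
    also have "\<dots> = cmod c * ((LBINT x. ?f x) + (LBINT x. ?f (x + z n)) - 2 * (LBINT x. ?f x * ?f (x + z n)))"
      using i ip[of n] integrable_translate[of ?f "z n"] by simp
    also have "(LBINT x. ?f (x + z n)) = (LBINT x. ?f x)"
      using i integrable_translate[of ?f "z n"] by simp
    also have "cmod c * ((LBINT x. ?f x) + (LBINT x. ?f x) - 2 * (LBINT x. ?f x * ?f (x + z n)))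
      = 2 * cmod c * (LBINT x. ?f x - ?f x * ?f (x + z n))"
      using i ip[of n] by (simp add: algebra_simps)
    finally show ?thesis .
  qed
  ultimately show ?thesis by simp
qed

text \<open>Continuity in the mean: true for indicators of open sets by dominated convergence, hence for integrable functions by approximation.\<close>
lemma L1_translation_continuous:
  fixes u :: "real^2 \<Rightarrow> complex"
  assumes "integrable lborel u" "z \<longlonglongrightarrow> 0"
  shows "(\<lambda>n. LBINT x. norm (u (x + z n) - u x)) \<longlonglongrightarrow> 0"
proof -
  have approx: "(\<lambda>n. LBINT x. norm (u (x + z n) - u x)) \<longlonglongrightarrow> 0"
    if u: "integrable lborel u" and
      ap: "\<And>e. e > 0 \<Longrightarrow> \<exists>v. integrable lborel v \<and> (\<lambda>n. LBINT x. norm (v (x + z n) - v x)) \<longlonglongrightarrow> 0 \<and>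
              (LBINT x. norm (u x - v x)) < e" for u :: "real^2 \<Rightarrow> complex"
  proof (rule LIMSEQ_I)
    fix e :: real assume "e > 0"
    then obtain v where v: "integrable lborel v" "(\<lambda>n. LBINT x. norm (v (x + z n) - v x)) \<longlonglongrightarrow> 0"
       "(LBINT x. norm (u x - v x)) < e/4" using ap[of "e/4"] by auto
    then obtain N where N: "\<And>n. n \<ge> N \<Longrightarrow> norm (LBINT x. norm (v (x + z n) - v x)) < e/4"
      using LIMSEQ_D[OF v(2), of "e/4"] \<open>e > 0\<close> by auto
    show "\<exists>no. \<forall>n\<ge>no. norm ((LBINT x. norm (u (x + z n) - u x)) - 0) < e"
    proof (intro exI[of _ N] allI impI)
      fix n assume "n \<ge> N"
      then show "norm ((LBINT x. norm (u (x + z n) - u x)) - 0) < e"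
        using L1_translation_triangle[OF u v(1), of "z n"] N[of n] v(3) \<open>e > 0\<close>
        by (simp add: abs_of_nonneg)
    qed
  qed
  show ?thesis using assms(1)
  proof (induction rule: integrable_induct)
    case (base A c)
    have A: "A \<in> sets borel" using base by simp
    show ?case
    proof (rule approx)
      show "integrable lborel (\<lambda>x. indicator A x *\<^sub>R c)"
        using base by (intro integrable_scaleR_left integrable_real_indicator) auto
      fix e :: real assume "e > 0"
      define d where "d = e / (cmod c + 1)"
      have d: "d > 0" "d * cmod c < e" using \<open>e > 0\<close>
        by (auto simp: d_def field_simps add_pos_nonneg)
      obtain U where U: "open U" "A \<subseteq> U" "U - A \<in> lmeasurable" "emeasure lebesgue (U - A) < ennreal d"
        using sets_lebesgue_outer_open[of A d] A d by auto
      have [measurable]: "U \<in> sets borel" "A \<in> sets borel" using U A by auto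
      have eU: "emeasure lborel (U - A) < ennreal d" using U(4) by simp
      have "emeasure lborel U \<le> emeasure lborel A + emeasure lborel (U - A)"
        using U(2) emeasure_subadditive[of A lborel "U - A"] by (simp add: Un_absorb1)
      also have "\<dots> < \<infinity>"
      proof -
        have "emeasure lborel (U - A) < \<infinity>" using less_trans[OF eU ennreal_less_top] by simp
        then show ?thesis using base(2)
          by (metis ennreal_add_eq_top infinity_ennreal_def less_top)
      qed
      finally have fU: "emeasure lborel U < \<infinity>" .
      show "\<exists>v. integrable lborel v \<and> (\<lambda>n. LBINT x. norm (v (x + z n) - v x)) \<longlonglongrightarrow> 0 \<and>
              (LBINT x. norm (indicator A x *\<^sub>R c - v x)) < e"
      proof (intro exI[of _ "\<lambda>x. indicator U x *\<^sub>R c"] conjI)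
        show "integrable lborel (\<lambda>x. indicator U x *\<^sub>R c)"
          using fU by (intro integrable_scaleR_left integrable_real_indicator) auto
        show "(\<lambda>n. LBINT x. norm (indicator U (x + z n) *\<^sub>R c - indicator U x *\<^sub>R c)) \<longlonglongrightarrow> 0"
          using L1_translation_indicator_open[OF U(1) fU assms(2)] .
        have "(LBINT x. norm (indicator A x *\<^sub>R c - indicator U x *\<^sub>R c)) =
          (LBINT x. indicator (U - A) x * cmod c)"
          using U(2) by (intro Bochner_Integration.integral_cong) (auto simp: indicator_def)
        also have "\<dots> = measure lborel (U - A) * cmod c" by simp
        also have "\<dots> \<le> d * cmod c"
          using eU d by (intro mult_right_mono) (auto simp: measure_def enn2real_leI)
        finally show "(LBINT x. norm (indicator A x *\<^sub>R c - indicator U x *\<^sub>R c)) < e" using d by simp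
      qed
    qed
  next
    case (add f g)
    note [measurable] = borel_measurable_integrable[OF add(1)] borel_measurable_integrable[OF add(2)]
    have i: "integrable lborel (\<lambda>x. norm (f (x + z n) - f x))" "integrable lborel (\<lambda>x. norm (g (x + z n) - g x))" for n
      using integrable_translate[of f "z n"] integrable_translate[of g "z n"] add by auto
    show ?case
    proof (rule tendsto_sandwich[OF _ _ tendsto_const])
      show "(\<lambda>n. (LBINT x. norm (f (x + z n) - f x)) + (LBINT x. norm (g (x + z n) - g x))) \<longlonglongrightarrow> 0"
        using tendsto_add[OF add.IH] by simp
      show "\<forall>\<^sub>F n in sequentially. (LBINT x. norm (f (x + z n) + g (x + z n) - (f x + g x))) \<le>
         (LBINT x. norm (f (x + z n) - f x)) + (LBINT x. norm (g (x + z n) - g x))"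
      proof (rule always_eventually, rule allI)
        fix n
        have "(LBINT x. norm (f (x + z n) + g (x + z n) - (f x + g x))) \<le>
           (LBINT x. norm (f (x + z n) - f x) + norm (g (x + z n) - g x))"
          using i[of n] integrable_translate[of f "z n"] integrable_translate[of g "z n"] add
          by (intro integral_mono) (auto intro: norm_diff_triangle_ineq)
        then show "(LBINT x. norm (f (x + z n) + g (x + z n) - (f x + g x))) \<le>
         (LBINT x. norm (f (x + z n) - f x)) + (LBINT x. norm (g (x + z n) - g x))"
          using i[of n] by simp
      qed
    qed auto
  next
    case (lim f s)
    show ?case
    proof (rule approx[OF lim(4)])
      fix e :: real assume "e > 0"
      have "(\<lambda>i. LBINT x. norm (f x - s i x)) \<longlonglongrightarrow> (LBINT (x::real^2). 0::real)"
      proof (rule integral_dominated_convergence)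
        show "integrable lborel (\<lambda>x. 3 * norm (f x))" using lim by auto
        show "AE x in lborel. (\<lambda>i. norm (f x - s i x)) \<longlonglongrightarrow> 0"
        proof (rule AE_I2)
          fix x :: "real^2" assume "x \<in> space lborel"
          then have "(\<lambda>i. norm (f x - s i x)) \<longlonglongrightarrow> norm (f x - f x)"
            using lim(2) by (intro tendsto_intros)
          then show "(\<lambda>i. norm (f x - s i x)) \<longlonglongrightarrow> 0" by simp
        qed
        show "AE x in lborel. norm (norm (f x - s i x)) \<le> 3 * norm (f x)" for i
        proof (rule AE_I2)
          fix x :: "real^2" assume "x \<in> space lborel"
          then have "norm (s i x) \<le> 2 * norm (f x)" using lim(3) by auto
          then show "norm (norm (f x - s i x)) \<le> 3 * norm (f x)"
            using norm_triangle_ineq4[of "f x" "s i x"] by simp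
        qed
      qed (use lim in auto)
      then have "(\<lambda>i. LBINT x. norm (f x - s i x)) \<longlonglongrightarrow> 0" by simp
      from LIMSEQ_D[OF this \<open>e > 0\<close>] obtain i where "norm ((LBINT x. norm (f x - s i x)) - 0) < e"
        by blast
      then show "\<exists>v. integrable lborel v \<and> (\<lambda>n. LBINT x. norm (v (x + z n) - v x)) \<longlonglongrightarrow> 0 \<and>
              (LBINT x. norm (f x - v x)) < e"
        using lim by (intro exI[of _ "s i"]) auto
    qed
  qed
qed

section \<open>Mollification\<close>

definition mollify :: "real \<Rightarrow> (real^2 \<Rightarrow> complex) \<Rightarrow> real^2 \<Rightarrow> complex" where
  "mollify \<epsilon> u x = (LBINT y. mol y *\<^sub>R u (x - \<epsilon> *\<^sub>R y))"

lemma mol_bounded: obtains C where "C > 0" "\<And>x. \<bar>mol x\<bar> \<le> C"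
proof -
  define C where "C = inverse (LBINT y. flat 0 (1 - (norm (y::real^2))\<^sup>2))"
  have "C > 0" using flat_unit_integral by (simp add: C_def)
  moreover have "\<bar>mol x\<bar> \<le> C" for x
    unfolding mol_def C_def using flat_unit_integral flat0_le_1 flat_nonneg
    by (simp add: abs_mult divide_inverse mult_left_le_one_le)
  ultimately show ?thesis using that by blast
qed

lemma mollify_integrand_integrable:
  fixes u :: "real^2 \<Rightarrow> complex"
  assumes "integrable lborel u" "\<epsilon> \<noteq> 0"
  shows "integrable lborel (\<lambda>y. mol y *\<^sub>R u (x - \<epsilon> *\<^sub>R y))"
proof -
  obtain C where C: "C > 0" "\<And>x. \<bar>mol x\<bar> \<le> C" using mol_bounded by blast
  have u: "integrable lborel (\<lambda>y. u (x - \<epsilon> *\<^sub>R y))"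
    using lborel_integral_affine(2)[of u "-\<epsilon>" x] assms by auto
  have "integrable lborel (\<lambda>y. C *\<^sub>R u (x - \<epsilon> *\<^sub>R y))" using u by auto
  then show ?thesis
    by (rule Bochner_Integration.integrable_bound)
      (use u C in \<open>auto intro!: mult_right_mono\<close>)
qed

lemma mollify_measurable [measurable]:
  assumes [measurable]: "u \<in> borel_measurable borel"
  shows "mollify \<epsilon> u \<in> borel_measurable borel"
  unfolding mollify_def[abs_def] by measurable

lemma mollify_L1:
  assumes u: "integrable lborel u"
  shows "\<epsilon> \<noteq> 0 \<Longrightarrow> integrable lborel (mollify \<epsilon> u)"
    and "(\<lambda>n. LBINT x. norm (mollify (1 / Suc n) u x - u x)) \<longlonglongrightarrow> 0"
proof -
  have [measurable]: "u \<in> borel_measurable borel" using u by auto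
  define T where "T w = (LBINT x. norm (u (x - w) - u x))" for w
  have [measurable]: "T \<in> borel_measurable borel" unfolding T_def[abs_def] by measurable
  have uw: "integrable lborel (\<lambda>x. u (x - w))" "(LBINT x. norm (u (x - w))) = (LBINT x. norm (u x))" for w
    using integrable_translate[of u "-w"] integrable_translate[of "\<lambda>x. norm (u x)" "-w"] u by auto
  have T0: "0 \<le> T w" for w by (simp add: T_def)
  have T2: "T w \<le> 2 * (LBINT x. norm (u x))" for w
  proof -
    have "T w \<le> (LBINT x. norm (u (x - w)) + norm (u x))"
      unfolding T_def using u uw by (intro integral_mono) (auto intro: norm_triangle_ineq4)
    then show ?thesis using u uw by simp
  qed
  have iT: "integrable lborel (\<lambda>y. mol y * T (\<epsilon> *\<^sub>R y))" for \<epsilon>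
  proof (rule Bochner_Integration.integrable_bound)
    show "integrable lborel (\<lambda>y. (2 * (LBINT x. norm (u x))) * mol y)"
      using mol_integral by simp
    show "AE y in lborel. norm (mol y * T (\<epsilon> *\<^sub>R y)) \<le> norm ((2 * (LBINT x. norm (u x))) * mol y)"
      using mol_nonneg T0 T2
      by (intro AE_I2) (simp add: abs_mult mult.commute mult_left_mono)
  qed simp
  have key: "(\<integral>\<^sup>+x. ennreal (norm (mollify \<epsilon> u x - u x)) \<partial>lborel) \<le> ennreal (LBINT y. mol y * T (\<epsilon> *\<^sub>R y))"
    if "\<epsilon> \<noteq> 0" for \<epsilon>
  proof -
    have 1: "ennreal (norm (mollify \<epsilon> u x - u x)) \<le> (\<integral>\<^sup>+y. ennreal (mol y * norm (u (x - \<epsilon> *\<^sub>R y) - u x)) \<partial>lborel)" for x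
    proof -
      have i1: "integrable lborel (\<lambda>y. mol y *\<^sub>R u (x - \<epsilon> *\<^sub>R y))"
        by (rule mollify_integrand_integrable[OF u that])
      have i2: "integrable lborel (\<lambda>y. mol y *\<^sub>R u x)" using mol_integral by simp
      have "mollify \<epsilon> u x - u x = (LBINT y. mol y *\<^sub>R u (x - \<epsilon> *\<^sub>R y)) - (LBINT y. mol y *\<^sub>R u x)"
        using mol_integral by (simp add: mollify_def)
      also have "\<dots> = (LBINT y. mol y *\<^sub>R u (x - \<epsilon> *\<^sub>R y) - mol y *\<^sub>R u x)"
        using i1 i2 by simp
      finally have "ennreal (norm (mollify \<epsilon> u x - u x)) \<le>
          (\<integral>\<^sup>+y. ennreal (norm (mol y *\<^sub>R u (x - \<epsilon> *\<^sub>R y) - mol y *\<^sub>R u x)) \<partial>lborel)"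
        using integral_norm_bound_ennreal[of lborel "\<lambda>y. mol y *\<^sub>R u (x - \<epsilon> *\<^sub>R y) - mol y *\<^sub>R u x"] i1 i2
        by auto
      also have "\<dots> = (\<integral>\<^sup>+y. ennreal (mol y * norm (u (x - \<epsilon> *\<^sub>R y) - u x)) \<partial>lborel)"
        by (intro nn_integral_cong) (simp add: mol_nonneg flip: scaleR_diff_right)
      finally show ?thesis .
    qed
    have "(\<integral>\<^sup>+x. ennreal (norm (mollify \<epsilon> u x - u x)) \<partial>lborel) \<le>
       (\<integral>\<^sup>+x. \<integral>\<^sup>+y. ennreal (mol y * norm (u (x - \<epsilon> *\<^sub>R y) - u x)) \<partial>lborel \<partial>lborel)"
      by (intro nn_integral_mono 1)
    also have "\<dots> = (\<integral>\<^sup>+y. \<integral>\<^sup>+x. ennreal (mol y * norm (u (x - \<epsilon> *\<^sub>R y) - u x)) \<partial>lborel \<partial>lborel)"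
      by (rule lborel_pair.Fubini'[symmetric]) measurable
    also have "\<dots> = (\<integral>\<^sup>+y. ennreal (mol y * T (\<epsilon> *\<^sub>R y)) \<partial>lborel)"
    proof (rule nn_integral_cong)
      fix y
      have "integrable lborel (\<lambda>x. mol y * norm (u (x - \<epsilon> *\<^sub>R y) - u x))"
        using u uw[of "\<epsilon> *\<^sub>R y"] by simp
      then show "(\<integral>\<^sup>+x. ennreal (mol y * norm (u (x - \<epsilon> *\<^sub>R y) - u x)) \<partial>lborel) = ennreal (mol y * T (\<epsilon> *\<^sub>R y))"
        using mol_nonneg by (subst nn_integral_eq_integral) (auto simp: T_def)
    qed
    also have "\<dots> = ennreal (LBINT y. mol y * T (\<epsilon> *\<^sub>R y))"
      using iT mol_nonneg T0 by (intro nn_integral_eq_integral) auto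
    finally show ?thesis .
  qed
  have imu: "integrable lborel (\<lambda>x. mollify \<epsilon> u x - u x)" if "\<epsilon> \<noteq> 0" for \<epsilon>
    using le_less_trans[OF key[OF that], of \<infinity>] by (intro integrableI_bounded) auto
  show "integrable lborel (mollify \<epsilon> u)" if "\<epsilon> \<noteq> 0" for \<epsilon>
    using Bochner_Integration.integrable_add[OF imu[OF that] u] by simp
  have lim: "(\<lambda>n. LBINT y. mol y * T ((1 / Suc n) *\<^sub>R y)) \<longlonglongrightarrow> (LBINT (y::real^2). 0::real)"
  proof (rule integral_dominated_convergence)
    show "integrable lborel (\<lambda>y. (2 * (LBINT x. norm (u x))) * mol y)"
      using mol_integral by simp
    show "AE y in lborel. norm (mol y * T ((1 / Suc n) *\<^sub>R y)) \<le> (2 * (LBINT x. norm (u x))) * mol y" for n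
      using mol_nonneg T0 T2
      by (intro AE_I2) (simp add: abs_mult mult.commute mult_left_mono)
    show "AE y in lborel. (\<lambda>n. mol y * T ((1 / Suc n) *\<^sub>R y)) \<longlonglongrightarrow> 0"
    proof (rule AE_I2)
      fix y :: "real^2"
      have "(\<lambda>n. 1 / real (Suc n)) \<longlonglongrightarrow> 0"
        using LIMSEQ_inverse_real_of_nat by (simp add: inverse_eq_divide)
      then have "(\<lambda>n. - ((1 / real (Suc n)) *\<^sub>R y)) \<longlonglongrightarrow> - (0 *\<^sub>R y)" by (intro tendsto_intros)
      then have "(\<lambda>n. T ((1 / Suc n) *\<^sub>R y)) \<longlonglongrightarrow> 0"
        using L1_translation_continuous[OF u, of "\<lambda>n. - ((1 / real (Suc n)) *\<^sub>R y)"] by (simp add: T_def)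
      then show "(\<lambda>n. mol y * T ((1 / Suc n) *\<^sub>R y)) \<longlonglongrightarrow> 0"
        by (rule tendsto_mult_right_zero)
    qed
  qed auto
  show "(\<lambda>n. LBINT x. norm (mollify (1 / Suc n) u x - u x)) \<longlonglongrightarrow> 0"
  proof (rule tendsto_sandwich[OF _ _ tendsto_const])
    show "\<forall>\<^sub>F n in sequentially. (LBINT x. norm (mollify (1 / Suc n) u x - u x)) \<le> (LBINT y. mol y * T ((1 / Suc n) *\<^sub>R y))"
    proof (rule always_eventually, rule allI)
      fix n
      have "ennreal (LBINT x. norm (mollify (1 / Suc n) u x - u x)) \<le> ennreal (LBINT y. mol y * T ((1 / Suc n) *\<^sub>R y))"
        using key[of "1 / Suc n"] imu[of "1 / Suc n"]
        by (subst nn_integral_eq_integral[symmetric]) auto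
      then show "(LBINT x. norm (mollify (1 / Suc n) u x - u x)) \<le> (LBINT y. mol y * T ((1 / Suc n) *\<^sub>R y))"
        using mol_nonneg T0 by (subst (asm) ennreal_le_iff) (auto intro!: Bochner_Integration.integral_nonneg)
    qed
    show "(\<lambda>n. LBINT y. mol y * T ((1 / Suc n) *\<^sub>R y)) \<longlonglongrightarrow> 0" using lim by simp
  qed auto
qed

text \<open>This form lets the definition of a weak derivative act on a mollification.\<close>
lemma mollify_eq_test:
  assumes [measurable]: "u \<in> borel_measurable borel" and "n > 0"
  shows "(LBINT w. mol (n *\<^sub>R (x - w)) *\<^sub>R u w) = (1/n)\<^sup>2 *\<^sub>R mollify (1/n) u x"
proof -
  have "(LBINT w. mol (n *\<^sub>R (x - w)) *\<^sub>R u w) =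
    (-(1/n))\<^sup>2 *\<^sub>R (LBINT y. mol (n *\<^sub>R (x - (x + (-(1/n)) *\<^sub>R y))) *\<^sub>R u (x + (-(1/n)) *\<^sub>R y))"
    using assms(2) by (intro lborel_integral_affine) auto
  then show ?thesis using assms(2) by (simp add: mollify_def scaleR_right_diff_distrib)
qed

lemma mollify_AE_subseq:
  assumes "integrable lborel u"
  obtains r :: "nat \<Rightarrow> nat" where "strict_mono r"
    "AE x in lborel. (\<lambda>n. mollify (1 / Suc (r n)) u x) \<longlonglongrightarrow> u x"
proof -
  obtain r :: "nat \<Rightarrow> nat" where r: "strict_mono r"
    "AE x in lborel. (\<lambda>n. mollify (1 / Suc (r n)) u x - u x) \<longlonglongrightarrow> 0"
    using tendsto_L1_AE_subseq[of lborel "\<lambda>n x. mollify (1 / Suc n) u x - u x"]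
      mollify_L1[OF assms] assms by auto
  have "AE x in lborel. (\<lambda>n. mollify (1 / Suc (r n)) u x) \<longlonglongrightarrow> u x"
    using r(2) by eventually_elim (simp add: LIM_zero_iff)
  then show ?thesis using r that by blast
qed

lemma borel_rep_integrable:
  assumes "open \<Omega>" "bounded \<Omega>" "u \<in> L2 \<Omega>" "borel_rep \<Omega> u u'"
  shows "integrable lborel u'"
  using LINT_eq_LBINT(2)[of \<Omega> u u'] L2_integrable[of \<Omega> u] bounded_open_finite_measure assms
  by (auto simp: L2_def)

text \<open>At a point of \<open>\<Omega>\<close> the mollifications at small scale are integrals against test functions, hence zero; and a sequence of mollifications converges almost everywhere to the function.\<close>
lemma fundamental_lemma:
  assumes "open \<Omega>" "bounded \<Omega>" "u \<in> L2 \<Omega>"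
    and 0: "\<And>\<phi>. test_function \<Omega> \<phi> \<Longrightarrow> (LINT x|lebesgue_on \<Omega>. of_real (\<phi> x) * u x) = 0"
  shows "AE x in lebesgue_on \<Omega>. u x = 0"
proof -
  have um: "u \<in> borel_measurable (lebesgue_on \<Omega>)" using assms by (simp add: L2_def)
  obtain u' where u': "borel_rep \<Omega> u u'" using borel_rep_exists[OF assms(1) um] by blast
  have [measurable]: "u' \<in> borel_measurable borel" using u' by (simp add: borel_rep_def)
  have iu: "integrable lborel u'" using borel_rep_integrable assms u' by blast
  obtain r :: "nat \<Rightarrow> nat" where r: "strict_mono r"
    "AE x in lborel. (\<lambda>n. mollify (1 / Suc (r n)) u' x) \<longlonglongrightarrow> u' x"
    using mollify_AE_subseq[OF iu] by blast
  have z: "mollify (1 / Suc n) u' x = 0" if "cball x (1 / Suc n) \<subseteq> \<Omega>" for n x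
  proof -
    let ?\<phi> = "\<lambda>w. mol (real (Suc n) *\<^sub>R (x - w))"
    have "test_function \<Omega> ?\<phi>" using that by (intro mol_test_function) auto
    then have "(LINT w|lebesgue_on \<Omega>. of_real (?\<phi> w) * u w) = 0" by (rule 0)
    moreover have "(LINT w|lebesgue_on \<Omega>. of_real (?\<phi> w) * u w) = (LBINT w. of_real (?\<phi> w) * u' w)"
      using assms um u' mol_integral
      by (intro LINT_eq_LBINT borel_rep_mult borel_measurable_times um) (auto intro!: borel_measurable_continuous_on_restrict measurable_completion measurable_restrict_space1)
    moreover have "\<dots> = (LBINT w. ?\<phi> w *\<^sub>R u' w)" by (simp add: scaleR_conv_of_real)
    ultimately show ?thesis using mollify_eq_test[of u' "real (Suc n)" x] by simp
  qed
  have "AE x in lborel. x \<in> \<Omega> \<longrightarrow> u' x = 0"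
    using r(2)
  proof eventually_elim
    case (elim x)
    show ?case
    proof
      assume "x \<in> \<Omega>"
      then obtain e where e: "e > 0" "cball x e \<subseteq> \<Omega>" using assms(1) open_contains_cball by blast
      obtain N where N: "1 / real (Suc N) < e" using e(1) nat_approx_posE by blast
      have "mollify (1 / Suc (r n)) u' x = 0" if "n \<ge> N" for n
      proof (rule z)
        have "r n \<ge> N" using r(1) that by (meson le_trans seq_suble)
        then have "1 / real (Suc (r n)) \<le> 1 / real (Suc N)" by (simp add: frac_le)
        then show "cball x (1 / Suc (r n)) \<subseteq> \<Omega>" using N e by (meson le_less_trans less_imp_le order_trans subset_cball)
      qed
      then have "(\<lambda>n. mollify (1 / Suc (r n)) u' x) \<longlonglongrightarrow> 0"
        by (intro tendsto_eventually) (auto simp: eventually_at_top_linorder)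
      then show "u' x = 0" using elim LIMSEQ_unique by blast
    qed
  qed
  then have "AE x in lborel. x \<in> \<Omega> \<longrightarrow> u x = 0"
    using u' unfolding borel_rep_def by (auto elim: AE_mp)
  then have "AE x in lebesgue. x \<in> \<Omega> \<longrightarrow> u x = 0" by (rule AE_completion)
  then show ?thesis using assms(1) by (simp add: AE_lebesgue_on_iff)
qed

section \<open>Weak gradients and differences\<close>

text \<open>A function together with a chosen weak gradient. Carrying the gradient along avoids the choice operator in the weak partial derivatives.\<close>
definition wgrad :: "(real^2) set \<Rightarrow> (real^2 \<Rightarrow> complex) \<Rightarrow> (2 \<Rightarrow> real^2 \<Rightarrow> complex) \<Rightarrow> bool" where
  "wgrad \<Omega> u g \<longleftrightarrow> u \<in> L2 \<Omega> \<and> (\<forall>j. g j \<in> L2 \<Omega> \<and> has_weak_partial \<Omega> j u (g j))"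

lemma jensen_nn:
  fixes f :: "'a \<Rightarrow> complex"
  assumes [measurable]: "p \<in> borel_measurable M" "f \<in> borel_measurable M"
    and p: "\<And>t. 0 \<le> p t" "(\<integral>\<^sup>+t. ennreal (p t) \<partial>M) \<le> 1"
  shows "ennreal ((cmod (LINT t|M. p t *\<^sub>R f t))\<^sup>2) \<le> (\<integral>\<^sup>+t. ennreal (p t * (cmod (f t))\<^sup>2) \<partial>M)"
proof (cases "integrable M (\<lambda>t. p t *\<^sub>R f t)")
  case True
  have "ennreal ((cmod (LINT t|M. p t *\<^sub>R f t))\<^sup>2) = (ennreal (cmod (LINT t|M. p t *\<^sub>R f t)))\<^sup>2"
    by (simp add: ennreal_power)
  also have "\<dots> \<le> (\<integral>\<^sup>+t. ennreal (norm (p t *\<^sub>R f t)) \<partial>M)\<^sup>2"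
    by (intro power_mono integral_norm_bound_ennreal True) auto
  also have "\<dots> = (\<integral>\<^sup>+t. ennreal (sqrt (p t)) * ennreal (sqrt (p t) * cmod (f t)) \<partial>M)\<^sup>2"
    using p by (intro arg_cong[where f="\<lambda>x. x\<^sup>2"] nn_integral_cong)
      (auto simp flip: ennreal_mult simp: mult.assoc[symmetric])
  also have "\<dots> \<le> (\<integral>\<^sup>+t. (ennreal (sqrt (p t)))\<^sup>2 \<partial>M) * (\<integral>\<^sup>+t. (ennreal (sqrt (p t) * cmod (f t)))\<^sup>2 \<partial>M)"
    by (intro Cauchy_Schwarz_nn_integral) auto
  also have "\<dots> = (\<integral>\<^sup>+t. ennreal (p t) \<partial>M) * (\<integral>\<^sup>+t. ennreal (p t * (cmod (f t))\<^sup>2) \<partial>M)"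
    using p by (simp add: ennreal_power power_mult_distrib)
  also have "\<dots> \<le> 1 * (\<integral>\<^sup>+t. ennreal (p t * (cmod (f t))\<^sup>2) \<partial>M)"
    using p by (intro mult_right_mono) auto
  finally show ?thesis by simp
next
  case False
  then show ?thesis by (simp add: not_integrable_integral_eq)
qed

lemma continuous_measurable_on:
  fixes f :: "real^2 \<Rightarrow> real"
  assumes "continuous_on UNIV f"
  shows "f \<in> borel_measurable borel" "(\<lambda>x. complex_of_real (f x)) \<in> borel_measurable borel"
    "f \<in> borel_measurable (lebesgue_on \<Omega>)"
    "(\<lambda>x. complex_of_real (f x)) \<in> borel_measurable (lebesgue_on \<Omega>)"
proof -
  show 1: "f \<in> borel_measurable borel" using assms by (rule borel_measurable_continuous_onI)
  then show 2: "(\<lambda>x. complex_of_real (f x)) \<in> borel_measurable borel" by measurable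
  show "f \<in> borel_measurable (lebesgue_on \<Omega>)"
    using 1 by (intro measurable_restrict_space1 measurable_completion) simp
  show "(\<lambda>x. complex_of_real (f x)) \<in> borel_measurable (lebesgue_on \<Omega>)"
    using 2 by (intro measurable_restrict_space1 measurable_completion) simp
qed

lemma test_function_continuous:
  assumes "test_function \<Omega> \<phi>"
  shows "continuous_on S \<phi>" "continuous_on S (\<lambda>x. frechet_derivative \<phi> (at x) (axis j 1))"
    "(\<phi> has_derivative frechet_derivative \<phi> (at x)) (at x)"
proof -
  have "Ck_on 0 UNIV \<phi>" "Ck_on (Suc 0) UNIV \<phi>"
    using assms unfolding test_function_def smooth_on_def by blast+
  moreover have b: "axis j 1 \<in> (Basis :: (real^2) set)" by (auto simp: Basis_vec_def)
  ultimately have c: "continuous_on UNIV (\<lambda>x. frechet_derivative \<phi> (at x) (axis j 1))" by auto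
  then show "continuous_on S (\<lambda>x. frechet_derivative \<phi> (at x) (axis j 1))"
    by (rule continuous_on_subset) simp
  from \<open>Ck_on 0 UNIV \<phi>\<close> \<open>Ck_on (Suc 0) UNIV \<phi>\<close>
  show "continuous_on S \<phi>" "(\<phi> has_derivative frechet_derivative \<phi> (at x)) (at x)"
    by (auto intro: continuous_on_subset simp: frechet_derivative_works)
qed

lemma test_function_deriv_0:
  assumes "test_function \<Omega> \<phi>" "x \<notin> closure {x. \<phi> x \<noteq> 0}"
  shows "frechet_derivative \<phi> (at x) v = 0"
proof -
  have "(\<phi> has_derivative (\<lambda>v. 0)) (at x)"
  proof (rule has_derivative_transform_within_open[where f="\<lambda>_. 0" and s="- closure {x. \<phi> x \<noteq> 0}"])
    show "\<And>y. y \<in> - closure {x. \<phi> x \<noteq> 0} \<Longrightarrow> 0 = \<phi> y"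
      using closure_subset[of "{x. \<phi> x \<noteq> 0}"] by auto
  qed (use assms in auto)
  then show ?thesis by (metis frechet_derivative_at)
qed

lemma continuous_bounded_support:
  fixes f :: "real^2 \<Rightarrow> real"
  assumes "continuous_on UNIV f" "compact K" "\<And>x. x \<notin> K \<Longrightarrow> f x = 0"
  obtains C where "C \<ge> 0" "\<And>x. \<bar>f x\<bar> \<le> C"
proof -
  have "bounded (f ` K)"
    using assms by (intro compact_imp_bounded compact_continuous_image) (auto intro: continuous_on_subset)
  then obtain C where C: "\<And>x. x \<in> K \<Longrightarrow> \<bar>f x\<bar> \<le> C" by (auto simp: bounded_iff)
  have "\<bar>f x\<bar> \<le> max C 0" for x using C[of x] assms(3)[of x] by (cases "x \<in> K") auto
  then show ?thesis using that[of "max C 0"] by auto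
qed

lemma test_function_bounded:
  assumes "test_function \<Omega> \<phi>"
  obtains C where "C \<ge> 0" "\<And>x. \<bar>\<phi> x\<bar> \<le> C" "\<And>x. \<bar>frechet_derivative \<phi> (at x) (axis j 1)\<bar> \<le> C"
proof -
  let ?K = "closure {x. \<phi> x \<noteq> 0}"
  have K: "compact ?K" using assms by (simp add: test_function_def)
  obtain C1 where C1: "C1 \<ge> 0" "\<And>x. \<bar>\<phi> x\<bar> \<le> C1"
    using continuous_bounded_support[OF test_function_continuous(1)[OF assms] K]
    by (metis (mono_tags, lifting) closure_subset mem_Collect_eq subset_iff)
  obtain C2 where C2: "C2 \<ge> 0" "\<And>x. \<bar>frechet_derivative \<phi> (at x) (axis j 1)\<bar> \<le> C2"
    using continuous_bounded_support[OF test_function_continuous(2)[OF assms] K, of j]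
      test_function_deriv_0[OF assms] by metis
  show ?thesis
    using that[of "C1 + C2"] C1 C2 by (metis add_increasing add_increasing2 add_nonneg_nonneg)
qed

lemma vec2_expansion: "(z :: real^2) = (\<Sum>j\<in>UNIV. z $ j *\<^sub>R axis j 1)"
  by (simp add: vec_eq_iff axis_def if_distrib[where f="\<lambda>x. _ * x"] cong: if_cong)

lemma test_function_L2:
  assumes "\<Omega> \<in> lmeasurable" "test_function \<Omega> \<phi>"
  shows "(\<lambda>x. complex_of_real (\<phi> x)) \<in> L2 \<Omega>"
    and "(\<lambda>x. complex_of_real (frechet_derivative \<phi> (at x) (axis j 1))) \<in> L2 \<Omega>"
proof -
  obtain C where C: "\<And>x. \<bar>\<phi> x\<bar> \<le> C" "\<And>x. \<bar>frechet_derivative \<phi> (at x) (axis j 1)\<bar> \<le> C"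
    using test_function_bounded[OF assms(2)] by metis
  show "(\<lambda>x. complex_of_real (\<phi> x)) \<in> L2 \<Omega>"
    "(\<lambda>x. complex_of_real (frechet_derivative \<phi> (at x) (axis j 1))) \<in> L2 \<Omega>"
    using L2_bounded_mult[OF L2_const(1)[OF assms(1), of 1], of _ C] C
      continuous_measurable_on(4)[OF test_function_continuous(1)[OF assms(2)]]
      continuous_measurable_on(4)[OF test_function_continuous(2)[OF assms(2)]]
    by fastforce+
qed

text \<open>For square integrable functions on a domain of finite measure, local integrability is automatic and the definition of weak derivatives becomes an identity of inner products.\<close>
lemma has_weak_partial_inner:
  assumes "\<Omega> \<in> lmeasurable" "u \<in> L2 \<Omega>" "g \<in> L2 \<Omega>"
  shows "has_weak_partial \<Omega> j u g \<longleftrightarrow> (\<forall>\<phi>. test_function \<Omega> \<phi> \<longrightarrow>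
    L2_inner \<Omega> u (\<lambda>x. of_real (frechet_derivative \<phi> (at x) (axis j 1))) = - L2_inner \<Omega> g (\<lambda>x. of_real (\<phi> x)))"
proof -
  have "locally_integrable \<Omega> v" if "v \<in> L2 \<Omega>" for v
    unfolding locally_integrable_def
  proof (intro allI impI)
    fix K assume K: "compact K \<and> K \<subseteq> \<Omega>"
    then have "K \<in> sets borel" by (simp add: borel_compact)
    then have "K \<in> sets lebesgue" "\<Omega> \<in> sets lebesgue" using assms(1) by auto
    moreover have "integrable (lebesgue_on \<Omega>) v" by (rule L2_integrable[OF assms(1) that])
    ultimately have "set_integrable lebesgue \<Omega> v"
      by (simp add: set_integrable_def integrable_restrict_space)
    then have "set_integrable lebesgue K v"
      using K \<open>K \<in> sets lebesgue\<close> by (auto intro: set_integrable_subset)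
    then show "integrable (lebesgue_on K) v"
      using \<open>K \<in> sets lebesgue\<close> by (simp add: set_integrable_def integrable_restrict_space)
  qed
  then show ?thesis
    using assms unfolding has_weak_partial_def L2_inner_def by (simp add: mult.commute)
qed

lemma weak_directional:
  assumes fin: "\<Omega> \<in> lmeasurable" and w: "wgrad \<Omega> u g" and t: "test_function \<Omega> \<phi>"
  shows "(LINT x|lebesgue_on \<Omega>. of_real (frechet_derivative \<phi> (at x) z) * u x) =
     - (LINT x|lebesgue_on \<Omega>. of_real (\<phi> x) * (\<Sum>j\<in>UNIV. of_real (z $ j) * g j x))"
proof -
  have u: "u \<in> L2 \<Omega>" and g: "g j \<in> L2 \<Omega>" for j using w by (auto simp: wgrad_def)
  note tL = test_function_L2[OF fin t]
  have lin: "frechet_derivative \<phi> (at x) z = (\<Sum>j\<in>UNIV. z $ j * frechet_derivative \<phi> (at x) (axis j 1))" for x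
  proof -
    have l: "linear (frechet_derivative \<phi> (at x))"
      using test_function_continuous(3)[OF t] has_derivative_linear by blast
    have "frechet_derivative \<phi> (at x) (\<Sum>j\<in>UNIV. z $ j *\<^sub>R axis j 1) = (\<Sum>j\<in>UNIV. z $ j * frechet_derivative \<phi> (at x) (axis j 1))"
      by (simp add: linear_sum[OF l] linear_scale[OF l])
    then show ?thesis using vec2_expansion[of z] by simp
  qed
  have "(LINT x|lebesgue_on \<Omega>. of_real (frechet_derivative \<phi> (at x) z) * u x) =
    (LINT x|lebesgue_on \<Omega>. (\<Sum>j\<in>UNIV. of_real (z $ j) * (u x * cnj (of_real (frechet_derivative \<phi> (at x) (axis j 1))))))"
    by (intro Bochner_Integration.integral_cong) (auto simp: lin sum_distrib_left mult_ac intro!: sum.cong)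
  also have "\<dots> = (\<Sum>j\<in>UNIV. of_real (z $ j) * L2_inner \<Omega> u (\<lambda>x. of_real (frechet_derivative \<phi> (at x) (axis j 1))))"
    unfolding L2_inner_def using L2_prod_integrable[OF u tL(2)]
    by (subst Bochner_Integration.integral_sum) auto
  also have "\<dots> = (\<Sum>j\<in>UNIV. of_real (z $ j) * (- L2_inner \<Omega> (g j) (\<lambda>x. of_real (\<phi> x))))"
    using w t has_weak_partial_inner[OF fin u g] by (intro sum.cong) (auto simp: wgrad_def)
  also have "\<dots> = - (LINT x|lebesgue_on \<Omega>. (\<Sum>j\<in>UNIV. of_real (z $ j) * (g j x * cnj (of_real (\<phi> x)))))"
    unfolding L2_inner_def using L2_prod_integrable[OF g tL(1)]
    by (subst Bochner_Integration.integral_sum) (auto simp: sum_negf)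
  also have "(LINT x|lebesgue_on \<Omega>. (\<Sum>j\<in>UNIV. of_real (z $ j) * (g j x * cnj (of_real (\<phi> x))))) =
      (LINT x|lebesgue_on \<Omega>. of_real (\<phi> x) * (\<Sum>j\<in>UNIV. of_real (z $ j) * g j x))"
    by (intro Bochner_Integration.integral_cong) (auto simp: sum_distrib_left mult_ac intro!: sum.cong)
  finally show ?thesis .
qed

text \<open>The fundamental theorem of calculus along the segment, applied to the smooth kernel. The weak derivative then moves from the kernel to the function, because the kernel centred at a point of the segment is a test function on \<open>\<Omega>\<close>.\<close>
lemma mollify_difference:
  fixes z :: "real^2"
  assumes op: "open \<Omega>" and bd: "bounded \<Omega>" and w: "wgrad \<Omega> u g"
    and u': "borel_rep \<Omega> u u'" and g': "\<And>j. borel_rep \<Omega> (g j) (g' j)"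
    and n: "n > 0" and path: "\<And>s. s \<in> {0..1} \<Longrightarrow> cball (x + s *\<^sub>R z) (1/n) \<subseteq> \<Omega>"
  defines "h \<equiv> \<lambda>y. \<Sum>j\<in>UNIV. of_real (z $ j) * g' j y"
  shows "mollify (1/n) u' (x + z) - mollify (1/n) u' x =
     (LBINT s. indicator {0..1} s *\<^sub>R mollify (1/n) h (x + s *\<^sub>R z))"
proof -
  have fin: "\<Omega> \<in> lmeasurable" using bounded_open_finite_measure op bd by blast
  have uL: "u \<in> L2 \<Omega>" and gL: "g j \<in> L2 \<Omega>" for j using w by (auto simp: wgrad_def)
  have [measurable]: "u' \<in> borel_measurable borel" "g' j \<in> borel_measurable borel" for j
    using u' g'[of j] by (auto simp: borel_rep_def)
  have iu: "integrable lborel u'" using borel_rep_integrable op bd uL u' by blast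
  have hm [measurable]: "h \<in> borel_measurable borel" unfolding h_def by measurable
  have h: "borel_rep \<Omega> (\<lambda>y. \<Sum>j\<in>UNIV. of_real (z $ j) * g j y) h"
    using borel_rep_add[OF borel_rep_mult[OF g'[of 1], of "\<lambda>_. of_real (z $ 1)"] borel_rep_mult[OF g'[of 2], of "\<lambda>_. of_real (z $ 2)"]]
    by (simp add: h_def sum_2)
  define \<phi> where "\<phi> p w = mol (n *\<^sub>R (p - w))" for p w
  define M where "M q = frechet_derivative mol (at q) z" for q
  have Mr: "M \<in> bump_ring" unfolding M_def using bump_ring_differentiable(2)[OF mol_ring] by auto
  have Mc: "continuous_on S M" for S using bump_ring_differentiable(3)[OF Mr] .
  have [measurable]: "M \<in> borel_measurable borel" using Mc by (rule borel_measurable_continuous_onI)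
  have molder: "(mol has_derivative frechet_derivative mol (at q)) (at q)" for q
    using bump_ring_differentiable(1)[OF mol_ring] .
  have mollin: "linear (frechet_derivative mol (at q))" for q using molder has_derivative_linear by blast
  have d1: "frechet_derivative (\<phi> p) (at w) z = - (n * M (n *\<^sub>R (p - w)))" for p w
  proof -
    have "((\<lambda>w. n *\<^sub>R (p - w)) has_derivative (\<lambda>v. - (n *\<^sub>R v))) (at w)"
      by (auto intro!: derivative_eq_intros)
    from diff_chain_at[OF this molder]
    have "(\<phi> p has_derivative (\<lambda>v. frechet_derivative mol (at (n *\<^sub>R (p - w))) (- (n *\<^sub>R v)))) (at w)"
      by (simp add: \<phi>_def[abs_def] o_def)
    then have "frechet_derivative (\<phi> p) (at w) = (\<lambda>v. frechet_derivative mol (at (n *\<^sub>R (p - w))) (- (n *\<^sub>R v)))"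
      by (rule frechet_derivative_at[symmetric])
    then show ?thesis by (simp add: M_def linear_neg[OF mollin] linear_scale[OF mollin])
  qed
  have ftc: "(LBINT s. indicator {0..1} s *\<^sub>R (n * M (n *\<^sub>R (x + s *\<^sub>R z - w)))) = \<phi> (x + z) w - \<phi> x w" for w
  proof -
    have "(LBINT s. indicator {0..1} s *\<^sub>R (n * M (n *\<^sub>R (x + s *\<^sub>R z - w)))) =
       \<phi> (x + 1 *\<^sub>R z) w - \<phi> (x + 0 *\<^sub>R z) w"
    proof (rule integral_FTC_atLeastAtMost)
      fix s :: real
      have "((\<lambda>s. n *\<^sub>R (x + s *\<^sub>R z - w)) has_derivative (\<lambda>t. n *\<^sub>R (t *\<^sub>R z))) (at s)"
        by (auto intro!: derivative_eq_intros)
      from diff_chain_at[OF this molder]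
      have "((\<lambda>s. \<phi> (x + s *\<^sub>R z) w) has_derivative (\<lambda>t. frechet_derivative mol (at (n *\<^sub>R (x + s *\<^sub>R z - w))) (n *\<^sub>R (t *\<^sub>R z)))) (at s)"
        by (simp add: \<phi>_def[abs_def] o_def)
      moreover have "frechet_derivative mol (at q) (n *\<^sub>R (t *\<^sub>R z)) = t *\<^sub>R (n * M q)" for q t
        by (simp add: M_def linear_scale[OF mollin])
      ultimately show "((\<lambda>s. \<phi> (x + s *\<^sub>R z) w) has_vector_derivative n * M (n *\<^sub>R (x + s *\<^sub>R z - w))) (at s within {0..1})"
        by (simp add: has_vector_derivative_def has_derivative_at_withinI)
    next
      show "continuous_on {0..1} (\<lambda>s. n * M (n *\<^sub>R (x + s *\<^sub>R z - w)))"
        by (intro continuous_intros continuous_on_compose2[OF Mc[of UNIV]]) auto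
    qed simp
    then show ?thesis by simp
  qed
  define f where "f s w = indicator {0..1::real} s *\<^sub>R ((n * M (n *\<^sub>R (x + s *\<^sub>R z - w))) *\<^sub>R u' w)" for s w
  have fm: "case_prod f \<in> borel_measurable (lborel \<Otimes>\<^sub>M lborel)"
    unfolding f_def[abs_def] by measurable
  obtain r where r: "\<And>y. y \<in> \<Omega> \<Longrightarrow> norm y \<le> r" using bd by (auto simp: bounded_iff)
  obtain C where C: "C \<ge> 0" "\<And>q. norm q \<le> n * (norm x + norm z + r) \<Longrightarrow> \<bar>M q\<bar> \<le> C"
  proof -
    have "bounded (M ` cball 0 (n * (norm x + norm z + r)))"
      using Mc by (intro compact_imp_bounded compact_continuous_image) auto
    then obtain C where "\<forall>q\<in>cball 0 (n * (norm x + norm z + r)). \<bar>M q\<bar> \<le> C"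
      by (auto simp: bounded_iff)
    then have "\<And>q. norm q \<le> n * (norm x + norm z + r) \<Longrightarrow> \<bar>M q\<bar> \<le> C" by simp
    then show ?thesis using that[of "max C 0"] by (meson le_max_iff_disj max.cobounded2)
  qed
  have fb: "norm (f s w) \<le> indicator {0..1} s * (n * C * norm (u' w))" for s w
  proof (cases "s \<in> {0..1} \<and> w \<in> \<Omega>")
    case True
    have "norm (x + s *\<^sub>R z - w) \<le> norm x + norm (s *\<^sub>R z) + norm w"
      by (meson add_mono norm_triangle_ineq norm_triangle_ineq4 order_trans order_refl)
    also have "\<dots> \<le> norm x + norm z + r"
      using True r[of w] by (auto intro!: add_mono mult_left_le_one_le)
    finally have "\<bar>M (n *\<^sub>R (x + s *\<^sub>R z - w))\<bar> \<le> C" using n by (intro C(2)) simp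
    then show ?thesis using True n by (auto simp: f_def abs_mult mult_right_mono)
  next
    case False
    then show ?thesis using u' by (auto simp: f_def borel_rep_def)
  qed
  have fi: "integrable lborel (\<lambda>w. f s w)" for s
  proof (rule Bochner_Integration.integrable_bound)
    show "integrable lborel (\<lambda>w. n * C * norm (u' w))" using iu by simp
    show "AE w in lborel. norm (f s w) \<le> norm (n * C * norm (u' w))"
      using fb[of s] C(1) n by (intro AE_I2) (smt (verit) indicator_def mult_cancel_right1 mult_nonneg_nonneg norm_ge_zero real_norm_def indicator_le_1 mult_left_le_one_le indicator_pos_le)
  qed (simp add: f_def)
  have fint: "integrable (lborel \<Otimes>\<^sub>M lborel) (case_prod f)"
  proof (rule lborel_pair.Fubini_integrable[OF fm])
    show "AE s in lborel. integrable lborel (\<lambda>w. case_prod f (s, w))" using fi by simp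
    show "integrable lborel (\<lambda>s. LBINT w. norm (case_prod f (s, w)))"
    proof (rule Bochner_Integration.integrable_bound)
      show "integrable lborel (\<lambda>s. indicator {0..1::real} s * (n * C * (LBINT w. norm (u' w))))"
        by (intro integrable_mult_left integrable_real_indicator) auto
      show "AE s in lborel. norm (LBINT w. norm (case_prod f (s, w))) \<le> norm (indicator {0..1::real} s * (n * C * (LBINT w. norm (u' w))))"
      proof (rule AE_I2)
        fix s :: real
        have "(LBINT w. norm (f s w)) \<le> (LBINT w. indicator {0..1} s * (n * C * norm (u' w)))"
          using fi iu fb by (intro integral_mono) auto
        then show "norm (LBINT w. norm (case_prod f (s, w))) \<le> norm (indicator {0..1::real} s * (n * C * (LBINT w. norm (u' w))))"
          using C(1) n by simp
      qed
    qed (use fm in measurable)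
  qed
  have dint: "(LBINT w. (n * M (n *\<^sub>R (p - w))) *\<^sub>R u' w) = (1/n)\<^sup>2 *\<^sub>R mollify (1/n) h p"
    if p: "cball p (1/n) \<subseteq> \<Omega>" for p
  proof -
    have t: "test_function \<Omega> (\<phi> p)" unfolding \<phi>_def by (rule mol_test_function[OF n p])
    have cM: "continuous_on UNIV (\<lambda>w. - (n * M (n *\<^sub>R (p - w))))"
      by (intro continuous_intros continuous_on_compose2[OF Mc[of UNIV]]) auto
    have c\<phi>: "continuous_on UNIV (\<phi> p)" using test_function_continuous(1)[OF t] .
    have hL: "(\<lambda>y. \<Sum>j\<in>UNIV. of_real (z $ j) * g j y) \<in> L2 \<Omega>"
      using gL by (intro L2_sum L2_cmult) auto
    have "(LBINT w. of_real (- (n * M (n *\<^sub>R (p - w)))) * u' w) =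
      (LINT w|lebesgue_on \<Omega>. of_real (- (n * M (n *\<^sub>R (p - w)))) * u w)"
      using op continuous_measurable_on[OF cM] u' uL
      by (intro LINT_eq_LBINT(1)[symmetric] borel_rep_mult borel_measurable_times) (auto simp: L2_def)
    also have "\<dots> = (LINT w|lebesgue_on \<Omega>. of_real (frechet_derivative (\<phi> p) (at w) z) * u w)"
      by (simp add: d1)
    also have "\<dots> = - (LINT w|lebesgue_on \<Omega>. of_real (\<phi> p w) * (\<Sum>j\<in>UNIV. of_real (z $ j) * g j w))"
      by (rule weak_directional[OF fin w t])
    also have "(LINT w|lebesgue_on \<Omega>. of_real (\<phi> p w) * (\<Sum>j\<in>UNIV. of_real (z $ j) * g j w)) =
       (LBINT w. of_real (\<phi> p w) * h w)"
      using op continuous_measurable_on[OF c\<phi>] h hL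
      by (intro LINT_eq_LBINT(1) borel_rep_mult borel_measurable_times) (auto simp: L2_def)
    also have "\<dots> = (1/n)\<^sup>2 *\<^sub>R mollify (1/n) h p"
      using mollify_eq_test[OF hm n, of p] by (simp add: \<phi>_def scaleR_conv_of_real)
    finally have "(LBINT w. of_real (- (n * M (n *\<^sub>R (p - w)))) * u' w) = - ((1/n)\<^sup>2 *\<^sub>R mollify (1/n) h p)" .
    then have "(LBINT w. - (of_real (n * M (n *\<^sub>R (p - w))) * u' w)) = - ((1/n)\<^sup>2 *\<^sub>R mollify (1/n) h p)"
      by simp
    then show ?thesis by (simp add: scaleR_conv_of_real)
  qed
  have i\<phi>: "integrable lborel (\<lambda>w. \<phi> p w *\<^sub>R u' w)" for p
  proof -
    obtain C where C: "C > 0" "\<And>x. \<bar>mol x\<bar> \<le> C" using mol_bounded by blast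
    have "integrable lborel (\<lambda>w. C *\<^sub>R u' w)" using iu by auto
    then show ?thesis
      by (rule Bochner_Integration.integrable_bound) (use C in \<open>auto simp: \<phi>_def intro!: mult_right_mono\<close>)
  qed
  have "(1/n)\<^sup>2 *\<^sub>R (mollify (1/n) u' (x + z) - mollify (1/n) u' x) =
    (LBINT w. \<phi> (x + z) w *\<^sub>R u' w) - (LBINT w. \<phi> x w *\<^sub>R u' w)"
    using mollify_eq_test[of u' n] n by (simp add: \<phi>_def scaleR_diff_right)
  also have "\<dots> = (LBINT w. (\<phi> (x + z) w - \<phi> x w) *\<^sub>R u' w)"
    using i\<phi> by (simp add: scaleR_diff_left)
  also have "\<dots> = (LBINT w. LBINT s. f s w)"
  proof (rule Bochner_Integration.integral_cong[OF refl])
    fix w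
    have "(LBINT s. f s w) = (LBINT s. (indicator {0..1::real} s *\<^sub>R (n * M (n *\<^sub>R (x + s *\<^sub>R z - w)))) *\<^sub>R u' w)"
      by (simp add: f_def)
    also have "\<dots> = (\<phi> (x + z) w - \<phi> x w) *\<^sub>R u' w"
    proof (cases "u' w = 0")
      case False
      have "integrable lborel (\<lambda>s. indicator {0..1::real} s *\<^sub>R (n * M (n *\<^sub>R (x + s *\<^sub>R z - w))))"
      proof -
        have "continuous_on {0..1} (\<lambda>s. n * M (n *\<^sub>R (x + s *\<^sub>R z - w)))"
          by (intro continuous_intros continuous_on_compose2[OF Mc[of UNIV]]) auto
        then show ?thesis
          using borel_integrable_atLeastAtMost'[of 0 1 "\<lambda>s. n * M (n *\<^sub>R (x + s *\<^sub>R z - w))"]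
          by (simp only: set_integrable_def)
      qed
      then show ?thesis by (subst integral_scaleR_left) (auto simp: ftc simp del: real_scaleR_def)
    qed simp
    finally show "(\<phi> (x + z) w - \<phi> x w) *\<^sub>R u' w = (LBINT s. f s w)" by simp
  qed
  also have "\<dots> = (LBINT s. LBINT w. f s w)"
    by (rule lborel_pair.Fubini_integral[OF fint])
  also have "\<dots> = (LBINT s. (1/n)\<^sup>2 *\<^sub>R (indicator {0..1} s *\<^sub>R mollify (1/n) h (x + s *\<^sub>R z)))"
  proof (rule Bochner_Integration.integral_cong[OF refl])
    fix s :: real
    show "(LBINT w. f s w) = (1/n)\<^sup>2 *\<^sub>R (indicator {0..1} s *\<^sub>R mollify (1/n) h (x + s *\<^sub>R z))"
      using dint[OF path[of s]] by (cases "s \<in> {0..1}") (auto simp: f_def)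
  qed
  also have "\<dots> = (1/n)\<^sup>2 *\<^sub>R (LBINT s. (indicator {0..1} s *\<^sub>R mollify (1/n) h (x + s *\<^sub>R z)))"
    by (rule Bochner_Integration.integral_scaleR_right)
  finally show ?thesis using n by simp
qed

lemma mollify_contraction:
  assumes [measurable]: "h \<in> borel_measurable borel"
  shows "(\<integral>\<^sup>+x. ennreal ((cmod (mollify \<epsilon> h (x + p)))\<^sup>2) \<partial>lborel) \<le> (\<integral>\<^sup>+x. ennreal ((cmod (h x))\<^sup>2) \<partial>lborel)"
proof -
  have mol1: "(\<integral>\<^sup>+y. ennreal (mol y) \<partial>lborel) = 1"
    using mol_integral mol_nonneg by (subst nn_integral_eq_integral) auto
  have "(\<integral>\<^sup>+x. ennreal ((cmod (mollify \<epsilon> h (x + p)))\<^sup>2) \<partial>lborel) \<le>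
     (\<integral>\<^sup>+x. \<integral>\<^sup>+y. ennreal (mol y * (cmod (h (x + p - \<epsilon> *\<^sub>R y)))\<^sup>2) \<partial>lborel \<partial>lborel)"
    unfolding mollify_def using mol1 mol_nonneg by (intro nn_integral_mono jensen_nn) auto
  also have "\<dots> = (\<integral>\<^sup>+y. \<integral>\<^sup>+x. ennreal (mol y * (cmod (h (x + p - \<epsilon> *\<^sub>R y)))\<^sup>2) \<partial>lborel \<partial>lborel)"
    by (rule lborel_pair.Fubini'[symmetric]) measurable
  also have "\<dots> = (\<integral>\<^sup>+y. ennreal (mol y) * (\<integral>\<^sup>+x. ennreal ((cmod (h x))\<^sup>2) \<partial>lborel) \<partial>lborel)"
  proof (rule nn_integral_cong)
    fix y
    have "(\<integral>\<^sup>+x. ennreal (mol y * (cmod (h (x + p - \<epsilon> *\<^sub>R y)))\<^sup>2) \<partial>lborel) =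
      ennreal (mol y) * (\<integral>\<^sup>+x. ennreal ((cmod (h (x + (p - \<epsilon> *\<^sub>R y))))\<^sup>2) \<partial>lborel)"
      using mol_nonneg by (subst nn_integral_cmult[symmetric]) (auto simp: ennreal_mult algebra_simps)
    then show "(\<integral>\<^sup>+x. ennreal (mol y * (cmod (h (x + p - \<epsilon> *\<^sub>R y)))\<^sup>2) \<partial>lborel) =
      ennreal (mol y) * (\<integral>\<^sup>+x. ennreal ((cmod (h x))\<^sup>2) \<partial>lborel)"
      using nn_integral_translate[of "\<lambda>x. ennreal ((cmod (h x))\<^sup>2)"] by simp
  qed
  also have "\<dots> = (\<integral>\<^sup>+x. ennreal ((cmod (h x))\<^sup>2) \<partial>lborel)"
    by (subst nn_integral_multc) (auto simp: mol1)
  finally show ?thesis .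
qed

lemma cmod_lincomb_sq:
  "(cmod (of_real a * w1 + of_real b * w2))\<^sup>2 \<le> (a\<^sup>2 + b\<^sup>2) * ((cmod w1)\<^sup>2 + (cmod w2)\<^sup>2)"
proof -
  have "cmod (of_real a * w1 + of_real b * w2) \<le> \<bar>a\<bar> * cmod w1 + \<bar>b\<bar> * cmod w2"
    by (rule order_trans[OF norm_triangle_ineq]) (simp add: norm_mult)
  then have "(cmod (of_real a * w1 + of_real b * w2))\<^sup>2 \<le> (\<bar>a\<bar> * cmod w1 + \<bar>b\<bar> * cmod w2)\<^sup>2"
    by (intro power_mono) auto
  also have "\<dots> \<le> (\<bar>a\<bar>\<^sup>2 + \<bar>b\<bar>\<^sup>2) * ((cmod w1)\<^sup>2 + (cmod w2)\<^sup>2)"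
    using zero_le_power2[of "\<bar>a\<bar> * cmod w2 - \<bar>b\<bar> * cmod w1"] by (simp only: power2_eq_square) (simp only: algebra_simps; linarith)
  finally show ?thesis by simp
qed

lemma norm_vec2_sq: "(norm (z :: real^2))\<^sup>2 = (z $ 1)\<^sup>2 + (z $ 2)\<^sup>2"
  by (simp add: norm_vec_def L2_set_def sum_2)

lemma AE_translate:
  fixes z :: "real^2"
  assumes "AE x in lborel. P x"
  shows "AE x in lborel. P (x + z)"
proof -
  obtain N where N: "{x \<in> space lborel. \<not> P x} \<subseteq> N" "emeasure lborel N = 0" "N \<in> sets lborel"
    by (rule AE_E[OF assms])
  have [measurable]: "N \<in> sets borel" using N by simp
  have "AE x in lborel. x \<notin> N" using N by (intro AE_not_in) (simp add: null_sets_def)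
  then have "AE x in distr lborel borel ((+) z). x \<notin> N" by (subst lborel_distr_plus)
  then have "AE x in lborel. z + x \<notin> N" using AE_distr_iff[of "(+) z" lborel borel "\<lambda>x. x \<notin> N"] by simp
  then show ?thesis
  proof eventually_elim
    case (elim x)
    then have "x + z \<notin> N" by (simp add: add.commute)
    then show ?case using N(1) by auto
  qed
qed

text \<open>For smooth functions this is the fundamental theorem of calculus along the segment from \<open>x\<close> to \<open>x + z\<close>, followed by Jensen's inequality and translation invariance. On a compact subset of \<open>G\<close> mollifications at small scale satisfy the same bound, and Fatou's lemma passes to the limit; compact subsets then exhaust \<open>G\<close>.\<close>
theorem difference_inequality:
  fixes z :: "real^2"
  assumes op: "open \<Omega>" and bd: "bounded \<Omega>" and w: "wgrad \<Omega> u g"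
    and u': "borel_rep \<Omega> u u'" and G: "open G"
    and path: "\<And>x s. x \<in> G \<Longrightarrow> s \<in> {0..1} \<Longrightarrow> x + s *\<^sub>R z \<in> \<Omega>"
  shows "(\<integral>\<^sup>+x. ennreal ((cmod (u' (x + z) - u' x))\<^sup>2) * indicator G x \<partial>lborel)
      \<le> ennreal ((norm z)\<^sup>2 * (nrm2 \<Omega> (g 1) + nrm2 \<Omega> (g 2)))"
proof -
  have uL: "u \<in> L2 \<Omega>" and gL: "g j \<in> L2 \<Omega>" for j using w by (auto simp: wgrad_def)
  have "\<forall>j. \<exists>g'. borel_rep \<Omega> (g j) g'" using borel_rep_exists[OF op] gL by (metis L2_measurable)
  then obtain g' where g': "\<And>j. borel_rep \<Omega> (g j) (g' j)" by metis
  have [measurable]: "u' \<in> borel_measurable borel" "g' j \<in> borel_measurable borel" for j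
    using u' g'[of j] by (auto simp: borel_rep_def)
  have [measurable]: "G \<in> sets borel" using G by auto
  have iu: "integrable lborel u'" using borel_rep_integrable op bd uL u' by blast
  define h where "h y = (\<Sum>j\<in>UNIV. of_real (z $ j) * g' j y)" for y
  have [measurable]: "h \<in> borel_measurable borel" unfolding h_def[abs_def] by measurable
  let ?R = "ennreal ((norm z)\<^sup>2 * (nrm2 \<Omega> (g 1) + nrm2 \<Omega> (g 2)))"
  have hR: "(\<integral>\<^sup>+x. ennreal ((cmod (h x))\<^sup>2) \<partial>lborel) \<le> ?R"
  proof -
    have "(\<integral>\<^sup>+x. ennreal ((cmod (h x))\<^sup>2) \<partial>lborel) \<le>
      (\<integral>\<^sup>+x. ennreal ((norm z)\<^sup>2) * (ennreal ((cmod (g' 1 x))\<^sup>2) + ennreal ((cmod (g' 2 x))\<^sup>2)) \<partial>lborel)"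
    proof (intro nn_integral_mono)
      fix x
      have "(cmod (h x))\<^sup>2 \<le> (norm z)\<^sup>2 * ((cmod (g' 1 x))\<^sup>2 + (cmod (g' 2 x))\<^sup>2)"
        unfolding h_def norm_vec2_sq sum_2 by (rule cmod_lincomb_sq)
      then show "ennreal ((cmod (h x))\<^sup>2) \<le> ennreal ((norm z)\<^sup>2) * (ennreal ((cmod (g' 1 x))\<^sup>2) + ennreal ((cmod (g' 2 x))\<^sup>2))"
        by (simp add: ennreal_leI flip: ennreal_mult ennreal_plus)
    qed
    also have "\<dots> = ennreal ((norm z)\<^sup>2) * (ennreal (nrm2 \<Omega> (g 1)) + ennreal (nrm2 \<Omega> (g 2)))"
      by (simp add: nn_integral_cmult nn_integral_add borel_rep_nrm2[OF op gL g'])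
    also have "\<dots> = ?R" by (simp flip: ennreal_mult ennreal_plus)
    finally show ?thesis .
  qed
  have fixedn: "(\<integral>\<^sup>+x. ennreal ((cmod (mollify (1/n) u' (x + z) - mollify (1/n) u' x))\<^sup>2) * indicator K x \<partial>lborel) \<le> ?R"
    if n: "n > 0" and K: "\<And>x s. x \<in> K \<Longrightarrow> s \<in> {0..1} \<Longrightarrow> cball (x + s *\<^sub>R z) (1/n) \<subseteq> \<Omega>" for n K
  proof -
    have "(\<integral>\<^sup>+x. ennreal ((cmod (mollify (1/n) u' (x + z) - mollify (1/n) u' x))\<^sup>2) * indicator K x \<partial>lborel) \<le>
      (\<integral>\<^sup>+x. \<integral>\<^sup>+s. ennreal (indicator {0..1} s * (cmod (mollify (1/n) h (x + s *\<^sub>R z)))\<^sup>2) \<partial>lborel \<partial>lborel)"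
    proof (intro nn_integral_mono)
      fix x
      show "ennreal ((cmod (mollify (1/n) u' (x + z) - mollify (1/n) u' x))\<^sup>2) * indicator K x \<le>
        (\<integral>\<^sup>+s. ennreal (indicator {0..1} s * (cmod (mollify (1/n) h (x + s *\<^sub>R z)))\<^sup>2) \<partial>lborel)"
      proof (cases "x \<in> K")
        case True
        have eq: "mollify (1/n) u' (x + z) - mollify (1/n) u' x =
            (LBINT s. indicator {0..1} s *\<^sub>R mollify (1/n) h (x + s *\<^sub>R z))"
          unfolding h_def[abs_def] using mollify_difference[OF op bd w u' g' n K[OF True]] by simp
        have "(\<integral>\<^sup>+s. ennreal (indicator {0..1::real} s) \<partial>lborel) \<le> 1"
          by (simp add: ennreal_indicator)
        then have "ennreal ((cmod (LBINT s. indicator {0..1} s *\<^sub>R mollify (1/n) h (x + s *\<^sub>R z)))\<^sup>2) \<le>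
           (\<integral>\<^sup>+s. ennreal (indicator {0..1} s * (cmod (mollify (1/n) h (x + s *\<^sub>R z)))\<^sup>2) \<partial>lborel)"
          by (intro jensen_nn) auto
        then show ?thesis using True eq by simp
      qed simp
    qed
    also have "\<dots> = (\<integral>\<^sup>+s. \<integral>\<^sup>+x. ennreal (indicator {0..1} s * (cmod (mollify (1/n) h (x + s *\<^sub>R z)))\<^sup>2) \<partial>lborel \<partial>lborel)"
      by (rule lborel_pair.Fubini'[symmetric]) measurable
    also have "\<dots> \<le> (\<integral>\<^sup>+s. indicator {0..1::real} s * ?R \<partial>lborel)"
    proof (intro nn_integral_mono)
      fix s :: real
      show "(\<integral>\<^sup>+x. ennreal (indicator {0..1} s * (cmod (mollify (1/n) h (x + s *\<^sub>R z)))\<^sup>2) \<partial>lborel) \<le> indicator {0..1} s * ?R"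
        using order_trans[OF mollify_contraction[of h "1/n" "s *\<^sub>R z"] hR] by (cases "s \<in> {0..1}") auto
    qed
    also have "\<dots> = ?R" by (subst nn_integral_multc) auto
    finally show ?thesis .
  qed
  obtain r :: "nat \<Rightarrow> nat" where r: "strict_mono r"
    "AE x in lborel. (\<lambda>n. mollify (1 / Suc (r n)) u' x) \<longlonglongrightarrow> u' x"
    using mollify_AE_subseq[OF iu] by blast
  have rz: "AE x in lborel. (\<lambda>n. mollify (1 / Suc (r n)) u' (x + z)) \<longlonglongrightarrow> u' (x + z)"
    using AE_translate[OF r(2)] .
  have cpt: "(\<integral>\<^sup>+x. ennreal ((cmod (u' (x + z) - u' x))\<^sup>2) * indicator K x \<partial>lborel) \<le> ?R"
    if K: "compact K" "K \<subseteq> G" for K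
  proof -
    have [measurable]: "K \<in> sets borel" using K(1) by (rule borel_compact)
    let ?P = "(\<lambda>(x, s). x + s *\<^sub>R z) ` (K \<times> {0..1})"
    have "compact ?P" using K(1)
      by (intro compact_continuous_image compact_Times) (auto intro!: continuous_intros simp: split_beta)
    moreover have "?P \<subseteq> \<Omega>" using path K(2) by auto
    ultimately obtain e where e: "e > 0" "(\<Union>x\<in>?P. ball x e) \<subseteq> \<Omega>"
      using compact_subset_open_imp_ball_epsilon_subset[OF _ op] by blast
    obtain N where N: "1 / real (Suc N) < e" using e(1) nat_approx_posE by blast
    let ?F = "\<lambda>n x. ennreal ((cmod (mollify (1 / Suc (r n)) u' (x + z) - mollify (1 / Suc (r n)) u' x))\<^sup>2) * indicator K x"
    have "(\<integral>\<^sup>+x. ennreal ((cmod (u' (x + z) - u' x))\<^sup>2) * indicator K x \<partial>lborel) =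
      (\<integral>\<^sup>+x. liminf (\<lambda>n. ?F n x) \<partial>lborel)"
    proof (rule nn_integral_cong_AE, use r(2) rz in eventually_elim)
      case (elim x)
      then have "(\<lambda>n. ennreal ((cmod (mollify (1 / Suc (r n)) u' (x + z) - mollify (1 / Suc (r n)) u' x))\<^sup>2)) \<longlonglongrightarrow>
         ennreal ((cmod (u' (x + z) - u' x))\<^sup>2)"
        by (intro tendsto_intros)
      then have "(\<lambda>n. ?F n x) \<longlonglongrightarrow> ennreal ((cmod (u' (x + z) - u' x))\<^sup>2) * indicator K x"
        by (cases "x \<in> K") auto
      then have "liminf (\<lambda>n. ?F n x) = ennreal ((cmod (u' (x + z) - u' x))\<^sup>2) * indicator K x"
        by (rule lim_imp_Liminf[OF sequentially_bot])
      then show ?case by (simp only:)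
    qed
    also have "\<dots> \<le> liminf (\<lambda>n. \<integral>\<^sup>+x. ?F n x \<partial>lborel)"
      by (intro nn_integral_liminf) measurable
    also have "\<dots> \<le> ?R"
    proof (rule Liminf_le)
      show "\<forall>\<^sub>F n in sequentially. (\<integral>\<^sup>+x. ?F n x \<partial>lborel) \<le> ?R"
        using eventually_ge_at_top[of N]
      proof eventually_elim
        case (elim n)
        have "r n \<ge> N" using r(1) elim by (meson le_trans seq_suble)
        then have "1 / real (Suc (r n)) \<le> 1 / real (Suc N)" by (simp add: frac_le)
        then have le: "1 / real (Suc (r n)) < e" using N by linarith
        show ?case
        proof (rule fixedn)
          fix x s assume xs: "x \<in> K" "s \<in> {0..1::real}"
          have "cball (x + s *\<^sub>R z) (1 / real (Suc (r n))) \<subseteq> ball (x + s *\<^sub>R z) e" using le by auto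
          also have "\<dots> \<subseteq> \<Omega>"
          proof -
            have "(x, s) \<in> K \<times> {0..1}" using xs by auto
            then have "ball ((\<lambda>(x, s). x + s *\<^sub>R z) (x, s)) e \<subseteq> (\<Union>x\<in>?P. ball x e)" by blast
            then show ?thesis using e(2) by simp
          qed
          finally show "cball (x + s *\<^sub>R z) (1 / real (Suc (r n))) \<subseteq> \<Omega>" .
        qed simp
      qed
    qed simp
    finally show ?thesis .
  qed
  obtain C :: "nat \<Rightarrow> (real^2) set" where C: "\<And>n. compact (C n)" "\<And>n. C n \<subseteq> G" "\<And>n. C n \<subseteq> interior (C (Suc n))"
      "\<Union>(range C) = G"
    using open_Union_compact_subsets[OF G] by metis
  have inc: "incseq C" using C(3) interior_subset by (intro incseq_SucI) blast
  let ?D = "density lborel (\<lambda>x. ennreal ((cmod (u' (x + z) - u' x))\<^sup>2))"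
  have [measurable]: "C n \<in> sets borel" for n using C(1) by (rule borel_compact)
  have "(\<lambda>n. emeasure ?D (C n)) \<longlonglongrightarrow> emeasure ?D (\<Union>(range C))"
    using inc by (intro Lim_emeasure_incseq) auto
  moreover have "emeasure ?D (C n) \<le> ?R" for n
    using cpt[OF C(1,2), of n] by (simp add: emeasure_density)
  ultimately have "emeasure ?D (\<Union>(range C)) \<le> ?R"
    by (meson LIMSEQ_le_const2)
  then show ?thesis using C(4) by (simp add: emeasure_density)
qed

section \<open>The Poincare inequality\<close>

text \<open>A subset \<open>G\<close> of \<open>\<Omega>\<close> on which every weakly differentiable function on \<open>\<Omega>\<close> is close to a constant, with the Dirichlet integral taken over all of \<open>\<Omega>\<close>. Measuring the gradient on \<open>\<Omega>\<close> is what allows such sets to be translated and combined.\<close>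
definition poincare_set :: "(real^2) set \<Rightarrow> (real^2) set \<Rightarrow> bool" where
  "poincare_set \<Omega> G \<longleftrightarrow> open G \<and> G \<noteq> {} \<and> G \<subseteq> \<Omega> \<and>
    (\<exists>C\<ge>0. \<forall>u g u'. wgrad \<Omega> u g \<longrightarrow> borel_rep \<Omega> u u' \<longrightarrow>
      (\<exists>c. (\<integral>\<^sup>+x. ennreal ((cmod (u' x - c))\<^sup>2) * indicator G x \<partial>lborel)
          \<le> ennreal (C * (nrm2 \<Omega> (g 1) + nrm2 \<Omega> (g 2)))))"

lemma open_bounded_measure:
  fixes G :: "(real^2) set"
  assumes "open G" "bounded G" "G \<noteq> {}"
  shows "emeasure lborel G = ennreal (measure lborel G)" "measure lborel G > 0"
proof -
  have "emeasure lborel G < \<infinity>" using assms(2) by (rule emeasure_bounded_finite)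
  then show 1: "emeasure lborel G = ennreal (measure lborel G)"
    by (intro emeasure_eq_ennreal_measure) auto
  have "\<not> negligible G" using open_not_negligible assms by blast
  then have "emeasure lborel G \<noteq> 0" using assms(1) by (auto simp: negligible_iff_null_sets null_sets_def)
  then have "measure lborel G \<noteq> 0" using 1 by auto
  then show "measure lborel G > 0" using measure_nonneg[of lborel G] by linarith
qed

text \<open>The mean square of \<open>u(y) - u(x)\<close> over pairs of points of \<open>G\<close> is an integral over the displacement \<open>z = y - x\<close> of the quantities that the difference inequality bounds. Some \<open>x\<close> does at least as well as the average over \<open>x\<close>, and its value \<open>u(x)\<close> is the constant.\<close>
lemma poincare_set_convex:
  assumes op: "open \<Omega>" and bd: "bounded \<Omega>" and G: "open G" "convex G" "G \<noteq> {}" "G \<subseteq> \<Omega>"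
  shows "poincare_set \<Omega> G"
proof -
  obtain r where r: "\<And>x. x \<in> G \<Longrightarrow> norm x \<le> r"
    using bounded_subset[OF bd G(4)] by (auto simp: bounded_iff)
  define d where "d = 2 * r + 1"
  define W where "W = measure lborel (cball (0::real^2) d)"
  define V where "V = measure lborel G"
  have [measurable]: "G \<in> sets borel" using G by auto
  have VG: "emeasure lborel G = ennreal V" "V > 0"
    using open_bounded_measure[OF G(1) bounded_subset[OF bd G(4)] G(3)] by (auto simp: V_def)
  then have Gpos: "emeasure lborel G \<noteq> 0" by simp
  have WG: "emeasure lborel (cball (0::real^2) d) = ennreal W" "W \<ge> 0"
  proof -
    have "emeasure lborel (cball (0::real^2) d) < \<infinity>" by (rule emeasure_bounded_finite) simp
    then show "emeasure lborel (cball (0::real^2) d) = ennreal W"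
      unfolding W_def by (intro emeasure_eq_ennreal_measure) auto
  qed (simp add: W_def)
  show ?thesis
    unfolding poincare_set_def
  proof (intro conjI G exI[of _ "2 * (W * d\<^sup>2) / V"] allI impI)
    show "0 \<le> 2 * (W * d\<^sup>2) / V" using VG WG by simp
    fix u g u'
    assume w: "wgrad \<Omega> u g" and u': "borel_rep \<Omega> u u'"
    define E where "E = nrm2 \<Omega> (g 1) + nrm2 \<Omega> (g 2)"
    have E: "E \<ge> 0" by (simp add: E_def)
    have [measurable]: "u' \<in> borel_measurable borel" using u' by (simp add: borel_rep_def)
    define F where "F x y = ennreal ((cmod (u' y - u' x))\<^sup>2) * (indicator G x * indicator G y)" for x y
    have [measurable]: "case_prod F \<in> borel_measurable (lborel \<Otimes>\<^sub>M lborel)"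
      unfolding F_def[abs_def] by measurable
    define \<Phi> where "\<Phi> x = (\<integral>\<^sup>+y. F x y \<partial>lborel)" for x
    have [measurable]: "\<Phi> \<in> borel_measurable borel" unfolding \<Phi>_def[abs_def] by measurable
    have 1: "(\<integral>\<^sup>+x. F x (x + z) \<partial>lborel) \<le> ennreal (d\<^sup>2 * E) * indicator (cball 0 d) z" for z
    proof (cases "z \<in> cball 0 d")
      case True
      let ?H = "G \<inter> (\<lambda>x. x + z) -` G"
      have oH: "open ?H" by (intro open_Int G open_vimage continuous_intros)
      have "(\<integral>\<^sup>+x. F x (x + z) \<partial>lborel) = (\<integral>\<^sup>+x. ennreal ((cmod (u' (x + z) - u' x))\<^sup>2) * indicator ?H x \<partial>lborel)"
        by (intro nn_integral_cong) (auto simp: F_def indicator_def)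
      also have "\<dots> \<le> ennreal ((norm z)\<^sup>2 * (nrm2 \<Omega> (g 1) + nrm2 \<Omega> (g 2)))"
      proof (rule difference_inequality[OF op bd w u' oH])
        fix x and s :: real assume x: "x \<in> ?H" "s \<in> {0..1}"
        then have "(1 - s) *\<^sub>R x + s *\<^sub>R (x + z) \<in> G"
          using G(2) unfolding convex_alt by auto
        then show "x + s *\<^sub>R z \<in> \<Omega>" using G(4) by (auto simp: algebra_simps)
      qed
      also have "\<dots> \<le> ennreal (d\<^sup>2 * E)"
        using True E unfolding E_def[symmetric] by (intro ennreal_leI mult_right_mono power_mono) auto
      finally show ?thesis using True by simp
    next
      case False
      have "F x (x + z) = 0" for x
      proof -
        have "norm z \<le> norm (x + z) + norm x" using norm_triangle_ineq4[of "x + z" x] by simp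
        then have "\<not> (x \<in> G \<and> x + z \<in> G)" using r[of x] r[of "x + z"] False by (auto simp: d_def)
        then show ?thesis by (auto simp: F_def indicator_def)
      qed
      then show ?thesis by simp
    qed
    have tot: "(\<integral>\<^sup>+x. \<Phi> x \<partial>lborel) \<le> ennreal (W * (d\<^sup>2 * E))"
    proof -
      have "(\<integral>\<^sup>+x. \<Phi> x \<partial>lborel) = (\<integral>\<^sup>+x. \<integral>\<^sup>+z. F x (x + z) \<partial>lborel \<partial>lborel)"
      proof (rule nn_integral_cong)
        fix x
        have "F x \<in> borel_measurable borel" unfolding F_def[abs_def] by measurable
        then show "\<Phi> x = (\<integral>\<^sup>+z. F x (x + z) \<partial>lborel)"
          using nn_integral_translate[of "F x" x] by (simp add: \<Phi>_def add.commute)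
      qed
      also have "\<dots> = (\<integral>\<^sup>+z. \<integral>\<^sup>+x. F x (x + z) \<partial>lborel \<partial>lborel)"
        unfolding F_def by (rule lborel_pair.Fubini'[symmetric]) measurable
      also have "\<dots> \<le> (\<integral>\<^sup>+z. ennreal (d\<^sup>2 * E) * indicator (cball 0 d) (z::real^2) \<partial>lborel)"
        by (intro nn_integral_mono 1)
      also have "\<dots> = ennreal (d\<^sup>2 * E) * ennreal W" by (simp add: nn_integral_cmult_indicator WG)
      also have "\<dots> = ennreal (W * (d\<^sup>2 * E))" using E WG by (simp add: ennreal_mult'[symmetric] mult.commute)
      finally show ?thesis .
    qed
    have "\<exists>x\<in>G. \<Phi> x \<le> ennreal (2 * (W * (d\<^sup>2 * E)) / V)"
    proof (rule ccontr)
      assume "\<not> (\<exists>x\<in>G. \<Phi> x \<le> ennreal (2 * (W * (d\<^sup>2 * E)) / V))"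
      then have gt: "\<And>x. x \<in> G \<Longrightarrow> \<Phi> x > ennreal (2 * (W * (d\<^sup>2 * E)) / V)" by (meson not_le)
      show False
      proof (cases "W * (d\<^sup>2 * E) = 0")
        case True
        then have "(\<integral>\<^sup>+x. \<Phi> x \<partial>lborel) \<le> ennreal 0" using tot by (simp only: True)
        then have "(\<integral>\<^sup>+x. \<Phi> x \<partial>lborel) = 0" by simp
        then have "AE x in lborel. \<Phi> x = 0" by (subst (asm) nn_integral_0_iff_AE) auto
        then have "AE x in lborel. x \<notin> G"
          by eventually_elim (use gt in fastforce)
        then show False using Gpos by (subst (asm) AE_iff_null_sets[symmetric]) (auto simp: null_sets_def)
      next
        case False
        then have p: "W * (d\<^sup>2 * E) > 0" using WG E by (simp add: zero_less_mult_iff less_le)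
        have "ennreal (2 * (W * (d\<^sup>2 * E))) = ennreal (2 * (W * (d\<^sup>2 * E)) / V) * ennreal V"
          using VG p by (subst ennreal_mult[symmetric]) auto
        also have "\<dots> = (\<integral>\<^sup>+x. ennreal (2 * (W * (d\<^sup>2 * E)) / V) * indicator G x \<partial>lborel)"
          by (simp add: nn_integral_cmult_indicator VG)
        also have "\<dots> \<le> (\<integral>\<^sup>+x. \<Phi> x \<partial>lborel)"
          by (intro nn_integral_mono) (auto simp: indicator_def less_imp_le[OF gt])
        finally have "ennreal (2 * (W * (d\<^sup>2 * E))) \<le> ennreal (W * (d\<^sup>2 * E))" using tot by (rule order_trans)
        then have "2 * (W * (d\<^sup>2 * E)) \<le> W * (d\<^sup>2 * E)" using p by (subst (asm) ennreal_le_iff) auto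
        then show False using p by linarith
      qed
    qed
    then obtain x where x: "x \<in> G" "\<Phi> x \<le> ennreal (2 * (W * (d\<^sup>2 * E)) / V)" by blast
    show "\<exists>c. (\<integral>\<^sup>+y. ennreal ((cmod (u' y - c))\<^sup>2) * indicator G y \<partial>lborel)
          \<le> ennreal (2 * (W * d\<^sup>2) / V * (nrm2 \<Omega> (g 1) + nrm2 \<Omega> (g 2)))"
      using x by (intro exI[of _ "u' x"]) (simp add: \<Phi>_def F_def E_def mult_ac)
  qed
qed

lemma ennreal_norm_sq_add_le:
  "ennreal ((cmod (a + b))\<^sup>2) \<le> 2 * ennreal ((cmod a)\<^sup>2) + 2 * ennreal ((cmod b)\<^sup>2)"
proof -
  have "ennreal ((cmod (a + b))\<^sup>2) \<le> ennreal (2 * (cmod a)\<^sup>2 + 2 * (cmod b)\<^sup>2)"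
    by (intro ennreal_leI norm_add_sq_le)
  also have "\<dots> = ennreal 2 * ennreal ((cmod a)\<^sup>2) + ennreal 2 * ennreal ((cmod b)\<^sup>2)"
    by (subst ennreal_plus) (auto simp: ennreal_mult'')
  finally show ?thesis by simp
qed

text \<open>If \<open>H\<close> can be moved by \<open>z\<close> into \<open>G\<close> along segments in \<open>\<Omega>\<close>, the difference inequality compares \<open>u\<close> on \<open>H\<close> with \<open>u\<close> on \<open>G\<close>.\<close>
lemma poincare_set_shift:
  assumes op: "open \<Omega>" and bd: "bounded \<Omega>" and G: "poincare_set \<Omega> G"
    and H: "open H" "H \<noteq> {}" "H \<subseteq> \<Omega>"
    and z: "\<And>x. x \<in> H \<Longrightarrow> x + z \<in> G" "\<And>x s. x \<in> H \<Longrightarrow> s \<in> {0..1} \<Longrightarrow> x + s *\<^sub>R z \<in> \<Omega>"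
  shows "poincare_set \<Omega> H"
proof -
  obtain C where C: "C \<ge> 0" "\<And>u g u'. wgrad \<Omega> u g \<Longrightarrow> borel_rep \<Omega> u u' \<Longrightarrow>
      (\<exists>c. (\<integral>\<^sup>+x. ennreal ((cmod (u' x - c))\<^sup>2) * indicator G x \<partial>lborel)
          \<le> ennreal (C * (nrm2 \<Omega> (g 1) + nrm2 \<Omega> (g 2))))"
    using G unfolding poincare_set_def by blast
  have [measurable]: "G \<in> sets borel" "H \<in> sets borel" using G H by (auto simp: poincare_set_def)
  show ?thesis
    unfolding poincare_set_def
  proof (intro conjI H exI[of _ "2 * (norm z)\<^sup>2 + 2 * C"] allI impI)
    show "0 \<le> 2 * (norm z)\<^sup>2 + 2 * C" using C by simp
    fix u g u'
    assume w: "wgrad \<Omega> u g" and u': "borel_rep \<Omega> u u'"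
    define E where "E = nrm2 \<Omega> (g 1) + nrm2 \<Omega> (g 2)"
    have E: "E \<ge> 0" by (simp add: E_def)
    have [measurable]: "u' \<in> borel_measurable borel" using u' by (simp add: borel_rep_def)
    obtain c where c: "(\<integral>\<^sup>+x. ennreal ((cmod (u' x - c))\<^sup>2) * indicator G x \<partial>lborel) \<le> ennreal (C * E)"
      using C(2)[OF w u'] by (auto simp: E_def)
    have d: "(\<integral>\<^sup>+x. ennreal ((cmod (u' (x + z) - u' x))\<^sup>2) * indicator H x \<partial>lborel) \<le> ennreal ((norm z)\<^sup>2 * E)"
      unfolding E_def by (rule difference_inequality[OF op bd w u' H(1) z(2)])
    have "(\<integral>\<^sup>+x. ennreal ((cmod (u' x - c))\<^sup>2) * indicator H x \<partial>lborel) \<le>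
      (\<integral>\<^sup>+x. 2 * (ennreal ((cmod (u' (x + z) - u' x))\<^sup>2) * indicator H x) +
         2 * (ennreal ((cmod (u' (x + z) - c))\<^sup>2) * indicator G (x + z)) \<partial>lborel)"
    proof (intro nn_integral_mono)
      fix x
      have "ennreal ((cmod (- (u' (x + z) - u' x) + (u' (x + z) - c)))\<^sup>2) \<le>
         2 * ennreal ((cmod (- (u' (x + z) - u' x)))\<^sup>2) + 2 * ennreal ((cmod (u' (x + z) - c))\<^sup>2)"
        by (rule ennreal_norm_sq_add_le)
      also have "- (u' (x + z) - u' x) + (u' (x + z) - c) = u' x - c" by simp
      finally show "ennreal ((cmod (u' x - c))\<^sup>2) * indicator H x \<le>
        2 * (ennreal ((cmod (u' (x + z) - u' x))\<^sup>2) * indicator H x) +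
         2 * (ennreal ((cmod (u' (x + z) - c))\<^sup>2) * indicator G (x + z))"
        using z(1)[of x] by (cases "x \<in> H") (auto simp: norm_minus_commute)
    qed
    also have "\<dots> = 2 * (\<integral>\<^sup>+x. ennreal ((cmod (u' (x + z) - u' x))\<^sup>2) * indicator H x \<partial>lborel) +
       2 * (\<integral>\<^sup>+x. ennreal ((cmod (u' (x + z) - c))\<^sup>2) * indicator G (x + z) \<partial>lborel)"
      by (simp add: nn_integral_add nn_integral_cmult)
    also have "(\<integral>\<^sup>+x. ennreal ((cmod (u' (x + z) - c))\<^sup>2) * indicator G (x + z) \<partial>lborel) =
       (\<integral>\<^sup>+x. ennreal ((cmod (u' x - c))\<^sup>2) * indicator G x \<partial>lborel)"
      by (rule nn_integral_translate) measurable
    also have "2 * (\<integral>\<^sup>+x. ennreal ((cmod (u' (x + z) - u' x))\<^sup>2) * indicator H x \<partial>lborel) +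
       2 * (\<integral>\<^sup>+x. ennreal ((cmod (u' x - c))\<^sup>2) * indicator G x \<partial>lborel)
       \<le> ennreal 2 * ennreal ((norm z)\<^sup>2 * E) + ennreal 2 * ennreal (C * E)"
      using c d by (intro add_mono mult_mono) auto
    also have "\<dots> = ennreal (2 * ((norm z)\<^sup>2 * E) + 2 * (C * E))"
      using E C by (subst ennreal_plus) (auto simp: ennreal_mult'')
    also have "2 * ((norm z)\<^sup>2 * E) + 2 * (C * E) = (2 * (norm z)\<^sup>2 + 2 * C) * E" by (simp add: algebra_simps)
    finally show "\<exists>c. (\<integral>\<^sup>+x. ennreal ((cmod (u' x - c))\<^sup>2) * indicator H x \<partial>lborel)
          \<le> ennreal ((2 * (norm z)\<^sup>2 + 2 * C) * (nrm2 \<Omega> (g 1) + nrm2 \<Omega> (g 2)))"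
      unfolding E_def by blast
  qed
qed

text \<open>The constants that belong to \<open>G\<close> and to \<open>H\<close> are both close to \<open>u\<close> on the open set \<open>G \<inter> H\<close>, hence close to each other.\<close>
lemma poincare_set_Un:
  assumes bd: "bounded \<Omega>" and G: "poincare_set \<Omega> G" and H: "poincare_set \<Omega> H" and ne: "G \<inter> H \<noteq> {}"
  shows "poincare_set \<Omega> (G \<union> H)"
proof -
  obtain C where C: "C \<ge> 0" "\<And>u g u'. wgrad \<Omega> u g \<Longrightarrow> borel_rep \<Omega> u u' \<Longrightarrow>
      (\<exists>c. (\<integral>\<^sup>+x. ennreal ((cmod (u' x - c))\<^sup>2) * indicator G x \<partial>lborel)
          \<le> ennreal (C * (nrm2 \<Omega> (g 1) + nrm2 \<Omega> (g 2))))"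
    using G unfolding poincare_set_def by blast
  obtain D where D: "D \<ge> 0" "\<And>u g u'. wgrad \<Omega> u g \<Longrightarrow> borel_rep \<Omega> u u' \<Longrightarrow>
      (\<exists>c. (\<integral>\<^sup>+x. ennreal ((cmod (u' x - c))\<^sup>2) * indicator H x \<partial>lborel)
          \<le> ennreal (D * (nrm2 \<Omega> (g 1) + nrm2 \<Omega> (g 2))))"
    using H unfolding poincare_set_def by blast
  have oG: "open G" "G \<subseteq> \<Omega>" "open H" "H \<subseteq> \<Omega>" using G H by (auto simp: poincare_set_def)
  have [measurable]: "G \<in> sets borel" "H \<in> sets borel" using oG by auto
  define v where "v = measure lborel (G \<inter> H)"
  define W where "W = measure lborel H"
  have v: "emeasure lborel (G \<inter> H) = ennreal v" "v > 0" "emeasure lborel H = ennreal W" "W \<ge> 0"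
    using open_bounded_measure[of "G \<inter> H"] open_bounded_measure[of H] oG ne
      bounded_subset[OF bd, of H] bounded_subset[OF bd, of "G \<inter> H"]
    by (auto simp: v_def W_def)
  define K where "K = C + 2 * D + 2 * W * ((2 * C + 2 * D) / v)"
  show ?thesis
    unfolding poincare_set_def
  proof (intro conjI exI[of _ K] allI impI)
    show "0 \<le> K" using C D v by (auto simp: K_def intro!: add_nonneg_nonneg divide_nonneg_pos)
    fix u g u'
    assume w: "wgrad \<Omega> u g" and u': "borel_rep \<Omega> u u'"
    define E where "E = nrm2 \<Omega> (g 1) + nrm2 \<Omega> (g 2)"
    have E: "E \<ge> 0" by (simp add: E_def)
    have [measurable]: "u' \<in> borel_measurable borel" using u' by (simp add: borel_rep_def)
    obtain c where c: "(\<integral>\<^sup>+x. ennreal ((cmod (u' x - c))\<^sup>2) * indicator G x \<partial>lborel) \<le> ennreal (C * E)"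
      using C(2)[OF w u'] by (auto simp: E_def)
    obtain d where d: "(\<integral>\<^sup>+x. ennreal ((cmod (u' x - d))\<^sup>2) * indicator H x \<partial>lborel) \<le> ennreal (D * E)"
      using D(2)[OF w u'] by (auto simp: E_def)
    have "ennreal ((cmod (d - c))\<^sup>2 * v) = (\<integral>\<^sup>+x. ennreal ((cmod (d - c))\<^sup>2) * indicator (G \<inter> H) x \<partial>lborel)"
      using v by (simp add: nn_integral_cmult_indicator ennreal_mult'')
    also have "\<dots> \<le> (\<integral>\<^sup>+x. 2 * (ennreal ((cmod (u' x - c))\<^sup>2) * indicator G x) +
        2 * (ennreal ((cmod (u' x - d))\<^sup>2) * indicator H x) \<partial>lborel)"
    proof (intro nn_integral_mono)
      fix x
      have "ennreal ((cmod ((u' x - c) + - (u' x - d)))\<^sup>2) \<le>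
         2 * ennreal ((cmod (u' x - c))\<^sup>2) + 2 * ennreal ((cmod (- (u' x - d)))\<^sup>2)"
        by (rule ennreal_norm_sq_add_le)
      also have "(u' x - c) + - (u' x - d) = d - c" by simp
      finally show "ennreal ((cmod (d - c))\<^sup>2) * indicator (G \<inter> H) x \<le>
        2 * (ennreal ((cmod (u' x - c))\<^sup>2) * indicator G x) + 2 * (ennreal ((cmod (u' x - d))\<^sup>2) * indicator H x)"
        by (auto simp: indicator_def norm_minus_commute)
    qed
    also have "\<dots> = 2 * (\<integral>\<^sup>+x. ennreal ((cmod (u' x - c))\<^sup>2) * indicator G x \<partial>lborel) +
        2 * (\<integral>\<^sup>+x. ennreal ((cmod (u' x - d))\<^sup>2) * indicator H x \<partial>lborel)"
      by (simp add: nn_integral_add nn_integral_cmult)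
    also have "\<dots> \<le> ennreal 2 * ennreal (C * E) + ennreal 2 * ennreal (D * E)"
      using c d by (intro add_mono mult_mono) auto
    also have "\<dots> = ennreal (2 * (C * E) + 2 * (D * E))"
      using E C D by (subst ennreal_plus) (auto simp: ennreal_mult'')
    also have "2 * (C * E) + 2 * (D * E) = (2 * C + 2 * D) * E" by (simp add: algebra_simps)
    finally have "(cmod (d - c))\<^sup>2 * v \<le> (2 * C + 2 * D) * E"
      using C D E by (subst (asm) ennreal_le_iff) auto
    then have dc: "(cmod (d - c))\<^sup>2 \<le> (2 * C + 2 * D) / v * E" using v by (simp add: field_simps)
    have "(\<integral>\<^sup>+x. ennreal ((cmod (u' x - c))\<^sup>2) * indicator (G \<union> H) x \<partial>lborel) \<le>
      (\<integral>\<^sup>+x. ennreal ((cmod (u' x - c))\<^sup>2) * indicator G x + (2 * (ennreal ((cmod (u' x - d))\<^sup>2) * indicator H x) +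
        2 * (ennreal ((cmod (d - c))\<^sup>2) * indicator H x)) \<partial>lborel)"
    proof (intro nn_integral_mono)
      fix x
      have "ennreal ((cmod ((u' x - d) + (d - c)))\<^sup>2) \<le>
         2 * ennreal ((cmod (u' x - d))\<^sup>2) + 2 * ennreal ((cmod (d - c))\<^sup>2)"
        by (rule ennreal_norm_sq_add_le)
      also have "(u' x - d) + (d - c) = u' x - c" by simp
      finally show "ennreal ((cmod (u' x - c))\<^sup>2) * indicator (G \<union> H) x \<le>
        ennreal ((cmod (u' x - c))\<^sup>2) * indicator G x + (2 * (ennreal ((cmod (u' x - d))\<^sup>2) * indicator H x) +
        2 * (ennreal ((cmod (d - c))\<^sup>2) * indicator H x))"
        by (cases "x \<in> G"; cases "x \<in> H") (auto simp: le_iff_add)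
    qed
    also have "\<dots> = (\<integral>\<^sup>+x. ennreal ((cmod (u' x - c))\<^sup>2) * indicator G x \<partial>lborel) +
        (2 * (\<integral>\<^sup>+x. ennreal ((cmod (u' x - d))\<^sup>2) * indicator H x \<partial>lborel) + 2 * (ennreal ((cmod (d - c))\<^sup>2) * ennreal W))"
      using v by (simp add: nn_integral_add nn_integral_cmult nn_integral_cmult_indicator)
    also have "\<dots> \<le> ennreal (C * E) + (ennreal 2 * ennreal (D * E) + ennreal 2 * (ennreal ((2 * C + 2 * D) / v * E) * ennreal W))"
      using c d dc by (intro add_mono mult_mono ennreal_leI) auto
    also have "\<dots> = ennreal (C * E + (2 * (D * E) + 2 * ((2 * C + 2 * D) / v * E * W)))"
    proof -
      have "0 \<le> (2 * C + 2 * D) / v * E" using C D E v by simp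
      have aux: "ennreal a + (ennreal 2 * ennreal b + ennreal 2 * (ennreal k * ennreal W)) = ennreal (a + (2 * b + 2 * (k * W)))"
        if "0 \<le> a" "0 \<le> b" "0 \<le> k" for a b k
        using that v by (simp add: ennreal_mult)
      show ?thesis using \<open>0 \<le> (2 * C + 2 * D) / v * E\<close> E C(1) D(1) by (intro aux) auto
    qed
    also have "C * E + (2 * (D * E) + 2 * ((2 * C + 2 * D) / v * E * W)) = K * E"
      by (simp add: K_def algebra_simps)
    finally show "\<exists>c. (\<integral>\<^sup>+x. ennreal ((cmod (u' x - c))\<^sup>2) * indicator (G \<union> H) x \<partial>lborel)
          \<le> ennreal (K * (nrm2 \<Omega> (g 1) + nrm2 \<Omega> (g 2)))"
      unfolding E_def by blast
  qed (use oG ne in auto)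
qed

text \<open>A maximal union of members of the cover that has the property is all of \<open>\<Omega>\<close>, since otherwise it would be disjoint from every other member and disconnect \<open>\<Omega>\<close>.\<close>
lemma poincare_set_connected_cover:
  assumes bd: "bounded \<Omega>" and F: "finite F" "\<And>G. G \<in> F \<Longrightarrow> poincare_set \<Omega> G" "\<Union>F = \<Omega>"
    and con: "connected \<Omega>" and ne: "\<Omega> \<noteq> {}"
  shows "poincare_set \<Omega> \<Omega>"
proof -
  define P where "P S \<longleftrightarrow> S \<subseteq> F \<and> poincare_set \<Omega> (\<Union>S)" for S
  obtain G0 where "G0 \<in> F" using F(3) ne by auto
  then have P0: "P {G0}" using F(2) by (simp add: P_def)
  have "\<And>S. P S \<Longrightarrow> card S < Suc (card F)"
    using F(1) by (auto simp: P_def card_mono less_Suc_eq_le)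
  then obtain S where S: "P S" "\<And>T. P T \<Longrightarrow> card T \<le> card S"
    using ex_has_greatest_nat[of P "{G0}" card "Suc (card F)"] P0 by (metis less_imp_le)
  have "\<Union>S = \<Omega>"
  proof (rule ccontr)
    assume neq: "\<Union>S \<noteq> \<Omega>"
    let ?R = "\<Union>(F - S)"
    have oG: "open G" "G \<subseteq> \<Omega>" if "G \<in> F" for G using F(2)[OF that] by (auto simp: poincare_set_def)
    have "open (\<Union>S)" "open ?R" using oG S(1) by (auto simp: P_def intro!: open_Union)
    moreover have "\<Omega> \<subseteq> \<Union>S \<union> ?R" using F(3) by auto
    moreover have "\<Union>S \<inter> \<Omega> \<noteq> {}" using S(1) by (metis P_def poincare_set_def inf.absorb1)
    moreover have "?R \<inter> \<Omega> \<noteq> {}" using neq F(3) S(1) by (auto simp: P_def)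
    ultimately have "\<Union>S \<inter> ?R \<inter> \<Omega> \<noteq> {}" using con unfolding connected_def by blast
    then obtain G where G: "G \<in> F - S" "\<Union>S \<inter> G \<noteq> {}" by auto
    then have "P (insert G S)"
      using poincare_set_Un[OF bd, of "\<Union>S" G] F(2) S(1) by (auto simp: P_def Un_commute)
    moreover have "card (insert G S) > card S" using G F(1) S(1) finite_subset by (fastforce simp: P_def)
    ultimately show False using S(2) by fastforce
  qed
  then show ?thesis using S(1) by (simp add: P_def)
qed

text \<open>The defining function \<open>f\<close> of the boundary strictly decreases along some coordinate direction near \<open>p\<close>. Moving the part of \<open>\<Omega>\<close> near \<open>p\<close> in that direction stays in \<open>\<Omega>\<close> and ends in a small disc inside \<open>\<Omega>\<close>.\<close>
lemma poincare_set_boundary: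
  assumes op: "open \<Omega>" and bd: "bounded \<Omega>" and sm: "smooth_boundary \<Omega>" and p: "p \<in> frontier \<Omega>"
  obtains N where "open N" "p \<in> N" "poincare_set \<Omega> (N \<inter> \<Omega>)"
proof -
  obtain U and f :: "real^2 \<Rightarrow> real" where U: "open U" "p \<in> U" "smooth_on U f"
    "\<forall>x\<in>U. frechet_derivative f (at x) \<noteq> (\<lambda>v. 0)" "\<Omega> \<inter> U = {x\<in>U. f x < 0}"
    using sm p unfolding smooth_boundary_def by blast
  have \<Omega>f: "x \<in> \<Omega> \<longleftrightarrow> f x < 0" if "x \<in> U" for x using U(5) that by blast
  have ck: "Ck_on (Suc 0) U f" using U(3) by (simp add: smooth_on_def)
  have der: "(f has_derivative frechet_derivative f (at x)) (at x)" if "x \<in> U" for x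
    using ck that by (auto simp: frechet_derivative_works)
  have lin: "linear (frechet_derivative f (at x))" if "x \<in> U" for x
    using der[OF that] has_derivative_linear by blast
  have "\<exists>b\<in>Basis. frechet_derivative f (at p) b \<noteq> 0"
  proof (rule ccontr)
    assume "\<not> (\<exists>b\<in>Basis. frechet_derivative f (at p) b \<noteq> 0)"
    then have "frechet_derivative f (at p) = (\<lambda>v. 0)"
      using lin[OF U(2)] linear_0 linear_zero by (intro linear_eq_stdbasis) auto
    then show False using U(2,4) by blast
  qed
  then obtain b where b: "b \<in> Basis" "frechet_derivative f (at p) b \<noteq> 0" by blast
  \<comment> \<open>The sign makes \<open>f\<close> increase in the direction \<open>e\<close>.\<close>
  define \<sigma> where "\<sigma> = sgn (frechet_derivative f (at p) b)"
  define e where "e = \<sigma> *\<^sub>R b"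
  define D where "D x = \<sigma> * frechet_derivative f (at x) b" for x
  have De: "frechet_derivative f (at x) e = D x" if "x \<in> U" for x
    using lin[OF that] by (simp add: D_def e_def linear_scale)
  have ne: "norm e = 1" using b by (simp add: e_def \<sigma>_def abs_sgn_eq)
  have "continuous_on U D" using ck b(1) unfolding D_def by (auto intro!: continuous_intros)
  moreover have "D p > 0" using b(2) by (simp add: D_def \<sigma>_def sgn_if)
  ultimately have "\<forall>\<^sub>F x in at p within U. D x > 0"
    using U(2) by (auto simp: continuous_on_def intro: order_tendstoD)
  then have "\<forall>\<^sub>F x in at p. D x > 0" by (simp only: at_within_open[OF U(2,1)])
  then have "\<forall>\<^sub>F x in nhds p. D x > 0" using \<open>D p > 0\<close> by (simp add: eventually_nhds_conv_at)
  then have "\<forall>\<^sub>F x in nhds p. x \<in> U \<and> D x > 0"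
    using eventually_conj[OF eventually_nhds_in_open[OF U(1,2)]] by blast
  then obtain \<rho> where \<rho>: "\<rho> > 0" "\<And>x. x \<in> ball p \<rho> \<Longrightarrow> x \<in> U \<and> D x > 0"
    unfolding eventually_nhds_metric by (metis dist_commute mem_ball)
  have mono: "f (x - t *\<^sub>R e) < f x" if "t > 0" "x \<in> ball p \<rho>" "x - t *\<^sub>R e \<in> ball p \<rho>" for x t
  proof -
    have seg: "x - s *\<^sub>R e \<in> ball p \<rho>" if "0 \<le> s" "s \<le> t" for s
    proof -
      have "(1 - s/t) *\<^sub>R x + (s/t) *\<^sub>R (x - t *\<^sub>R e) \<in> ball p \<rho>"
        using convex_ball[of p \<rho>] \<open>t > 0\<close> \<open>x \<in> ball p \<rho>\<close> \<open>x - t *\<^sub>R e \<in> ball p \<rho>\<close> \<open>0 \<le> s\<close> \<open>s \<le> t\<close>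
        unfolding convex_alt by (metis divide_le_eq_1_pos divide_nonneg_pos)
      then show ?thesis using \<open>t > 0\<close> by (simp add: algebra_simps)
    qed
    have "\<exists>y<0. (((\<lambda>s. f (x - s *\<^sub>R e)) has_real_derivative y) (at s))" if "0 \<le> s" "s \<le> t" for s
    proof -
      have xU: "x - s *\<^sub>R e \<in> U" "D (x - s *\<^sub>R e) > 0" using seg[OF that] \<rho>(2) by auto
      have "((\<lambda>s. x - s *\<^sub>R e) has_derivative (\<lambda>t. - (t *\<^sub>R e))) (at s)"
        by (auto intro!: derivative_eq_intros)
      from diff_chain_at[OF this der[OF xU(1)]]
      have "((\<lambda>s. f (x - s *\<^sub>R e)) has_derivative (\<lambda>t. frechet_derivative f (at (x - s *\<^sub>R e)) (- (t *\<^sub>R e)))) (at s)"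
        by (simp add: o_def)
      moreover have "frechet_derivative f (at (x - s *\<^sub>R e)) (- (t *\<^sub>R e)) = (- D (x - s *\<^sub>R e)) * t" for t
        using lin[OF xU(1)] De[OF xU(1)] by (simp add: linear_neg linear_scale)
      then have "(\<lambda>t. frechet_derivative f (at (x - s *\<^sub>R e)) (- (t *\<^sub>R e))) = (*) (- D (x - s *\<^sub>R e))"
        by (intro ext)
      ultimately have "((\<lambda>s. f (x - s *\<^sub>R e)) has_real_derivative (- D (x - s *\<^sub>R e))) (at s)"
        unfolding has_field_derivative_def by (simp only:)
      then show ?thesis using xU(2) by (intro exI[of _ "- D (x - s *\<^sub>R e)"]) auto
    qed
    then have "f (x - t *\<^sub>R e) < f (x - 0 *\<^sub>R e)"
      by (intro DERIV_neg_imp_decreasing[OF \<open>t > 0\<close>]) metis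
    then show ?thesis by simp
  qed
  have down: "x - t *\<^sub>R e \<in> \<Omega>" if "t \<ge> 0" "x \<in> \<Omega>" "x \<in> ball p \<rho>" "x - t *\<^sub>R e \<in> ball p \<rho>" for x t
  proof (cases "t = 0")
    case False
    then have "f (x - t *\<^sub>R e) < f x" using that by (intro mono) auto
    moreover have "f x < 0" using that(2) \<rho>(2)[OF that(3)] \<Omega>f by blast
    ultimately have "f (x - t *\<^sub>R e) < 0" by linarith
    then show ?thesis using \<rho>(2)[OF that(4)] \<Omega>f by blast
  qed (use that in auto)
  have fp: "f p \<le> 0"
  proof (rule ccontr)
    assume "\<not> f p \<le> 0"
    moreover have "continuous_on U f"
      by (intro continuous_at_imp_continuous_on ballI has_derivative_continuous[OF der])
    ultimately have "(f \<longlongrightarrow> f p) (at p within U)" "0 < f p"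
      using U(2) unfolding continuous_on_def by auto
    then have "\<forall>\<^sub>F x in at p within U. f x > 0" by (rule order_tendstoD(1))
    then have "\<forall>\<^sub>F x in at p. f x > 0" by (simp only: at_within_open[OF U(2,1)])
    moreover have "\<forall>\<^sub>F x in at p. x \<in> U" using U(1,2) by (rule eventually_at_in_open')
    ultimately have "\<forall>\<^sub>F x in at p. x \<in> U \<and> f x > 0" using eventually_conj by blast
    then obtain S where S: "open S" "p \<in> S" "\<And>x. x \<in> S \<Longrightarrow> x \<noteq> p \<Longrightarrow> x \<in> U \<and> f x > 0"
      by (auto simp: eventually_at_topological)
    have "p \<in> closure \<Omega>" "p \<notin> \<Omega>" using p op by (auto simp: frontier_def interior_open)
    then obtain y where "y \<in> \<Omega>" "y \<in> S" using open_Int_closure_eq_empty[OF S(1), of \<Omega>] S(2) by blast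
    then have "y \<in> U" "f y > 0" using S(3)[of y] \<open>p \<notin> \<Omega>\<close> by blast+
    then show False using \<Omega>f[of y] \<open>y \<in> \<Omega>\<close> by simp
  qed
  \<comment> \<open>Translates by at most \<open>h\<close> of points within \<open>\<rho>/4\<close> of \<open>p\<close> stay in the ball of radius \<open>\<rho>\<close>.\<close>
  define h where "h = \<rho> / 4"
  have h: "h > 0" using \<rho>(1) by (simp add: h_def)
  have inb: "p - h *\<^sub>R e \<in> ball p \<rho>" using h ne \<rho>(1) by (simp add: dist_norm h_def)
  have "f (p - h *\<^sub>R e) < 0" using mono[OF h, of p] inb \<rho>(1) fp by simp
  then have "p - h *\<^sub>R e \<in> \<Omega>" using \<rho>(2)[OF inb] \<Omega>f by blast
  then obtain \<delta>0 where "\<delta>0 > 0" "ball (p - h *\<^sub>R e) \<delta>0 \<subseteq> \<Omega>" using op open_contains_ball by blast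
  define \<delta> where "\<delta> = min \<delta>0 (\<rho> / 4)"
  have \<delta>: "\<delta> > 0" "\<delta> \<le> \<rho> / 4" "ball (p - h *\<^sub>R e) \<delta> \<subseteq> \<Omega>"
    using \<open>\<delta>0 > 0\<close> \<open>ball (p - h *\<^sub>R e) \<delta>0 \<subseteq> \<Omega>\<close> \<rho>(1) by (auto simp: \<delta>_def)
  have g0: "poincare_set \<Omega> (ball (p - h *\<^sub>R e) \<delta>)"
    using \<delta> by (intro poincare_set_convex[OF op bd]) auto
  show ?thesis
  proof (rule that[of "ball p \<delta>"])
    show "poincare_set \<Omega> (ball p \<delta> \<inter> \<Omega>)"
    proof (rule poincare_set_shift[OF op bd g0, where z="- h *\<^sub>R e"])
      show "open (ball p \<delta> \<inter> \<Omega>)" using op by auto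
      have "p \<in> closure \<Omega>" using p by (simp add: frontier_def)
      then show "ball p \<delta> \<inter> \<Omega> \<noteq> {}"
        using open_Int_closure_eq_empty[OF open_ball, of p \<delta> \<Omega>] \<delta>(1) centre_in_ball[of p \<delta>] by blast
      show "x + - h *\<^sub>R e \<in> ball (p - h *\<^sub>R e) \<delta>" if "x \<in> ball p \<delta> \<inter> \<Omega>" for x
        using that by (simp add: dist_norm)
      show "x + s *\<^sub>R (- h *\<^sub>R e) \<in> \<Omega>" if x: "x \<in> ball p \<delta> \<inter> \<Omega>" and s: "s \<in> {0..1}" for x s
      proof -
        have "norm ((s * h) *\<^sub>R e) \<le> h" using s h ne by (simp add: mult_left_le_one_le)
        moreover have "norm (p - x) < \<delta>" using x by (simp add: dist_norm)
        moreover have "norm (p - x + (s * h) *\<^sub>R e) \<le> norm (p - x) + norm ((s * h) *\<^sub>R e)" by (rule norm_triangle_ineq)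
        ultimately have "norm (p - x + (s * h) *\<^sub>R e) < \<rho>" using \<delta>(2) h by (simp add: h_def)
        then have "x - (s * h) *\<^sub>R e \<in> ball p \<rho>" by (simp add: dist_norm algebra_simps)
        then have "x - (s * h) *\<^sub>R e \<in> \<Omega>"
          using x s h \<delta>(2) \<rho>(1) by (intro down) auto
        then show ?thesis by simp
      qed
    qed auto
  qed (use \<delta> in auto)
qed

lemma poincare_set_domain:
  assumes op: "open \<Omega>" and bd: "bounded \<Omega>" and sm: "smooth_boundary \<Omega>"
    and con: "connected \<Omega>" and ne: "\<Omega> \<noteq> {}"
  shows "poincare_set \<Omega> \<Omega>"
proof -
  have "\<exists>N. open N \<and> p \<in> N \<and> poincare_set \<Omega> (N \<inter> \<Omega>)" if "p \<in> closure \<Omega>" for p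
  proof (cases "p \<in> \<Omega>")
    case True
    then obtain d where d: "d > 0" "ball p d \<subseteq> \<Omega>" using op open_contains_ball by blast
    then have "poincare_set \<Omega> (ball p d)" by (intro poincare_set_convex[OF op bd]) auto
    moreover have "ball p d \<inter> \<Omega> = ball p d" using d by auto
    ultimately show ?thesis using d by (intro exI[of _ "ball p d"]) auto
  next
    case False
    then have "p \<in> frontier \<Omega>" using that op by (simp add: frontier_def interior_open)
    then show ?thesis using poincare_set_boundary[OF op bd sm] by metis
  qed
  then obtain N where N: "\<And>p. p \<in> closure \<Omega> \<Longrightarrow> open (N p) \<and> p \<in> N p \<and> poincare_set \<Omega> (N p \<inter> \<Omega>)"
    by metis
  have "compact (closure \<Omega>)" using bd by simp
  then obtain T where T: "T \<subseteq> closure \<Omega>" "finite T" "closure \<Omega> \<subseteq> (\<Union>p\<in>T. N p)"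
    by (rule compactE_image[where C="closure \<Omega>" and f=N]) (use N in auto)
  show ?thesis
  proof (rule poincare_set_connected_cover[OF bd _ _ _ con ne])
    show "finite ((\<lambda>p. N p \<inter> \<Omega>) ` T)" using T by simp
    show "\<And>G. G \<in> (\<lambda>p. N p \<inter> \<Omega>) ` T \<Longrightarrow> poincare_set \<Omega> G" using N T(1) by auto
    show "\<Union>((\<lambda>p. N p \<inter> \<Omega>) ` T) = \<Omega>" using T(3) closure_subset by fastforce
  qed
qed

definition poincare :: "(real^2) set \<Rightarrow> real \<Rightarrow> bool" where
  "poincare \<Omega> P \<longleftrightarrow> P > 0 \<and> (\<forall>u g. wgrad \<Omega> u g \<longrightarrow>
     (\<exists>c. nrm2 \<Omega> (\<lambda>x. u x - c) \<le> P * (nrm2 \<Omega> (g 1) + nrm2 \<Omega> (g 2))))"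

lemma poincare_set_imp_poincare:
  assumes op: "open \<Omega>" and bd: "bounded \<Omega>" and g: "poincare_set \<Omega> \<Omega>"
  obtains P where "poincare \<Omega> P"
proof -
  obtain C where C: "C \<ge> 0" "\<And>u g u'. wgrad \<Omega> u g \<Longrightarrow> borel_rep \<Omega> u u' \<Longrightarrow>
      (\<exists>c. (\<integral>\<^sup>+x. ennreal ((cmod (u' x - c))\<^sup>2) * indicator \<Omega> x \<partial>lborel)
          \<le> ennreal (C * (nrm2 \<Omega> (g 1) + nrm2 \<Omega> (g 2))))"
    using g unfolding poincare_set_def by blast
  have "poincare \<Omega> (C + 1)"
    unfolding poincare_def
  proof (intro conjI allI impI)
    show "C + 1 > 0" using C by simp
    fix u g assume w: "wgrad \<Omega> u g"
    then have uL: "u \<in> L2 \<Omega>" by (simp add: wgrad_def)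
    obtain u' where u': "borel_rep \<Omega> u u'" using borel_rep_exists[OF op L2_measurable[OF uL]] .
    obtain c where c: "(\<integral>\<^sup>+x. ennreal ((cmod (u' x - c))\<^sup>2) * indicator \<Omega> x \<partial>lborel)
          \<le> ennreal (C * (nrm2 \<Omega> (g 1) + nrm2 \<Omega> (g 2)))" using C(2)[OF w u'] by blast
    have L: "(\<lambda>x. u x - c) \<in> L2 \<Omega>"
      using uL L2_const(1)[OF bounded_open_finite_measure[OF op bd]] by (intro L2_diff)
    have [measurable]: "\<Omega> \<in> sets borel" using op by simp
    have r: "borel_rep \<Omega> (\<lambda>x. u x - c) (\<lambda>x. (u' x - c) * indicator \<Omega> x)"
      using u' unfolding borel_rep_def by (auto elim!: eventually_mono)
    have "ennreal (nrm2 \<Omega> (\<lambda>x. u x - c)) = (\<integral>\<^sup>+x. ennreal ((cmod (u' x - c))\<^sup>2) * indicator \<Omega> x \<partial>lborel)"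
      unfolding borel_rep_nrm2[OF op L r] by (intro nn_integral_cong) (auto simp: indicator_def)
    then have "nrm2 \<Omega> (\<lambda>x. u x - c) \<le> C * (nrm2 \<Omega> (g 1) + nrm2 \<Omega> (g 2))"
      using c C(1) ennreal_le_iff[of "C * (nrm2 \<Omega> (g 1) + nrm2 \<Omega> (g 2))" "nrm2 \<Omega> (\<lambda>x. u x - c)"] by simp
    also have "\<dots> \<le> (C + 1) * (nrm2 \<Omega> (g 1) + nrm2 \<Omega> (g 2))" by (intro mult_right_mono) auto
    finally show "\<exists>c. nrm2 \<Omega> (\<lambda>x. u x - c) \<le> (C + 1) * (nrm2 \<Omega> (g 1) + nrm2 \<Omega> (g 2))" by blast
  qed
  then show ?thesis by (rule that)
qed

section \<open>Calculus of weak gradients\<close>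

lemma wgrad_unique:
  assumes op: "open \<Omega>" and bd: "bounded \<Omega>" and "wgrad \<Omega> u g" "wgrad \<Omega> u h"
  shows "AE x in lebesgue_on \<Omega>. g j x = h j x"
proof -
  have fin: "\<Omega> \<in> lmeasurable" using bounded_open_finite_measure op bd by blast
  have L: "u \<in> L2 \<Omega>" "g j \<in> L2 \<Omega>" "h j \<in> L2 \<Omega>" using assms by (auto simp: wgrad_def)
  have "AE x in lebesgue_on \<Omega>. g j x - h j x = 0"
  proof (rule fundamental_lemma[OF op bd L2_diff[OF L(2,3)]])
    fix \<phi> assume t: "test_function \<Omega> \<phi>"
    have pL: "(\<lambda>x. complex_of_real (\<phi> x)) \<in> L2 \<Omega>" by (rule test_function_L2(1)[OF fin t])
    have "- L2_inner \<Omega> (g j) (\<lambda>x. of_real (\<phi> x)) = - L2_inner \<Omega> (h j) (\<lambda>x. of_real (\<phi> x))"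
      using has_weak_partial_inner[OF fin L(1,2)] has_weak_partial_inner[OF fin L(1,3)] assms(3,4) t
      unfolding wgrad_def by metis
    then have "L2_inner \<Omega> (g j) (\<lambda>x. of_real (\<phi> x)) - L2_inner \<Omega> (h j) (\<lambda>x. of_real (\<phi> x)) = 0" by simp
    then show "(LINT x|lebesgue_on \<Omega>. of_real (\<phi> x) * (g j x - h j x)) = 0"
      unfolding L2_inner_def using L2_prod_integrable[OF L(2) pL] L2_prod_integrable[OF L(3) pL]
      by (simp add: right_diff_distrib mult.commute)
  qed
  then show ?thesis by simp
qed

lemma wgrad_add:
  assumes fin: "\<Omega> \<in> lmeasurable" and "wgrad \<Omega> u g" "wgrad \<Omega> v h"
  shows "wgrad \<Omega> (\<lambda>x. u x + v x) (\<lambda>j x. g j x + h j x)"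
proof -
  have L: "u \<in> L2 \<Omega>" "\<And>j. g j \<in> L2 \<Omega>" "v \<in> L2 \<Omega>" "\<And>j. h j \<in> L2 \<Omega>" using assms by (auto simp: wgrad_def)
  show ?thesis using assms(2,3) L
    by (auto simp: wgrad_def L2_add has_weak_partial_inner[OF fin] L2_inner_add_left test_function_L2[OF fin])
qed

lemma wgrad_cmult:
  assumes fin: "\<Omega> \<in> lmeasurable" and "wgrad \<Omega> u g"
  shows "wgrad \<Omega> (\<lambda>x. c * u x) (\<lambda>j x. c * g j x)"
proof -
  have L: "u \<in> L2 \<Omega>" "\<And>j. g j \<in> L2 \<Omega>" using assms by (auto simp: wgrad_def)
  have "has_weak_partial \<Omega> j (\<lambda>x. c * u x) (\<lambda>x. c * g j x)" for j
  proof -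
    have "has_weak_partial \<Omega> j u (g j)" using assms(2) by (simp add: wgrad_def)
    then show ?thesis
      unfolding has_weak_partial_inner[OF fin L2_cmult[OF L(1)] L2_cmult[OF L(2)]]
        has_weak_partial_inner[OF fin L(1) L(2)] L2_inner_cmult_left
      by simp
  qed
  then show ?thesis using L by (simp add: wgrad_def L2_cmult)
qed

lemma L2_inner_tendsto:
  assumes "\<And>n. f n \<in> L2 \<Omega>" "g \<in> L2 \<Omega>" "h \<in> L2 \<Omega>" "(\<lambda>n. nrm2 \<Omega> (\<lambda>x. f n x - g x)) \<longlonglongrightarrow> 0"
  shows "(\<lambda>n. L2_inner \<Omega> (f n) h) \<longlonglongrightarrow> L2_inner \<Omega> g h"
proof -
  have "(\<lambda>n. L2_inner \<Omega> (f n) h - L2_inner \<Omega> g h) \<longlonglongrightarrow> 0"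
  proof (rule Lim_null_comparison)
    show "(\<lambda>n. sqrt (nrm2 \<Omega> (\<lambda>x. f n x - g x) * nrm2 \<Omega> h)) \<longlonglongrightarrow> 0"
      using tendsto_real_sqrt[OF tendsto_mult_left_zero[OF assms(4), of "nrm2 \<Omega> h"]] by simp
    show "\<forall>\<^sub>F n in sequentially. norm (L2_inner \<Omega> (f n) h - L2_inner \<Omega> g h) \<le> sqrt (nrm2 \<Omega> (\<lambda>x. f n x - g x) * nrm2 \<Omega> h)"
    proof (rule always_eventually, rule allI)
      fix n
      have d: "(\<lambda>x. f n x - g x) \<in> L2 \<Omega>" using assms L2_diff by blast
      have "L2_inner \<Omega> (f n) h = L2_inner \<Omega> (\<lambda>x. (f n x - g x) + g x) h" by simp
      also have "\<dots> = L2_inner \<Omega> (\<lambda>x. f n x - g x) h + L2_inner \<Omega> g h"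
        using d assms by (intro L2_inner_add_left)
      finally show "norm (L2_inner \<Omega> (f n) h - L2_inner \<Omega> g h) \<le> sqrt (nrm2 \<Omega> (\<lambda>x. f n x - g x) * nrm2 \<Omega> h)"
        using L2_Cauchy_Schwarz[OF d assms(3)] by (simp add: real_le_rsqrt)
    qed
  qed
  then show ?thesis by (simp add: LIM_zero_iff)
qed

lemma nrm2_tendsto:
  assumes f: "\<And>n. f n \<in> L2 \<Omega>" and g: "g \<in> L2 \<Omega>" and lim: "(\<lambda>n. nrm2 \<Omega> (\<lambda>x. f n x - g x)) \<longlonglongrightarrow> 0"
  shows "(\<lambda>n. nrm2 \<Omega> (f n)) \<longlonglongrightarrow> nrm2 \<Omega> g"
proof -
  have e: "nrm2 \<Omega> (f n) = nrm2 \<Omega> (\<lambda>x. f n x - g x) + (2 * Re (L2_inner \<Omega> (f n) g) - nrm2 \<Omega> g)" for n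
  proof -
    have "nrm2 \<Omega> (\<lambda>x. f n x + (-1) * g x) = nrm2 \<Omega> (f n) + 2 * Re (L2_inner \<Omega> (f n) (\<lambda>x. (-1) * g x)) + nrm2 \<Omega> (\<lambda>x. (-1) * g x)"
      using f g by (intro nrm2_add L2_cmult)
    then show ?thesis unfolding L2_inner_cmult_right nrm2_cmult by simp
  qed
  have "(\<lambda>n. nrm2 \<Omega> (\<lambda>x. f n x - g x) + (2 * Re (L2_inner \<Omega> (f n) g) - nrm2 \<Omega> g)) \<longlonglongrightarrow> 0 + (2 * Re (L2_inner \<Omega> g g) - nrm2 \<Omega> g)"
    by (intro tendsto_intros lim L2_inner_tendsto f g)
  then show ?thesis using e by (simp add: L2_inner_self)
qed

text \<open>The definition by inner products against test functions passes to limits in the mean. This closedness is what makes minimizers available.\<close>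
lemma wgrad_closed:
  assumes fin: "\<Omega> \<in> lmeasurable" and w: "\<And>n. wgrad \<Omega> (u n) (g n)"
    and v: "v \<in> L2 \<Omega>" "(\<lambda>n. nrm2 \<Omega> (\<lambda>x. u n x - v x)) \<longlonglongrightarrow> 0"
    and h: "\<And>j. h j \<in> L2 \<Omega>" "\<And>j. (\<lambda>n. nrm2 \<Omega> (\<lambda>x. g n j x - h j x)) \<longlonglongrightarrow> 0"
  shows "wgrad \<Omega> v h"
proof -
  have L: "u n \<in> L2 \<Omega>" "g n j \<in> L2 \<Omega>" for n j using w by (auto simp: wgrad_def)
  have "has_weak_partial \<Omega> j v (h j)" for j
    unfolding has_weak_partial_inner[OF fin v(1) h(1)]
  proof (intro allI impI)
    fix \<phi> assume t: "test_function \<Omega> \<phi>"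
    let ?d = "\<lambda>x. complex_of_real (frechet_derivative \<phi> (at x) (axis j 1))"
    let ?p = "\<lambda>x. complex_of_real (\<phi> x)"
    have a: "(\<lambda>n. L2_inner \<Omega> (u n) ?d) \<longlonglongrightarrow> L2_inner \<Omega> v ?d"
      using L v test_function_L2[OF fin t] by (intro L2_inner_tendsto)
    have b: "(\<lambda>n. - L2_inner \<Omega> (g n j) ?p) \<longlonglongrightarrow> - L2_inner \<Omega> (h j) ?p"
      using L h test_function_L2[OF fin t] by (intro tendsto_minus L2_inner_tendsto)
    have "L2_inner \<Omega> (u n) ?d = - L2_inner \<Omega> (g n j) ?p" for n
      using w[of n] t has_weak_partial_inner[OF fin L] by (auto simp: wgrad_def)
    then show "L2_inner \<Omega> v ?d = - L2_inner \<Omega> (h j) ?p" using a b LIMSEQ_unique by simp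
  qed
  then show ?thesis using v h by (simp add: wgrad_def)
qed

lemma integral_derivative_compact_support:
  fixes w :: "real^2 \<Rightarrow> complex"
  assumes der: "\<And>x. ((\<lambda>t. w (x + t *\<^sub>R e)) has_vector_derivative w' x) (at 0)"
    and cont: "continuous_on UNIV w" "continuous_on UNIV w'"
    and K: "compact K" "\<And>x. x \<notin> K \<Longrightarrow> w x = 0" "\<And>x. x \<notin> K \<Longrightarrow> w' x = 0"
  shows "(LBINT x. w' x) = 0"
proof -
  have [measurable]: "w \<in> borel_measurable borel" "w' \<in> borel_measurable borel"
    using cont by (auto intro: borel_measurable_continuous_onI)
  have "bounded (w' ` K)"
    using K(1) cont(2) by (intro compact_imp_bounded compact_continuous_image) (auto intro: continuous_on_subset)
  then obtain C0 where C0: "\<And>x. x \<in> K \<Longrightarrow> cmod (w' x) \<le> C0" by (auto simp: bounded_iff)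
  define C where "C = max C0 0"
  have C: "C \<ge> 0" "cmod (w' x) \<le> C" for x
    using C0[of x] K(3)[of x] by (cases "x \<in> K"; auto simp: C_def)+
  have der_t: "((\<lambda>t. w (x + t *\<^sub>R e)) has_vector_derivative w' (x + t *\<^sub>R e)) (at t)" for x t
  proof -
    have "((\<lambda>s. w ((x + t *\<^sub>R e) + s *\<^sub>R e)) has_vector_derivative w' (x + t *\<^sub>R e)) (at (t - t))"
      using der[of "x + t *\<^sub>R e"] by simp
    moreover have "((\<lambda>s. s - t) has_real_derivative 1) (at t)" by (auto intro!: derivative_eq_intros)
    ultimately have "((\<lambda>s. w ((x + t *\<^sub>R e) + s *\<^sub>R e)) \<circ> (\<lambda>s. s - t) has_vector_derivative (1 *\<^sub>R w' (x + t *\<^sub>R e))) (at t)"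
      by (intro vector_diff_chain_at) (auto simp: has_real_derivative_iff_has_vector_derivative)
    then show ?thesis by (simp add: o_def algebra_simps)
  qed
  have lip: "cmod (w (x + t *\<^sub>R e) - w x) \<le> C * t" if "t \<ge> 0" for x t
  proof -
    have "norm (w (x + t *\<^sub>R e) - w (x + 0 *\<^sub>R e)) \<le> C * norm (t - 0)"
    proof (rule differentiable_bound[of "{0..t}" "\<lambda>t. w (x + t *\<^sub>R e)" "\<lambda>s h. h *\<^sub>R w' (x + s *\<^sub>R e)"])
      show "((\<lambda>t. w (x + t *\<^sub>R e)) has_derivative (\<lambda>h. h *\<^sub>R w' (x + s *\<^sub>R e))) (at s within {0..t})" for s
        using der_t[of x s] by (simp add: has_vector_derivative_def has_derivative_at_withinI)
      show "onorm (\<lambda>h. h *\<^sub>R w' (x + s *\<^sub>R e)) \<le> C" for s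
        using C by (intro onorm_le) (simp add: mult.commute[of C] mult_left_mono)
    qed (use that in auto)
    then show ?thesis using that by simp
  qed
  obtain r where r: "\<And>x. x \<in> K \<Longrightarrow> norm x \<le> r" using compact_imp_bounded[OF K(1)] by (auto simp: bounded_iff)
  define S where "S = cball (0::real^2) (r + norm e)"
  have iw: "integrable lborel w"
  proof -
    have "set_integrable lborel K w"
      using borel_integrable_compact[OF K(1), of w] continuous_on_subset[OF cont(1), of K]
      by (simp add: set_integrable_def)
    moreover have "(\<lambda>x. indicator K x *\<^sub>R w x) = w" using K(2) by (auto simp: indicator_def fun_eq_iff)
    ultimately show ?thesis by (simp add: set_integrable_def)
  qed
  define t where "t n = 1 / real (Suc n)" for n
  have t: "0 < t n" "t n \<le> 1" for n by (auto simp: t_def)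
  have "(\<lambda>n. LBINT x. (1 / t n) *\<^sub>R (w (x + t n *\<^sub>R e) - w x)) \<longlonglongrightarrow> (LBINT x. w' x)"
  proof (rule integral_dominated_convergence)
    show "integrable lborel (\<lambda>x. C * indicator S x)"
      unfolding S_def using emeasure_bounded_finite[of "cball (0::real^2) (r + norm e)"]
      by (intro integrable_mult_right integrable_real_indicator) auto
    show "AE x in lborel. norm ((1 / t n) *\<^sub>R (w (x + t n *\<^sub>R e) - w x)) \<le> C * indicator S x" for n
    proof (rule AE_I2)
      fix x
      show "norm ((1 / t n) *\<^sub>R (w (x + t n *\<^sub>R e) - w x)) \<le> C * indicator S x"
      proof (cases "x \<in> S")
        case True
        have "norm ((1 / t n) *\<^sub>R (w (x + t n *\<^sub>R e) - w x)) = (1 / t n) * norm (w (x + t n *\<^sub>R e) - w x)"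
          using t(1)[of n] by (simp del: scaleR_diff_right)
        also have "\<dots> \<le> (1 / t n) * (C * t n)"
          using lip[of "t n" x] t[of n] by (intro mult_left_mono) auto
        finally show ?thesis using True t(1)[of n] by simp
      next
        case False
        then have nx: "norm x > r + norm e" by (simp add: S_def)
        have te: "norm (t n *\<^sub>R e) \<le> norm e" using t[of n] by (simp add: mult_left_le_one_le)
        have "norm x \<le> norm (x + t n *\<^sub>R e) + norm (t n *\<^sub>R e)"
          using norm_triangle_ineq4[of "x + t n *\<^sub>R e" "t n *\<^sub>R e"] by simp
        then have "x \<notin> K" "x + t n *\<^sub>R e \<notin> K"
          using r[of x] r[of "x + t n *\<^sub>R e"] nx te norm_ge_zero[of e] by linarith+
        then show ?thesis using K(2) C by simp
      qed
    qed
    show "AE x in lborel. (\<lambda>n. (1 / t n) *\<^sub>R (w (x + t n *\<^sub>R e) - w x)) \<longlonglongrightarrow> w' x"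
    proof (rule AE_I2)
      fix x
      have tl: "t \<longlonglongrightarrow> 0" unfolding t_def using LIMSEQ_inverse_real_of_nat by (simp add: inverse_eq_divide)
      have "(\<lambda>h. norm (w (x + (0 + h) *\<^sub>R e) - w (x + 0 *\<^sub>R e) - h *\<^sub>R w' x) / norm h) \<midarrow>0\<rightarrow> 0"
        using der[of x] by (simp add: has_vector_derivative_def has_derivative_at)
      moreover have "filterlim t (at 0) sequentially"
        using tl t(1) by (auto simp: filterlim_at less_imp_neq[THEN not_sym])
      ultimately have "(\<lambda>n. norm (w (x + (0 + t n) *\<^sub>R e) - w (x + 0 *\<^sub>R e) - t n *\<^sub>R w' x) / norm (t n)) \<longlonglongrightarrow> 0"
        by (rule filterlim_compose)
      moreover have "norm (w (x + (0 + t n) *\<^sub>R e) - w (x + 0 *\<^sub>R e) - t n *\<^sub>R w' x) / norm (t n)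
        = norm ((1 / t n) *\<^sub>R (w (x + t n *\<^sub>R e) - w x) - w' x)" for n
      proof -
        have "(1 / t n) *\<^sub>R (w (x + t n *\<^sub>R e) - w x) - w' x = (1 / t n) *\<^sub>R (w (x + t n *\<^sub>R e) - w x - t n *\<^sub>R w' x)"
          using t(1)[of n] by (simp add: scaleR_diff_right)
        then show ?thesis using t(1)[of n] by (simp del: scaleR_diff_right add: divide_inverse mult.commute)
      qed
      ultimately have "(\<lambda>n. norm ((1 / t n) *\<^sub>R (w (x + t n *\<^sub>R e) - w x) - w' x)) \<longlonglongrightarrow> 0" by simp
      then show "(\<lambda>n. (1 / t n) *\<^sub>R (w (x + t n *\<^sub>R e) - w x)) \<longlonglongrightarrow> w' x"
        by (simp add: tendsto_norm_zero_iff LIM_zero_iff)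
    qed
  qed auto
  moreover have z: "(LBINT x. (1 / t n) *\<^sub>R (w (x + t n *\<^sub>R e) - w x)) = 0" for n
    using iw integrable_translate[of w "t n *\<^sub>R e"] by simp
  ultimately have "(\<lambda>n::nat. 0) \<longlonglongrightarrow> (LBINT x. w' x)" by (simp only: z)
  then show ?thesis by (rule LIMSEQ_unique[OF _ tendsto_const])
qed

text \<open>The product of the function with a test function, extended by zero, is continuously differentiable on the plane with compact support, so the integral of its partial derivative vanishes.\<close>
lemma wgrad_classical:
  assumes op: "open \<Omega>" and bd: "bounded \<Omega>"
    and der: "\<And>x. x \<in> \<Omega> \<Longrightarrow> (v has_derivative (\<lambda>h. \<Sum>j\<in>UNIV. of_real (h $ j) * D j x)) (at x)"
    and cD: "\<And>j. continuous_on \<Omega> (D j)" and L: "v \<in> L2 \<Omega>" "\<And>j. D j \<in> L2 \<Omega>"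
  shows "wgrad \<Omega> v D"
proof -
  have fin: "\<Omega> \<in> lmeasurable" using bounded_open_finite_measure op bd by blast
  have cv: "continuous_on \<Omega> v"
    by (intro continuous_at_imp_continuous_on ballI has_derivative_continuous[OF der])
  have "has_weak_partial \<Omega> j v (D j)" for j
    unfolding has_weak_partial_inner[OF fin L(1) L(2)]
  proof (intro allI impI)
    fix \<phi> assume t: "test_function \<Omega> \<phi>"
    let ?d = "\<lambda>x. frechet_derivative \<phi> (at x) (axis j 1)"
    define K where "K = closure {x. \<phi> x \<noteq> 0}"
    have K: "compact K" "K \<subseteq> \<Omega>" using t unfolding test_function_def K_def by blast+
    have \<phi>0: "\<phi> x = 0" if "x \<notin> K" for x
      using that closure_subset[of "{x. \<phi> x \<noteq> 0}"] unfolding K_def by blast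
    have d0: "?d x = 0" if "x \<notin> K" for x using test_function_deriv_0[OF t] that unfolding K_def by blast
    define w where "w x = (if x \<in> \<Omega> then of_real (\<phi> x) * v x else 0)" for x
    define w' where "w' x = (if x \<in> \<Omega> then of_real (?d x) * v x + of_real (\<phi> x) * D j x else 0)" for x
    have wK: "w x = 0" "w' x = 0" if "x \<notin> K" for x
      using \<phi>0[OF that] d0[OF that] by (simp_all add: w_def w'_def)
    have cover: "(UNIV :: (real^2) set) = \<Omega> \<union> - K" using K(2) by blast
    have oK: "open (- K)" using compact_imp_closed[OF K(1)] by (rule open_Compl)
    have cw: "continuous_on UNIV w"
      unfolding cover
    proof (rule continuous_on_open_Un[OF op oK])
      have "continuous_on \<Omega> (\<lambda>x. of_real (\<phi> x) * v x)"
        by (intro continuous_intros cv test_function_continuous(1)[OF t])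
      then show "continuous_on \<Omega> w" by (rule continuous_on_eq) (simp add: w_def)
      show "continuous_on (- K) w"
        by (rule continuous_on_eq[of _ "\<lambda>_. 0"]) (use wK(1) in simp_all)
    qed
    have cw': "continuous_on UNIV w'"
      unfolding cover
    proof (rule continuous_on_open_Un[OF op oK])
      have "continuous_on \<Omega> (\<lambda>x. of_real (?d x) * v x + of_real (\<phi> x) * D j x)"
        by (intro continuous_intros cv cD test_function_continuous(1,2)[OF t])
      then show "continuous_on \<Omega> w'" by (rule continuous_on_eq) (simp add: w'_def)
      show "continuous_on (- K) w'"
        by (rule continuous_on_eq[of _ "\<lambda>_. 0"]) (use wK(2) in simp_all)
    qed
    have dw: "((\<lambda>t. w (x + t *\<^sub>R axis j 1)) has_vector_derivative w' x) (at 0)" for x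
    proof (cases "x \<in> \<Omega>")
      case True
      have "(w has_derivative (\<lambda>h. of_real (\<phi> x) * (\<Sum>j\<in>UNIV. of_real (h $ j) * D j x) + of_real (frechet_derivative \<phi> (at x) h) * v x)) (at x)"
      proof (rule has_derivative_transform_within_open[OF _ op True])
        show "((\<lambda>x. of_real (\<phi> x) * v x) has_derivative (\<lambda>h. of_real (\<phi> x) * (\<Sum>j\<in>UNIV. of_real (h $ j) * D j x) + of_real (frechet_derivative \<phi> (at x) h) * v x)) (at x)"
          by (intro has_derivative_mult has_derivative_of_real der[OF True] test_function_continuous(3)[OF t])
      qed (simp add: w_def)
      then have 1: "(w has_derivative (\<lambda>h. of_real (\<phi> x) * (\<Sum>j\<in>UNIV. of_real (h $ j) * D j x) + of_real (frechet_derivative \<phi> (at x) h) * v x)) (at (x + 0 *\<^sub>R axis j 1))"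
        by simp
      have 2: "((\<lambda>t. x + t *\<^sub>R axis j 1) has_derivative (\<lambda>s. s *\<^sub>R axis j 1)) (at 0)"
        by (auto intro!: derivative_eq_intros)
      have lin: "linear (frechet_derivative \<phi> (at x))"
        using test_function_continuous(3)[OF t] has_derivative_linear by blast
      have "(\<Sum>k\<in>UNIV. of_real ((s *\<^sub>R axis j 1 :: real^2) $ k) * D k x) = of_real s * D j x" for s
      proof -
        have "of_real ((s *\<^sub>R axis j 1 :: real^2) $ k) * D k x = (if k = j then of_real s * D j x else 0)" for k
          by (simp add: axis_def)
        then show ?thesis by simp
      qed
      note sumD = this
      have "(\<lambda>s. of_real (\<phi> x) * (\<Sum>k\<in>UNIV. of_real ((s *\<^sub>R axis j 1 :: real^2) $ k) * D k x) + of_real (frechet_derivative \<phi> (at x) (s *\<^sub>R axis j 1)) * v x) =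
        (\<lambda>s. s *\<^sub>R w' x)"
      proof
        fix s
        have w'x: "w' x = of_real (?d x) * v x + of_real (\<phi> x) * D j x" using True by (simp add: w'_def)
        show "of_real (\<phi> x) * (\<Sum>k\<in>UNIV. of_real ((s *\<^sub>R axis j 1 :: real^2) $ k) * D k x) + of_real (frechet_derivative \<phi> (at x) (s *\<^sub>R axis j 1)) * v x = s *\<^sub>R w' x"
          unfolding sumD w'x linear_scale[OF lin] by (simp add: scaleR_conv_of_real distrib_left)
      qed
      then show ?thesis
        using diff_chain_at[OF 2 1] unfolding has_vector_derivative_def o_def by simp
    next
      case False
      then have xK: "x \<in> - K" using K(2) by blast
      have "\<forall>\<^sub>F y in nhds x. w y = 0"
        using eventually_nhds_in_open[OF oK xK] by eventually_elim (use wK(1) in simp)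
      then have "(w has_derivative (\<lambda>_. 0)) (at x)"
        by (intro has_derivative_transform_eventually[OF has_derivative_const[of 0]])
          (auto simp: eventually_nhds_conv_at elim: eventually_mono)
      then have 1: "(w has_derivative (\<lambda>_. 0)) (at (x + 0 *\<^sub>R axis j 1))" by simp
      have 2: "((\<lambda>t. x + t *\<^sub>R axis j 1) has_derivative (\<lambda>s. s *\<^sub>R axis j 1)) (at 0)"
        by (auto intro!: derivative_eq_intros)
      show ?thesis
        using diff_chain_at[OF 2 1] wK(2)[of x] xK by (simp add: has_vector_derivative_def o_def)
    qed
    have "(LBINT x. w' x) = 0"
      by (rule integral_derivative_compact_support[OF dw cw cw' K(1) wK])
    moreover have "(LINT x|lebesgue_on \<Omega>. v x * cnj (of_real (?d x)) + D j x * cnj (of_real (\<phi> x))) = (LBINT x. w' x)"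
    proof (rule LINT_eq_LBINT(1))
      show "borel_rep \<Omega> (\<lambda>x. v x * cnj (of_real (?d x)) + D j x * cnj (of_real (\<phi> x))) w'"
        unfolding borel_rep_def using cw' by (auto intro!: borel_measurable_continuous_onI AE_I2 simp: w'_def mult.commute)
      show "(\<lambda>x. v x * cnj (of_real (?d x)) + D j x * cnj (of_real (\<phi> x))) \<in> borel_measurable (lebesgue_on \<Omega>)"
        using L2_prod_integrable[OF L(1) test_function_L2(2)[OF fin t], of j]
          L2_prod_integrable[OF L(2)[of j] test_function_L2(1)[OF fin t]] by (intro borel_measurable_add) auto
    qed (use op in auto)
    ultimately have "L2_inner \<Omega> v (\<lambda>x. of_real (?d x)) + L2_inner \<Omega> (D j) (\<lambda>x. of_real (\<phi> x)) = 0"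
      unfolding L2_inner_def using L2_prod_integrable[OF L(1) test_function_L2(2)[OF fin t], of j]
          L2_prod_integrable[OF L(2)[of j] test_function_L2(1)[OF fin t]] by (subst Bochner_Integration.integral_add[symmetric]) auto
    then show "L2_inner \<Omega> v (\<lambda>x. of_real (?d x)) = - L2_inner \<Omega> (D j) (\<lambda>x. of_real (\<phi> x))"
      by (simp add: eq_neg_iff_add_eq_0)
  qed
  then show ?thesis using L by (simp add: wgrad_def)
qed

lemma wgrad_const:
  assumes op: "open \<Omega>" and bd: "bounded \<Omega>"
  shows "wgrad \<Omega> (\<lambda>x. c) (\<lambda>j x. 0)"
  using L2_const(1)[OF bounded_open_finite_measure[OF op bd]]
  by (intro wgrad_classical[OF op bd]) (simp_all add: L2_zero)

section \<open>The lowest eigenvalue as a minimum\<close>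

text \<open>The components of \<open>(-i\<nabla> + B A)u\<close> for the chosen weak gradient \<open>g\<close> of \<open>u\<close>.\<close>
definition magnetic_grad :: "real \<Rightarrow> (2 \<Rightarrow> real^2 \<Rightarrow> complex) \<Rightarrow> (real^2 \<Rightarrow> complex) \<Rightarrow> 2 \<Rightarrow> real^2 \<Rightarrow> complex" where
  "magnetic_grad B g u j x = - \<i> * g j x + of_real (B * vec_potential x $ j) * u x"

definition energy :: "real \<Rightarrow> (real^2) set \<Rightarrow> (real^2 \<Rightarrow> complex) \<Rightarrow> (2 \<Rightarrow> real^2 \<Rightarrow> complex) \<Rightarrow> real" where
  "energy B \<Omega> u g = nrm2 \<Omega> (magnetic_grad B g u 1) + nrm2 \<Omega> (magnetic_grad B g u 2)"

definition dirichlet :: "(real^2) set \<Rightarrow> (2 \<Rightarrow> real^2 \<Rightarrow> complex) \<Rightarrow> real" where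
  "dirichlet \<Omega> g = nrm2 \<Omega> (g 1) + nrm2 \<Omega> (g 2)"

lemma energy_nonneg: "0 \<le> energy B \<Omega> u g" by (simp add: energy_def)
lemma dirichlet_nonneg: "0 \<le> dirichlet \<Omega> g" by (simp add: dirichlet_def)

lemma vec_potential_nth: "vec_potential x $ 1 = - (x $ 2) / 2" "vec_potential x $ 2 = x $ 1 / 2"
  by (simp_all add: vec_potential_def)

lemma vec_potential_continuous: "continuous_on UNIV (\<lambda>x. vec_potential x $ j)"
proof -
  have "j = 1 \<or> j = 2" by (rule exhaust_2)
  then show ?thesis
  proof
    assume j: "j = 1"
    show ?thesis unfolding j vec_potential_nth by (intro continuous_intros) simp
  next
    assume j: "j = 2"
    show ?thesis unfolding j vec_potential_nth by (intro continuous_intros) simp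
  qed
qed

lemma vec_potential_bounded:
  assumes "bounded \<Omega>"
  obtains R where "R > 0" "\<And>x j. x \<in> \<Omega> \<Longrightarrow> \<bar>vec_potential x $ j\<bar> \<le> R"
proof -
  obtain r where r: "\<And>x. x \<in> \<Omega> \<Longrightarrow> norm x \<le> r" using assms by (auto simp: bounded_iff)
  have "\<bar>vec_potential x $ j\<bar> \<le> \<bar>r\<bar> + 1" if "x \<in> \<Omega>" for x j
    using exhaust_2[of j] r[OF that] component_le_norm_cart[of x 1] component_le_norm_cart[of x 2]
    by (auto simp: vec_potential_nth)
  then show ?thesis using that[of "\<bar>r\<bar> + 1"] by fastforce
qed

lemma L2_vec_potential:
  assumes "x_bound \<ge> 0" "\<And>x j. x \<in> \<Omega> \<Longrightarrow> \<bar>vec_potential x $ j\<bar> \<le> x_bound" "u \<in> L2 \<Omega>"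
  shows "(\<lambda>x. of_real (B * vec_potential x $ j) * u x) \<in> L2 \<Omega>"
    and "nrm2 \<Omega> (\<lambda>x. of_real (B * vec_potential x $ j) * u x) \<le> B\<^sup>2 * x_bound\<^sup>2 * nrm2 \<Omega> u"
proof -
  have c: "continuous_on UNIV (\<lambda>x. B * vec_potential x $ j)"
    by (intro continuous_intros vec_potential_continuous)
  have b: "cmod (complex_of_real (B * vec_potential x $ j)) \<le> \<bar>B\<bar> * x_bound" if "x \<in> \<Omega>" for x
    unfolding norm_of_real abs_mult using assms(2)[OF that, of j] by (intro mult_left_mono) auto
  show "(\<lambda>x. of_real (B * vec_potential x $ j) * u x) \<in> L2 \<Omega>"
    by (rule L2_bounded_mult[OF assms(3) continuous_measurable_on(4)[OF c] b])
  show "nrm2 \<Omega> (\<lambda>x. of_real (B * vec_potential x $ j) * u x) \<le> B\<^sup>2 * x_bound\<^sup>2 * nrm2 \<Omega> u"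
    using nrm2_bounded_mult[OF assms(3) continuous_measurable_on(4)[OF c] b] by (simp add: power_mult_distrib)
qed

lemma magnetic_grad_L2:
  assumes "bounded \<Omega>" "wgrad \<Omega> u g"
  shows "magnetic_grad B g u j \<in> L2 \<Omega>"
proof -
  obtain R where "R > 0" "\<And>x j. x \<in> \<Omega> \<Longrightarrow> \<bar>vec_potential x $ j\<bar> \<le> R"
    using vec_potential_bounded[OF assms(1)] by blast
  then show ?thesis unfolding magnetic_grad_def[abs_def]
    using assms(2) by (intro L2_add L2_cmult L2_vec_potential(1)[of R]) (auto simp: wgrad_def)
qed

lemma magnetic_grad_add: "magnetic_grad B (\<lambda>j x. g j x + h j x) (\<lambda>x. u x + v x) j = (\<lambda>x. magnetic_grad B g u j x + magnetic_grad B h v j x)"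
  by (simp add: magnetic_grad_def fun_eq_iff algebra_simps)

lemma magnetic_grad_cmult: "magnetic_grad B (\<lambda>j x. c * g j x) (\<lambda>x. c * u x) j = (\<lambda>x. c * magnetic_grad B g u j x)"
  by (simp add: magnetic_grad_def fun_eq_iff algebra_simps)

definition magnetic_sesq :: "real \<Rightarrow> (real^2) set \<Rightarrow> (real^2 \<Rightarrow> complex) \<Rightarrow> (2 \<Rightarrow> real^2 \<Rightarrow> complex) \<Rightarrow> (real^2 \<Rightarrow> complex) \<Rightarrow> (2 \<Rightarrow> real^2 \<Rightarrow> complex) \<Rightarrow> complex" where
  "magnetic_sesq B \<Omega> u g v h = L2_inner \<Omega> (magnetic_grad B g u 1) (magnetic_grad B h v 1) + L2_inner \<Omega> (magnetic_grad B g u 2) (magnetic_grad B h v 2)"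

lemma H1_wgrad:
  assumes "u \<in> H1 \<Omega>"
  shows "wgrad \<Omega> u (\<lambda>j. weak_partial \<Omega> j u)"
proof -
  have "weak_partial \<Omega> j u \<in> L2 \<Omega> \<and> has_weak_partial \<Omega> j u (weak_partial \<Omega> j u)" for j
  proof -
    have "\<exists>g. g \<in> L2 \<Omega> \<and> has_weak_partial \<Omega> j u g" using assms unfolding H1_def by blast
    then show ?thesis unfolding weak_partial_def by (rule someI_ex)
  qed
  then show ?thesis using assms by (simp add: wgrad_def H1_def)
qed

lemma wgrad_H1: "wgrad \<Omega> u g \<Longrightarrow> u \<in> H1 \<Omega>"
  by (auto simp: wgrad_def H1_def)

text \<open>Weak derivatives are unique up to null sets, so the form does not depend on the chosen gradients.\<close>
lemma magnetic_form_eq: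
  assumes op: "open \<Omega>" and bd: "bounded \<Omega>" and u: "wgrad \<Omega> u g" and v: "wgrad \<Omega> v h"
  shows "magnetic_form B \<Omega> u v = magnetic_sesq B \<Omega> u g v h"
proof -
  let ?gu = "\<lambda>j. weak_partial \<Omega> j u" and ?gv = "\<lambda>j. weak_partial \<Omega> j v"
  have wu: "wgrad \<Omega> u ?gu" and wv: "wgrad \<Omega> v ?gv" using H1_wgrad wgrad_H1 u v by blast+
  have eq: "magnetic_partial B \<Omega> j u = magnetic_grad B ?gu u j" "magnetic_partial B \<Omega> j v = magnetic_grad B ?gv v j" for j
    by (auto simp: fun_eq_iff magnetic_partial_def magnetic_grad_def)
  have ae: "AE x in lebesgue_on \<Omega>. magnetic_grad B ?gu u j x = magnetic_grad B g u j x" "AE x in lebesgue_on \<Omega>. magnetic_grad B ?gv v j x = magnetic_grad B h v j x" for j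
    using wgrad_unique[OF op bd wu u, of j] wgrad_unique[OF op bd wv v, of j]
    by (auto simp: magnetic_grad_def elim!: eventually_mono)
  have L: "magnetic_grad B ?gu u j \<in> L2 \<Omega>" "magnetic_grad B g u j \<in> L2 \<Omega>" "magnetic_grad B ?gv v j \<in> L2 \<Omega>" "magnetic_grad B h v j \<in> L2 \<Omega>" for j
    using magnetic_grad_L2[OF bd] wu wv u v by auto
  have m: "(\<lambda>x. magnetic_grad B ?gu u j x * cnj (magnetic_grad B ?gv v j x)) \<in> borel_measurable (lebesgue_on \<Omega>)"
     "(\<lambda>x. magnetic_grad B g u j x * cnj (magnetic_grad B h v j x)) \<in> borel_measurable (lebesgue_on \<Omega>)" for j
    using L2_prod_integrable[OF L(1,3)] L2_prod_integrable[OF L(2,4)] by auto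
  have "magnetic_form B \<Omega> u v = (\<Sum>j\<in>UNIV. L2_inner \<Omega> (magnetic_grad B ?gu u j) (magnetic_grad B ?gv v j))"
    unfolding magnetic_form_def eq L2_inner_def
    by (rule Bochner_Integration.integral_sum) (rule L2_prod_integrable[OF L(1,3)])
  also have "\<dots> = (\<Sum>j\<in>UNIV. L2_inner \<Omega> (magnetic_grad B g u j) (magnetic_grad B h v j))"
  proof (rule sum.cong[OF refl])
    fix j :: 2
    show "L2_inner \<Omega> (magnetic_grad B ?gu u j) (magnetic_grad B ?gv v j) = L2_inner \<Omega> (magnetic_grad B g u j) (magnetic_grad B h v j)"
      unfolding L2_inner_def
    proof (rule integral_cong_AE[OF m])
      show "AE x in lebesgue_on \<Omega>. magnetic_grad B ?gu u j x * cnj (magnetic_grad B ?gv v j x) = magnetic_grad B g u j x * cnj (magnetic_grad B h v j x)"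
        using ae(1)[of j] ae(2)[of j] by eventually_elim simp
    qed
  qed
  finally show ?thesis by (simp add: sum_2 magnetic_sesq_def)
qed

lemma magnetic_sesq_self: "magnetic_sesq B \<Omega> u g u g = of_real (energy B \<Omega> u g)"
  by (simp add: magnetic_sesq_def energy_def L2_inner_self)

lemma energy_perturb:
  assumes bd: "bounded \<Omega>" and u: "wgrad \<Omega> u g" and v: "wgrad \<Omega> v h"
  shows "energy B \<Omega> (\<lambda>x. u x + t * v x) (\<lambda>j x. g j x + t * h j x) =
     energy B \<Omega> u g + 2 * Re (cnj t * magnetic_sesq B \<Omega> u g v h) + (cmod t)\<^sup>2 * energy B \<Omega> v h"
  using magnetic_grad_L2[OF bd u] magnetic_grad_L2[OF bd v]
  by (simp add: energy_def magnetic_grad_add[of B g "\<lambda>j x. t * h j x" u "\<lambda>x. t * v x"] magnetic_grad_cmult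
      nrm2_add L2_cmult L2_inner_cmult_right nrm2_cmult magnetic_sesq_def algebra_simps)

lemma nrm2_perturb:
  assumes "u \<in> L2 \<Omega>" "v \<in> L2 \<Omega>"
  shows "nrm2 \<Omega> (\<lambda>x. u x + t * v x) = nrm2 \<Omega> u + 2 * Re (cnj t * L2_inner \<Omega> u v) + (cmod t)\<^sup>2 * nrm2 \<Omega> v"
  using assms by (simp add: nrm2_add L2_cmult L2_inner_cmult_right nrm2_cmult)

text \<open>The first variation at a minimum: moving a little in the direction \<open>-z\<close> would make the expression negative.\<close>
lemma perturbation_zero:
  fixes z :: complex
  assumes "\<And>t. 0 \<le> 2 * Re (cnj t * z) + (cmod t)\<^sup>2 * q" "q \<ge> 0"
  shows "z = 0"
proof (rule ccontr)
  assume "z \<noteq> 0"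
  define s where "s = 1 / (q + 1)"
  have s: "s > 0" "s * q < 1" using assms(2) by (auto simp: s_def)
  have "0 \<le> 2 * Re (cnj (- of_real s * z) * z) + (cmod (- of_real s * z))\<^sup>2 * q" by (rule assms(1))
  also have "cnj (- of_real s * z) * z = - of_real (s * (cmod z)\<^sup>2)"
    using complex_norm_square[of z] by (simp add: mult.commute mult.left_commute)
  also have "2 * Re (- of_real (s * (cmod z)\<^sup>2)) + (cmod (- of_real s * z))\<^sup>2 * q = s * (cmod z)\<^sup>2 * (s * q - 2)"
    using s by (simp add: norm_mult power_mult_distrib algebra_simps power2_eq_square)
  finally have "0 \<le> s * (cmod z)\<^sup>2 * (s * q - 2)" .
  moreover have "s * (cmod z)\<^sup>2 > 0" using s \<open>z \<noteq> 0\<close> by simp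
  ultimately show False using s(2) by (simp add: zero_le_mult_iff)
qed

text \<open>The Euler equation of a minimizer of the Rayleigh quotient is the eigenvalue equation, and every eigenvalue is the Rayleigh quotient of its eigenfunction, hence not smaller.\<close>
lemma minimizer_eigenvalue:
  assumes op: "open \<Omega>" and bd: "bounded \<Omega>" and w: "wgrad \<Omega> u g" and n: "nrm2 \<Omega> u = 1"
    and min: "\<And>v h. wgrad \<Omega> v h \<Longrightarrow> energy B \<Omega> u g * nrm2 \<Omega> v \<le> energy B \<Omega> v h"
  shows "lambda1N B \<Omega> = energy B \<Omega> u g"
  unfolding lambda1N_def
proof (rule Least_equality)
  have fin: "\<Omega> \<in> lmeasurable" using bounded_open_finite_measure op bd by blast
  let ?l = "energy B \<Omega> u g"
  have uL: "u \<in> L2 \<Omega>" using w by (simp add: wgrad_def)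
  show "neumann_eigenvalue B \<Omega> ?l"
    unfolding neumann_eigenvalue_def
  proof (intro exI[of _ u] conjI)
    show "\<not> (AE x in lebesgue_on \<Omega>. u x = 0)"
    proof
      assume "AE x in lebesgue_on \<Omega>. u x = 0"
      then have "nrm2 \<Omega> u = nrm2 \<Omega> (\<lambda>x. 0)" by (intro nrm2_cong_AE uL L2_zero)
      then show False using n by (simp add: nrm2_def)
    qed
    show "magnetic_neumann B \<Omega> u (\<lambda>x. of_real ?l * u x)"
      unfolding magnetic_neumann_def
    proof (intro conjI ballI)
      show "u \<in> H1 \<Omega>" using w wgrad_H1 by blast
      show "(\<lambda>x. of_real ?l * u x) \<in> L2 \<Omega>" by (rule L2_cmult[OF uL])
      fix v assume "v \<in> H1 \<Omega>"
      define h where "h = (\<lambda>j. weak_partial \<Omega> j v)"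
      have v: "wgrad \<Omega> v h" using \<open>v \<in> H1 \<Omega>\<close> H1_wgrad by (simp add: h_def)
      then have vL: "v \<in> L2 \<Omega>" by (simp add: wgrad_def)
      have "magnetic_sesq B \<Omega> u g v h - of_real ?l * L2_inner \<Omega> u v = 0"
      proof (rule perturbation_zero)
        show "0 \<le> energy B \<Omega> v h - ?l * nrm2 \<Omega> v" using min[OF v] by simp
        fix t
        have "wgrad \<Omega> (\<lambda>x. u x + t * v x) (\<lambda>j x. g j x + t * h j x)"
          by (intro wgrad_add[OF fin w] wgrad_cmult[OF fin v])
        from min[OF this] show "0 \<le> 2 * Re (cnj t * (magnetic_sesq B \<Omega> u g v h - of_real ?l * L2_inner \<Omega> u v)) +
            (cmod t)\<^sup>2 * (energy B \<Omega> v h - ?l * nrm2 \<Omega> v)"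
          unfolding energy_perturb[OF bd w v] nrm2_perturb[OF uL vL] n
          by (simp add: algebra_simps)
      qed
      then show "magnetic_form B \<Omega> u v = L2_inner \<Omega> (\<lambda>x. of_real ?l * u x) v"
        by (simp add: magnetic_form_eq[OF op bd w v] L2_inner_cmult_left)
    qed
  qed
next
  fix \<mu> assume "neumann_eigenvalue B \<Omega> \<mu>"
  then obtain v where v: "\<not> (AE x in lebesgue_on \<Omega>. v x = 0)" "v \<in> H1 \<Omega>"
     "magnetic_form B \<Omega> v v = L2_inner \<Omega> (\<lambda>x. of_real \<mu> * v x) v"
    unfolding neumann_eigenvalue_def magnetic_neumann_def by blast
  define h where "h = (\<lambda>j. weak_partial \<Omega> j v)"
  have wv: "wgrad \<Omega> v h" using v(2) H1_wgrad by (simp add: h_def)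
  have "complex_of_real (energy B \<Omega> v h) = of_real (\<mu> * nrm2 \<Omega> v)"
    using v(3) by (simp add: magnetic_form_eq[OF op bd wv wv] magnetic_sesq_self L2_inner_cmult_left L2_inner_self)
  then have e: "energy B \<Omega> v h = \<mu> * nrm2 \<Omega> v" by (simp only: of_real_eq_iff)
  have "nrm2 \<Omega> v \<noteq> 0" using v(1) nrm2_eq_0_AE wv by (auto simp: wgrad_def)
  then have "nrm2 \<Omega> v > 0" using nrm2_nonneg[of \<Omega> v] by linarith
  then show "energy B \<Omega> u g \<le> \<mu>" using min[OF wv] unfolding e by simp
qed

definition mean :: "(real^2) set \<Rightarrow> (real^2 \<Rightarrow> complex) \<Rightarrow> complex" where
  "mean \<Omega> u = L2_inner \<Omega> u (\<lambda>x. 1) / of_real (measure lebesgue \<Omega>)"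

lemma mean_decomposition:
  assumes fin: "\<Omega> \<in> lmeasurable" and V: "measure lebesgue \<Omega> > 0" and u: "u \<in> L2 \<Omega>"
  shows "nrm2 \<Omega> (\<lambda>x. u x - c) = nrm2 \<Omega> (\<lambda>x. u x - mean \<Omega> u) + (cmod (mean \<Omega> u - c))\<^sup>2 * measure lebesgue \<Omega>"
proof -
  let ?V = "measure lebesgue \<Omega>" let ?m = "mean \<Omega> u"
  note C = L2_const(1)[OF fin]
  have d: "(\<lambda>x. u x - ?m) \<in> L2 \<Omega>" using u C by (intro L2_diff)
  have "L2_inner \<Omega> (\<lambda>x. u x + - ?m) (\<lambda>x. 1) = L2_inner \<Omega> u (\<lambda>x. 1) + L2_inner \<Omega> (\<lambda>x. - ?m * 1) (\<lambda>x. 1)"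
    using u C[of 1] C[of "- ?m"] by (subst L2_inner_add_left) auto
  also have "L2_inner \<Omega> (\<lambda>x. - ?m * 1) (\<lambda>x. 1) = - ?m * of_real ?V"
    unfolding L2_inner_cmult_left using L2_inner_self[of \<Omega> "\<lambda>x. 1"] L2_const(2)[OF fin, of 1] by simp
  finally have 0: "L2_inner \<Omega> (\<lambda>x. u x - ?m) (\<lambda>x. 1) = 0" using V by (simp add: mean_def)
  have "nrm2 \<Omega> (\<lambda>x. (u x - ?m) + (?m - c) * 1) =
    nrm2 \<Omega> (\<lambda>x. u x - ?m) + 2 * Re (L2_inner \<Omega> (\<lambda>x. u x - ?m) (\<lambda>x. (?m - c) * 1)) + nrm2 \<Omega> (\<lambda>x. (?m - c) * 1)"
    using d L2_cmult[OF C, of "?m - c" 1] by (intro nrm2_add) auto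
  also have "L2_inner \<Omega> (\<lambda>x. u x - ?m) (\<lambda>x. (?m - c) * 1) = 0"
    unfolding L2_inner_cmult_right 0 by simp
  finally show ?thesis using L2_const(2)[OF fin, of "?m - c"] by simp
qed

lemma mean_diff:
  assumes fin: "\<Omega> \<in> lmeasurable" and "u \<in> L2 \<Omega>" "v \<in> L2 \<Omega>"
  shows "mean \<Omega> (\<lambda>x. u x + (-1) * v x) = mean \<Omega> u - mean \<Omega> v"
  unfolding mean_def using assms L2_const(1)[OF fin, of 1]
  by (simp only: L2_inner_add_left[OF _ L2_cmult] L2_inner_cmult_left) (simp add: diff_divide_distrib)

text \<open>Among all constants the mean is the best approximation, so the constant in the Poincare inequality may be taken to be the mean.\<close>
lemma poincare_mean:
  assumes fin: "\<Omega> \<in> lmeasurable" and V: "measure lebesgue \<Omega> > 0" and P: "poincare \<Omega> P" and w: "wgrad \<Omega> u g"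
  shows "nrm2 \<Omega> (\<lambda>x. u x - mean \<Omega> u) \<le> P * dirichlet \<Omega> g"
    and "nrm2 \<Omega> u \<le> P * dirichlet \<Omega> g + (cmod (mean \<Omega> u))\<^sup>2 * measure lebesgue \<Omega>"
    and "(cmod (mean \<Omega> u))\<^sup>2 * measure lebesgue \<Omega> \<le> nrm2 \<Omega> u"
proof -
  have u: "u \<in> L2 \<Omega>" using w by (simp add: wgrad_def)
  obtain c where c: "nrm2 \<Omega> (\<lambda>x. u x - c) \<le> P * dirichlet \<Omega> g"
    using P w unfolding poincare_def dirichlet_def by blast
  have "0 \<le> (cmod (mean \<Omega> u - c))\<^sup>2 * measure lebesgue \<Omega>" by simp
  then show 1: "nrm2 \<Omega> (\<lambda>x. u x - mean \<Omega> u) \<le> P * dirichlet \<Omega> g"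
    using c mean_decomposition[OF fin V u, of c] by linarith
  show "nrm2 \<Omega> u \<le> P * dirichlet \<Omega> g + (cmod (mean \<Omega> u))\<^sup>2 * measure lebesgue \<Omega>"
    using 1 mean_decomposition[OF fin V u, of 0] by simp
  show "(cmod (mean \<Omega> u))\<^sup>2 * measure lebesgue \<Omega> \<le> nrm2 \<Omega> u"
    using mean_decomposition[OF fin V u, of 0] nrm2_nonneg[of \<Omega> "\<lambda>x. u x - mean \<Omega> u"] by simp
qed

lemma dirichlet_energy_bounds:
  assumes R: "R \<ge> 0" "\<And>x j. x \<in> \<Omega> \<Longrightarrow> \<bar>vec_potential x $ j\<bar> \<le> R" and bd: "bounded \<Omega>" and w: "wgrad \<Omega> u g"
  shows "dirichlet \<Omega> g \<le> 2 * energy B \<Omega> u g + 4 * (B\<^sup>2 * R\<^sup>2) * nrm2 \<Omega> u"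
    and "nrm2 \<Omega> (magnetic_grad B g u j) \<le> 2 * nrm2 \<Omega> (g j) + 2 * (B\<^sup>2 * R\<^sup>2 * nrm2 \<Omega> u)"
proof -
  have L: "u \<in> L2 \<Omega>" "g j \<in> L2 \<Omega>" for j using w by (auto simp: wgrad_def)
  note A = L2_vec_potential[OF R L(1), of B]
  have "nrm2 \<Omega> (g j) \<le> 2 * nrm2 \<Omega> (magnetic_grad B g u j) + 2 * (B\<^sup>2 * R\<^sup>2 * nrm2 \<Omega> u)" for j
  proof -
    have "nrm2 \<Omega> (g j) = nrm2 \<Omega> (\<lambda>x. (- \<i>) * g j x)" by (simp only: nrm2_cmult) simp
    also have "(\<lambda>x. (- \<i>) * g j x) = (\<lambda>x. magnetic_grad B g u j x + - (of_real (B * vec_potential x $ j) * u x))"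
      by (simp add: magnetic_grad_def)
    also have "nrm2 \<Omega> \<dots> \<le> 2 * nrm2 \<Omega> (magnetic_grad B g u j) + 2 * nrm2 \<Omega> (\<lambda>x. - (of_real (B * vec_potential x $ j) * u x))"
      by (intro nrm2_add_le magnetic_grad_L2[OF bd w] L2_uminus A)
    also have "\<dots> \<le> 2 * nrm2 \<Omega> (magnetic_grad B g u j) + 2 * (B\<^sup>2 * R\<^sup>2 * nrm2 \<Omega> u)"
      using A(2)[of j] unfolding nrm2_uminus by linarith
    finally show ?thesis .
  qed
  from this[of 1] this[of 2] show "dirichlet \<Omega> g \<le> 2 * energy B \<Omega> u g + 4 * (B\<^sup>2 * R\<^sup>2) * nrm2 \<Omega> u"
    by (simp add: dirichlet_def energy_def)
  have "nrm2 \<Omega> (magnetic_grad B g u j) \<le> 2 * nrm2 \<Omega> (\<lambda>x. - \<i> * g j x) + 2 * nrm2 \<Omega> (\<lambda>x. of_real (B * vec_potential x $ j) * u x)"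
    unfolding magnetic_grad_def[abs_def] by (intro nrm2_add_le L2_cmult L A)
  also have "nrm2 \<Omega> (\<lambda>x. - \<i> * g j x) = nrm2 \<Omega> (g j)" by (simp only: nrm2_cmult) simp
  finally show "nrm2 \<Omega> (magnetic_grad B g u j) \<le> 2 * nrm2 \<Omega> (g j) + 2 * (B\<^sup>2 * R\<^sup>2 * nrm2 \<Omega> u)"
    using A(2)[of j] by linarith
qed

text \<open>The direct method, with the smallness of \<open>B\<close> in place of a compact embedding. The parallelogram law bounds the energy of the difference of two almost minimizers by the norm of that difference times a multiple of \<open>B\<^sup>2\<close>, plus a small error. The Poincare inequality bounds that norm by the Dirichlet integral and the difference of the means, and for small \<open>B\<close> the Dirichlet integral can be absorbed.\<close>
theorem lambda1N_minimum:
  assumes op: "open \<Omega>" and bd: "bounded \<Omega>" and ne: "\<Omega> \<noteq> {}" and P: "poincare \<Omega> P"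
    and R: "R > 0" "\<And>x j. x \<in> \<Omega> \<Longrightarrow> \<bar>vec_potential x $ j\<bar> \<le> R"
    and B: "16 * (B\<^sup>2 * R\<^sup>2) * P \<le> 1"
  shows "\<exists>u g. wgrad \<Omega> u g \<and> nrm2 \<Omega> u = 1 \<and> energy B \<Omega> u g = lambda1N B \<Omega>"
    and "wgrad \<Omega> v h \<Longrightarrow> lambda1N B \<Omega> * nrm2 \<Omega> v \<le> energy B \<Omega> v h"
proof -
  have fin: "\<Omega> \<in> lmeasurable" using bounded_open_finite_measure op bd by blast
  define V where "V = measure lebesgue \<Omega>"
  have V: "V > 0" using open_bounded_measure(2)[OF op bd ne] op by (simp add: V_def measure_completion)
  have P0: "P > 0" using P by (simp add: poincare_def)
  define b where "b = B\<^sup>2 * R\<^sup>2"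
  have b: "b \<ge> 0" "16 * b * P \<le> 1" using B by (auto simp: b_def)
  define S where "S = {e. \<exists>u g. wgrad \<Omega> u g \<and> nrm2 \<Omega> u = 1 \<and> e = energy B \<Omega> u g}"
  define l where "l = Inf S"
  have Sb: "bdd_below S" by (rule bdd_belowI[of _ 0]) (auto simp: S_def energy_nonneg)
  have scale: "wgrad \<Omega> (\<lambda>x. c * v x) (\<lambda>j x. c * h j x)" "nrm2 \<Omega> (\<lambda>x. c * v x) = (cmod c)\<^sup>2 * nrm2 \<Omega> v"
     "energy B \<Omega> (\<lambda>x. c * v x) (\<lambda>j x. c * h j x) = (cmod c)\<^sup>2 * energy B \<Omega> v h" if "wgrad \<Omega> v h" for v h c
    using wgrad_cmult[OF fin that] by (auto simp: nrm2_cmult energy_def magnetic_grad_cmult algebra_simps)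
  have lower: "l * nrm2 \<Omega> v \<le> energy B \<Omega> v h" if w: "wgrad \<Omega> v h" for v h
  proof (cases "nrm2 \<Omega> v = 0")
    case True
    then show ?thesis by (simp add: energy_nonneg)
  next
    case False
    then have p: "nrm2 \<Omega> v > 0" using nrm2_nonneg[of \<Omega> v] by linarith
    define c where "c = complex_of_real (1 / sqrt (nrm2 \<Omega> v))"
    have c2: "(cmod c)\<^sup>2 = 1 / nrm2 \<Omega> v" using p by (simp add: c_def power_divide norm_divide)
    have "energy B \<Omega> (\<lambda>x. c * v x) (\<lambda>j x. c * h j x) \<in> S"
      unfolding S_def using scale[OF w, of c] c2 p by (intro CollectI exI conjI refl) auto
    then have "l \<le> (cmod c)\<^sup>2 * energy B \<Omega> v h"
      unfolding l_def using cInf_lower[OF _ Sb] scale[OF w, of c] by metis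
    then show ?thesis using p c2 by (simp add: field_simps)
  qed
  have one: "wgrad \<Omega> (\<lambda>x. 1) (\<lambda>j x. 0)" by (rule wgrad_const[OF op bd])
  have n1: "nrm2 \<Omega> (\<lambda>x. 1) = V" using L2_const(2)[OF fin, of 1] by (simp add: V_def)
  have l2b: "l \<le> 2 * b"
  proof -
    have "nrm2 \<Omega> (magnetic_grad B (\<lambda>j x. 0) (\<lambda>x. 1) j) \<le> b * V" for j
      using L2_vec_potential(2)[OF less_imp_le[OF R(1)] R(2), of \<Omega> "\<lambda>x. 1" B j] one n1
      by (simp add: magnetic_grad_def[abs_def] wgrad_def b_def)
    from this[of 1] this[of 2] have "energy B \<Omega> (\<lambda>x. 1) (\<lambda>j x. 0) \<le> 2 * b * V"
      unfolding energy_def by linarith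
    with lower[OF one] have "l * V \<le> 2 * b * V" unfolding n1 by (rule order_trans)
    then show ?thesis using V by simp
  qed
  have Sne: "S \<noteq> {}"
  proof -
    define c where "c = complex_of_real (1 / sqrt V)"
    have "(cmod c)\<^sup>2 = 1 / V" using V by (simp add: c_def power_divide norm_divide)
    then have "energy B \<Omega> (\<lambda>x. c * 1) (\<lambda>j x. c * 0) \<in> S"
      unfolding S_def using scale[OF one, of c] V n1 by (intro CollectI exI conjI refl) auto
    then show ?thesis by blast
  qed
  have "\<forall>n. \<exists>u g. wgrad \<Omega> u g \<and> nrm2 \<Omega> u = 1 \<and> energy B \<Omega> u g < l + 1 / real (Suc n)"
  proof
    fix n
    have "Inf S < l + 1 / real (Suc n)" by (simp add: l_def)
    then obtain e where "e \<in> S" "e < l + 1 / real (Suc n)" using cInf_lessD[OF Sne] by blast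
    then show "\<exists>u g. wgrad \<Omega> u g \<and> nrm2 \<Omega> u = 1 \<and> energy B \<Omega> u g < l + 1 / real (Suc n)"
      by (auto simp: S_def)
  qed
  then obtain u0 g0 where s0: "\<And>n. wgrad \<Omega> (u0 n) (g0 n)" "\<And>n. nrm2 \<Omega> (u0 n) = 1"
     "\<And>n. energy B \<Omega> (u0 n) (g0 n) < l + 1 / real (Suc n)" by metis
  have mb: "(cmod (mean \<Omega> (u0 n)))\<^sup>2 \<le> 1 / V" for n
    using poincare_mean(3)[OF fin _ P s0(1)[of n]] V s0(2)[of n] by (simp add: V_def[symmetric] field_simps)
  have "bounded (range (\<lambda>n. mean \<Omega> (u0 n)))"
    unfolding bounded_iff using real_le_rsqrt[OF mb] by blast
  then obtain c r where r: "strict_mono (r :: nat \<Rightarrow> nat)" "((\<lambda>n. mean \<Omega> (u0 n)) \<circ> r) \<longlonglongrightarrow> c"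
    using bounded_imp_convergent_subsequence by blast
  define U where "U n = u0 (r n)" for n
  define G where "G n = g0 (r n)" for n
  have w: "wgrad \<Omega> (U n) (G n)" and nU: "nrm2 \<Omega> (U n) = 1" for n using s0 by (auto simp: U_def G_def)
  have UL: "U n \<in> L2 \<Omega>" and GL: "G n j \<in> L2 \<Omega>" for n j using w[of n] by (auto simp: wgrad_def)
  have eU: "energy B \<Omega> (U n) (G n) < l + 1 / real (Suc n)" for n
  proof -
    have "n \<le> r n" using r(1) by (rule seq_suble)
    then have "1 / real (Suc (r n)) \<le> 1 / real (Suc n)" by (simp add: frac_le)
    then show ?thesis using less_le_trans[OF s0(3)[of "r n"] add_left_mono] unfolding U_def G_def by blast
  qed
  have mC: "(\<lambda>n. mean \<Omega> (U n)) \<longlonglongrightarrow> c" using r(2) by (simp add: U_def o_def)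
  \<comment> \<open>A common bound for the constants that the absorption argument below produces for the difference and for its gradient.\<close>
  define K where "K = (1 + P) * (8 + 16 * b * V) + V + 1"
  have K: "K > 0" using P0 b V by (auto simp: K_def intro!: add_nonneg_pos add_nonneg_nonneg mult_nonneg_nonneg)
  have diffs: "nrm2 \<Omega> (\<lambda>x. U m x - U n x) \<le> K * \<eta>" "nrm2 \<Omega> (\<lambda>x. G m j x - G n j x) \<le> K * \<eta>"
    if \<eta>: "1 / real (Suc m) \<le> \<eta> / 2" "1 / real (Suc n) \<le> \<eta> / 2" "(cmod (mean \<Omega> (U m) - mean \<Omega> (U n)))\<^sup>2 \<le> \<eta>" "\<eta> > 0" for m n \<eta> j
  proof -
    let ?d = "\<lambda>x. U m x + (-1) * U n x" and ?e = "\<lambda>j x. G m j x + (-1) * G n j x"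
    let ?p = "\<lambda>x. U m x + 1 * U n x" and ?q = "\<lambda>j x. G m j x + 1 * G n j x"
    have wd: "wgrad \<Omega> ?d ?e" and wp: "wgrad \<Omega> ?p ?q"
      by (intro wgrad_add[OF fin] wgrad_cmult[OF fin] w)+
    define D where "D = dirichlet \<Omega> ?e"
    define N where "N = nrm2 \<Omega> ?d"
    define \<mu> where "\<mu> = (cmod (mean \<Omega> ?d))\<^sup>2"
    have \<mu>: "\<mu> \<le> \<eta>" unfolding \<mu>_def mean_diff[OF fin UL UL] using \<eta> by simp
    \<comment> \<open>The parallelogram law, for the energy and for the norm.\<close>
    have pe: "energy B \<Omega> ?p ?q + energy B \<Omega> ?d ?e = 2 * energy B \<Omega> (U m) (G m) + 2 * energy B \<Omega> (U n) (G n)"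
      unfolding energy_perturb[OF bd w w] by simp
    have pn: "nrm2 \<Omega> ?p + nrm2 \<Omega> ?d = 4" unfolding nrm2_perturb[OF UL UL] nU by simp
    have "energy B \<Omega> ?d ?e - l * N \<le> 2 * (energy B \<Omega> (U m) (G m) - l) + 2 * (energy B \<Omega> (U n) (G n) - l)"
    proof -
      have "l * nrm2 \<Omega> ?p = l * (4 - N)" using pn by (simp add: N_def)
      then show ?thesis using lower[OF wp] pe by (simp add: algebra_simps)
    qed
    also have "\<dots> \<le> 2 * \<eta>"
    proof -
      have aux: "2 * (x - l) + 2 * (y - l) \<le> 2 * \<eta>" if "x < l + \<eta> / 2" "y < l + \<eta> / 2" for x y
        using that by argo
      show ?thesis by (rule aux[OF less_le_trans[OF eU add_left_mono[OF \<eta>(1)]] less_le_trans[OF eU add_left_mono[OF \<eta>(2)]]])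
    qed
    finally have Q: "energy B \<Omega> ?d ?e \<le> 2 * \<eta> + l * N" by linarith
    have N0: "0 \<le> N" by (simp add: N_def)
    have "l * N \<le> 2 * b * N" using l2b N0 by (rule mult_right_mono)
    moreover have "D \<le> 2 * energy B \<Omega> ?d ?e + 4 * b * N"
      unfolding D_def N_def b_def by (rule dirichlet_energy_bounds(1)[OF less_imp_le[OF R(1)] R(2) bd wd])
    ultimately have D1: "D \<le> 4 * \<eta> + 8 * (b * N)" using Q by linarith
    have N1: "N \<le> P * D + \<mu> * V"
      using poincare_mean(2)[OF fin _ P wd] V unfolding D_def N_def \<mu>_def V_def by simp
    \<comment> \<open>Since \<open>16 b P \<le> 1\<close>, the term \<open>8 b N\<close> in the bound for \<open>D\<close> costs at most half of \<open>D\<close>.\<close>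
    have "b * N \<le> b * (P * D + \<mu> * V)" using N1 b(1) by (rule mult_left_mono)
    also have "\<dots> \<le> D / 16 + b * V * \<eta>"
    proof -
      have D0: "0 \<le> D" by (simp add: D_def dirichlet_nonneg)
      have "(16 * b * P) * D \<le> 1 * D" using b(2) D0 by (rule mult_right_mono)
      moreover have "b * V * \<mu> \<le> b * V * \<eta>" using \<mu> b V by (intro mult_left_mono) auto
      ultimately show ?thesis by (simp add: algebra_simps)
    qed
    finally have D2: "D \<le> 8 * \<eta> + 16 * b * V * \<eta>" using D1 by linarith
    have bV: "0 \<le> b * V" using b V by simp
    have D3: "D \<le> (8 + 16 * b * V) * \<eta>" using D2 by (simp add: algebra_simps)
    have "P * D \<le> P * ((8 + 16 * b * V) * \<eta>)" using D3 P0 by (intro mult_left_mono) auto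
    moreover have "\<mu> * V \<le> \<eta> * V" using \<mu> V by (intro mult_right_mono) auto
    ultimately have N2: "N \<le> P * ((8 + 16 * b * V) * \<eta>) + \<eta> * V" using N1 by linarith
    have Ke: "K * \<eta> = (8 + 16 * b * V) * \<eta> + P * ((8 + 16 * b * V) * \<eta>) + \<eta> * V + \<eta>"
      by (simp add: K_def algebra_simps)
    have pos: "0 \<le> (8 + 16 * b * V) * \<eta>" "0 \<le> \<eta> * V" using \<eta>(4) bV V by auto
    have pos2: "0 \<le> P * ((8 + 16 * b * V) * \<eta>)" using pos P0 by simp
    show "nrm2 \<Omega> (\<lambda>x. U m x - U n x) \<le> K * \<eta>"
      using N2 Ke pos \<eta>(4) by (simp add: N_def)
    have "nrm2 \<Omega> (\<lambda>x. G m j x - G n j x) \<le> D"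
      unfolding D_def dirichlet_def using exhaust_2[of j] by auto
    then show "nrm2 \<Omega> (\<lambda>x. G m j x - G n j x) \<le> K * \<eta>"
      using D3 Ke pos pos2 \<eta>(4) by linarith
  qed
  have cauchy: "\<exists>M. \<forall>m\<ge>M. \<forall>n\<ge>M. nrm2 \<Omega> (\<lambda>x. U m x - U n x) < e \<and> (\<forall>j. nrm2 \<Omega> (\<lambda>x. G m j x - G n j x) < e)" if "e > 0" for e
  proof -
    define \<eta> where "\<eta> = e / (2 * K)"
    have \<eta>: "\<eta> > 0" "K * \<eta> < e" using that K by (auto simp: \<eta>_def)
    obtain M1 where M1: "1 / real (Suc M1) < \<eta> / 2" using nat_approx_posE[of "\<eta>/2"] \<eta> by auto
    have "Cauchy (\<lambda>n. mean \<Omega> (U n))" using mC by (rule LIMSEQ_imp_Cauchy)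
    then obtain M2 where M2: "\<And>m n. m \<ge> M2 \<Longrightarrow> n \<ge> M2 \<Longrightarrow> norm (mean \<Omega> (U m) - mean \<Omega> (U n)) < sqrt \<eta>"
      using CauchyD[of _ "sqrt \<eta>"] \<eta>(1) by fastforce
    have tail: "1 / real (Suc m) \<le> \<eta> / 2" if "m \<ge> M1" for m
    proof -
      have "1 / real (Suc m) \<le> 1 / real (Suc M1)" using that by (simp add: frac_le)
      also note less_imp_le[OF M1]
      finally show ?thesis .
    qed
    show ?thesis
    proof (intro exI[of _ "max M1 M2"] allI impI conjI)
      fix m n assume mn: "max M1 M2 \<le> m" "max M1 M2 \<le> n"
      have "(cmod (mean \<Omega> (U m) - mean \<Omega> (U n)))\<^sup>2 \<le> (sqrt \<eta>)\<^sup>2"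
        using M2[of m n] mn by (intro power_mono) auto
      then have c: "(cmod (mean \<Omega> (U m) - mean \<Omega> (U n)))\<^sup>2 \<le> \<eta>" using \<eta>(1) by simp
      have t: "1 / real (Suc m) \<le> \<eta> / 2" "1 / real (Suc n) \<le> \<eta> / 2" using tail mn by auto
      show "nrm2 \<Omega> (\<lambda>x. U m x - U n x) < e" using diffs(1)[OF t c \<eta>(1)] \<eta>(2) by linarith
      show "nrm2 \<Omega> (\<lambda>x. G m j x - G n j x) < e" for j using diffs(2)[OF t c \<eta>(1), of j] \<eta>(2) by linarith
    qed
  qed
  obtain u where u: "u \<in> L2 \<Omega>" "(\<lambda>n. nrm2 \<Omega> (\<lambda>x. U n x - u x)) \<longlonglongrightarrow> 0"
  proof (rule L2_complete[of \<Omega> U])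
    fix e :: real assume "e > 0"
    from cauchy[OF this] show "\<exists>N. \<forall>m\<ge>N. \<forall>n\<ge>N. nrm2 \<Omega> (\<lambda>x. U m x - U n x) < e" by blast
  qed (use fin UL in auto)
  have "\<forall>j. \<exists>h. h \<in> L2 \<Omega> \<and> (\<lambda>n. nrm2 \<Omega> (\<lambda>x. G n j x - h x)) \<longlonglongrightarrow> 0"
  proof
    fix j
    obtain h where "h \<in> L2 \<Omega>" "(\<lambda>n. nrm2 \<Omega> (\<lambda>x. G n j x - h x)) \<longlonglongrightarrow> 0"
    proof (rule L2_complete[of \<Omega> "\<lambda>n. G n j"])
      fix e :: real assume "e > 0"
      from cauchy[OF this] show "\<exists>N. \<forall>m\<ge>N. \<forall>n\<ge>N. nrm2 \<Omega> (\<lambda>x. G m j x - G n j x) < e" by blast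
    qed (use fin GL in auto)
    then show "\<exists>h. h \<in> L2 \<Omega> \<and> (\<lambda>n. nrm2 \<Omega> (\<lambda>x. G n j x - h x)) \<longlonglongrightarrow> 0" by blast
  qed
  from choice[OF this] obtain g where
    g': "\<forall>j. g j \<in> L2 \<Omega> \<and> (\<lambda>n. nrm2 \<Omega> (\<lambda>x. G n j x - g j x)) \<longlonglongrightarrow> 0" ..
  then have g: "\<And>j. g j \<in> L2 \<Omega>" "\<And>j. (\<lambda>n. nrm2 \<Omega> (\<lambda>x. G n j x - g j x)) \<longlonglongrightarrow> 0" by blast+
  have wu: "wgrad \<Omega> u g" by (rule wgrad_closed[OF fin w u g])
  have "(\<lambda>n. nrm2 \<Omega> (U n)) \<longlonglongrightarrow> nrm2 \<Omega> u" by (rule nrm2_tendsto[OF UL u])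
  then have nu: "nrm2 \<Omega> u = 1" unfolding nU by (rule LIMSEQ_unique[OF tendsto_const, symmetric])
  have mlim: "(\<lambda>n. nrm2 \<Omega> (\<lambda>x. magnetic_grad B (G n) (U n) j x - magnetic_grad B g u j x)) \<longlonglongrightarrow> 0" for j
  proof (rule tendsto_sandwich[OF _ _ tendsto_const])
    have "(\<lambda>n. 2 * nrm2 \<Omega> (\<lambda>x. G n j x - g j x) + 2 * (b * nrm2 \<Omega> (\<lambda>x. U n x - u x))) \<longlonglongrightarrow> 2 * 0 + 2 * (b * 0)"
      by (intro tendsto_intros u g)
    then show "(\<lambda>n. 2 * nrm2 \<Omega> (\<lambda>x. G n j x - g j x) + 2 * (b * nrm2 \<Omega> (\<lambda>x. U n x - u x))) \<longlonglongrightarrow> 0" by simp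
    show "\<forall>\<^sub>F n in sequentially. nrm2 \<Omega> (\<lambda>x. magnetic_grad B (G n) (U n) j x - magnetic_grad B g u j x) \<le>
       2 * nrm2 \<Omega> (\<lambda>x. G n j x - g j x) + 2 * (b * nrm2 \<Omega> (\<lambda>x. U n x - u x))"
    proof (rule always_eventually, rule allI)
      fix n
      have wd: "wgrad \<Omega> (\<lambda>x. U n x + (-1) * u x) (\<lambda>j x. G n j x + (-1) * g j x)"
        by (intro wgrad_add[OF fin] wgrad_cmult[OF fin] w wu)
      have "magnetic_grad B (\<lambda>j x. G n j x + (-1) * g j x) (\<lambda>x. U n x + (-1) * u x) j = (\<lambda>x. magnetic_grad B (G n) (U n) j x - magnetic_grad B g u j x)"
        unfolding magnetic_grad_add[of B "G n" "\<lambda>j x. (-1) * g j x" "U n" "\<lambda>x. (-1) * u x"] magnetic_grad_cmult by simp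
      then show "nrm2 \<Omega> (\<lambda>x. magnetic_grad B (G n) (U n) j x - magnetic_grad B g u j x) \<le>
       2 * nrm2 \<Omega> (\<lambda>x. G n j x - g j x) + 2 * (b * nrm2 \<Omega> (\<lambda>x. U n x - u x))"
        using dirichlet_energy_bounds(2)[OF less_imp_le[OF R(1)] R(2) bd wd, of B j] by (simp add: b_def)
    qed
  qed auto
  have elim: "(\<lambda>n. energy B \<Omega> (U n) (G n)) \<longlonglongrightarrow> energy B \<Omega> u g"
    unfolding energy_def by (intro tendsto_add nrm2_tendsto magnetic_grad_L2[OF bd w] magnetic_grad_L2[OF bd wu] mlim)
  have "energy B \<Omega> u g \<le> l"
  proof (rule LIMSEQ_le[OF elim])
    have "(\<lambda>n. l + inverse (real (Suc n))) \<longlonglongrightarrow> l + 0" by (intro tendsto_intros LIMSEQ_inverse_real_of_nat)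
    then show "(\<lambda>n. l + 1 / real (Suc n)) \<longlonglongrightarrow> l" by (simp add: inverse_eq_divide)
    show "\<exists>N. \<forall>n\<ge>N. energy B \<Omega> (U n) (G n) \<le> l + 1 / real (Suc n)" using eU less_imp_le by blast
  qed
  moreover have "l \<le> energy B \<Omega> u g" using lower[OF wu] nu by simp
  ultimately have le: "energy B \<Omega> u g = l" by simp
  have ll: "lambda1N B \<Omega> = energy B \<Omega> u g"
    by (rule minimizer_eigenvalue[OF op bd wu nu]) (use lower le in simp)
  show "\<exists>u g. wgrad \<Omega> u g \<and> nrm2 \<Omega> u = 1 \<and> energy B \<Omega> u g = lambda1N B \<Omega>"
    using wu nu ll by auto
  show "lambda1N B \<Omega> * nrm2 \<Omega> v \<le> energy B \<Omega> v h" if "wgrad \<Omega> v h"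
    using lower[OF that] ll le by simp
qed

section \<open>The lower bound on the disc\<close>

definition Apot :: "2 \<Rightarrow> real^2 \<Rightarrow> complex" where
  "Apot j x = of_real (vec_potential x $ j)"

lemma Apot_L2:
  assumes "open \<Omega>" "bounded \<Omega>"
  shows "Apot j \<in> L2 \<Omega>"
proof -
  obtain R where "R > 0" "\<And>x j. x \<in> \<Omega> \<Longrightarrow> \<bar>vec_potential x $ j\<bar> \<le> R"
    using vec_potential_bounded[OF assms(2)] by blast
  from L2_vec_potential(1)[OF less_imp_le[OF this(1)] this(2) L2_const(1)[OF bounded_open_finite_measure[OF assms], of 1], of 1 j]
  show ?thesis by (simp add: Apot_def[abs_def])
qed

lemma flat0_has_derivative:
  "((\<lambda>x::real^2. flat 0 (\<alpha> - \<beta> * (norm x)\<^sup>2)) has_derivative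
     (\<lambda>v. flat 2 (\<alpha> - \<beta> * (norm x)\<^sup>2) * ((- 2 * \<beta>) * (x \<bullet> v)))) (at x)"
proof -
  have 1: "((\<lambda>x. \<alpha> - \<beta> * (norm x)\<^sup>2) has_derivative (\<lambda>v. (- 2 * \<beta>) * (x \<bullet> v))) (at x)"
    unfolding power2_norm_eq_inner by (auto intro!: derivative_eq_intros simp: algebra_simps inner_commute)
  have 2: "(flat 0 has_derivative (\<lambda>t. flat 2 (\<alpha> - \<beta> * (norm x)\<^sup>2) * t)) (at (\<alpha> - \<beta> * (norm x)\<^sup>2))"
    using flat_has_derivative[of 0 "\<alpha> - \<beta> * (norm x)\<^sup>2"] by (simp add: has_field_derivative_def numeral_2_eq_2)
  show ?thesis using diff_chain_at[OF 1 2] by (simp add: o_def)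
qed

lemma inner_axis_real2: "x \<bullet> axis j 1 = x $ j" "axis j 1 \<bullet> x = x $ j" for x :: "real^2"
  by (simp_all add: inner_axis inner_commute)

lemma axis2_nth: "(axis 1 1 :: real^2) $ 2 = 0" "(axis 2 1 :: real^2) $ 1 = 0"
  by (simp_all add: axis_def)

text \<open>The vector potential is tangential to circles and free of divergence. Multiplied by radial cut-offs it stays free of divergence, and the cut-off fields consist of test functions on the disc; dominated convergence removes the cut-offs.\<close>
lemma disc_potential_orthogonal_gradient:
  assumes R: "R > 0" and w: "wgrad (ball 0 R) u g"
  shows "L2_inner (ball 0 R) (g 1) (Apot 1) + L2_inner (ball 0 R) (g 2) (Apot 2) = 0"
proof -
  let ?D = "ball (0::real^2) R"
  have fin: "?D \<in> lmeasurable" by (rule bounded_open_finite_measure) auto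
  have L: "u \<in> L2 ?D" "g j \<in> L2 ?D" for j using w by (auto simp: wgrad_def)
  \<comment> \<open>The argument of the cut-off tends to infinity inside the disc and is negative near the circle of radius \<open>R\<close>.\<close>
  define \<alpha> where "\<alpha> n = real (Suc n) * (R\<^sup>2 * (1 - 1 / (real n + 2)))" for n
  define \<eta> where "\<eta> n x = flat 0 (\<alpha> n - real (Suc n) * (norm (x::real^2))\<^sup>2)" for n x
  define \<eta>' where "\<eta>' n x = flat 2 (\<alpha> n - real (Suc n) * (norm (x::real^2))\<^sup>2)" for n x
  have \<eta>r: "\<eta> n \<in> bump_ring" for n
    using bump_ring.flat[of 0 "\<alpha> n" "real (Suc n)" "0::real^2"] by (simp add: \<eta>_def[abs_def])
  have \<eta>d: "(\<eta> n has_derivative (\<lambda>v. \<eta>' n x * ((- 2 * real (Suc n)) * (x \<bullet> v)))) (at x)" for n x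
    unfolding \<eta>_def[abs_def] \<eta>'_def by (rule flat0_has_derivative)
  have \<eta>0: "\<eta> n x = 0" if "(norm x)\<^sup>2 \<ge> R\<^sup>2 * (1 - 1 / (real n + 2))" for n x
  proof -
    have "real (Suc n) * (R\<^sup>2 * (1 - 1 / (real n + 2)) - (norm x)\<^sup>2) \<le> 0"
      using that by (intro mult_nonneg_nonpos) auto
    then have "\<not> \<alpha> n - real (Suc n) * (norm x)\<^sup>2 > 0"
      unfolding \<alpha>_def right_diff_distrib[symmetric] by (simp only: not_less)
    then show ?thesis by (simp add: \<eta>_def flat_def del: of_nat_Suc)
  qed
  define \<phi>1 where "\<phi>1 n x = \<eta> n x * ((x \<bullet> axis 2 1) * (- 1 / 2))" for n and x :: "real^2"
  define \<phi>2 where "\<phi>2 n x = \<eta> n x * ((x \<bullet> axis 1 1) * (1 / 2))" for n and x :: "real^2"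
  have test: "test_function ?D f" if fr: "f \<in> bump_ring" and f0: "\<And>x. \<eta> n x = 0 \<Longrightarrow> f x = 0" for f n
  proof -
    define s where "s = sqrt (1 - 1 / (real n + 2))"
    have s: "0 \<le> s" "s < 1" "s\<^sup>2 = 1 - 1 / (real n + 2)" by (auto simp: s_def)
    have "norm x \<le> R * s" if "f x \<noteq> 0" for x
    proof (rule power2_le_imp_le)
      have "\<eta> n x \<noteq> 0" using f0[of x] that by blast
      then have "(norm x)\<^sup>2 < R\<^sup>2 * (1 - 1 / (real n + 2))" using \<eta>0[of n x] by linarith
      then show "(norm x)\<^sup>2 \<le> (R * s)\<^sup>2" by (simp only: power_mult_distrib s(3))
      show "0 \<le> R * s" using R s by simp
    qed
    moreover have "R * s < R" using R s by simp
    ultimately show ?thesis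
      by (intro bump_ring_test_function[OF fr, of "cball 0 (R * s)"]) auto
  qed
  have t1: "test_function ?D (\<phi>1 n)" for n
  proof (rule test[of _ n])
    show "\<phi>1 n \<in> bump_ring" unfolding \<phi>1_def[abs_def] by (intro bump_ring.mult \<eta>r bump_ring.coord bump_ring.const)
  qed (simp add: \<phi>1_def)
  have t2: "test_function ?D (\<phi>2 n)" for n
  proof (rule test[of _ n])
    show "\<phi>2 n \<in> bump_ring" unfolding \<phi>2_def[abs_def] by (intro bump_ring.mult \<eta>r bump_ring.coord bump_ring.const)
  qed (simp add: \<phi>2_def)
  have fd1: "frechet_derivative (\<phi>1 n) (at x) (axis 1 1) = \<eta>' n x * real (Suc n) * (x $ 1) * (x $ 2)" for n x
  proof -
    have "(\<phi>1 n has_derivative (\<lambda>v. \<eta> n x * ((v \<bullet> axis 2 1) * (- 1 / 2)) + (\<eta>' n x * ((- 2 * real (Suc n)) * (x \<bullet> v))) * ((x \<bullet> axis 2 1) * (- 1 / 2)))) (at x)"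
      unfolding \<phi>1_def[abs_def]
      by (intro has_derivative_mult \<eta>d has_derivative_mult_left has_derivative_inner_left has_derivative_ident)
    then have "frechet_derivative (\<phi>1 n) (at x) = (\<lambda>v. \<eta> n x * ((v \<bullet> axis 2 1) * (- 1 / 2)) + (\<eta>' n x * ((- 2 * real (Suc n)) * (x \<bullet> v))) * ((x \<bullet> axis 2 1) * (- 1 / 2)))"
      by (rule frechet_derivative_at[symmetric])
    then show ?thesis by (simp add: inner_axis_real2 axis2_nth algebra_simps)
  qed
  have fd2: "frechet_derivative (\<phi>2 n) (at x) (axis 2 1) = - (\<eta>' n x * real (Suc n) * (x $ 1) * (x $ 2))" for n x
  proof -
    have "(\<phi>2 n has_derivative (\<lambda>v. \<eta> n x * ((v \<bullet> axis 1 1) * (1 / 2)) + (\<eta>' n x * ((- 2 * real (Suc n)) * (x \<bullet> v))) * ((x \<bullet> axis 1 1) * (1 / 2)))) (at x)"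
      unfolding \<phi>2_def[abs_def]
      by (intro has_derivative_mult \<eta>d has_derivative_mult_left has_derivative_inner_left has_derivative_ident)
    then have "frechet_derivative (\<phi>2 n) (at x) = (\<lambda>v. \<eta> n x * ((v \<bullet> axis 1 1) * (1 / 2)) + (\<eta>' n x * ((- 2 * real (Suc n)) * (x \<bullet> v))) * ((x \<bullet> axis 1 1) * (1 / 2)))"
      by (rule frechet_derivative_at[symmetric])
    then show ?thesis by (simp add: inner_axis_real2 axis2_nth algebra_simps)
  qed
  have zero: "L2_inner ?D (g 1) (\<lambda>x. of_real (\<phi>1 n x)) + L2_inner ?D (g 2) (\<lambda>x. of_real (\<phi>2 n x)) = 0" for n
  proof -
    have "L2_inner ?D u (\<lambda>x. of_real (frechet_derivative (\<phi>1 n) (at x) (axis 1 1))) = - L2_inner ?D (g 1) (\<lambda>x. of_real (\<phi>1 n x))"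
      using w t1 has_weak_partial_inner[OF fin L] by (auto simp: wgrad_def)
    moreover have "L2_inner ?D u (\<lambda>x. of_real (frechet_derivative (\<phi>2 n) (at x) (axis 2 1))) = - L2_inner ?D (g 2) (\<lambda>x. of_real (\<phi>2 n x))"
      using w t2 has_weak_partial_inner[OF fin L] by (auto simp: wgrad_def)
    moreover have "L2_inner ?D u (\<lambda>x. of_real (frechet_derivative (\<phi>2 n) (at x) (axis 2 1))) =
        - L2_inner ?D u (\<lambda>x. of_real (frechet_derivative (\<phi>1 n) (at x) (axis 1 1)))"
      unfolding fd1 fd2 L2_inner_def by simp
    ultimately show ?thesis by simp
  qed
  have \<eta>lim: "(\<lambda>n. \<eta> n x) \<longlonglongrightarrow> 1" if "norm x < R" for x
  proof -
    define d where "d = R\<^sup>2 - (norm x)\<^sup>2"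
    have d: "d > 0" using that by (simp add: d_def power_strict_mono)
    have "filterlim (\<lambda>n. real (Suc n) * d - R\<^sup>2) at_top sequentially"
    proof -
      have "filterlim (\<lambda>n. real (Suc n)) at_top sequentially"
        using filterlim_compose[OF filterlim_real_sequentially filterlim_Suc] by simp
      then have "filterlim (\<lambda>n. d * real (Suc n)) at_top sequentially"
        by (rule filterlim_tendsto_pos_mult_at_top[OF tendsto_const d])
      then have "filterlim (\<lambda>n. - R\<^sup>2 + d * real (Suc n)) at_top sequentially"
        by (rule filterlim_tendsto_add_at_top[OF tendsto_const])
      then show ?thesis by (simp add: algebra_simps)
    qed
    then have l: "filterlim (\<lambda>n. \<alpha> n - real (Suc n) * (norm x)\<^sup>2) at_top sequentially"
    proof (rule filterlim_at_top_mono, intro always_eventually allI)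
      fix n
      have "real (Suc n) * R\<^sup>2 / (real n + 2) \<le> R\<^sup>2" by (simp add: field_simps)
      then show "real (Suc n) * d - R\<^sup>2 \<le> \<alpha> n - real (Suc n) * (norm x)\<^sup>2"
        unfolding \<alpha>_def d_def by (simp add: algebra_simps)
    qed
    have "((\<lambda>t::real. exp (- (1 / t))) \<longlongrightarrow> exp (- 0)) at_top"
      by (intro tendsto_intros) (simp add: tendsto_divide_0[OF tendsto_const filterlim_at_top_imp_at_infinity[OF filterlim_ident]])
    moreover have "\<forall>\<^sub>F t in at_top. exp (- (1 / t)) = flat 0 t"
      using eventually_gt_at_top[of 0] by eventually_elim (simp add: flat_def)
    ultimately have "(flat 0 \<longlongrightarrow> 1) at_top" using Lim_transform_eventually by fastforce
    then show ?thesis unfolding \<eta>_def using l by (rule filterlim_compose)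
  qed
  have lim: "(\<lambda>n. L2_inner ?D (g j) (\<lambda>x. of_real (\<eta> n x * vec_potential x $ j))) \<longlonglongrightarrow> L2_inner ?D (g j) (Apot j)" for j
    unfolding L2_inner_def
  proof (rule integral_dominated_convergence)
    have gA: "integrable (lebesgue_on ?D) (\<lambda>x. g j x * cnj (Apot j x))"
      by (rule L2_prod_integrable[OF L(2) Apot_L2]) auto
    then show "(\<lambda>x. g j x * cnj (Apot j x)) \<in> borel_measurable (lebesgue_on ?D)" by auto
    show "integrable (lebesgue_on ?D) (\<lambda>x. norm (g j x * cnj (Apot j x)))" using gA by auto
    have c: "continuous_on UNIV (\<lambda>x. \<eta> n x * vec_potential x $ j)" for n
      by (intro continuous_intros vec_potential_continuous bump_ring_differentiable(3)[OF \<eta>r])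
    show "(\<lambda>x. g j x * cnj (of_real (\<eta> n x * vec_potential x $ j))) \<in> borel_measurable (lebesgue_on ?D)" for n
      unfolding complex_cnj_complex_of_real using continuous_measurable_on(4)[OF c] L(2)[of j]
      by (intro borel_measurable_times) (auto simp: L2_def)
    show "AE x in lebesgue_on ?D. norm (g j x * cnj (of_real (\<eta> n x * vec_potential x $ j))) \<le> norm (g j x * cnj (Apot j x))" for n
    proof (rule AE_I2)
      fix x
      have "\<bar>\<eta> n x\<bar> \<le> 1" using flat0_le_1 flat_nonneg by (simp add: \<eta>_def)
      then have "\<bar>\<eta> n x * vec_potential x $ j\<bar> \<le> \<bar>vec_potential x $ j\<bar>"
        by (simp add: abs_mult mult_left_le_one_le)
      then show "norm (g j x * cnj (of_real (\<eta> n x * vec_potential x $ j))) \<le> norm (g j x * cnj (Apot j x))"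
        unfolding norm_mult complex_mod_cnj norm_of_real Apot_def by (rule mult_left_mono) simp
    qed
    show "AE x in lebesgue_on ?D. (\<lambda>n. g j x * cnj (of_real (\<eta> n x * vec_potential x $ j))) \<longlonglongrightarrow> g j x * cnj (Apot j x)"
    proof (rule AE_I2)
      fix x assume "x \<in> space (lebesgue_on ?D)"
      then have "norm x < R" by (simp add: space_restrict_space)
      then have "(\<lambda>n. g j x * cnj (of_real (\<eta> n x * vec_potential x $ j))) \<longlonglongrightarrow> g j x * cnj (of_real (1 * vec_potential x $ j))"
        by (intro tendsto_intros \<eta>lim)
      then show "(\<lambda>n. g j x * cnj (of_real (\<eta> n x * vec_potential x $ j))) \<longlonglongrightarrow> g j x * cnj (Apot j x)"
        by (simp add: Apot_def)
    qed
  qed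
  have "\<phi>1 n x = \<eta> n x * vec_potential x $ 1" "\<phi>2 n x = \<eta> n x * vec_potential x $ 2" for n x
    by (simp_all add: \<phi>1_def \<phi>2_def vec_potential_nth inner_axis_real2)
  then have "L2_inner ?D (g 1) (\<lambda>x. of_real (\<eta> n x * vec_potential x $ 1)) + L2_inner ?D (g 2) (\<lambda>x. of_real (\<eta> n x * vec_potential x $ 2)) = 0" for n
    using zero[of n] by (simp del: of_real_mult)
  moreover have "(\<lambda>n. L2_inner ?D (g 1) (\<lambda>x. of_real (\<eta> n x * vec_potential x $ 1)) + L2_inner ?D (g 2) (\<lambda>x. of_real (\<eta> n x * vec_potential x $ 2)))
     \<longlonglongrightarrow> L2_inner ?D (g 1) (Apot 1) + L2_inner ?D (g 2) (Apot 2)"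
    by (intro tendsto_add lim)
  ultimately have "(\<lambda>n::nat. 0) \<longlonglongrightarrow> L2_inner ?D (g 1) (Apot 1) + L2_inner ?D (g 2) (Apot 2)" by (simp only:)
  then show ?thesis by (rule LIMSEQ_unique[OF _ tendsto_const])
qed

definition potential_energy :: "(real^2) set \<Rightarrow> real" where
  "potential_energy \<Omega> = nrm2 \<Omega> (Apot 1) + nrm2 \<Omega> (Apot 2)"

text \<open>Write the minimizer as its mean \<open>c\<close> plus a remainder \<open>v\<close> of size \<open>O(B)\<close>. In the energy the cross term between the gradient of \<open>u\<close> and \<open>B c A\<close> vanishes by orthogonality, the cross term between \<open>B A v\<close> and \<open>B c A\<close> is of order \<open>B\<^sup>3\<close>, and the square of \<open>B c A\<close> gives the main term.\<close>
theorem disc_lower_bound: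
  assumes R: "R > 0"
  defines "D \<equiv> ball (0::real^2) R"
  shows "\<exists>K\<ge>0. \<exists>B\<^sub>1>0. \<forall>B\<in>{0<..<B\<^sub>1}.
     B\<^sup>2 * (potential_energy D / measure lebesgue D) - K * B^3 \<le> lambda1N B D"
proof -
  have op: "open D" and bd: "bounded D" and ne: "D \<noteq> {}" using R by (auto simp: D_def)
  have fin: "D \<in> lmeasurable" by (rule bounded_open_finite_measure[OF op bd])
  define V where "V = measure lebesgue D"
  have V: "V > 0" using open_bounded_measure(2)[OF op bd ne] op by (simp add: V_def measure_completion)
  have "poincare_set D D" using op bd ne by (intro poincare_set_convex) (auto simp: D_def)
  then obtain P where P: "poincare D P" using poincare_set_imp_poincare[OF op bd] by blast
  have P0: "P > 0" using P by (simp add: poincare_def)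
  obtain \<rho> where \<rho>: "\<rho> > 0" "\<And>x j. x \<in> D \<Longrightarrow> \<bar>vec_potential x $ j\<bar> \<le> \<rho>"
    using vec_potential_bounded[OF bd] by blast
  define a where "a = potential_energy D"
  have a0: "a \<ge> 0" by (simp add: a_def potential_energy_def)
  have AL: "Apot j \<in> L2 D" for j by (rule Apot_L2[OF op bd])
  have An: "nrm2 D (Apot j) \<le> \<rho>\<^sup>2 * V" for j
    using L2_vec_potential(2)[OF less_imp_le[OF \<rho>(1)] \<rho>(2) L2_const(1)[OF fin, of 1], of 1 j] L2_const(2)[OF fin, of 1]
    by (simp add: Apot_def[abs_def] V_def)
  \<comment> \<open>The first summand accounts for \<open>\<bar>c\<bar>\<^sup>2\<close> being slightly less than \<open>1/V\<close>, the second for the cross term.\<close>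
  define K where "K = 8 * P * \<rho>\<^sup>2 * (a / V) + 4 * (\<rho>\<^sup>2 * (\<rho> * sqrt (8 * P)))"
  define B1 where "B1 = min 1 (1 / (4 * \<rho> * sqrt P))"
  show ?thesis
  proof (rule exI[of _ K], rule conjI, goal_cases)
    case 1
    show "K \<ge> 0" using P0 \<rho> a0 V by (auto simp: K_def intro!: add_nonneg_nonneg mult_nonneg_nonneg)
  next
    case 2
    show ?case
  proof (rule exI[of _ B1], rule conjI, goal_cases)
    case 1
    show "B1 > 0" using P0 \<rho> by (simp add: B1_def)
  next
    case 2
    show ?case
  proof
    fix B assume B: "B \<in> {0<..<B1}"
    then have B0: "B > 0" "B < 1" "B < 1 / (4 * \<rho> * sqrt P)" by (auto simp: B1_def)
    define b where "b = B\<^sup>2 * \<rho>\<^sup>2"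
    have b0: "b \<ge> 0" by (simp add: b_def)
    have small: "16 * (B\<^sup>2 * \<rho>\<^sup>2) * P \<le> 1"
    proof -
      have "B * (4 * \<rho> * sqrt P) \<le> 1" using B0(3) P0 \<rho>(1) by (simp add: field_simps)
      then have "(B * (4 * \<rho> * sqrt P))\<^sup>2 \<le> 1\<^sup>2" using B0 P0 \<rho>(1) by (intro power_mono) auto
      then show ?thesis using P0 by (simp add: power_mult_distrib mult_ac)
    qed
    have var1: "\<exists>u g. wgrad D u g \<and> nrm2 D u = 1 \<and> energy B D u g = lambda1N B D"
      by (rule lambda1N_minimum(1)[OF op bd ne P \<rho> small])
    have var2: "lambda1N B D * nrm2 D v \<le> energy B D v h" if "wgrad D v h" for v h
      by (rule lambda1N_minimum(2)[OF op bd ne P \<rho> small that])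
    define l where "l = lambda1N B D"
    obtain u g where w: "wgrad D u g" and n1: "nrm2 D u = 1" and e: "energy B D u g = l"
      using var1 unfolding l_def by blast
    have L: "u \<in> L2 D" "g j \<in> L2 D" for j using w by (auto simp: wgrad_def)
    have l2b: "l \<le> 2 * b"
    proof -
      have one: "wgrad D (\<lambda>x. 1) (\<lambda>j x. 0)" by (rule wgrad_const[OF op bd])
      have "nrm2 D (magnetic_grad B (\<lambda>j x. 0) (\<lambda>x. 1) j) \<le> b * V" for j
        using L2_vec_potential(2)[OF less_imp_le[OF \<rho>(1)] \<rho>(2) L2_const(1)[OF fin, of 1], of B j] L2_const(2)[OF fin, of 1]
        by (simp add: magnetic_grad_def[abs_def] b_def V_def)
      from this[of 1] this[of 2] have "energy B D (\<lambda>x. 1) (\<lambda>j x. 0) \<le> 2 * b * V" unfolding energy_def by linarith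
      then have "l * V \<le> 2 * b * V" using var2[OF one] L2_const(2)[OF fin, of 1] by (simp add: l_def V_def)
      then show ?thesis using V by simp
    qed
    have dg: "dirichlet D g \<le> 8 * b"
    proof -
      have "dirichlet D g \<le> 2 * energy B D u g + 4 * (B\<^sup>2 * \<rho>\<^sup>2) * nrm2 D u"
        by (rule dirichlet_energy_bounds(1)[OF less_imp_le[OF \<rho>(1)] \<rho>(2) bd w])
      then show ?thesis unfolding e n1 b_def[symmetric] using l2b by linarith
    qed
    define c where "c = mean D u"
    define v where "v x = u x - c" for x
    have vL: "v \<in> L2 D" unfolding v_def[abs_def] using L L2_const(1)[OF fin] by (intro L2_diff)
    have nv: "nrm2 D v \<le> 8 * P * b"
    proof -
      have "nrm2 D v \<le> P * dirichlet D g"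
        using poincare_mean(1)[OF fin _ P w] V by (simp add: v_def[abs_def] c_def V_def)
      also have "\<dots> \<le> P * (8 * b)" using dg P0 by (intro mult_left_mono) auto
      finally show ?thesis by simp
    qed
    have cV: "(cmod c)\<^sup>2 * V = 1 - nrm2 D v"
      using mean_decomposition[OF fin _ L(1), of 0] V n1 by (simp add: v_def[abs_def] c_def V_def)
    have cV1: "(cmod c)\<^sup>2 \<le> 1 / V"
    proof -
      have "(cmod c)\<^sup>2 * V \<le> 1" using cV nrm2_nonneg[of D v] by linarith
      then show ?thesis using V by (simp add: pos_le_divide_eq)
    qed
    have cV2: "(cmod c)\<^sup>2 \<ge> (1 - 8 * P * b) / V"
    proof -
      have "1 - 8 * P * b \<le> (cmod c)\<^sup>2 * V" using cV nv by linarith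
      then show ?thesis using V by (simp add: pos_divide_le_eq)
    qed
    define X where "X j x = (- \<i>) * g j x + of_real B * (Apot j x * v x)" for j x
    define Y where "Y j x = (of_real B * c) * Apot j x" for j x
    have AvL: "(\<lambda>x. Apot j x * v x) \<in> L2 D" and Avn: "nrm2 D (\<lambda>x. Apot j x * v x) \<le> \<rho>\<^sup>2 * nrm2 D v" for j
      using L2_vec_potential[OF less_imp_le[OF \<rho>(1)] \<rho>(2) vL, of 1 j] by (simp_all add: Apot_def)
    have XL: "X j \<in> L2 D" and YL: "Y j \<in> L2 D" for j
      unfolding X_def[abs_def] Y_def[abs_def] by (intro L2_add L2_cmult L AL AvL)+
    have mXY: "magnetic_grad B g u j = (\<lambda>x. X j x + Y j x)" for j
      by (auto simp: magnetic_grad_def X_def Y_def v_def Apot_def algebra_simps)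
    have lb: "nrm2 D (magnetic_grad B g u j) \<ge> 2 * Re (L2_inner D (X j) (Y j)) + B\<^sup>2 * (cmod c)\<^sup>2 * nrm2 D (Apot j)" for j
    proof -
      have "nrm2 D (magnetic_grad B g u j) = nrm2 D (X j) + 2 * Re (L2_inner D (X j) (Y j)) + nrm2 D (Y j)"
        unfolding mXY by (rule nrm2_add[OF XL YL])
      moreover have "nrm2 D (Y j) = B\<^sup>2 * (cmod c)\<^sup>2 * nrm2 D (Apot j)"
        unfolding Y_def[abs_def] nrm2_cmult by (simp add: norm_mult power_mult_distrib)
      ultimately show ?thesis using nrm2_nonneg[of D "X j"] by linarith
    qed
    define z where "z j = L2_inner D (\<lambda>x. Apot j x * v x) (Apot j)" for j
    have XY: "L2_inner D (X j) (Y j) = cnj (of_real B * c) * ((- \<i>) * L2_inner D (g j) (Apot j) + of_real B * z j)" for j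
    proof -
      have "L2_inner D (X j) (Y j) = cnj (of_real B * c) * L2_inner D (X j) (Apot j)"
        unfolding Y_def[abs_def] by (rule L2_inner_cmult_right)
      also have "L2_inner D (X j) (Apot j) = L2_inner D (\<lambda>x. (- \<i>) * g j x) (Apot j) + L2_inner D (\<lambda>x. of_real B * (Apot j x * v x)) (Apot j)"
        unfolding X_def[abs_def] by (intro L2_inner_add_left L2_cmult L AL AvL)
      finally show ?thesis unfolding L2_inner_cmult_left z_def .
    qed
    have sumXY: "L2_inner D (X 1) (Y 1) + L2_inner D (X 2) (Y 2) = cnj (of_real B * c) * (of_real B * (z 1 + z 2))"
    proof -
      have "L2_inner D (X 1) (Y 1) + L2_inner D (X 2) (Y 2) =
        cnj (of_real B * c) * ((- \<i>) * (L2_inner D (g 1) (Apot 1) + L2_inner D (g 2) (Apot 2)) + of_real B * (z 1 + z 2))"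
        unfolding XY by (simp add: algebra_simps)
      then show ?thesis using disc_potential_orthogonal_gradient[OF R w[unfolded D_def]] by (simp add: D_def)
    qed
    have zb: "cmod (z j) \<le> \<rho>\<^sup>2 * sqrt (nrm2 D v) * sqrt V" for j
    proof -
      have "(cmod (z j))\<^sup>2 \<le> nrm2 D (\<lambda>x. Apot j x * v x) * nrm2 D (Apot j)"
        unfolding z_def by (rule L2_Cauchy_Schwarz[OF AvL AL])
      also have "\<dots> \<le> (\<rho>\<^sup>2 * nrm2 D v) * (\<rho>\<^sup>2 * V)" using Avn An by (intro mult_mono) auto
      also have "\<dots> = (\<rho>\<^sup>2 * sqrt (nrm2 D v) * sqrt V)\<^sup>2"
        unfolding power_mult_distrib using V by (simp add: power2_eq_square[of "\<rho>\<^sup>2"])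
      finally have "(cmod (z j))\<^sup>2 \<le> (\<rho>\<^sup>2 * sqrt (nrm2 D v) * sqrt V)\<^sup>2" .
      moreover have "0 \<le> \<rho>\<^sup>2 * sqrt (nrm2 D v) * sqrt V"
        using V by (intro mult_nonneg_nonneg) simp_all
      ultimately show ?thesis by (rule power2_le_imp_le)
    qed
    have "cmod (cnj (of_real B * c) * (of_real B * (z 1 + z 2))) \<le> 2 * B\<^sup>2 * \<rho>\<^sup>2 * sqrt (nrm2 D v)"
    proof -
      have "cmod (z 1 + z 2) \<le> 2 * (\<rho>\<^sup>2 * sqrt (nrm2 D v) * sqrt V)"
        using norm_triangle_ineq[of "z 1" "z 2"] zb[of 1] zb[of 2] by linarith
      moreover have "cmod c \<le> 1 / sqrt V"
        using real_le_rsqrt[OF cV1] by (simp add: real_sqrt_divide)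
      ultimately have "cmod c * cmod (z 1 + z 2) \<le> (1 / sqrt V) * (2 * (\<rho>\<^sup>2 * sqrt (nrm2 D v) * sqrt V))"
        using V by (intro mult_mono) auto
      also have "\<dots> = 2 * \<rho>\<^sup>2 * sqrt (nrm2 D v)" using V by simp
      finally have "B\<^sup>2 * (cmod c * cmod (z 1 + z 2)) \<le> B\<^sup>2 * (2 * \<rho>\<^sup>2 * sqrt (nrm2 D v))" by (intro mult_left_mono) auto
      then show ?thesis using B0 by (simp add: norm_mult power2_eq_square mult_ac)
    qed
    also have "2 * B\<^sup>2 * \<rho>\<^sup>2 * sqrt (nrm2 D v) \<le> 2 * B\<^sup>2 * \<rho>\<^sup>2 * (B * (\<rho> * sqrt (8 * P)))"
    proof -
      have "sqrt (nrm2 D v) \<le> sqrt ((B * \<rho>)\<^sup>2 * (8 * P))"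
        using nv by (intro real_sqrt_le_mono) (simp add: b_def power_mult_distrib mult_ac)
      also have "\<dots> = B * (\<rho> * sqrt (8 * P))" using B0 \<rho>(1) unfolding real_sqrt_mult[of "(B * \<rho>)\<^sup>2"] by simp
      finally show ?thesis by (intro mult_left_mono) auto
    qed
    finally have cross: "- (2 * B\<^sup>2 * \<rho>\<^sup>2 * (B * (\<rho> * sqrt (8 * P)))) \<le> Re (cnj (of_real B * c) * (of_real B * (z 1 + z 2)))"
      using abs_Re_le_cmod[of "cnj (of_real B * c) * (of_real B * (z 1 + z 2))"] by linarith
    have "l \<ge> 2 * Re (L2_inner D (X 1) (Y 1) + L2_inner D (X 2) (Y 2)) + B\<^sup>2 * (cmod c)\<^sup>2 * a"
      using lb[of 1] lb[of 2] unfolding e[symmetric] energy_def a_def potential_energy_def by (simp add: algebra_simps)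
    then have 1: "l \<ge> B\<^sup>2 * (cmod c)\<^sup>2 * a - 4 * B\<^sup>2 * \<rho>\<^sup>2 * (B * (\<rho> * sqrt (8 * P)))"
      using cross unfolding sumXY by linarith
    have "B\<^sup>2 * ((1 - 8 * P * b) / V) * a \<le> B\<^sup>2 * (cmod c)\<^sup>2 * a"
      using cV2 a0 by (intro mult_right_mono mult_left_mono) auto
    moreover have "B\<^sup>2 * ((1 - 8 * P * b) / V) * a = B\<^sup>2 * (a / V) - B * (B^3 * (8 * P * \<rho>\<^sup>2 * (a / V)))"
      using V by (simp add: b_def field_simps power2_eq_square power3_eq_cube)
    moreover have "B * (B^3 * (8 * P * \<rho>\<^sup>2 * (a / V))) \<le> 1 * (B^3 * (8 * P * \<rho>\<^sup>2 * (a / V)))"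
      using B0 P0 V a0 by (intro mult_right_mono) auto
    moreover have "4 * B\<^sup>2 * \<rho>\<^sup>2 * (B * (\<rho> * sqrt (8 * P))) = B^3 * (4 * (\<rho>\<^sup>2 * (\<rho> * sqrt (8 * P))))"
      by (simp add: power2_eq_square power3_eq_cube)
    ultimately have "l \<ge> B\<^sup>2 * (a / V) - (B^3 * (8 * P * \<rho>\<^sup>2 * (a / V)) + B^3 * (4 * (\<rho>\<^sup>2 * (\<rho> * sqrt (8 * P)))))"
      using 1 by linarith
    then show "B\<^sup>2 * (potential_energy D / measure lebesgue D) - K * B ^ 3 \<le> lambda1N B D"
      by (simp add: K_def l_def a_def V_def algebra_simps)
  qed
  qed
  qed
qed

section \<open>Conformal change of variables and monomials\<close>

text \<open>The identification of the plane \<open>\<real>\<^sup>2\<close> with the complex numbers; \<open>vx\<close> is the inverse.\<close>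
definition cx :: "real^2 \<Rightarrow> complex" where "cx x = Complex (x $ 1) (x $ 2)"
definition vx :: "complex \<Rightarrow> real^2" where "vx z = (\<chi> i. if i = 1 then Re z else Im z)"

lemma vx_nth [simp]: "vx z $ 1 = Re z" "vx z $ 2 = Im z" by (simp_all add: vx_def)
lemma cx_vx [simp]: "cx (vx z) = z" by (simp add: cx_def)
lemma vx_cx [simp]: "vx (cx x) = x" by (simp add: cx_def vec_eq_iff forall_2)
lemma cx_eq_iff: "cx x = cx y \<longleftrightarrow> x = y" by (metis vx_cx)
lemma norm_cx [simp]: "norm (cx x) = norm x"
  by (simp add: cx_def cmod_def norm_vec_def L2_set_def sum_2)
lemma norm_vx [simp]: "norm (vx z) = norm z" using norm_cx[of "vx z"] by simp
lemma cx_add: "cx (x + y) = cx x + cx y" and cx_diff: "cx (x - y) = cx x - cx y"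
  and cx_scaleR: "cx (r *\<^sub>R x) = r *\<^sub>R cx x" and cx_0: "cx 0 = 0"
  by (auto simp: cx_def complex_eq_iff)
lemma vx_add: "vx (x + y) = vx x + vx y" and vx_scaleR: "vx (r *\<^sub>R x) = r *\<^sub>R vx x" and vx_diff: "vx (x - y) = vx x - vx y"
  by (auto simp: vec_eq_iff forall_2)
lemma bounded_linear_cx: "bounded_linear cx"
  by (rule bounded_linear_intro[where K=1]) (auto simp: cx_add cx_scaleR)
lemma bounded_linear_vx: "bounded_linear vx"
  by (rule bounded_linear_intro[where K=1]) (auto simp: vx_add vx_scaleR)
lemma continuous_on_cx [continuous_intros]: "continuous_on S f \<Longrightarrow> continuous_on S (\<lambda>x. cx (f x))"
  using bounded_linear.continuous_on[OF bounded_linear_cx] .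
lemma continuous_on_vx [continuous_intros]: "continuous_on S f \<Longrightarrow> continuous_on S (\<lambda>x. vx (f x))"
  using bounded_linear.continuous_on[OF bounded_linear_vx] .
lemma cx_image_iff: "z \<in> cx ` S \<longleftrightarrow> vx z \<in> S" by (metis cx_vx imageE image_eqI vx_cx)
lemma cx_image_vimage: "cx ` S = vx -` S" by (auto simp: cx_image_iff)
lemma open_cx_image: "open S \<Longrightarrow> open (cx ` S)"
  unfolding cx_image_vimage by (rule open_vimage) (auto intro: continuous_intros)
lemma cx_ball: "cx ` ball c r = ball (cx c) r"
  unfolding cx_image_vimage by (auto simp: dist_norm) (metis cx_diff cx_vx norm_cx)+

lemma det_complex_mult: "det (matrix (\<lambda>h. vx (w * cx h))) = (cmod w)\<^sup>2"
  using cmod_power2[of w] by (simp add: det_2 matrix_def cx_def axis_def power2_eq_square)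

lemma conformal_derivative:
  assumes "(f has_field_derivative w) (at (cx x))"
  shows "((\<lambda>x. vx (f (cx x))) has_derivative (\<lambda>h. vx (w * cx h))) (at x)"
proof -
  have 1: "(cx has_derivative cx) (at x)" by (rule bounded_linear_imp_has_derivative[OF bounded_linear_cx])
  have 2: "(f has_derivative (*) w) (at (cx x))" using assms by (simp add: has_field_derivative_def)
  have 3: "(vx has_derivative vx) (at (f (cx x)))" by (rule bounded_linear_imp_has_derivative[OF bounded_linear_vx])
  show ?thesis
    using diff_chain_at[OF diff_chain_at[OF 1 2]] 3 by (simp add: o_def)
qed

text \<open>The Jacobian of a holomorphic map is the square of the modulus of its complex derivative.\<close>
lemma conformal_change:
  fixes F :: "real^2 \<Rightarrow> real"
  assumes S: "open S" and f: "\<And>x. x \<in> S \<Longrightarrow> (f has_field_derivative f' (cx x)) (at (cx x))"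
    and inj: "inj_on f (cx ` S)" and T: "T = (\<lambda>x. vx (f (cx x))) ` S" and Tm: "T \<in> sets lebesgue"
    and F: "integrable (lebesgue_on T) F"
  shows "integrable (lebesgue_on S) (\<lambda>x. (cmod (f' (cx x)))\<^sup>2 * F (vx (f (cx x))))"
    and "(LINT x|lebesgue_on T. F x) = (LINT x|lebesgue_on S. (cmod (f' (cx x)))\<^sup>2 * F (vx (f (cx x))))"
proof -
  let ?g = "\<lambda>x. vx (f (cx x))"
  have Sm: "S \<in> sets lebesgue" using S by auto
  have der: "(?g has_derivative (\<lambda>h. vx (f' (cx x) * cx h))) (at x within S)" if "x \<in> S" for x
    using conformal_derivative[OF f[OF that]] by (rule has_derivative_at_withinI)
  have ig: "inj_on ?g S"
    using inj by (auto simp: inj_on_def cx_eq_iff) (metis cx_vx cx_eq_iff image_eqI)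
  have FT: "F absolutely_integrable_on T"
    using F Tm by (simp add: set_integrable_def integrable_restrict_space)
  have eqT: "(LINT x|lebesgue_on T. F x) = integral T F"
    using lebesgue_integral_eq_integral[OF F Tm] .
  have cov: "(\<lambda>x. \<bar>det (matrix (\<lambda>h. vx (f' (cx x) * cx h)))\<bar> *\<^sub>R (vec (F (?g x)) :: real^1)) absolutely_integrable_on S \<and>
     integral S (\<lambda>x. \<bar>det (matrix (\<lambda>h. vx (f' (cx x) * cx h)))\<bar> *\<^sub>R (vec (F (?g x)) :: real^1)) = vec (integral T F)
     \<longleftrightarrow> (\<lambda>x. vec (F x) :: real^1) absolutely_integrable_on (?g ` S) \<and> integral (?g ` S) (\<lambda>x. vec (F x) :: real^1) = vec (integral T F)"
    by (rule has_absolute_integral_change_of_variables[OF Sm der ig])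
  have "(\<lambda>x. vec (F x) :: real^1) absolutely_integrable_on T \<and> integral T (\<lambda>x. vec (F x) :: real^1) = vec (integral T F)"
    using FT by (simp add: absolutely_integrable_on_1_iff integral_on_1_eq vec_eq_iff)
  then have "(\<lambda>x. (cmod (f' (cx x)))\<^sup>2 * F (?g x)) absolutely_integrable_on S \<and>
     integral S (\<lambda>x. (cmod (f' (cx x)))\<^sup>2 * F (?g x)) = integral T F"
    using cov unfolding T[symmetric] det_complex_mult
    by (simp add: absolutely_integrable_on_1_iff integral_on_1_eq vec_eq_iff)
  then have a: "(\<lambda>x. (cmod (f' (cx x)))\<^sup>2 * F (?g x)) absolutely_integrable_on S"
    and b: "integral S (\<lambda>x. (cmod (f' (cx x)))\<^sup>2 * F (?g x)) = integral T F" by auto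
  show i: "integrable (lebesgue_on S) (\<lambda>x. (cmod (f' (cx x)))\<^sup>2 * F (?g x))"
    using a Sm by (simp add: set_integrable_def integrable_restrict_space)
  show "(LINT x|lebesgue_on T. F x) = (LINT x|lebesgue_on S. (cmod (f' (cx x)))\<^sup>2 * F (?g x))"
    using lebesgue_integral_eq_integral[OF i Sm] eqT b by simp
qed

lemma conformal_change_complex:
  fixes F :: "real^2 \<Rightarrow> complex"
  assumes S: "open S" and f: "\<And>x. x \<in> S \<Longrightarrow> (f has_field_derivative f' (cx x)) (at (cx x))"
    and inj: "inj_on f (cx ` S)" and T: "T = (\<lambda>x. vx (f (cx x))) ` S" and Tm: "T \<in> sets lebesgue"
    and F: "integrable (lebesgue_on T) F"
  shows "(LINT x|lebesgue_on T. F x) = (LINT x|lebesgue_on S. of_real ((cmod (f' (cx x)))\<^sup>2) * F (vx (f (cx x))))"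
proof -
  let ?G = "\<lambda>x. of_real ((cmod (f' (cx x)))\<^sup>2) * F (vx (f (cx x)))"
  note re = conformal_change[OF S f inj T Tm, of "\<lambda>x. Re (F x)"]
  note im = conformal_change[OF S f inj T Tm, of "\<lambda>x. Im (F x)"]
  have iRe: "integrable (lebesgue_on T) (\<lambda>x. Re (F x))" and iIm: "integrable (lebesgue_on T) (\<lambda>x. Im (F x))"
    using F by auto
  have "integrable (lebesgue_on S) (\<lambda>x. of_real (Re (?G x)) + \<i> * of_real (Im (?G x)))"
    using re(1)[OF _ iRe] im(1)[OF _ iIm]
    by (intro Bochner_Integration.integrable_add integrable_mult_right integrable_of_real) auto
  then have i: "integrable (lebesgue_on S) ?G" by (simp only: complex_eq[symmetric])
  show ?thesis
  proof (rule complex_eqI)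
    show "Re (LINT x|lebesgue_on T. F x) = Re (LINT x|lebesgue_on S. ?G x)"
      using re(2)[OF _ iRe] F i by (simp flip: integral_Re)
    show "Im (LINT x|lebesgue_on T. F x) = Im (LINT x|lebesgue_on S. ?G x)"
      using im(2)[OF _ iIm] F i by (simp flip: integral_Im)
  qed
qed

abbreviation udisc :: "(real^2) set" where "udisc \<equiv> ball 0 1"

lemma continuous_bounded_L2:
  assumes "open S" "bounded S" "continuous_on S f" "\<And>x. x \<in> S \<Longrightarrow> cmod (f x) \<le> K"
  shows "f \<in> L2 S"
proof -
  have m: "f \<in> borel_measurable (lebesgue_on S)"
    using assms(1,3) by (intro continuous_imp_measurable_on_sets_lebesgue) auto
  show ?thesis
    using L2_bounded_mult[OF L2_const(1)[OF bounded_open_finite_measure[OF assms(1,2)], of 1] m assms(4)] by simp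
qed

lemma continuous_L2_bounded_domain:
  assumes "open S" "bounded S" "continuous_on UNIV f"
  shows "f \<in> L2 S"
proof -
  have "compact (closure S)" using assms(2) by simp
  then have "bounded (f ` closure S)"
    using assms(3) by (intro compact_imp_bounded compact_continuous_image) (auto intro: continuous_on_subset)
  then obtain K where "\<And>x. x \<in> closure S \<Longrightarrow> cmod (f x) \<le> K" by (auto simp: bounded_iff)
  then show ?thesis
    using closure_subset[of S] assms continuous_on_subset[OF assms(3)]
    by (intro continuous_bounded_L2[of S f K]) auto
qed

definition mon :: "nat \<Rightarrow> real^2 \<Rightarrow> complex" where "mon n x = cx x ^ n"

lemma mon_continuous: "continuous_on S (mon n)"
  unfolding mon_def[abs_def] by (intro continuous_intros)

lemma mon_L2: "mon n \<in> L2 (ball c r)"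
  by (rule continuous_L2_bounded_domain) (auto intro: mon_continuous)

lemma rotation_image:
  assumes "cmod w = 1"
  shows "(\<lambda>x. vx (w * cx x)) ` ball 0 r = ball 0 r"
proof -
  have w: "w \<noteq> 0" using assms by auto
  show ?thesis
  proof (intro equalityI subsetI)
    fix y assume "y \<in> ball (0::real^2) r"
    then have "vx (cx y / w) \<in> ball 0 r" using assms by (simp add: norm_divide)
    moreover have "y = vx (w * cx (vx (cx y / w)))" using w by simp
    ultimately show "y \<in> (\<lambda>x. vx (w * cx x)) ` ball 0 r" by blast
  qed (use assms in \<open>auto simp: norm_mult\<close>)
qed

lemma scaling_image:
  assumes "s > 0"
  shows "(\<lambda>x. vx (of_real s * cx x)) ` ball 0 r = ball 0 (s * r)"
proof (intro equalityI subsetI)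
  fix y assume "y \<in> ball (0::real^2) (s * r)"
  then have "vx (cx y / of_real s) \<in> ball 0 r" using assms by (simp add: norm_divide field_simps)
  moreover have "y = vx (of_real s * cx (vx (cx y / of_real s)))" using assms by simp
  ultimately show "y \<in> (\<lambda>x. vx (of_real s * cx x)) ` ball 0 r" by blast
qed (use assms in \<open>auto simp: norm_mult\<close>)

text \<open>A rotation multiplies the inner product of two different monomials by a number other than one.\<close>
lemma mon_orthogonal:
  assumes "m \<noteq> n"
  shows "L2_inner (ball 0 r) (mon m) (mon n) = 0"
proof -
  obtain w where w: "cmod w = 1" "w ^ m * cnj (w ^ n) \<noteq> 1"
  proof -
    define \<theta> where "\<theta> = pi / (real m - real n)"
    have "cis \<theta> ^ m * cnj (cis \<theta> ^ n) = cis (real m * \<theta> + - (real n * \<theta>))"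
      by (simp only: Complex.DeMoivre cis_cnj cis_mult)
    also have "real m * \<theta> + - (real n * \<theta>) = (real m - real n) * \<theta>" by (simp add: left_diff_distrib)
    also have "\<dots> = pi" using assms by (simp add: \<theta>_def)
    finally show ?thesis using that[of "cis \<theta>"] by simp
  qed
  let ?I = "L2_inner (ball 0 r) (mon m) (mon n)"
  have "?I = (LINT x|lebesgue_on (ball 0 r). of_real ((cmod w)\<^sup>2) * (mon m (vx (w * cx x)) * cnj (mon n (vx (w * cx x)))))"
    unfolding L2_inner_def
  proof (rule conformal_change_complex[where f'="\<lambda>_. w"])
    show "integrable (lebesgue_on (ball 0 r)) (\<lambda>x. mon m x * cnj (mon n x))"
      by (rule L2_prod_integrable[OF mon_L2 mon_L2])
    show "inj_on ((*) w) (cx ` ball 0 r)" using w by (auto simp: inj_on_def)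
    show "\<And>x. ((*) w has_field_derivative w) (at (cx x))"
      by (auto intro!: derivative_eq_intros)
  qed (simp_all add: rotation_image[OF w(1)])
  also have "\<dots> = (w ^ m * cnj (w ^ n)) * ?I"
    using w by (simp add: L2_inner_def mon_def power_mult_distrib mult_ac flip: integral_mult_right_zero)
  finally have "(w ^ m * cnj (w ^ n) - 1) * ?I = 0" by (simp add: algebra_simps)
  then show ?thesis using w by simp
qed

lemma mon_scaling:
  assumes "s > 0"
  shows "nrm2 (ball 0 (s * r)) (mon n) = s ^ (2 * n + 2) * nrm2 (ball 0 r) (mon n)"
proof -
  have "nrm2 (ball 0 (s * r)) (mon n) = (LINT x|lebesgue_on (ball 0 r). (cmod (of_real s))\<^sup>2 * (cmod (mon n (vx (of_real s * cx x))))\<^sup>2)"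
    unfolding nrm2_def
  proof (rule conformal_change(2)[where f'="\<lambda>_. of_real s"])
    show "integrable (lebesgue_on (ball 0 (s * r))) (\<lambda>x. (cmod (mon n x))\<^sup>2)"
      by (rule L2_integrable_sq[OF mon_L2])
    show "inj_on ((*) (complex_of_real s)) (cx ` ball 0 r)" using assms by (auto simp: inj_on_def)
    show "\<And>x. ((*) (complex_of_real s) has_field_derivative of_real s) (at (cx x))"
      by (auto intro!: derivative_eq_intros)
  qed (simp_all add: scaling_image[OF assms])
  also have "\<dots> = (LINT x|lebesgue_on (ball 0 r). s ^ (2 * n + 2) * (cmod (mon n x))\<^sup>2)"
  proof (intro Bochner_Integration.integral_cong refl)
    fix x
    have "s ^ (2 * n + 2) = s\<^sup>2 * (s ^ n)\<^sup>2" by (simp add: power_add power_even_eq power2_eq_square[of s])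
    then show "(cmod (of_real s))\<^sup>2 * (cmod (mon n (vx (of_real s * cx x))))\<^sup>2 = s ^ (2 * n + 2) * (cmod (mon n x))\<^sup>2"
      using assms by (simp add: mon_def norm_mult norm_power power_mult_distrib)
  qed
  finally show ?thesis by (simp add: nrm2_def)
qed

lemma measure_ball2:
  assumes "r \<ge> 0" shows "measure lebesgue (ball (c::real^2) r) = pi * r\<^sup>2"
  using content_ball[OF assms, of c] by (simp add: unit_ball_vol_2 measure_completion)

text \<open>No polar coordinates are needed. With \<open>J\<close> the squared norm, the dilation law makes the integral over the ring between the radii \<open>sqrt t\<close> and 1 equal to \<open>J (1 - t\<^sup>n\<^sup>+\<^sup>1)\<close>, and on the ring the squared modulus of the monomial lies between \<open>t\<^sup>n\<close> and 1. Divide by \<open>1 - t\<close> and let \<open>t\<close> tend to 1.\<close>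
lemma mon_nrm2_unit: "nrm2 udisc (mon n) = pi / (real n + 1)"
proof -
  let ?J = "nrm2 udisc (mon n)"
  have bounds: "t ^ n * pi \<le> ?J * (\<Sum>i\<le>n. t ^ i)" "?J * (\<Sum>i\<le>n. t ^ i) \<le> pi" if t: "0 < t" "t < 1" for t
  proof -
    define s where "s = sqrt t"
    have s: "0 < s" "s < 1" "s\<^sup>2 = t" using t by (auto simp: s_def)
    let ?A = "udisc - ball 0 s"
    have sub: "ball (0::real^2) s \<subseteq> udisc" using s by auto
    have mA: "?A \<in> lmeasurable" by (intro fmeasurable.Diff) auto
    have iD: "set_integrable lebesgue udisc (\<lambda>x. (cmod (mon n x))\<^sup>2)"
      using L2_integrable_sq[OF mon_L2[of n 0 1]] by (simp add: set_integrable_def integrable_restrict_space)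
    have iA: "set_integrable lebesgue ?A (\<lambda>x. (cmod (mon n x))\<^sup>2)" and iB: "set_integrable lebesgue (ball 0 s) (\<lambda>x. (cmod (mon n x))\<^sup>2)"
      by (rule set_integrable_subset[OF iD]; use sub in auto)+
    have nr: "nrm2 S (mon n) = (LINT x:S|lebesgue. (cmod (mon n x))\<^sup>2)" if "S \<in> sets borel" for S
      using that by (simp add: nrm2_def set_lebesgue_integral_def integral_restrict_space)
    have Jsplit: "?J = (LINT x:?A|lebesgue. (cmod (mon n x))\<^sup>2) + nrm2 (ball 0 s) (mon n)"
    proof -
      have "(LINT x:?A \<union> ball 0 s|lebesgue. (cmod (mon n x))\<^sup>2) = (LINT x:?A|lebesgue. (cmod (mon n x))\<^sup>2) + (LINT x:ball 0 s|lebesgue. (cmod (mon n x))\<^sup>2)"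
        by (rule set_integral_Un[OF _ iA iB]) auto
      moreover have "?A \<union> ball 0 s = udisc" using sub by auto
      ultimately show ?thesis using nr by simp
    qed
    then have JA: "?J * (1 - t ^ (n + 1)) = (LINT x:?A|lebesgue. (cmod (mon n x))\<^sup>2)"
    proof -
      have "s ^ (2 * n + 2) = t ^ (n + 1)" using power_mult[of s 2 "n + 1"] unfolding s(3) by simp
      then have "nrm2 (ball 0 s) (mon n) = t ^ (n + 1) * ?J" using mon_scaling[OF s(1), of 1 n] by simp
      then have "?J - ?J * t ^ (n + 1) = (LINT x:?A|lebesgue. (cmod (mon n x))\<^sup>2)"
        using Jsplit by (metis add_diff_cancel_right' mult.commute)
      then show ?thesis by (simp only: right_diff_distrib mult_1_right)
    qed
    have meas: "measure lebesgue ?A = pi * (1 - t)"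
    proof -
      have "measure lebesgue ?A = measure lebesgue udisc - measure lebesgue (ball (0::real^2) s)"
        using sub by (intro measurable_measure_Diff) auto
      also have "\<dots> = pi * 1\<^sup>2 - pi * s\<^sup>2" using s by (subst (1 2) measure_ball2) auto
      finally show ?thesis using s by (simp add: right_diff_distrib)
    qed
    have ci: "set_integrable lebesgue ?A (\<lambda>x. c)" for c :: real
      using mA by (simp add: set_integrable_def integrable_mult_left_iff fmeasurable_def less_top)
    have cI: "(LINT x:?A|lebesgue. c) = c * (pi * (1 - t))" for c :: real
      using mA meas by (simp add: set_lebesgue_integral_def mult.commute)
    have val: "(cmod (mon n x))\<^sup>2 = ((norm x)\<^sup>2) ^ n" for x
      by (simp add: mon_def norm_power flip: power_mult) (simp add: mult.commute)
    have up: "(LINT x:?A|lebesgue. (cmod (mon n x))\<^sup>2) \<le> (LINT x:?A|lebesgue. 1)"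
      by (rule set_integral_mono[OF iA ci]) (auto simp: val power_le_one)
    have lo: "(LINT x:?A|lebesgue. t ^ n) \<le> (LINT x:?A|lebesgue. (cmod (mon n x))\<^sup>2)"
    proof (rule set_integral_mono[OF ci iA])
      fix x assume "x \<in> ?A"
      then have "s\<^sup>2 \<le> (norm x)\<^sup>2" using s by (intro power_mono) auto
      then show "t ^ n \<le> (cmod (mon n x))\<^sup>2" unfolding val using s t by (intro power_mono) auto
    qed
    have geo: "1 - t ^ (n + 1) = (1 - t) * (\<Sum>i\<le>n. t ^ i)"
      using sum_gp_basic[of t n] by simp
    have "(t ^ n * pi) * (1 - t) \<le> (?J * (\<Sum>i\<le>n. t ^ i)) * (1 - t)"
      using lo unfolding cI JA[symmetric] geo by (simp add: mult_ac)
    then show "t ^ n * pi \<le> ?J * (\<Sum>i\<le>n. t ^ i)" using t by (simp add: mult_le_cancel_right)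
    have "(?J * (\<Sum>i\<le>n. t ^ i)) * (1 - t) \<le> pi * (1 - t)"
      using up unfolding cI JA[symmetric] geo by (simp add: mult_ac)
    then show "?J * (\<Sum>i\<le>n. t ^ i) \<le> pi" using t by (simp add: mult_le_cancel_right)
  qed
  have ev: "\<forall>\<^sub>F t in at_left (1::real). 0 < t \<and> t < 1"
    by (auto simp: eventually_at_left_field intro!: exI[of _ 0])
  have l1: "((\<lambda>t. ?J * (\<Sum>i\<le>n. t ^ i)) \<longlongrightarrow> pi) (at_left 1)"
  proof (rule tendsto_sandwich[OF _ _ _ tendsto_const])
    have "((\<lambda>t::real. t ^ n * pi) \<longlongrightarrow> 1 ^ n * pi) (at_left 1)" by (intro tendsto_intros)
    then show "((\<lambda>t. t ^ n * pi) \<longlongrightarrow> pi) (at_left (1::real))" by simp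
  qed (use ev bounds in \<open>auto elim!: eventually_mono\<close>)
  have l2: "((\<lambda>t. ?J * (\<Sum>i\<le>n. t ^ i)) \<longlongrightarrow> ?J * (\<Sum>i\<le>n. 1 ^ i)) (at_left (1::real))" by (intro tendsto_intros)
  have "?J * (\<Sum>i\<le>n. 1 ^ i) = pi" by (rule tendsto_unique[OF _ l2 l1]) simp
  then show ?thesis by (simp add: field_simps)
qed

lemma mon_inner: "L2_inner udisc (mon m) (mon n) = (if m = n then of_real (pi / (real n + 1)) else 0)"
  using mon_orthogonal[of m n 1] L2_inner_self[of udisc "mon n"] mon_nrm2_unit[of n] by auto

lemma disc_potential_energy:
  assumes "R > 0"
  shows "potential_energy (ball 0 R) = pi * R ^ 4 / 8"
proof -
  let ?D = "ball (0::real^2) R"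
  have L: "Apot j \<in> L2 ?D" for j by (rule Apot_L2) auto
  have "potential_energy ?D = (LINT x|lebesgue_on ?D. (cmod (Apot 1 x))\<^sup>2 + (cmod (Apot 2 x))\<^sup>2)"
    unfolding potential_energy_def nrm2_def
    by (rule Bochner_Integration.integral_add[symmetric]; rule L2_integrable_sq[OF L])
  also have "\<dots> = (LINT x|lebesgue_on ?D. (1 / 4) * (cmod (mon 1 x))\<^sup>2)"
    by (intro Bochner_Integration.integral_cong refl)
      (simp add: Apot_def vec_potential_nth mon_def norm_vec2_sq power_divide)
  also have "\<dots> = (1 / 4) * nrm2 (ball 0 (R * 1)) (mon 1)" by (simp add: nrm2_def)
  also have "\<dots> = pi * R ^ 4 / 8" unfolding mon_scaling[OF assms] mon_nrm2_unit by simp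
  finally show ?thesis .
qed

section \<open>A torsion inequality for polynomials\<close>

definition disc_poly :: "(nat \<Rightarrow> complex) \<Rightarrow> nat \<Rightarrow> real^2 \<Rightarrow> complex" where
  "disc_poly a N x = (\<Sum>n\<le>N. a n * mon n x)"
definition disc_poly' :: "(nat \<Rightarrow> complex) \<Rightarrow> nat \<Rightarrow> real^2 \<Rightarrow> complex" where
  "disc_poly' a N x = (\<Sum>n\<le>N. of_nat n * a n * mon (n - 1) x)"
text \<open>The orthogonal projection of \<open>cnj p \<cdot> p'\<close> onto the holomorphic functions: on the unit disc the projection of \<open>cnj (z\<^sup>k) \<cdot> j z\<^sup>j\<^sup>-\<^sup>1\<close> is \<open>(j - k) z\<^sup>j\<^sup>-\<^sup>k\<^sup>-\<^sup>1\<close>. The truncated difference of natural numbers makes the terms with \<open>j \<le> k\<close> vanish, as it should be.\<close>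
definition bergman_proj :: "(nat \<Rightarrow> complex) \<Rightarrow> nat \<Rightarrow> real^2 \<Rightarrow> complex" where
  "bergman_proj a N x = (\<Sum>j\<le>N. \<Sum>k\<le>N. of_nat (j - k) * a j * cnj (a k) * mon (j - k - 1) x)"

lemma L2_inner_sum_left:
  assumes "\<And>i. i \<in> I \<Longrightarrow> f i \<in> L2 \<Omega>" "g \<in> L2 \<Omega>"
  shows "L2_inner \<Omega> (\<lambda>x. \<Sum>i\<in>I. f i x) g = (\<Sum>i\<in>I. L2_inner \<Omega> (f i) g)"
  using assms
proof (induction I rule: infinite_finite_induct)
  case (insert i I)
  then show ?case by (simp add: L2_inner_add_left L2_sum)
qed (simp_all add: L2_inner_def)

lemma L2_inner_sum_right:
  assumes "\<And>i. i \<in> I \<Longrightarrow> f i \<in> L2 \<Omega>" "g \<in> L2 \<Omega>"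
  shows "L2_inner \<Omega> g (\<lambda>x. \<Sum>i\<in>I. f i x) = (\<Sum>i\<in>I. L2_inner \<Omega> g (f i))"
  by (subst L2_inner_commute, subst L2_inner_sum_left[OF assms])
    (auto simp: cnj_sum intro!: sum.cong L2_inner_commute[symmetric])

lemma L2_inner_double_sums:
  assumes "\<And>p l. F p l \<in> L2 \<Omega>" "\<And>j k. G j k \<in> L2 \<Omega>"
  shows "L2_inner \<Omega> (\<lambda>x. \<Sum>p\<in>I. \<Sum>l\<in>J. c p l * F p l x) (\<lambda>x. \<Sum>j\<in>K. \<Sum>k\<in>M. d j k * G j k x) =
    (\<Sum>p\<in>I. \<Sum>l\<in>J. \<Sum>j\<in>K. \<Sum>k\<in>M. c p l * (cnj (d j k) * L2_inner \<Omega> (F p l) (G j k)))"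
  using assms
  by (simp add: L2_inner_sum_left L2_inner_sum_right L2_sum L2_cmult L2_inner_cmult_left L2_inner_cmult_right sum_distrib_left)

lemma mon_mult: "mon m x * mon n x = mon (m + n) x" by (simp add: mon_def power_add)

lemma mixed_inner:
  "L2_inner udisc (\<lambda>x. cnj (mon k x) * mon m x) (mon n) = (if m = n + k then of_real (pi / (real m + 1)) else 0)"
proof -
  have "L2_inner udisc (\<lambda>x. cnj (mon k x) * mon m x) (mon n) = L2_inner udisc (mon m) (mon (n + k))"
    unfolding L2_inner_def by (intro Bochner_Integration.integral_cong refl) (simp add: mon_def power_add mult_ac)
  then show ?thesis by (simp add: mon_inner)
qed

lemma cnj_mon_L2: "(\<lambda>x. cnj (mon k x) * mon m x) \<in> L2 udisc"
  by (rule continuous_L2_bounded_domain) (auto intro!: continuous_intros mon_continuous)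

lemma disc_poly_continuous: "continuous_on S (disc_poly a N)" "continuous_on S (disc_poly' a N)" "continuous_on S (bergman_proj a N)"
  unfolding disc_poly_def[abs_def] disc_poly'_def[abs_def] bergman_proj_def[abs_def] by (intro continuous_intros mon_continuous)+

lemma disc_poly_L2: "disc_poly a N \<in> L2 udisc" "disc_poly' a N \<in> L2 udisc" "bergman_proj a N \<in> L2 udisc" "(\<lambda>x. cnj (disc_poly a N x) * disc_poly' a N x) \<in> L2 udisc"
  "(\<lambda>x. disc_poly a N x * disc_poly' a N x) \<in> L2 udisc"
  by (rule continuous_L2_bounded_domain; (intro continuous_intros disc_poly_continuous)?; simp)+

definition quartic :: "(nat \<Rightarrow> complex) \<Rightarrow> nat \<Rightarrow> nat \<Rightarrow> nat \<Rightarrow> nat \<Rightarrow> complex" where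
  "quartic a p l j k = a p * a l * cnj (a j) * cnj (a k)"

text \<open>All squared norms below are sums of this shape, because monomials of different degrees are orthogonal.\<close>
definition quartic_sum :: "(nat \<Rightarrow> complex) \<Rightarrow> nat \<Rightarrow> (nat \<Rightarrow> nat \<Rightarrow> nat \<Rightarrow> nat \<Rightarrow> nat) \<Rightarrow> complex" where
  "quartic_sum a N F = (\<Sum>p\<le>N. \<Sum>l\<le>N. \<Sum>j\<le>N. \<Sum>k\<le>N. if p + l = j + k then of_nat (F p l j k) * quartic a p l j k else 0)"

lemma quartic_sum_add: "quartic_sum a N (\<lambda>p l j k. F p l j k + G p l j k) = quartic_sum a N F + quartic_sum a N G"
  unfolding quartic_sum_def sum.distrib[symmetric] by (intro sum.cong refl) (auto simp: algebra_simps)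

lemma quartic_sum_cmult: "quartic_sum a N (\<lambda>p l j k. c * F p l j k) = of_nat c * quartic_sum a N F"
  unfolding quartic_sum_def sum_distrib_left by (intro sum.cong refl) (auto simp: algebra_simps)

lemma quartic_sum_cong: "(\<And>p l j k. p \<le> N \<Longrightarrow> l \<le> N \<Longrightarrow> j \<le> N \<Longrightarrow> k \<le> N \<Longrightarrow> p + l = j + k \<Longrightarrow> F p l j k = G p l j k) \<Longrightarrow> quartic_sum a N F = quartic_sum a N G"
  unfolding quartic_sum_def by (intro sum.cong refl) auto

lemma quartic_sum_swap1: "quartic_sum a N (\<lambda>p l j k. F l p j k) = quartic_sum a N F"
  unfolding quartic_sum_def by (subst sum.swap) (intro sum.cong refl, auto simp: quartic_def add.commute mult_ac)

lemma quartic_sum_swap2: "quartic_sum a N (\<lambda>p l j k. F p l k j) = quartic_sum a N F"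
  unfolding quartic_sum_def
proof (rule sum.cong[OF refl], rule sum.cong[OF refl])
  fix p l
  show "(\<Sum>j\<le>N. \<Sum>k\<le>N. if p + l = j + k then of_nat (F p l k j) * quartic a p l j k else 0) =
        (\<Sum>j\<le>N. \<Sum>k\<le>N. if p + l = j + k then of_nat (F p l j k) * quartic a p l j k else 0)"
    by (subst sum.swap) (intro sum.cong refl, auto simp: quartic_def add.commute mult_ac)
qed

text \<open>Under \<open>p + l = j + k\<close> the four truncated differences of an upper and a lower index add up to \<open>p + l - 2 min(p, l, j, k)\<close>, and each of them contributes the same quartic sum by symmetry.\<close>
lemma quartic_sum_min: "4 * quartic_sum a N (\<lambda>p l j k. j - l) + 2 * quartic_sum a N (\<lambda>p l j k. min (min p l) (min j k)) = quartic_sum a N (\<lambda>p l j k. p + l)"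
proof -
  have "4 * quartic_sum a N (\<lambda>p l j k. j - l) = quartic_sum a N (\<lambda>p l j k. j - l) + quartic_sum a N (\<lambda>p l j k. j - p) + (quartic_sum a N (\<lambda>p l j k. k - l) + quartic_sum a N (\<lambda>p l j k. k - p))"
    using quartic_sum_swap1[of a N "\<lambda>p l j k. j - l"] quartic_sum_swap2[of a N "\<lambda>p l j k. j - l"] quartic_sum_swap2[of a N "\<lambda>p l j k. j - p"] by simp
  also have "\<dots> = quartic_sum a N (\<lambda>p l j k. (j - l) + (j - p) + ((k - l) + (k - p)))" by (simp only: quartic_sum_add)
  finally have "4 * quartic_sum a N (\<lambda>p l j k. j - l) + 2 * quartic_sum a N (\<lambda>p l j k. min (min p l) (min j k)) =
     quartic_sum a N (\<lambda>p l j k. (j - l) + (j - p) + ((k - l) + (k - p)) + 2 * min (min p l) (min j k))"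
    using quartic_sum_cmult[of a N 2 "\<lambda>p l j k. min (min p l) (min j k)"] by (simp only: quartic_sum_add of_nat_numeral)
  also have "\<dots> = quartic_sum a N (\<lambda>p l j k. p + l)" by (rule quartic_sum_cong) linarith
  finally show ?thesis .
qed

lemma inner_cnj_disc_poly:
  "L2_inner udisc (\<lambda>x. cnj (disc_poly a N x) * disc_poly' a N x) (bergman_proj a N) = of_real pi * quartic_sum a N (\<lambda>p l j k. j - l)"
proof -
  have e: "(\<lambda>x. cnj (disc_poly a N x) * disc_poly' a N x) = (\<lambda>x. \<Sum>k\<le>N. \<Sum>p\<le>N. (cnj (a k) * of_nat p * a p) * (cnj (mon k x) * mon (p - 1) x))"
    by (simp add: fun_eq_iff disc_poly_def disc_poly'_def sum_product cnj_sum mult_ac)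
  have "L2_inner udisc (\<lambda>x. cnj (disc_poly a N x) * disc_poly' a N x) (bergman_proj a N) =
    (\<Sum>k\<le>N. \<Sum>p\<le>N. \<Sum>j\<le>N. \<Sum>l\<le>N. (cnj (a k) * of_nat p * a p) * (cnj (of_nat (j - l) * a j * cnj (a l)) * L2_inner udisc (\<lambda>x. cnj (mon k x) * mon (p - 1) x) (mon (j - l - 1))))"
    unfolding e bergman_proj_def[abs_def]
    by (simp add: L2_inner_sum_left L2_inner_sum_right L2_sum L2_cmult cnj_mon_L2 mon_L2 L2_inner_cmult_left L2_inner_cmult_right
        mult.assoc sum_distrib_left)
  also have "\<dots> = (\<Sum>k\<le>N. \<Sum>p\<le>N. \<Sum>j\<le>N. \<Sum>l\<le>N. of_real pi * (if p + l = j + k then of_nat (j - l) * quartic a p l j k else 0))"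
  proof (intro sum.cong refl)
    fix k p j l
    show "(cnj (a k) * of_nat p * a p) * (cnj (of_nat (j - l) * a j * cnj (a l)) * L2_inner udisc (\<lambda>x. cnj (mon k x) * mon (p - 1) x) (mon (j - l - 1))) =
      of_real pi * (if p + l = j + k then of_nat (j - l) * quartic a p l j k else 0)"
    proof (cases "j > l \<and> p > 0")
      case True
      then have iff: "(p - 1 = (j - l - 1) + k) = (p + l = j + k)" by auto
      have "real (p - 1) + 1 = real p" using True by simp
      then have v: "L2_inner udisc (\<lambda>x. cnj (mon k x) * mon (p - 1) x) (mon (j - l - 1)) = (if p + l = j + k then of_real (pi / real p) else 0)"
        unfolding mixed_inner iff by simp
      show ?thesis unfolding v using True by (auto simp: quartic_def mult_ac)
    qed (cases "j > l"; auto)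
  qed
  also have "\<dots> = of_real pi * quartic_sum a N (\<lambda>p l j k. j - l)"
  proof -
    have "(\<Sum>k\<le>N. \<Sum>p\<le>N. \<Sum>j\<le>N. \<Sum>l\<le>N. X k p j l) = (\<Sum>p\<le>N. \<Sum>l\<le>N. \<Sum>j\<le>N. \<Sum>k\<le>N. X k p j l)" for X :: "nat \<Rightarrow> nat \<Rightarrow> nat \<Rightarrow> nat \<Rightarrow> complex"
    proof -
      have "(\<Sum>k\<le>N. \<Sum>p\<le>N. \<Sum>j\<le>N. \<Sum>l\<le>N. X k p j l) = (\<Sum>p\<le>N. \<Sum>k\<le>N. \<Sum>j\<le>N. \<Sum>l\<le>N. X k p j l)" by (rule sum.swap)
      also have "\<dots> = (\<Sum>p\<le>N. \<Sum>k\<le>N. \<Sum>l\<le>N. \<Sum>j\<le>N. X k p j l)" by (rule sum.cong[OF refl], rule sum.cong[OF refl], rule sum.swap)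
      also have "\<dots> = (\<Sum>p\<le>N. \<Sum>l\<le>N. \<Sum>k\<le>N. \<Sum>j\<le>N. X k p j l)" by (rule sum.cong[OF refl], rule sum.swap)
      also have "\<dots> = (\<Sum>p\<le>N. \<Sum>l\<le>N. \<Sum>j\<le>N. \<Sum>k\<le>N. X k p j l)" by (rule sum.cong[OF refl], rule sum.cong[OF refl], rule sum.swap)
      finally show ?thesis .
    qed
    then show ?thesis unfolding quartic_sum_def by (simp add: sum_distrib_left)
  qed
  finally show ?thesis .
qed

lemma nrm2_bergman_proj: "of_real (nrm2 udisc (bergman_proj a N)) = of_real pi * quartic_sum a N (\<lambda>p l j k. j - l)"
proof -
  have "of_real (nrm2 udisc (bergman_proj a N)) = L2_inner udisc (bergman_proj a N) (bergman_proj a N)" by (simp add: L2_inner_self)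
  also have "\<dots> = (\<Sum>p\<le>N. \<Sum>k\<le>N. \<Sum>j\<le>N. \<Sum>l\<le>N. (of_nat (p - k) * a p * cnj (a k)) * (cnj (of_nat (j - l) * a j * cnj (a l)) * L2_inner udisc (mon (p - k - 1)) (mon (j - l - 1))))"
    unfolding bergman_proj_def[abs_def]
    by (simp add: L2_inner_sum_left L2_inner_sum_right L2_sum L2_cmult mon_L2 L2_inner_cmult_left L2_inner_cmult_right
        mult.assoc sum_distrib_left)
  also have "\<dots> = (\<Sum>p\<le>N. \<Sum>k\<le>N. \<Sum>j\<le>N. \<Sum>l\<le>N. of_real pi * (if p + l = j + k then of_nat (j - l) * quartic a p l j k else 0))"
  proof (intro sum.cong refl)
    fix k p j l
    show "(of_nat (p - k) * a p * cnj (a k)) * (cnj (of_nat (j - l) * a j * cnj (a l)) * L2_inner udisc (mon (p - k - 1)) (mon (j - l - 1))) =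
      of_real pi * (if p + l = j + k then of_nat (j - l) * quartic a p l j k else 0)"
    proof (cases "j > l \<and> p > k")
      case True
      then have iff: "(p - k - 1 = j - l - 1) = (p + l = j + k)" by auto
      have "real (j - l - 1) + 1 = real (j - l)" using True by simp
      then have v: "L2_inner udisc (mon (p - k - 1)) (mon (j - l - 1)) = (if p + l = j + k then of_real (pi / real (j - l)) else 0)"
        unfolding mon_inner iff by simp
      have "p - k = j - l" if "p + l = j + k" using that True by auto
      then show ?thesis unfolding v using True by (auto simp: quartic_def mult_ac simp del: of_nat_diff)
    qed (cases "j > l"; auto)
  qed
  also have "\<dots> = of_real pi * quartic_sum a N (\<lambda>p l j k. j - l)"
  proof -
    have "(\<Sum>p\<le>N. \<Sum>k\<le>N. \<Sum>j\<le>N. \<Sum>l\<le>N. X k p j l) = (\<Sum>p\<le>N. \<Sum>l\<le>N. \<Sum>j\<le>N. \<Sum>k\<le>N. X k p j l)" for X :: "nat \<Rightarrow> nat \<Rightarrow> nat \<Rightarrow> nat \<Rightarrow> complex"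
    proof -
      have "(\<Sum>p\<le>N. \<Sum>k\<le>N. \<Sum>j\<le>N. \<Sum>l\<le>N. X k p j l) = (\<Sum>p\<le>N. \<Sum>k\<le>N. \<Sum>l\<le>N. \<Sum>j\<le>N. X k p j l)" by (rule sum.cong[OF refl], rule sum.cong[OF refl], rule sum.swap)
      also have "\<dots> = (\<Sum>p\<le>N. \<Sum>l\<le>N. \<Sum>k\<le>N. \<Sum>j\<le>N. X k p j l)" by (rule sum.cong[OF refl], rule sum.swap)
      also have "\<dots> = (\<Sum>p\<le>N. \<Sum>l\<le>N. \<Sum>j\<le>N. \<Sum>k\<le>N. X k p j l)" by (rule sum.cong[OF refl], rule sum.cong[OF refl], rule sum.swap)
      finally show ?thesis .
    qed
    then show ?thesis unfolding quartic_sum_def by (simp add: sum_distrib_left)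
  qed
  finally show ?thesis .
qed

lemma nrm2_cnj_disc_poly: "of_real (nrm2 udisc (\<lambda>x. cnj (disc_poly a N x) * disc_poly' a N x)) = of_real (pi / 4) * quartic_sum a N (\<lambda>p l j k. p + l)"
proof -
  have half: "disc_poly a N x * disc_poly' a N x = (\<Sum>p\<le>N. \<Sum>l\<le>N. (of_nat (p + l) / 2 * a p * a l) * mon (p + l - 1) x)" for x
  proof -
    have 1: "disc_poly a N x * disc_poly' a N x = (\<Sum>p\<le>N. \<Sum>l\<le>N. (of_nat l * a p * a l) * mon (p + l - 1) x)"
      unfolding disc_poly_def disc_poly'_def sum_product
    proof (intro sum.cong refl)
      fix p l
      show "(a p * mon p x) * (of_nat l * a l * mon (l - 1) x) = (of_nat l * a p * a l) * mon (p + l - 1) x"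
        using mon_mult[of p x "l - 1"] by (cases "l = 0") (auto simp: mult_ac)
    qed
    then have 2: "disc_poly a N x * disc_poly' a N x = (\<Sum>p\<le>N. \<Sum>l\<le>N. (of_nat p * a p * a l) * mon (p + l - 1) x)"
      by (subst sum.swap) (simp add: add.commute mult_ac)
    have "2 * (disc_poly a N x * disc_poly' a N x) = disc_poly a N x * disc_poly' a N x + disc_poly a N x * disc_poly' a N x" by simp
    also have "\<dots> = (\<Sum>p\<le>N. \<Sum>l\<le>N. (of_nat l * a p * a l) * mon (p + l - 1) x) + (\<Sum>p\<le>N. \<Sum>l\<le>N. (of_nat p * a p * a l) * mon (p + l - 1) x)"
      by (subst 1, subst 2) simp
    also have "\<dots> = (\<Sum>p\<le>N. \<Sum>l\<le>N. 2 * ((of_nat (p + l) / 2 * a p * a l) * mon (p + l - 1) x))"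
      unfolding sum.distrib[symmetric] by (intro sum.cong refl) (simp add: field_simps)
    also have "\<dots> = 2 * (\<Sum>p\<le>N. \<Sum>l\<le>N. (of_nat (p + l) / 2 * a p * a l) * mon (p + l - 1) x)"
      by (simp add: sum_distrib_left)
    finally show ?thesis by simp
  qed
  have "nrm2 udisc (\<lambda>x. cnj (disc_poly a N x) * disc_poly' a N x) = nrm2 udisc (\<lambda>x. disc_poly a N x * disc_poly' a N x)"
    by (simp add: nrm2_def norm_mult)
  then have "of_real (nrm2 udisc (\<lambda>x. cnj (disc_poly a N x) * disc_poly' a N x)) = L2_inner udisc (\<lambda>x. disc_poly a N x * disc_poly' a N x) (\<lambda>x. disc_poly a N x * disc_poly' a N x)"
    by (simp add: L2_inner_self)
  also have "\<dots> = (\<Sum>p\<le>N. \<Sum>l\<le>N. \<Sum>j\<le>N. \<Sum>k\<le>N. (of_nat (p + l) / 2 * a p * a l) * (cnj (of_nat (j + k) / 2 * a j * a k) * L2_inner udisc (mon (p + l - 1)) (mon (j + k - 1))))"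
    unfolding half by (rule L2_inner_double_sums) (rule mon_L2)+
  also have "\<dots> = (\<Sum>p\<le>N. \<Sum>l\<le>N. \<Sum>j\<le>N. \<Sum>k\<le>N. of_real (pi / 4) * (if p + l = j + k then of_nat (p + l) * quartic a p l j k else 0))"
  proof (intro sum.cong refl)
    fix k p j l
    show "(of_nat (p + l) / 2 * a p * a l) * (cnj (of_nat (j + k) / 2 * a j * a k) * L2_inner udisc (mon (p + l - 1)) (mon (j + k - 1))) =
      of_real (pi / 4) * (if p + l = j + k then of_nat (p + l) * quartic a p l j k else 0)"
    proof (cases "p + l > 0 \<and> j + k > 0")
      case True
      then have iff: "(p + l - 1 = j + k - 1) = (p + l = j + k)" by auto
      have "j + k - 1 + 1 = j + k" using True by auto
      then have "real (j + k - 1) + 1 = real (j + k)" by (metis of_nat_1 of_nat_add)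
      then have v: "L2_inner udisc (mon (p + l - 1)) (mon (j + k - 1)) = (if p + l = j + k then of_real (pi / real (j + k)) else 0)"
        unfolding mon_inner iff by simp
      show ?thesis
      proof (cases "p + l = j + k")
        case eq: True
        define n where "n = j + k"
        have n: "n > 0" using True by (simp add: n_def)
        have pln: "p + l = n" using eq by (simp add: n_def)
        have "L2_inner udisc (mon (n - 1)) (mon (n - 1)) = of_real (pi / real n)"
          using v unfolding pln n_def[symmetric] by simp
        then show ?thesis unfolding pln n_def[symmetric] quartic_def using n by (simp add: field_simps)
      qed (use v in simp)
    qed auto
  qed
  also have "\<dots> = of_real (pi / 4) * quartic_sum a N (\<lambda>p l j k. p + l)"
    unfolding quartic_sum_def by (simp add: sum_distrib_left)
  finally show ?thesis .
qed

text \<open>Pythagoras: the squared distance to the projection is the difference of the squared norms.\<close>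
lemma bergman_defect:
  "of_real (nrm2 udisc (\<lambda>x. cnj (disc_poly a N x) * disc_poly' a N x - bergman_proj a N x)) = of_real (pi / 2) * quartic_sum a N (\<lambda>p l j k. min (min p l) (min j k))"
proof -
  let ?f = "\<lambda>x. cnj (disc_poly a N x) * disc_poly' a N x" and ?q = "bergman_proj a N"
  define S where "S = nrm2 udisc ?q"
  have "nrm2 udisc (\<lambda>x. ?f x + (-1) * ?q x) = nrm2 udisc ?f + 2 * Re (L2_inner udisc ?f (\<lambda>x. (-1) * ?q x)) + nrm2 udisc (\<lambda>x. (-1) * ?q x)"
    by (intro nrm2_add L2_cmult disc_poly_L2)
  also have "L2_inner udisc ?f (\<lambda>x. (-1) * ?q x) = - of_real S"
    unfolding L2_inner_cmult_right inner_cnj_disc_poly S_def nrm2_bergman_proj by simp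
  also have "nrm2 udisc (\<lambda>x. (-1) * ?q x) = S" by (simp only: nrm2_cmult S_def) simp
  finally have "nrm2 udisc (\<lambda>x. ?f x - ?q x) = nrm2 udisc ?f - S" by simp
  then have "complex_of_real (nrm2 udisc (\<lambda>x. ?f x - ?q x)) = of_real (nrm2 udisc ?f) - of_real S" by simp
  also have "\<dots> = of_real (pi / 4) * quartic_sum a N (\<lambda>p l j k. p + l) - of_real pi * quartic_sum a N (\<lambda>p l j k. j - l)"
    unfolding S_def nrm2_bergman_proj nrm2_cnj_disc_poly ..
  also have "\<dots> = of_real (pi / 2) * quartic_sum a N (\<lambda>p l j k. min (min p l) (min j k))"
    unfolding quartic_sum_min[symmetric] by (simp add: algebra_simps)
  finally show ?thesis .
qed

lemma nrm2_disc_poly': "nrm2 udisc (disc_poly' a N) = pi * (\<Sum>n\<le>N. real n * (cmod (a n))\<^sup>2)"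
proof -
  have "of_real (nrm2 udisc (disc_poly' a N)) = L2_inner udisc (disc_poly' a N) (disc_poly' a N)" by (simp add: L2_inner_self)
  also have "\<dots> = (\<Sum>p\<le>N. \<Sum>j\<le>N. (of_nat p * a p) * (cnj (of_nat j * a j) * L2_inner udisc (mon (p - 1)) (mon (j - 1))))"
    unfolding disc_poly'_def[abs_def]
    by (simp add: L2_inner_sum_left L2_inner_sum_right L2_sum L2_cmult mon_L2 L2_inner_cmult_left L2_inner_cmult_right
        mult.assoc sum_distrib_left)
  also have "\<dots> = (\<Sum>p\<le>N. \<Sum>j\<le>N. if j = p then of_real (pi * (real p * (cmod (a p))\<^sup>2)) else 0)"
  proof (intro sum.cong refl)
    fix p j
    show "(of_nat p * a p) * (cnj (of_nat j * a j) * L2_inner udisc (mon (p - 1)) (mon (j - 1))) = (if j = p then of_real (pi * (real p * (cmod (a p))\<^sup>2)) else 0)"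
    proof (cases "p > 0 \<and> j > 0")
      case True
      then have iff: "(p - 1 = j - 1) = (j = p)" by auto
      have "real (j - 1) + 1 = real j" using True by simp
      then have v: "L2_inner udisc (mon (p - 1)) (mon (j - 1)) = (if j = p then of_real (pi / real j) else 0)"
        unfolding mon_inner iff by simp
      show ?thesis unfolding v using True complex_norm_square[of "a p"] by (auto simp: field_simps)
    qed auto
  qed
  also have "\<dots> = of_real (pi * (\<Sum>n\<le>N. real n * (cmod (a n))\<^sup>2))" by (simp add: sum_distrib_left)
  finally show ?thesis by (simp only: of_real_eq_iff)
qed

definition index_square :: "nat \<Rightarrow> (nat \<times> nat) set" where "index_square N = {..N} \<times> {..N}"
definition diag :: "nat \<Rightarrow> nat \<Rightarrow> nat \<Rightarrow> (nat \<times> nat) set" where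
  "diag N s n = {x \<in> index_square N. s \<le> fst x \<and> s \<le> snd x \<and> fst x + snd x = n}"

lemma finite_index_square [simp]: "finite (index_square N)" "finite (diag N s n)" by (auto simp: index_square_def diag_def)

definition diag_sum :: "(nat \<Rightarrow> complex) \<Rightarrow> nat \<Rightarrow> nat \<Rightarrow> nat \<Rightarrow> complex" where
  "diag_sum a N s n = (\<Sum>x\<in>diag N s n. a (fst x) * a (snd x))"

lemma pair_sum: "(\<Sum>s\<in>A. \<Sum>n\<in>B. f s n) = (\<Sum>z\<in>A \<times> B. f (fst z) (snd z))"
  by (simp add: sum.cartesian_product split_beta)

lemma quartic_sum_pairs: "quartic_sum a N F = (\<Sum>x\<in>index_square N. \<Sum>y\<in>index_square N. if fst x + snd x = fst y + snd y
    then of_nat (F (fst x) (snd x) (fst y) (snd y)) * ((a (fst x) * a (snd x)) * cnj (a (fst y) * a (snd y))) else 0)"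
proof -
  have pairs: "(\<Sum>p\<le>N. \<Sum>l\<le>N. f p l) = (\<Sum>x\<in>index_square N. f (fst x) (snd x))" for f :: "nat \<Rightarrow> nat \<Rightarrow> complex"
    unfolding index_square_def by (simp add: sum.cartesian_product split_beta)
  show ?thesis
    unfolding quartic_sum_def quartic_def
    by (subst pairs, rule sum.cong[OF refl], subst pairs) (intro sum.cong refl, simp add: mult.assoc)
qed

lemma sum_le_indicator:
  fixes c :: "'a::semiring_1"
  assumes "m \<le> N"
  shows "(\<Sum>s = 1..N. if s \<le> m then c else 0) = of_nat m * c"
proof -
  have "(\<Sum>s = 1..N. if s \<le> m then c else 0) = (\<Sum>s\<in>{s \<in> {1..N}. s \<le> m}. c)"
    by (rule sum.inter_filter[symmetric]) simp
  also have "{s \<in> {1..N}. s \<le> m} = {1..m}" using assms by auto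
  finally show ?thesis by simp
qed

text \<open>The minimum counts the \<open>s \<ge> 1\<close> below all four indices; for fixed \<open>s\<close> and \<open>n\<close> the quartic sum factorizes.\<close>
lemma quartic_sum_min_squares:
  "quartic_sum a N (\<lambda>p l j k. min (min p l) (min j k)) = (\<Sum>s = 1..N. \<Sum>n\<le>2 * N. of_real ((cmod (diag_sum a N s n))\<^sup>2))"
proof -
  define \<alpha> where "\<alpha> x = a (fst x) * a (snd x)" for x
  define \<kappa> where "\<kappa> s n x = (if s \<le> fst x \<and> s \<le> snd x \<and> fst x + snd x = n then \<alpha> x else 0)" for s n x
  have d: "diag_sum a N s n = (\<Sum>x\<in>index_square N. \<kappa> s n x)" for s n
    unfolding diag_sum_def diag_def \<kappa>_def \<alpha>_def by (rule sum.inter_filter) simp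
  have "(\<Sum>s = 1..N. \<Sum>n\<le>2 * N. complex_of_real ((cmod (diag_sum a N s n))\<^sup>2)) =
    (\<Sum>s = 1..N. \<Sum>n\<le>2 * N. \<Sum>x\<in>index_square N. \<Sum>y\<in>index_square N. \<kappa> s n x * cnj (\<kappa> s n y))"
  proof -
    have "complex_of_real ((cmod z)\<^sup>2) = z * cnj z" for z using complex_norm_square[of z] by simp
    then show ?thesis by (simp only: d cnj_sum sum_product)
  qed
  also have "\<dots> = (\<Sum>x\<in>index_square N. \<Sum>y\<in>index_square N. \<Sum>s = 1..N. \<Sum>n\<le>2 * N. \<kappa> s n x * cnj (\<kappa> s n y))"
  proof -
    have "(\<Sum>s = 1..N. \<Sum>n\<le>2 * N. \<Sum>x\<in>index_square N. \<Sum>y\<in>index_square N. \<kappa> s n x * cnj (\<kappa> s n y)) =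
       (\<Sum>z\<in>{1..N} \<times> {..2 * N}. \<Sum>w\<in>index_square N \<times> index_square N. \<kappa> (fst z) (snd z) (fst w) * cnj (\<kappa> (fst z) (snd z) (snd w)))"
      by (subst pair_sum, rule sum.cong[OF refl], rule pair_sum)
    also have "\<dots> = (\<Sum>w\<in>index_square N \<times> index_square N. \<Sum>z\<in>{1..N} \<times> {..2 * N}. \<kappa> (fst z) (snd z) (fst w) * cnj (\<kappa> (fst z) (snd z) (snd w)))"
      by (rule sum.swap)
    also have "\<dots> = (\<Sum>w\<in>index_square N \<times> index_square N. \<Sum>s = 1..N. \<Sum>n\<le>2 * N. \<kappa> s n (fst w) * cnj (\<kappa> s n (snd w)))"
      by (rule sum.cong[OF refl], rule pair_sum[symmetric])
    also have "\<dots> = (\<Sum>x\<in>index_square N. \<Sum>y\<in>index_square N. \<Sum>s = 1..N. \<Sum>n\<le>2 * N. \<kappa> s n x * cnj (\<kappa> s n y))"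
      by (rule pair_sum[symmetric])
    finally show ?thesis .
  qed
  also have "\<dots> = quartic_sum a N (\<lambda>p l j k. min (min p l) (min j k))"
    unfolding quartic_sum_pairs
  proof (rule sum.cong[OF refl], rule sum.cong[OF refl])
    fix x y assume xy: "x \<in> index_square N" "y \<in> index_square N"
    let ?m = "min (min (fst x) (snd x)) (min (fst y) (snd y))"
    have xN: "fst x + snd x \<le> 2 * N" "?m \<le> N" using xy by (auto simp: index_square_def)
    define c where "c = (if fst x + snd x = fst y + snd y then \<alpha> x * cnj (\<alpha> y) else 0)"
    have "(\<Sum>n\<le>2 * N. \<kappa> s n x * cnj (\<kappa> s n y)) = (if s \<le> ?m then c else 0)" for s
    proof -
      have "(\<Sum>n\<le>2 * N. \<kappa> s n x * cnj (\<kappa> s n y)) = (\<Sum>n\<le>2 * N. if n = fst x + snd x then (if s \<le> ?m then c else 0) else 0)"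
        by (intro sum.cong refl) (auto simp: \<kappa>_def c_def)
      then show ?thesis using xN(1) by simp
    qed
    then have "(\<Sum>s = 1..N. \<Sum>n\<le>2 * N. \<kappa> s n x * cnj (\<kappa> s n y)) = of_nat ?m * c"
      using sum_le_indicator[OF xN(2)] by simp
    then show "(\<Sum>s = 1..N. \<Sum>n\<le>2 * N. \<kappa> s n x * cnj (\<kappa> s n y)) =
      (if fst x + snd x = fst y + snd y then of_nat ?m * ((a (fst x) * a (snd x)) * cnj (a (fst y) * a (snd y))) else 0)"
      by (simp add: \<alpha>_def c_def)
  qed
  finally show ?thesis by simp
qed

lemma sum_remove2:
  assumes "finite X" "e1 \<in> X" "e2 \<in> X" "e1 \<noteq> e2"
  shows "sum h X = h e1 + h e2 + sum h (X - {e1, e2})"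
proof -
  have "sum h X = h e1 + sum h (X - {e1})" by (rule sum.remove[OF assms(1,2)])
  also have "sum h (X - {e1}) = h e2 + sum h (X - {e1} - {e2})" using assms by (intro sum.remove) auto
  also have "X - {e1} - {e2} = X - {e1, e2}" by auto
  finally show ?thesis by (simp add: add.assoc)
qed

lemma Cauchy_Schwarz_card:
  fixes f :: "'a \<Rightarrow> complex"
  assumes "finite X" "real (card X) \<le> c"
  shows "(cmod (sum f X))\<^sup>2 \<le> c * (\<Sum>x\<in>X. (cmod (f x))\<^sup>2)"
proof -
  have "(cmod (sum f X))\<^sup>2 \<le> (\<Sum>x\<in>X. cmod (f x))\<^sup>2" by (intro power_mono norm_sum) auto
  also have "\<dots> \<le> (\<Sum>x\<in>X. (cmod (f x))\<^sup>2) * real (card X)"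
    using sum_squared_le_sum_of_squares[of "\<lambda>x. cmod (f x)" X] by (simp add: mult.commute)
  also have "\<dots> \<le> (\<Sum>x\<in>X. (cmod (f x))\<^sup>2) * c" using assms by (intro mult_left_mono sum_nonneg) auto
  finally show ?thesis by (simp add: mult.commute)
qed

text \<open>Replacing two summands by their average keeps the sum and lowers the sum of squares by half the square of their difference.\<close>
lemma Cauchy_Schwarz_card_gap:
  fixes f :: "'a \<Rightarrow> complex"
  assumes X: "finite X" "real (card X) \<le> c" and e: "e1 \<in> X" "e2 \<in> X" "e1 \<noteq> e2"
  shows "(cmod (sum f X))\<^sup>2 \<le> c * (\<Sum>x\<in>X. (cmod (f x))\<^sup>2) - (cmod (f e1 - f e2))\<^sup>2"
proof -
  define m where "m = (f e1 + f e2) / 2"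
  \<comment> \<open>The two summands are replaced by their average.\<close>
  define g where "g x = (if x = e1 \<or> x = e2 then m else f x)" for x
  let ?Y = "X - {e1, e2}"
  note split = sum_remove2[OF X(1) e]
  have gY: "sum g ?Y = sum f ?Y" "(\<Sum>x\<in>?Y. (cmod (g x))\<^sup>2) = (\<Sum>x\<in>?Y. (cmod (f x))\<^sup>2)"
    by (intro sum.cong refl; auto simp: g_def)+
  have "sum g X = sum f X" unfolding split[of g] split[of f] using gY(1) by (simp add: g_def m_def)
  then have "(cmod (sum f X))\<^sup>2 \<le> c * (\<Sum>x\<in>X. (cmod (g x))\<^sup>2)"
    using Cauchy_Schwarz_card[OF X, of g] by simp
  also have "(\<Sum>x\<in>X. (cmod (g x))\<^sup>2) = (\<Sum>x\<in>X. (cmod (f x))\<^sup>2) - (cmod (f e1 - f e2))\<^sup>2 / 2"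
  proof -
    have "2 * (cmod m)\<^sup>2 = (cmod (f e1))\<^sup>2 + (cmod (f e2))\<^sup>2 - (cmod (f e1 - f e2))\<^sup>2 / 2"
      unfolding m_def cmod_power2 by (simp add: power2_eq_square field_simps)
    then show ?thesis unfolding split[of "\<lambda>x. (cmod (g x))\<^sup>2"] split[of "\<lambda>x. (cmod (f x))\<^sup>2"]
      using gY(2) by (simp add: g_def)
  qed
  finally have 1: "(cmod (sum f X))\<^sup>2 \<le> c * (\<Sum>x\<in>X. (cmod (f x))\<^sup>2) - (c / 2) * (cmod (f e1 - f e2))\<^sup>2"
    by (simp add: algebra_simps)
  have "card {e1, e2} \<le> card X" using X e by (intro card_mono) auto
  then have "c / 2 \<ge> 1" using X e by simp
  then have "1 * (cmod (f e1 - f e2))\<^sup>2 \<le> (c / 2) * (cmod (f e1 - f e2))\<^sup>2" by (intro mult_right_mono) auto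
  then show ?thesis using 1 by simp
qed

lemma card_diag: "diag N s n \<noteq> {} \<Longrightarrow> real (card (diag N s n)) \<le> real n + 1 - 2 * real s"
proof -
  assume "diag N s n \<noteq> {}"
  then have n: "2 * s \<le> n" by (auto simp: diag_def)
  have "card (diag N s n) = card (fst ` diag N s n)"
    by (intro card_image[symmetric]) (auto simp: inj_on_def diag_def)
  also have "\<dots> \<le> card {s..n - s}" by (intro card_mono) (auto simp: diag_def)
  also have "\<dots> = n - s + 1 - s" by simp
  finally show ?thesis using n by linarith
qed

text \<open>A pair \<open>(p, l)\<close> occurs for \<open>s \<le> min p l\<close>, and the weights \<open>p + l + 1 - 2 s\<close> for these \<open>s\<close> add up to \<open>p \<cdot> l\<close>.\<close>
lemma sum_diagonal_weights:
  fixes b :: "nat \<Rightarrow> real"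
  shows "(\<Sum>s = 1..N. \<Sum>n\<le>2 * N. (real n + 1 - 2 * real s) * (\<Sum>x\<in>diag N s n. b (fst x) * b (snd x))) = (\<Sum>p\<le>N. real p * b p)\<^sup>2"
proof -
  define \<kappa> where "\<kappa> s n x = (if s \<le> fst x \<and> s \<le> snd x \<and> fst x + snd x = n then (real n + 1 - 2 * real s) * (b (fst x) * b (snd x)) else 0)" for s n and x :: "nat \<times> nat"
  have "(real n + 1 - 2 * real s) * (\<Sum>x\<in>diag N s n. b (fst x) * b (snd x)) = (\<Sum>x\<in>index_square N. \<kappa> s n x)" for s n
    unfolding diag_def \<kappa>_def sum_distrib_left by (rule sum.inter_filter) simp
  then have "(\<Sum>s = 1..N. \<Sum>n\<le>2 * N. (real n + 1 - 2 * real s) * (\<Sum>x\<in>diag N s n. b (fst x) * b (snd x))) =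
     (\<Sum>s = 1..N. \<Sum>n\<le>2 * N. \<Sum>x\<in>index_square N. \<kappa> s n x)" by simp
  also have "\<dots> = (\<Sum>z\<in>{1..N} \<times> {..2 * N}. \<Sum>x\<in>index_square N. \<kappa> (fst z) (snd z) x)"
    by (rule pair_sum)
  also have "\<dots> = (\<Sum>x\<in>index_square N. \<Sum>z\<in>{1..N} \<times> {..2 * N}. \<kappa> (fst z) (snd z) x)" by (rule sum.swap)
  also have "\<dots> = (\<Sum>x\<in>index_square N. \<Sum>s = 1..N. \<Sum>n\<le>2 * N. \<kappa> s n x)"
    by (rule sum.cong[OF refl]) (rule pair_sum[symmetric])
  also have "\<dots> = (\<Sum>x\<in>index_square N. (real (fst x) * b (fst x)) * (real (snd x) * b (snd x)))"
  proof (rule sum.cong[OF refl])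
    fix x assume x: "x \<in> index_square N"
    define m where "m = min (fst x) (snd x)"
    have xN: "fst x + snd x \<le> 2 * N" "m \<le> N" using x by (auto simp: index_square_def m_def)
    define \<beta> where "\<beta> = b (fst x) * b (snd x)"
    define t where "t = real (fst x) + real (snd x)"
    have "(\<Sum>n\<le>2 * N. \<kappa> s n x) = (if s \<le> m then (t + 1 - 2 * real s) * \<beta> else 0)" for s
    proof -
      have "(\<Sum>n\<le>2 * N. \<kappa> s n x) = (\<Sum>n\<le>2 * N. if n = fst x + snd x then (if s \<le> m then (t + 1 - 2 * real s) * \<beta> else 0) else 0)"
        by (intro sum.cong refl) (auto simp: \<kappa>_def m_def \<beta>_def t_def)
      then show ?thesis using xN(1) by simp
    qed
    then have "(\<Sum>s = 1..N. \<Sum>n\<le>2 * N. \<kappa> s n x) = (\<Sum>s = 1..N. if s \<le> m then (t + 1 - 2 * real s) * \<beta> else 0)" by simp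
    also have "\<dots> = (\<Sum>s\<in>{s \<in> {1..N}. s \<le> m}. (t + 1 - 2 * real s) * \<beta>)" by (rule sum.inter_filter[symmetric]) simp
    also have "{s \<in> {1..N}. s \<le> m} = {1..m}" using xN by auto
    also have "(\<Sum>s\<in>{1..m}. (t + 1 - 2 * real s) * \<beta>) = real m * (t - real m) * \<beta>"
      by (induction m) (auto simp: algebra_simps)
    also have "real m * (t - real m) = real (fst x) * real (snd x)"
      by (auto simp: m_def t_def min_def)
    finally show "(\<Sum>s = 1..N. \<Sum>n\<le>2 * N. \<kappa> s n x) = (real (fst x) * b (fst x)) * (real (snd x) * b (snd x))"
      by (simp add: \<beta>_def)
  qed
  also have "\<dots> = (\<Sum>p\<le>N. real p * b p)\<^sup>2"
    unfolding index_square_def power2_eq_square sum_product by (simp add: sum.cartesian_product split_beta)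
  finally show ?thesis .
qed

text \<open>Cauchy-Schwarz on each diagonal, with weight the number of its pairs. On the diagonal \<open>s = 1\<close>, \<open>n = n0\<close> the two pairs \<open>(1, n0 - 1)\<close> and \<open>(2, n0 - 2)\<close> are different as \<open>n0 \<ge> 4\<close>, and they supply the gap.\<close>
theorem polynomial_torsion_bound:
  assumes "4 \<le> n0" "n0 \<le> N"
  shows "nrm2 udisc (\<lambda>x. cnj (disc_poly a N x) * disc_poly' a N x - bergman_proj a N x) \<le>
    (nrm2 udisc (disc_poly' a N))\<^sup>2 / (2 * pi) - (pi / 2) * (cmod (a 1 * a (n0 - 1) - a 2 * a (n0 - 2)))\<^sup>2"
proof -
  define b where "b p = (cmod (a p))\<^sup>2" for p
  define \<gamma> where "\<gamma> = (cmod (a 1 * a (n0 - 1) - a 2 * a (n0 - 2)))\<^sup>2"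
  define W where "W s n = (real n + 1 - 2 * real s) * (\<Sum>x\<in>diag N s n. b (fst x) * b (snd x))" for s n
  have le: "(cmod (diag_sum a N s n))\<^sup>2 \<le> W s n - (if s = 1 \<and> n = n0 then \<gamma> else 0)" for s n
  proof (cases "s = 1 \<and> n = n0")
    case True
    let ?e1 = "(1, n0 - 1)" and ?e2 = "(2, n0 - 2)"
    have e: "?e1 \<in> diag N 1 n0" "?e2 \<in> diag N 1 n0" "?e1 \<noteq> ?e2" using assms by (auto simp: diag_def index_square_def)
    then have c: "real (card (diag N 1 n0)) \<le> real n0 + 1 - 2 * real 1" by (intro card_diag) auto
    have "(cmod (diag_sum a N 1 n0))\<^sup>2 \<le> (real n0 + 1 - 2 * real 1) * (\<Sum>x\<in>diag N 1 n0. (cmod (a (fst x) * a (snd x)))\<^sup>2) - \<gamma>"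
      using Cauchy_Schwarz_card_gap[OF _ c e, of "\<lambda>x. a (fst x) * a (snd x)"] by (simp add: diag_sum_def \<gamma>_def)
    then show ?thesis using True by (simp add: W_def b_def norm_mult power_mult_distrib)
  next
    case False
    show ?thesis
    proof (cases "diag N s n = {}")
      case True
      then show ?thesis using False by (auto simp: W_def diag_sum_def)
    next
      case ne: False
      then show ?thesis using Cauchy_Schwarz_card[OF _ card_diag[OF ne], of "\<lambda>x. a (fst x) * a (snd x)"]
        unfolding if_not_P[OF False] by (simp add: W_def b_def diag_sum_def norm_mult power_mult_distrib del: One_nat_def)
    qed
  qed
  have "complex_of_real (nrm2 udisc (\<lambda>x. cnj (disc_poly a N x) * disc_poly' a N x - bergman_proj a N x)) =
     of_real ((pi / 2) * (\<Sum>s = 1..N. \<Sum>n\<le>2 * N. (cmod (diag_sum a N s n))\<^sup>2))"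
    unfolding bergman_defect quartic_sum_min_squares by simp
  then have "nrm2 udisc (\<lambda>x. cnj (disc_poly a N x) * disc_poly' a N x - bergman_proj a N x) = (pi / 2) * (\<Sum>s = 1..N. \<Sum>n\<le>2 * N. (cmod (diag_sum a N s n))\<^sup>2)"
    by (simp only: of_real_eq_iff)
  also have "\<dots> \<le> (pi / 2) * (\<Sum>s = 1..N. \<Sum>n\<le>2 * N. W s n - (if s = 1 \<and> n = n0 then \<gamma> else 0))"
    by (intro mult_left_mono sum_mono le) auto
  also have "(\<Sum>s = 1..N. \<Sum>n\<le>2 * N. W s n - (if s = 1 \<and> n = n0 then \<gamma> else 0)) = (\<Sum>p\<le>N. real p * b p)\<^sup>2 - \<gamma>"
  proof -
    have "(\<Sum>n\<le>2 * N. if s = 1 \<and> n = n0 then \<gamma> else 0) = (if s = 1 then \<gamma> else 0)" for s :: nat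
      using assms by auto
    moreover have "(\<Sum>s = 1..N. if s = 1 then \<gamma> else 0) = \<gamma>" using assms by (subst sum.delta) auto
    ultimately show ?thesis
      unfolding sum_diagonal_weights[symmetric] W_def sum_subtractf by simp
  qed
  also have "(pi / 2) * ((\<Sum>p\<le>N. real p * b p)\<^sup>2 - \<gamma>) = (nrm2 udisc (disc_poly' a N))\<^sup>2 / (2 * pi) - (pi / 2) * \<gamma>"
    unfolding nrm2_disc_poly' b_def by (simp add: power_mult_distrib right_diff_distrib power2_eq_square)
  finally show ?thesis by (simp add: \<gamma>_def)
qed

section \<open>The upper bound by a trial function\<close>

text \<open>With \<open>G\<close> the inverse of \<open>f\<close>, the function \<open>k = (q \<circ> G) G'\<close> on \<open>\<Omega>\<close> has the primitive \<open>Q \<circ> G\<close>. A multiple of the imaginary part of this primitive serves as phase: in complex notation \<open>A\<^sub>1 - i A\<^sub>2\<close> is \<open>- (i/2) cnj z\<close>, and the gradient of the phase changes it into \<open>- (i/2) (cnj z - k)\<close>. Pulling back by \<open>f\<close> multiplies by \<open>f'\<close>, and \<open>f' \<cdot> (G' \<circ> f) = 1\<close>.\<close>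
lemma conformal_trial_function:
  fixes f G q Q :: "complex \<Rightarrow> complex"
  assumes op: "open \<Omega>" and bd: "bounded \<Omega>"
    and f: "f holomorphic_on ball 0 1" and G: "G holomorphic_on cx ` \<Omega>"
    and fG: "\<And>w. w \<in> cx ` \<Omega> \<Longrightarrow> G w \<in> ball 0 1 \<and> f (G w) = w"
    and Gf: "\<And>z. z \<in> ball 0 1 \<Longrightarrow> f z \<in> cx ` \<Omega> \<and> G (f z) = z"
    and Q: "\<And>z. (Q has_field_derivative q z) (at z)" and qc: "continuous_on UNIV q"
  shows "\<exists>v h. wgrad \<Omega> v h \<and> nrm2 \<Omega> v = measure lebesgue \<Omega> \<and>
     energy B \<Omega> v h = B\<^sup>2 / 4 * nrm2 udisc (\<lambda>x. cnj (f (cx x)) * deriv f (cx x) - q (cx x))"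
proof -
  let ?W = "cx ` \<Omega>"
  have oW: "open ?W" using open_cx_image[OF op] .
  have fin: "\<Omega> \<in> lmeasurable" by (rule bounded_open_finite_measure[OF op bd])
  have df: "(f has_field_derivative deriv f z) (at z)" if "z \<in> ball 0 1" for z
    using holomorphic_derivI[OF f open_ball that] .
  have dG: "(G has_field_derivative deriv G w) (at w)" if "w \<in> ?W" for w
    using holomorphic_derivI[OF G oW that] .
  have inv: "deriv f z * deriv G (f z) = 1" if z: "z \<in> ball 0 1" for z
  proof -
    have "((\<lambda>z. G (f z)) has_field_derivative deriv G (f z) * deriv f z) (at z)"
      using DERIV_chain[OF dG[of "f z"] df[OF z]] Gf[OF z] by (simp add: o_def)
    moreover have "((\<lambda>z. G (f z)) has_field_derivative 1) (at z)"
      by (rule DERIV_cong_ev[THEN iffD1, OF refl _ refl DERIV_ident])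
        (use eventually_nhds_in_open[OF open_ball z] Gf in \<open>auto elim!: eventually_mono\<close>)
    ultimately show ?thesis using DERIV_unique by (metis mult.commute)
  qed
  define k where "k w = q (G w) * deriv G w" for w
  \<comment> \<open>The factor makes \<open>Re \<Phi>\<close> half the imaginary part of the primitive \<open>Q \<circ> G\<close> of \<open>k\<close>.\<close>
  define \<Phi> where "\<Phi> w = Q (G w) * (- \<i> / 2)" for w
  have d\<Phi>: "(\<Phi> has_field_derivative (k w * (- \<i> / 2))) (at w)" if "w \<in> ?W" for w
    unfolding \<Phi>_def k_def using DERIV_cmult_right[OF DERIV_chain[OF Q dG[OF that]], of "- \<i> / 2"]
    by (simp add: o_def)
  have cG: "continuous_on ?W G" using G by (rule holomorphic_on_imp_continuous_on)
  have cdG: "continuous_on ?W (deriv G)"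
    using holomorphic_deriv[OF G oW] by (rule holomorphic_on_imp_continuous_on)
  have ck: "continuous_on ?W k" unfolding k_def
    by (intro continuous_intros cdG continuous_on_compose2[OF qc cG]) auto
  have ckx: "continuous_on \<Omega> (\<lambda>x. k (cx x))"
    by (rule continuous_on_compose2[OF ck]) (auto intro: continuous_intros)
  define v where "v x = exp (- \<i> * of_real B * of_real (Re (\<Phi> (cx x))))" for x
  have nv: "cmod (v x) = 1" for x by (simp add: v_def norm_exp_eq_Re)
  define h where "h j x = v x * (if j = 1 then - \<i> * of_real B * of_real (Im (k (cx x)) / 2) else - \<i> * of_real B * of_real (Re (k (cx x)) / 2))" for j :: 2 and x
  have h1: "h 1 x = v x * (- \<i> * of_real B * of_real (Im (k (cx x)) / 2))" and h2: "h 2 x = v x * (- \<i> * of_real B * of_real (Re (k (cx x)) / 2))" for x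
    by (simp_all add: h_def)
  have dv: "(v has_derivative (\<lambda>e. \<Sum>j\<in>UNIV. of_real (e $ j) * h j x)) (at x)" if x: "x \<in> \<Omega>" for x
  proof -
    have xW: "cx x \<in> ?W" using x by blast
    have 1: "(cx has_derivative cx) (at x)" by (rule bounded_linear_imp_has_derivative[OF bounded_linear_cx])
    have 2: "(\<Phi> has_derivative (*) (k (cx x) * (- \<i> / 2))) (at (cx x))"
      using d\<Phi>[OF xW] by (simp add: has_field_derivative_def)
    have 3: "((\<lambda>x. \<Phi> (cx x)) has_derivative (\<lambda>e. k (cx x) * (- \<i> / 2) * cx e)) (at x)"
      using diff_chain_at[OF 1 2] by (simp add: o_def)
    have 4: "((\<lambda>x. - \<i> * of_real B * of_real (Re (\<Phi> (cx x)))) has_derivative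
       (\<lambda>e. - \<i> * of_real B * of_real (Re (k (cx x) * (- \<i> / 2) * cx e)))) (at x)"
      by (intro has_derivative_mult_right has_derivative_of_real has_derivative_Re 3)
    have 5: "(exp has_derivative (*) (v x)) (at (- \<i> * of_real B * of_real (Re (\<Phi> (cx x)))))"
      using DERIV_exp[of "- \<i> * of_real B * of_real (Re (\<Phi> (cx x)))"] by (simp add: has_field_derivative_def v_def)
    have "(v has_derivative (\<lambda>e. v x * (- \<i> * of_real B * of_real (Re (k (cx x) * (- \<i> / 2) * cx e))))) (at x)"
      using diff_chain_at[OF 4 5] by (simp add: o_def v_def[abs_def])
    moreover have "v x * (- \<i> * of_real B * of_real (Re (k (cx x) * (- \<i> / 2) * cx e))) = (\<Sum>j\<in>UNIV. of_real (e $ j) * h j x)" for e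
    proof -
      have "Re (k (cx x) * (- \<i> / 2) * cx e) = e $ 1 * (Im (k (cx x)) / 2) + e $ 2 * (Re (k (cx x)) / 2)"
        by (simp add: cx_def field_simps)
      then show ?thesis unfolding sum_2 h1 h2 by (simp add: algebra_simps)
    qed
    ultimately show ?thesis by simp
  qed
  have cv: "continuous_on \<Omega> v"
    by (intro continuous_at_imp_continuous_on ballI has_derivative_continuous[OF dv])
  have ch: "continuous_on \<Omega> (h j)" for j
    unfolding h_def using ckx by (cases "j = 1") (auto intro!: continuous_intros cv)
  have vL: "v \<in> L2 \<Omega>" using nv by (intro continuous_bounded_L2[OF op bd cv, of 1]) auto
  have "integrable (lebesgue_on \<Omega>) (\<lambda>x. (cmod (deriv G (cx x)))\<^sup>2 * (cmod (q (cx (vx (G (cx x))))))\<^sup>2)"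
  proof (rule conformal_change(1)[OF op, where F="\<lambda>x. (cmod (q (cx x)))\<^sup>2" and T=udisc])
    show "\<And>x. x \<in> \<Omega> \<Longrightarrow> (G has_field_derivative deriv G (cx x)) (at (cx x))" by (rule dG) blast
    show "inj_on G ?W" using fG by (metis inj_onI)
    show "udisc = (\<lambda>x. vx (G (cx x))) ` \<Omega>"
    proof (intro equalityI subsetI)
      fix y assume "y \<in> udisc"
      then have y: "cx y \<in> ball 0 1" by simp
      then obtain x where "x \<in> \<Omega>" "f (cx y) = cx x" using Gf by blast
      then have "vx (G (cx x)) = y" using Gf[OF y] by (metis vx_cx)
      then show "y \<in> (\<lambda>x. vx (G (cx x))) ` \<Omega>" using \<open>x \<in> \<Omega>\<close> by blast
    next
      fix y assume "y \<in> (\<lambda>x. vx (G (cx x))) ` \<Omega>"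
      then show "y \<in> udisc" using fG by fastforce
    qed
    have "(\<lambda>x. q (cx x)) \<in> L2 udisc"
      by (rule continuous_L2_bounded_domain) (auto intro!: continuous_intros continuous_on_compose2[OF qc])
    then show "integrable (lebesgue_on udisc) (\<lambda>x. (cmod (q (cx x)))\<^sup>2)" by (rule L2_integrable_sq)
  qed auto
  then have ik: "integrable (lebesgue_on \<Omega>) (\<lambda>x. (cmod (k (cx x)))\<^sup>2)"
    by (simp add: k_def norm_mult power_mult_distrib mult.commute)
  have hm: "h j \<in> borel_measurable (lebesgue_on \<Omega>)" for j
    using op ch by (intro continuous_imp_measurable_on_sets_lebesgue) auto
  have hL: "h j \<in> L2 \<Omega>" for j
  proof (rule L2_dominated[OF hm])
    show "integrable (lebesgue_on \<Omega>) (\<lambda>x. B\<^sup>2 * (cmod (k (cx x)))\<^sup>2)" using ik by simp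
    fix x
    have "\<bar>Im (k (cx x)) / 2\<bar> \<le> cmod (k (cx x))" "\<bar>Re (k (cx x)) / 2\<bar> \<le> cmod (k (cx x))"
      using abs_Im_le_cmod[of "k (cx x)"] abs_Re_le_cmod[of "k (cx x)"] by auto
    then have "cmod (h j x) \<le> \<bar>B\<bar> * cmod (k (cx x))"
      using mult_left_mono[of "\<bar>Im (k (cx x))\<bar>" "cmod (k (cx x)) * 2" "\<bar>B\<bar>"]
        mult_left_mono[of "\<bar>Re (k (cx x))\<bar>" "cmod (k (cx x)) * 2" "\<bar>B\<bar>"]
      by (auto simp: h_def norm_mult nv simp del: of_real_divide)
    then have "(cmod (h j x))\<^sup>2 \<le> (\<bar>B\<bar> * cmod (k (cx x)))\<^sup>2" by (intro power_mono) auto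
    then show "(cmod (h j x))\<^sup>2 \<le> B\<^sup>2 * (cmod (k (cx x)))\<^sup>2" by (simp add: power_mult_distrib)
  qed
  have w: "wgrad \<Omega> v h" by (rule wgrad_classical[OF op bd dv ch vL hL])
  have "nrm2 \<Omega> v = nrm2 \<Omega> (\<lambda>x. 1)" by (simp add: nrm2_def nv)
  then have n: "nrm2 \<Omega> v = measure lebesgue \<Omega>" using L2_const(2)[OF fin, of 1] by simp
  define F where "F x = B\<^sup>2 / 4 * (cmod (cnj (cx x) - k (cx x)))\<^sup>2" for x
  have pw: "(cmod (magnetic_grad B h v 1 x))\<^sup>2 + (cmod (magnetic_grad B h v 2 x))\<^sup>2 = F x" for x
  proof -
    have "magnetic_grad B h v 1 x = v x * of_real (- (B / 2) * (x $ 2 + Im (k (cx x))))"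
      unfolding magnetic_grad_def h1 vec_potential_nth by (simp add: field_simps)
    then have m1: "(cmod (magnetic_grad B h v 1 x))\<^sup>2 = (B / 2)\<^sup>2 * (x $ 2 + Im (k (cx x)))\<^sup>2"
      by (simp only: norm_mult nv norm_of_real power_mult_distrib power2_abs) simp
    have "magnetic_grad B h v 2 x = v x * of_real ((B / 2) * (x $ 1 - Re (k (cx x))))"
      unfolding magnetic_grad_def h2 vec_potential_nth by (simp add: field_simps)
    then have m2: "(cmod (magnetic_grad B h v 2 x))\<^sup>2 = (B / 2)\<^sup>2 * (x $ 1 - Re (k (cx x)))\<^sup>2"
      by (simp only: norm_mult nv norm_of_real power_mult_distrib power2_abs) simp
    have "(cmod (cnj (cx x) - k (cx x)))\<^sup>2 = (x $ 1 - Re (k (cx x)))\<^sup>2 + (x $ 2 + Im (k (cx x)))\<^sup>2"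
      unfolding cmod_power2 by (simp add: cx_def power2_eq_square algebra_simps)
    then show ?thesis unfolding m1 m2 F_def by (simp add: power_divide algebra_simps)
  qed
  have mL: "magnetic_grad B h v j \<in> L2 \<Omega>" for j by (rule magnetic_grad_L2[OF bd w])
  have iF: "integrable (lebesgue_on \<Omega>) F"
    using Bochner_Integration.integrable_add[OF L2_integrable_sq[OF mL[of 1]] L2_integrable_sq[OF mL[of 2]]]
    by (simp add: pw)
  have "energy B \<Omega> v h = (LINT x|lebesgue_on \<Omega>. F x)"
    unfolding energy_def nrm2_def
    by (subst Bochner_Integration.integral_add[symmetric]) (use L2_integrable_sq[OF mL] pw in auto)
  also have "\<dots> = (LINT x|lebesgue_on udisc. (cmod (deriv f (cx x)))\<^sup>2 * F (vx (f (cx x))))"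
  proof (rule conformal_change(2)[OF open_ball _ _ _ _ iF])
    show "\<And>x. x \<in> udisc \<Longrightarrow> (f has_field_derivative deriv f (cx x)) (at (cx x))" by (rule df) simp
    show "inj_on f (cx ` udisc)" using Gf by (intro inj_onI) (metis cx_ball cx_0)
    show "\<Omega> = (\<lambda>x. vx (f (cx x))) ` udisc"
    proof (intro equalityI subsetI)
      fix y assume "y \<in> \<Omega>"
      then have y: "G (cx y) \<in> ball 0 1" "f (G (cx y)) = cx y" using fG by auto
      then have "y = vx (f (cx (vx (G (cx y)))))" by simp
      moreover have "vx (G (cx y)) \<in> udisc" using y by simp
      ultimately show "y \<in> (\<lambda>x. vx (f (cx x))) ` udisc" by blast
    next
      fix y assume "y \<in> (\<lambda>x. vx (f (cx x))) ` udisc"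
      then obtain x where x: "x \<in> udisc" "y = vx (f (cx x))" by blast
      then have "f (cx x) \<in> ?W" using Gf[of "cx x"] by simp
      then show "y \<in> \<Omega>" using x by (auto simp: cx_image_iff)
    qed
  qed (use op in auto)
  also have "\<dots> = (LINT x|lebesgue_on udisc. B\<^sup>2 / 4 * (cmod (cnj (f (cx x)) * deriv f (cx x) - q (cx x)))\<^sup>2)"
  proof (intro Bochner_Integration.integral_cong refl)
    fix x :: "real^2" assume "x \<in> space (lebesgue_on udisc)"
    then have z: "cx x \<in> ball 0 1" by (simp add: space_restrict_space)
    have "deriv f (cx x) * (cnj (f (cx x)) - k (f (cx x))) = cnj (f (cx x)) * deriv f (cx x) - q (cx x) * (deriv f (cx x) * deriv G (f (cx x)))"
      unfolding k_def using Gf[OF z] by (simp add: algebra_simps)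
    then have "cnj (f (cx x)) * deriv f (cx x) - q (cx x) = deriv f (cx x) * (cnj (f (cx x)) - k (f (cx x)))"
      unfolding inv[OF z] by simp
    then show "(cmod (deriv f (cx x)))\<^sup>2 * F (vx (f (cx x))) = B\<^sup>2 / 4 * (cmod (cnj (f (cx x)) * deriv f (cx x) - q (cx x)))\<^sup>2"
      by (simp add: F_def norm_mult power_mult_distrib)
  qed
  also have "\<dots> = B\<^sup>2 / 4 * nrm2 udisc (\<lambda>x. cnj (f (cx x)) * deriv f (cx x) - q (cx x))"
    unfolding nrm2_def by (rule integral_mult_right_zero)
  finally show ?thesis using w n by blast
qed

section \<open>Gauge transformations\<close>

text \<open>By the product rule this set contains its partial derivatives, so products of smooth functions are smooth.\<close>
inductive_set smooth_ring :: "('a::euclidean_space \<Rightarrow> real) set" where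
  base: "smooth_on UNIV f \<Longrightarrow> f \<in> smooth_ring"
| add: "f \<in> smooth_ring \<Longrightarrow> g \<in> smooth_ring \<Longrightarrow> (\<lambda>x. f x + g x) \<in> smooth_ring"
| mult: "f \<in> smooth_ring \<Longrightarrow> g \<in> smooth_ring \<Longrightarrow> (\<lambda>x. f x * g x) \<in> smooth_ring"

lemma smooth_ring_derivative:
  assumes "f \<in> smooth_ring"
  shows "(\<forall>x. f differentiable (at x)) \<and> (\<forall>b\<in>Basis. (\<lambda>x. frechet_derivative f (at x) b) \<in> smooth_ring)"
  using assms
proof induction
  case (base f)
  have 1: "Ck_on (Suc k) UNIV f" for k using base unfolding smooth_on_def by blast
  then have "f differentiable (at x)" for x using 1[of 0] by simp
  moreover have "(\<lambda>x. frechet_derivative f (at x) b) \<in> smooth_ring" if "b \<in> Basis" for b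
  proof (rule smooth_ring.base)
    show "smooth_on UNIV (\<lambda>x. frechet_derivative f (at x) b)"
      unfolding smooth_on_def
    proof
      fix k show "Ck_on k UNIV (\<lambda>x. frechet_derivative f (at x) b)" using 1[of k] that by simp
    qed
  qed
  ultimately show ?case by blast
next
  case (add f g)
  have d: "(f has_derivative frechet_derivative f (at x)) (at x)" "(g has_derivative frechet_derivative g (at x)) (at x)" for x
    using add.IH frechet_derivative_works by blast+
  have "((\<lambda>x. f x + g x) has_derivative (\<lambda>v. frechet_derivative f (at x) v + frechet_derivative g (at x) v)) (at x)" for x
    by (intro has_derivative_add d)
  then have "frechet_derivative (\<lambda>x. f x + g x) (at x) = (\<lambda>v. frechet_derivative f (at x) v + frechet_derivative g (at x) v)" "(\<lambda>x. f x + g x) differentiable (at x)" for x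
    by (auto intro!: differentiableI frechet_derivative_at[symmetric])
  then show ?case using add.IH by (simp add: smooth_ring.add)
next
  case (mult f g)
  have d: "(f has_derivative frechet_derivative f (at x)) (at x)" "(g has_derivative frechet_derivative g (at x)) (at x)" for x
    using mult.IH frechet_derivative_works by blast+
  have "((\<lambda>x. f x * g x) has_derivative (\<lambda>v. f x * frechet_derivative g (at x) v + frechet_derivative f (at x) v * g x)) (at x)" for x
    by (intro has_derivative_mult d)
  then have "frechet_derivative (\<lambda>x. f x * g x) (at x) = (\<lambda>v. f x * frechet_derivative g (at x) v + frechet_derivative f (at x) v * g x)" "(\<lambda>x. f x * g x) differentiable (at x)" for x
    by (auto intro!: differentiableI frechet_derivative_at[symmetric])
  then show ?case using mult.IH mult.hyps by (simp add: smooth_ring.add smooth_ring.mult)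
qed

lemma closed_subset_compact: "compact K \<Longrightarrow> closed S \<Longrightarrow> S \<subseteq> K \<Longrightarrow> compact S"
  for K S :: "'a::t2_space set"
  using compact_Int_closed[of K S] by (simp add: Int_absorb1)

lemma smooth_on_mult:
  fixes f g :: "'a::euclidean_space \<Rightarrow> real"
  assumes "smooth_on UNIV f" "smooth_on UNIV g"
  shows "smooth_on UNIV (\<lambda>x. f x * g x)"
  unfolding smooth_on_def
proof (intro allI Ck_on_closed_family[of smooth_ring])
  fix h :: "'a \<Rightarrow> real" assume h: "h \<in> smooth_ring"
  fix x show "h differentiable (at x)" using smooth_ring_derivative[OF h] by simp
next
  fix h :: "'a \<Rightarrow> real" and b :: 'a assume h: "h \<in> smooth_ring" "b \<in> Basis"
  then show "(\<lambda>x. frechet_derivative h (at x) b) \<in> smooth_ring" using smooth_ring_derivative[OF h(1)] by simp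
next
  show "(\<lambda>x. f x * g x) \<in> smooth_ring" by (intro smooth_ring.mult smooth_ring.base assms)
qed

lemma smooth_on_trig:
  fixes l :: "'a::euclidean_space"
  shows "smooth_on UNIV (\<lambda>x. a * cos (x \<bullet> l) + b * sin (x \<bullet> l) :: real)"
proof -
  let ?F = "{f :: 'a \<Rightarrow> real. \<exists>a b. f = (\<lambda>x. a * cos (x \<bullet> l) + b * sin (x \<bullet> l))}"
  have d: "((\<lambda>x. a * cos (x \<bullet> l) + b * sin (x \<bullet> l)) has_derivative (\<lambda>v. (b * cos (x \<bullet> l) - a * sin (x \<bullet> l)) * (v \<bullet> l))) (at x)" for a b x
    by (auto intro!: derivative_eq_intros simp: algebra_simps)
  show ?thesis unfolding smooth_on_def
  proof (intro allI Ck_on_closed_family[of ?F])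
    fix f and x :: 'a assume "f \<in> ?F"
    then show "f differentiable (at x)" using d differentiableI by blast
  next
    fix f and e :: 'a assume "f \<in> ?F"
    then obtain a b where f: "f = (\<lambda>x. a * cos (x \<bullet> l) + b * sin (x \<bullet> l))" by blast
    have "frechet_derivative f (at x) = (\<lambda>v. (b * cos (x \<bullet> l) - a * sin (x \<bullet> l)) * (v \<bullet> l))" for x
      unfolding f using d by (rule frechet_derivative_at[symmetric])
    then have "(\<lambda>x. frechet_derivative f (at x) e) = (\<lambda>x. (b * (e \<bullet> l)) * cos (x \<bullet> l) + (- a * (e \<bullet> l)) * sin (x \<bullet> l))"
      by (simp add: fun_eq_iff algebra_simps)
    then show "(\<lambda>x. frechet_derivative f (at x) e) \<in> ?F" by blast
  qed blast
qed

lemma smooth_on_translate: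
  fixes f :: "'a::euclidean_space \<Rightarrow> real"
  assumes "smooth_on UNIV f"
  shows "smooth_on UNIV (\<lambda>x. f (x + c))"
    and "frechet_derivative (\<lambda>x. f (x + c)) (at x) v = frechet_derivative f (at (x + c)) v"
proof -
  let ?F = "{h :: 'a \<Rightarrow> real. \<exists>f. smooth_on UNIV f \<and> h = (\<lambda>x. f (x + c))}"
  have d: "((\<lambda>x. f (x + c)) has_derivative frechet_derivative f (at (x + c))) (at x)" if "smooth_on UNIV f" for f :: "'a \<Rightarrow> real" and x
  proof -
    have "Ck_on (Suc 0) UNIV f" using that unfolding smooth_on_def by blast
    then have 1: "(f has_derivative frechet_derivative f (at (x + c))) (at (x + c))" by (simp add: frechet_derivative_works)
    have 2: "((\<lambda>x. x + c) has_derivative (\<lambda>v. v)) (at x)" by (auto intro!: derivative_eq_intros)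
    show ?thesis using diff_chain_at[OF 2 1] by (simp add: o_def)
  qed
  show "frechet_derivative (\<lambda>x. f (x + c)) (at x) v = frechet_derivative f (at (x + c)) v"
    by (subst frechet_derivative_at[OF d[OF assms], symmetric]) (rule refl)
  show "smooth_on UNIV (\<lambda>x. f (x + c))" unfolding smooth_on_def
  proof (intro allI Ck_on_closed_family[of ?F])
    fix h and x :: 'a assume "h \<in> ?F"
    then obtain f where f: "smooth_on UNIV f" "h = (\<lambda>x. f (x + c))" by blast
    show "h differentiable (at x)" unfolding f(2) by (rule differentiableI[OF d[OF f(1)]])
  next
    fix h and e :: 'a assume "h \<in> ?F" "e \<in> Basis"
    then obtain f where f: "smooth_on UNIV f" "h = (\<lambda>x. f (x + c))" by blast
    have "smooth_on UNIV (\<lambda>x. frechet_derivative f (at x) e)"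
      unfolding smooth_on_def
    proof
      fix k
      have "Ck_on (Suc k) UNIV f" using f unfolding smooth_on_def by blast
      then show "Ck_on k UNIV (\<lambda>x. frechet_derivative f (at x) e)" using \<open>e \<in> Basis\<close> by simp
    qed
    moreover have "(\<lambda>x. frechet_derivative h (at x) e) = (\<lambda>x. (\<lambda>x. frechet_derivative f (at x) e) (x + c))"
      unfolding f(2) by (intro ext, subst frechet_derivative_at[OF d[OF f(1)], symmetric]) (rule refl)
    ultimately show "(\<lambda>x. frechet_derivative h (at x) e) \<in> ?F" by blast
  qed (use assms in blast)
qed

lemma test_function_mult:
  assumes "test_function \<Omega> \<phi>" "smooth_on UNIV f"
  shows "test_function \<Omega> (\<lambda>x. \<phi> x * f x)"
proof -
  have sub: "closure {x. \<phi> x * f x \<noteq> 0} \<subseteq> closure {x. \<phi> x \<noteq> 0}" by (intro closure_mono) auto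
  have "compact (closure {x. \<phi> x * f x \<noteq> 0})"
    using closed_subset_compact[OF _ _ sub] assms(1) by (simp add: test_function_def)
  moreover have "smooth_on UNIV (\<lambda>x. \<phi> x * f x)"
    using assms by (intro smooth_on_mult) (auto simp: test_function_def)
  ultimately show ?thesis
    unfolding test_function_def using order_trans[OF sub] assms(1) by (simp add: test_function_def)
qed

lemma test_function_translate:
  assumes t: "test_function (ball c R) \<phi>"
  shows "test_function (ball 0 R) (\<lambda>x. \<phi> (x + c))"
proof -
  define K where "K = closure {x. \<phi> x \<noteq> 0}"
  have K: "compact K" "K \<subseteq> ball c R" "{x. \<phi> x \<noteq> 0} \<subseteq> K"
    using t closure_subset[of "{x. \<phi> x \<noteq> 0}"] unfolding test_function_def K_def by simp_all
  define K' where "K' = (\<lambda>x. x - c) ` K"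
  have K': "compact K'" unfolding K'_def using K(1) by (intro compact_continuous_image continuous_intros)
  have "{x. \<phi> (x + c) \<noteq> 0} \<subseteq> K'"
  proof
    fix x assume "x \<in> {x. \<phi> (x + c) \<noteq> 0}"
    then have "x + c \<in> K" using K(3) by blast
    then show "x \<in> K'" unfolding K'_def by (intro image_eqI[of _ _ "x + c"]) simp_all
  qed
  then have sub: "closure {x. \<phi> (x + c) \<noteq> 0} \<subseteq> K'" using K' by (simp add: closure_minimal compact_imp_closed)
  have "K' \<subseteq> ball 0 R" using K(2) unfolding K'_def by (auto simp: dist_norm norm_minus_commute)
  moreover have "compact (closure {x. \<phi> (x + c) \<noteq> 0})"
    by (rule closed_subset_compact[OF K' _ sub]) simp
  moreover have "smooth_on UNIV (\<lambda>x. \<phi> (x + c))"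
    using t by (intro smooth_on_translate(1)) (simp add: test_function_def)
  ultimately show ?thesis using order_trans[OF sub] by (simp add: test_function_def)
qed

lemma smooth_cos_sin: "smooth_on UNIV (\<lambda>x::real^2. cos (x \<bullet> l))" "smooth_on UNIV (\<lambda>x::real^2. sin (x \<bullet> l))"
  using smooth_on_trig[of 1 l 0] smooth_on_trig[of 0 l 1] by simp_all

text \<open>Against a test function the phase is moved over: its real and imaginary parts times a test function are again test functions.\<close>
lemma wgrad_phase:
  fixes l :: "real^2"
  assumes fin: "\<Omega> \<in> lmeasurable" and w: "wgrad \<Omega> u g"
  defines "e \<equiv> \<lambda>x. cis (x \<bullet> l)"
  shows "wgrad \<Omega> (\<lambda>x. e x * u x) (\<lambda>j x. e x * (g j x + \<i> * of_real (l $ j) * u x))"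
proof -
  have L: "u \<in> L2 \<Omega>" "g j \<in> L2 \<Omega>" for j using w by (auto simp: wgrad_def)
  have ce: "continuous_on UNIV e" unfolding e_def by (intro continuous_intros)
  then have "e \<in> borel_measurable borel" by (rule borel_measurable_continuous_onI)
  then have em: "e \<in> borel_measurable (lebesgue_on \<Omega>)"
    by (intro measurable_restrict_space1 measurable_completion) simp
  have eb: "cmod (e x) \<le> 1" for x by (simp add: e_def)
  have hL: "(\<lambda>x. g j x + \<i> * of_real (l $ j) * u x) \<in> L2 \<Omega>" for j by (intro L2_add L2_cmult L)
  have euL: "(\<lambda>x. e x * u x) \<in> L2 \<Omega>" by (rule L2_bounded_mult[OF L(1) em eb])
  have ehL: "(\<lambda>x. e x * (g j x + \<i> * of_real (l $ j) * u x)) \<in> L2 \<Omega>" for j by (rule L2_bounded_mult[OF hL em eb])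
  have "has_weak_partial \<Omega> j (\<lambda>x. e x * u x) (\<lambda>x. e x * (g j x + \<i> * of_real (l $ j) * u x))" for j
    unfolding has_weak_partial_inner[OF fin euL ehL]
  proof (intro allI impI)
    fix \<phi> assume t: "test_function \<Omega> \<phi>"
    define C where "C x = \<phi> x * cos (x \<bullet> l)" for x
    define S where "S x = \<phi> x * sin (x \<bullet> l)" for x
    have tC: "test_function \<Omega> C" and tS: "test_function \<Omega> S"
      unfolding C_def[abs_def] S_def[abs_def] by (intro test_function_mult[OF t] smooth_cos_sin)+
    let ?d = "\<lambda>f x. frechet_derivative f (at x) (axis j 1) :: real"
    have dC: "?d C x = \<phi> x * (- sin (x \<bullet> l) * l $ j) + ?d \<phi> x * cos (x \<bullet> l)"
      and dS: "?d S x = \<phi> x * (cos (x \<bullet> l) * l $ j) + ?d \<phi> x * sin (x \<bullet> l)" for x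
    proof -
      have "(C has_derivative (\<lambda>v. \<phi> x * (- sin (x \<bullet> l) * (v \<bullet> l)) + frechet_derivative \<phi> (at x) v * cos (x \<bullet> l))) (at x)"
        unfolding C_def[abs_def]
        by (intro has_derivative_mult test_function_continuous(3)[OF t]) (auto intro!: derivative_eq_intros)
      then show "?d C x = \<phi> x * (- sin (x \<bullet> l) * l $ j) + ?d \<phi> x * cos (x \<bullet> l)"
        by (subst frechet_derivative_at[symmetric], assumption) (simp add: inner_axis')
      have "(S has_derivative (\<lambda>v. \<phi> x * (cos (x \<bullet> l) * (v \<bullet> l)) + frechet_derivative \<phi> (at x) v * sin (x \<bullet> l))) (at x)"
        unfolding S_def[abs_def]
        by (intro has_derivative_mult test_function_continuous(3)[OF t]) (auto intro!: derivative_eq_intros)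
      then show "?d S x = \<phi> x * (cos (x \<bullet> l) * l $ j) + ?d \<phi> x * sin (x \<bullet> l)"
        by (subst frechet_derivative_at[symmetric], assumption) (simp add: inner_axis')
    qed
    let ?c = "\<lambda>f x. complex_of_real (f x)"
    note tL = test_function_L2(1)[OF fin t] test_function_L2[OF fin tC] test_function_L2[OF fin tS]
    have wC: "L2_inner \<Omega> u (?c (?d C)) = - L2_inner \<Omega> (g j) (?c C)" and wS: "L2_inner \<Omega> u (?c (?d S)) = - L2_inner \<Omega> (g j) (?c S)"
      using w tC tS has_weak_partial_inner[OF fin L] unfolding wgrad_def by blast+
    have "L2_inner \<Omega> (\<lambda>x. e x * u x) (?c (?d \<phi>)) =
      L2_inner \<Omega> u (?c (?d C)) + \<i> * L2_inner \<Omega> u (?c (?d S)) - \<i> * of_real (l $ j) * L2_inner \<Omega> (\<lambda>x. e x * u x) (?c \<phi>)"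
    proof -
      have pw: "e x * u x * cnj (?c (?d \<phi>) x) = u x * cnj (?c (?d C) x) + \<i> * (u x * cnj (?c (?d S) x)) - \<i> * of_real (l $ j) * (e x * u x * cnj (?c \<phi> x))" for x
        unfolding dC dS e_def cis_conv_exp exp_Euler by (simp add: algebra_simps cos_of_real sin_of_real)
      show ?thesis unfolding L2_inner_def pw
        using L2_prod_integrable[OF L(1) tL(3), of j] L2_prod_integrable[OF L(1) tL(5), of j] L2_prod_integrable[OF euL tL(1)]
        by (simp del: complex_cnj_complex_of_real)
    qed
    also have "\<dots> = - (L2_inner \<Omega> (g j) (?c C) + \<i> * L2_inner \<Omega> (g j) (?c S) + \<i> * of_real (l $ j) * L2_inner \<Omega> (\<lambda>x. e x * u x) (?c \<phi>))"
      unfolding wC wS by (simp add: algebra_simps)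
    also have "L2_inner \<Omega> (g j) (?c C) + \<i> * L2_inner \<Omega> (g j) (?c S) + \<i> * of_real (l $ j) * L2_inner \<Omega> (\<lambda>x. e x * u x) (?c \<phi>) =
       L2_inner \<Omega> (\<lambda>x. e x * (g j x + \<i> * of_real (l $ j) * u x)) (?c \<phi>)"
    proof -
      have pw: "e x * (g j x + \<i> * of_real (l $ j) * u x) * cnj (?c \<phi> x) = g j x * cnj (?c C x) + \<i> * (g j x * cnj (?c S x)) + \<i> * of_real (l $ j) * (e x * u x * cnj (?c \<phi> x))" for x
        unfolding C_def S_def e_def cis_conv_exp exp_Euler by (simp add: algebra_simps cos_of_real sin_of_real)
      show ?thesis unfolding L2_inner_def pw
        using L2_prod_integrable[OF L(2) tL(2), of j] L2_prod_integrable[OF L(2) tL(4), of j] L2_prod_integrable[OF euL tL(1)]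
        by (simp del: complex_cnj_complex_of_real)
    qed
    finally show "L2_inner \<Omega> (\<lambda>x. e x * u x) (?c (?d \<phi>)) = - L2_inner \<Omega> (\<lambda>x. e x * (g j x + \<i> * of_real (l $ j) * u x)) (?c \<phi>)" .
  qed
  then show ?thesis using euL ehL by (simp add: wgrad_def)
qed

section \<open>Translated discs\<close>

lemma integral_translate_ball:
  fixes F :: "real^2 \<Rightarrow> complex"
  assumes F: "integrable (lebesgue_on (ball 0 R)) F"
  shows "integrable (lebesgue_on (ball c R)) (\<lambda>x. F (x - c))"
    and "(LINT x|lebesgue_on (ball c R). F (x - c)) = (LINT x|lebesgue_on (ball 0 R). F x)"
proof -
  have d: "((\<lambda>z. z - cx c) has_field_derivative (\<lambda>_. 1) (cx x)) (at (cx x))" for x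
    by (auto intro!: derivative_eq_intros)
  have e: "vx (cx x - cx c) = x - c" for x by (metis cx_diff vx_cx)
  have T: "ball 0 R = (\<lambda>x. vx (cx x - cx c)) ` ball c R"
  proof (intro equalityI subsetI)
    fix y :: "real^2" assume "y \<in> ball 0 R"
    then have "y + c \<in> ball c R" by (simp add: dist_norm)
    moreover have "y = vx (cx (y + c) - cx c)" by (simp add: e)
    ultimately show "y \<in> (\<lambda>x. vx (cx x - cx c)) ` ball c R" by blast
  qed (auto simp: e dist_norm norm_minus_commute)
  have inj: "inj_on (\<lambda>z. z - cx c) (cx ` ball c R)" by (simp add: inj_on_def)
  note cc = conformal_change[OF open_ball d inj T]
  have iR: "integrable (lebesgue_on (ball c R)) (\<lambda>x. Re (F (x - c)))"
    using cc(1)[of "\<lambda>x. Re (F x)"] F by (simp add: e)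
  have iI: "integrable (lebesgue_on (ball c R)) (\<lambda>x. Im (F (x - c)))"
    using cc(1)[of "\<lambda>x. Im (F x)"] F by (simp add: e)
  have "integrable (lebesgue_on (ball c R)) (\<lambda>x. of_real (Re (F (x - c))) + \<i> * of_real (Im (F (x - c))))"
    by (intro Bochner_Integration.integrable_add integrable_mult_right integrable_of_real iR iI)
  then show "integrable (lebesgue_on (ball c R)) (\<lambda>x. F (x - c))" by (simp flip: complex_eq)
  show "(LINT x|lebesgue_on (ball c R). F (x - c)) = (LINT x|lebesgue_on (ball 0 R). F x)"
    using conformal_change_complex[OF open_ball d inj T _ F] by (simp add: e)
qed

text \<open>Integrals over translated balls agree, as a translation is a conformal map with derivative one.\<close>
lemma L2_translate_ball:
  assumes u: "u \<in> L2 (ball 0 R)"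
  shows "(\<lambda>x. u (x - c)) \<in> L2 (ball c R)"
    and "nrm2 (ball c R) (\<lambda>x. u (x - c)) = nrm2 (ball 0 R) u"
proof -
  have fin: "ball 0 R \<in> (lmeasurable :: (real^2) set set)" by simp
  note iu = integral_translate_ball[OF L2_integrable[OF fin u], of c]
  have i: "integrable (lebesgue_on (ball 0 R)) (\<lambda>x. complex_of_real ((cmod (u x))\<^sup>2))"
    using L2_integrable_sq[OF u] by (rule integrable_of_real)
  have "integrable (lebesgue_on (ball c R)) (\<lambda>x. complex_of_real ((cmod (u (x - c)))\<^sup>2))"
    using integral_translate_ball(1)[OF i] .
  then have "integrable (lebesgue_on (ball c R)) (\<lambda>x. (cmod (u (x - c)))\<^sup>2)"
    by (subst (asm) complex_of_real_integrable_eq)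
  then show "(\<lambda>x. u (x - c)) \<in> L2 (ball c R)"
    using borel_measurable_integrable[OF iu(1)] by (simp add: L2_def)
  show "nrm2 (ball c R) (\<lambda>x. u (x - c)) = nrm2 (ball 0 R) u"
    using integral_translate_ball(2)[OF i, of c] unfolding nrm2_def integral_complex_of_real of_real_eq_iff .
qed

lemma wgrad_translate_ball:
  assumes w: "wgrad (ball 0 R) u g"
  shows "wgrad (ball c R) (\<lambda>x. u (x - c)) (\<lambda>j x. g j (x - c))"
proof -
  have L: "u \<in> L2 (ball 0 R)" "g j \<in> L2 (ball 0 R)" for j using w by (auto simp: wgrad_def)
  note L' = L2_translate_ball(1)[OF L(1)] L2_translate_ball(1)[OF L(2)]
  have fin: "ball a R \<in> (lmeasurable :: (real^2) set set)" for a by simp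
  have "has_weak_partial (ball c R) j (\<lambda>x. u (x - c)) (\<lambda>x. g j (x - c))" for j
    unfolding has_weak_partial_inner[OF fin L']
  proof (intro allI impI)
    fix \<phi> assume t: "test_function (ball c R) \<phi>"
    define \<psi> where "\<psi> x = \<phi> (x + c)" for x
    have t': "test_function (ball 0 R) \<psi>" unfolding \<psi>_def[abs_def] by (rule test_function_translate[OF t])
    have d: "frechet_derivative \<psi> (at x) (axis j 1) = frechet_derivative \<phi> (at (x + c)) (axis j 1)" for x
      unfolding \<psi>_def[abs_def] using t by (intro smooth_on_translate(2)) (simp add: test_function_def)
    have sh: "L2_inner (ball c R) (\<lambda>x. h (x - c)) p = L2_inner (ball 0 R) h q"
      if "h \<in> L2 (ball 0 R)" "q \<in> L2 (ball 0 R)" "\<And>x. p x = q (x - c)" for h p q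
      unfolding L2_inner_def that(3) by (rule integral_translate_ball(2)[OF L2_prod_integrable[OF that(1,2)]])
    have "L2_inner (ball c R) (\<lambda>x. u (x - c)) (\<lambda>x. of_real (frechet_derivative \<phi> (at x) (axis j 1)))
      = L2_inner (ball 0 R) u (\<lambda>x. of_real (frechet_derivative \<psi> (at x) (axis j 1)))"
      by (rule sh[OF L(1) test_function_L2(2)[OF fin t']]) (simp add: d)
    also have "\<dots> = - L2_inner (ball 0 R) (g j) (\<lambda>x. of_real (\<psi> x))"
      using w t' has_weak_partial_inner[OF fin L] unfolding wgrad_def by blast
    also have "L2_inner (ball 0 R) (g j) (\<lambda>x. of_real (\<psi> x)) = L2_inner (ball c R) (\<lambda>x. g j (x - c)) (\<lambda>x. of_real (\<phi> x))"
      by (rule sh[OF L(2) test_function_L2(1)[OF fin t'], symmetric]) (simp add: \<psi>_def)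
    finally show "L2_inner (ball c R) (\<lambda>x. u (x - c)) (\<lambda>x. of_real (frechet_derivative \<phi> (at x) (axis j 1)))
      = - L2_inner (ball c R) (\<lambda>x. g j (x - c)) (\<lambda>x. of_real (\<phi> x))" .
  qed
  then show ?thesis using L' by (simp add: wgrad_def)
qed

text \<open>The bound on \<open>B\<close> depends on the Poincare constant and on the size of the vector potential, both fixed by \<open>\<Omega>\<close>.\<close>
lemma lambda1N_small_field:
  assumes op: "open \<Omega>" and bd: "bounded \<Omega>" and ne: "\<Omega> \<noteq> {}" and g: "poincare_set \<Omega> \<Omega>"
  shows "\<exists>b>0. \<forall>B\<in>{0<..<b}.
    (\<exists>u h. wgrad \<Omega> u h \<and> nrm2 \<Omega> u = 1 \<and> energy B \<Omega> u h = lambda1N B \<Omega>) \<and>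
    (\<forall>v h. wgrad \<Omega> v h \<longrightarrow> lambda1N B \<Omega> * nrm2 \<Omega> v \<le> energy B \<Omega> v h)"
proof -
  obtain P where P: "poincare \<Omega> P" by (rule poincare_set_imp_poincare[OF op bd g])
  obtain R where R: "R > 0" "\<And>x j. x \<in> \<Omega> \<Longrightarrow> \<bar>vec_potential x $ j\<bar> \<le> R"
    using vec_potential_bounded[OF bd] by blast
  define m where "m = 16 * R\<^sup>2 * \<bar>P\<bar>"
  define b where "b = 1 / (1 + m)"
  have c: "0 \<le> m" by (simp add: m_def)
  then have b: "b > 0" "b \<le> 1" unfolding b_def by (simp_all add: divide_le_eq_1)
  have "16 * (B\<^sup>2 * R\<^sup>2) * P \<le> 1" if B: "B \<in> {0<..<b}" for B
  proof -
    have "B\<^sup>2 \<le> b" using B b mult_mono[of B b B 1] by (simp add: power2_eq_square)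
    have "16 * (B\<^sup>2 * R\<^sup>2) * P \<le> B\<^sup>2 * m"
      using mult_left_mono[OF abs_ge_self[of P], of "B\<^sup>2 * (16 * R\<^sup>2)"] by (simp add: mult_ac m_def)
    also have "\<dots> \<le> b * m" using \<open>B\<^sup>2 \<le> b\<close> c by (rule mult_right_mono)
    also have "\<dots> \<le> 1" using c unfolding b_def by (simp add: divide_le_eq_1)
    finally show ?thesis .
  qed
  then show ?thesis using lambda1N_minimum[OF op bd ne P R] b by blast
qed

text \<open>Translating by \<open>c\<close> changes the vector potential by the constant vector \<open>A(c)\<close>, which is the gradient of a linear function and is compensated by a phase.\<close>
lemma lambda1N_translated_disc:
  assumes R: "R > 0"
  shows "\<exists>b>0. \<forall>B\<in>{0<..<b}. lambda1N B (ball c R) \<le> lambda1N B (ball 0 R)"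
proof -
  have gd: "poincare_set (ball a R) (ball a R)" for a :: "real^2" using R by (intro poincare_set_convex) auto
  have sm: "\<exists>b>0. \<forall>B\<in>{0<..<b}.
    (\<exists>u h. wgrad (ball a R) u h \<and> nrm2 (ball a R) u = 1 \<and> energy B (ball a R) u h = lambda1N B (ball a R)) \<and>
    (\<forall>v h. wgrad (ball a R) v h \<longrightarrow> lambda1N B (ball a R) * nrm2 (ball a R) v \<le> energy B (ball a R) v h)" for a :: "real^2"
    using R by (intro lambda1N_small_field gd) auto
  obtain b where b: "b > 0" "\<And>B. B \<in> {0<..<b} \<Longrightarrow> \<exists>u h. wgrad (ball 0 R) u h \<and> nrm2 (ball 0 R) u = 1 \<and> energy B (ball 0 R) u h = lambda1N B (ball 0 R)"
    using sm[of 0] by blast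
  obtain b' where b': "b' > 0" "\<And>B v h. B \<in> {0<..<b'} \<Longrightarrow> wgrad (ball c R) v h \<Longrightarrow> lambda1N B (ball c R) * nrm2 (ball c R) v \<le> energy B (ball c R) v h"
    using sm[of c] by blast
  have "lambda1N B (ball c R) \<le> lambda1N B (ball 0 R)" if B: "B \<in> {0<..<min b b'}" for B
  proof -
    obtain u g where u: "wgrad (ball 0 R) u g" "nrm2 (ball 0 R) u = 1" "energy B (ball 0 R) u g = lambda1N B (ball 0 R)"
      using b(2)[of B] B by auto
    \<comment> \<open>The phase has the constant gradient \<open>- B A(c)\<close>.\<close>
    define l where "l = - B *\<^sub>R vec_potential c"
    have ll: "l $ j = - B * vec_potential c $ j" for j by (simp add: l_def)
    define v where "v x = cis (x \<bullet> l) * u (x - c)" for x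
    define h where "h j x = cis (x \<bullet> l) * (g j (x - c) + \<i> * of_real (l $ j) * u (x - c))" for j x
    have w: "wgrad (ball c R) v h"
      unfolding v_def[abs_def] h_def[abs_def] by (rule wgrad_phase[OF _ wgrad_translate_ball[OF u(1)]]) simp
    have A: "vec_potential (x - c) $ j = vec_potential x $ j - vec_potential c $ j" for x j
      using exhaust_2[of j] by (auto simp: vec_potential_nth diff_divide_distrib)
    have uL: "u \<in> L2 (ball 0 R)" using u(1) by (simp add: wgrad_def)
    have mL: "magnetic_grad B g u j \<in> L2 (ball 0 R)" for j by (rule magnetic_grad_L2[OF bounded_ball u(1)])
    have "nrm2 (ball c R) v = nrm2 (ball c R) (\<lambda>x. u (x - c))"
      by (simp add: nrm2_def v_def norm_mult)
    then have nv: "nrm2 (ball c R) v = 1" by (simp add: L2_translate_ball(2)[OF uL] u(2))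
    have m: "magnetic_grad B h v j x = cis (x \<bullet> l) * magnetic_grad B g u j (x - c)" for j x
      unfolding magnetic_grad_def h_def v_def A ll by (simp add: algebra_simps)
    have "nrm2 (ball c R) (magnetic_grad B h v j) = nrm2 (ball c R) (\<lambda>x. magnetic_grad B g u j (x - c))" for j
      by (simp add: nrm2_def m norm_mult)
    then have "nrm2 (ball c R) (magnetic_grad B h v j) = nrm2 (ball 0 R) (magnetic_grad B g u j)" for j
      by (simp add: L2_translate_ball(2)[OF mL])
    then have "energy B (ball c R) v h = lambda1N B (ball 0 R)" using u(3) by (simp add: energy_def)
    then show ?thesis using b'(2)[OF _ w, of B] B nv by simp
  qed
  then show ?thesis using b(1) b'(1) by (intro exI[of _ "min b b'"]) auto
qed

section \<open>Approximation in the mean\<close>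

lemma nrm2_sqrt_triangle:
  assumes "f \<in> L2 \<Omega>" "g \<in> L2 \<Omega>"
  shows "sqrt (nrm2 \<Omega> (\<lambda>x. f x + g x)) \<le> sqrt (nrm2 \<Omega> f) + sqrt (nrm2 \<Omega> g)"
proof -
  have "Re (L2_inner \<Omega> f g) \<le> cmod (L2_inner \<Omega> f g)" by (rule complex_Re_le_cmod)
  also have "\<dots> \<le> sqrt (nrm2 \<Omega> f * nrm2 \<Omega> g)"
    using L2_Cauchy_Schwarz[OF assms] by (intro real_le_rsqrt) simp
  finally have "Re (L2_inner \<Omega> f g) \<le> sqrt (nrm2 \<Omega> f) * sqrt (nrm2 \<Omega> g)" by (simp add: real_sqrt_mult)
  then have "nrm2 \<Omega> (\<lambda>x. f x + g x) \<le> (sqrt (nrm2 \<Omega> f) + sqrt (nrm2 \<Omega> g))\<^sup>2"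
    using nrm2_add[OF assms] by (simp add: power2_sum)
  then show ?thesis by (intro real_le_lsqrt) auto
qed

text \<open>Apply Fatou's lemma to the functions \<open>2 \<bar>u\<^sub>n\<bar>\<^sup>2 + 2 \<bar>v\<bar>\<^sup>2 - \<bar>u\<^sub>n - v\<bar>\<^sup>2\<close>, which are nonnegative by the parallelogram law and converge to \<open>4 \<bar>v\<bar>\<^sup>2\<close>.\<close>
lemma L2_convergence_from_norms:
  fixes u :: "nat \<Rightarrow> real^2 \<Rightarrow> complex"
  assumes \<Omega>: "\<Omega> \<in> sets lebesgue" and u: "\<And>n. u n \<in> L2 \<Omega>" and v: "v \<in> L2 \<Omega>" and pos: "0 < nrm2 \<Omega> v"
    and lim: "\<And>x. x \<in> \<Omega> \<Longrightarrow> (\<lambda>n. u n x) \<longlonglongrightarrow> v x"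
    and W: "\<And>n. nrm2 \<Omega> (u n) \<le> W n" "W \<longlonglongrightarrow> nrm2 \<Omega> v"
  shows "(\<lambda>n. nrm2 \<Omega> (\<lambda>x. u n x - v x)) \<longlonglongrightarrow> 0"
proof -
  let ?V = "nrm2 \<Omega> v" let ?d = "\<lambda>n. nrm2 \<Omega> (\<lambda>x. u n x - v x)"
  define F where "F n x = 2 * (cmod (u n x))\<^sup>2 + 2 * (cmod (v x))\<^sup>2 - (cmod (u n x - v x))\<^sup>2" for n x
  note iu = L2_integrable_sq[OF u] and iv = L2_integrable_sq[OF v] and id = L2_integrable_sq[OF L2_diff[OF u v]]
  have F0: "0 \<le> F n x" for n x
  proof -
    have "(cmod (u n x - v x))\<^sup>2 \<le> (cmod (u n x) + cmod (v x))\<^sup>2" by (intro power_mono norm_triangle_ineq4) auto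
    also have "\<dots> \<le> 2 * (cmod (u n x))\<^sup>2 + 2 * (cmod (v x))\<^sup>2"
      using zero_le_power2[of "cmod (u n x) - cmod (v x)"] by (simp add: power2_eq_square algebra_simps)
    finally show ?thesis by (simp add: F_def)
  qed
  have iF: "integrable (lebesgue_on \<Omega>) (F n)" for n
    unfolding F_def[abs_def] using iu[of n] iv id[of n] by auto
  have IF: "(LINT x|lebesgue_on \<Omega>. F n x) = 2 * nrm2 \<Omega> (u n) + 2 * ?V - ?d n" for n
    unfolding F_def nrm2_def using iu[of n] iv id[of n] by simp
  have Flim: "(\<lambda>n. F n x) \<longlonglongrightarrow> 4 * (cmod (v x))\<^sup>2" if "x \<in> \<Omega>" for x
  proof -
    have "(\<lambda>n. F n x) \<longlonglongrightarrow> 2 * (cmod (v x))\<^sup>2 + 2 * (cmod (v x))\<^sup>2 - (cmod (v x - v x))\<^sup>2"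
      unfolding F_def by (intro tendsto_intros lim that)
    then show ?thesis by simp
  qed
  have liminf_F: "liminf (\<lambda>n. ennreal (F n x)) = ennreal (4 * (cmod (v x))\<^sup>2)" if "x \<in> \<Omega>" for x
    by (rule lim_imp_Liminf[OF sequentially_bot tendsto_ennrealI[OF Flim[OF that]]])
  have "ennreal (4 * ?V) = (\<integral>\<^sup>+x. ennreal (4 * (cmod (v x))\<^sup>2) \<partial>lebesgue_on \<Omega>)"
    unfolding nrm2_def using iv by (subst nn_integral_eq_integral) auto
  also have "\<dots> = (\<integral>\<^sup>+x. liminf (\<lambda>n. ennreal (F n x)) \<partial>lebesgue_on \<Omega>)"
    by (intro nn_integral_cong) (simp add: liminf_F space_restrict_space)
  also have "\<dots> \<le> liminf (\<lambda>n. \<integral>\<^sup>+x. ennreal (F n x) \<partial>lebesgue_on \<Omega>)"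
    by (rule nn_integral_liminf) (use borel_measurable_integrable[OF iF] in measurable)
  also have "(\<lambda>n. \<integral>\<^sup>+x. ennreal (F n x) \<partial>lebesgue_on \<Omega>) = (\<lambda>n. ennreal (2 * nrm2 \<Omega> (u n) + 2 * ?V - ?d n))"
    unfolding IF[symmetric] by (intro ext nn_integral_eq_integral iF AE_I2 F0)
  finally have fatou: "ennreal (4 * ?V) \<le> liminf (\<lambda>n. ennreal (2 * nrm2 \<Omega> (u n) + 2 * ?V - ?d n))" .
  show ?thesis
  proof (rule order_tendstoI)
    fix e :: real assume "e < 0"
    then have "e < ?d n" for n using nrm2_nonneg[of \<Omega> "\<lambda>x. u n x - v x"] by linarith
    then show "\<forall>\<^sub>F n in sequentially. e < ?d n" by simp
  next
    fix e :: real assume e: "0 < e"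
    have "ennreal (4 * ?V - e / 2) < ennreal (4 * ?V)" using e pos by (intro ennreal_lessI) auto
    then have "\<forall>\<^sub>F n in sequentially. ennreal (4 * ?V - e / 2) < ennreal (2 * nrm2 \<Omega> (u n) + 2 * ?V - ?d n)"
      using fatou unfolding le_Liminf_iff by blast
    moreover have "\<forall>\<^sub>F n in sequentially. W n < ?V + e / 4" using e by (intro order_tendstoD(2)[OF W(2)]) auto
    ultimately show "\<forall>\<^sub>F n in sequentially. ?d n < e"
    proof eventually_elim
      case (elim n)
      have "4 * ?V - e / 2 < 2 * nrm2 \<Omega> (u n) + 2 * ?V - ?d n"
        using elim(1) by (metis ennreal_less_iff ennreal_neg leI less_le_trans not_less_zero order_less_imp_le)
      then show ?case using elim(2) W(1)[of n] by linarith
    qed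
  qed
qed

lemma power_series_uniform:
  fixes b :: "nat \<Rightarrow> complex"
  assumes s: "\<And>w. w \<in> ball 0 1 \<Longrightarrow> (\<lambda>n. b n * w ^ n) sums F w" and r: "0 \<le> r" "r < 1" and e: "0 < e"
  shows "\<forall>\<^sub>F N in sequentially. \<forall>z\<in>cball 0 r. cmod ((\<Sum>n<N. b n * z ^ n) - F z) < e"
proof -
  define \<rho> where "\<rho> = (1 + r) / 2"
  have \<rho>: "r < \<rho>" "\<rho> < 1" using r by (auto simp: \<rho>_def)
  have "summable (\<lambda>n. b n * of_real \<rho> ^ n)" using s[of "of_real \<rho>"] \<rho> r by (auto simp: sums_iff)
  then have sm: "summable (\<lambda>n. norm (b n * of_real r ^ n))" by (rule powser_insidea) (use \<rho> r in auto)
  have "uniform_limit (cball 0 r) (\<lambda>N z. \<Sum>n<N. b n * z ^ n) (\<lambda>z. suminf (\<lambda>n. b n * z ^ n)) sequentially"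
    by (rule Weierstrass_m_test[OF _ sm]) (use r in \<open>auto simp: norm_mult norm_power intro!: mult_left_mono power_mono\<close>)
  moreover have "suminf (\<lambda>n. b n * z ^ n) = F z" if "z \<in> cball 0 r" for z
    using s[of z] that r by (auto simp: sums_iff)
  ultimately show ?thesis using e unfolding uniform_limit_iff by (auto simp: dist_norm elim!: eventually_mono)
qed

text \<open>The substitution \<open>z \<mapsto> r z\<close> turns the left side into the integral over the smaller disc.\<close>
lemma nrm2_dilation_le:
  assumes g: "(\<lambda>x. g (cx x)) \<in> L2 udisc" and r: "0 < r" "r \<le> 1"
  shows "nrm2 udisc (\<lambda>x. of_real r * g (of_real r * cx x)) \<le> nrm2 udisc (\<lambda>x. g (cx x))"
proof -
  have sub: "ball 0 r \<subseteq> udisc" using r by auto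
  have i: "integrable lebesgue (\<lambda>x. indicator udisc x *\<^sub>R (cmod (g (cx x)))\<^sup>2)"
    using L2_integrable_sq[OF g] by (subst (asm) integrable_restrict_space) auto
  have i': "integrable lebesgue (\<lambda>x. indicator (ball 0 r) x *\<^sub>R (cmod (g (cx x)))\<^sup>2)"
  proof (rule Bochner_Integration.integrable_bound[OF i])
    have "integrable lebesgue (\<lambda>x. indicator (ball 0 r) x *\<^sub>R (indicator udisc x *\<^sub>R (cmod (g (cx x)))\<^sup>2))"
      by (rule integrable_mult_indicator[OF _ i]) auto
    also have "(\<lambda>x. indicator (ball 0 r) x *\<^sub>R (indicator udisc x *\<^sub>R (cmod (g (cx x)))\<^sup>2)) = (\<lambda>x. indicator (ball 0 r) x *\<^sub>R (cmod (g (cx x)))\<^sup>2)"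
      using r by (intro ext) (simp add: indicator_def)
    finally show "(\<lambda>x. indicator (ball 0 r) x *\<^sub>R (cmod (g (cx x)))\<^sup>2) \<in> borel_measurable lebesgue"
      by (rule borel_measurable_integrable)
    show "AE x in lebesgue. norm (indicator (ball 0 r) x *\<^sub>R (cmod (g (cx x)))\<^sup>2) \<le> norm (indicator udisc x *\<^sub>R (cmod (g (cx x)))\<^sup>2)"
      using r by (intro AE_I2) (simp add: indicator_def)
  qed
  have ib: "integrable (lebesgue_on (ball 0 r)) (\<lambda>x. (cmod (g (cx x)))\<^sup>2)"
    by (subst integrable_restrict_space) (use i' in auto)
  have "nrm2 udisc (\<lambda>x. of_real r * g (of_real r * cx x))
     = (LINT x|lebesgue_on udisc. (cmod (of_real r))\<^sup>2 * (cmod (g (cx (vx (of_real r * cx x)))))\<^sup>2)"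
    unfolding nrm2_def by (simp add: norm_mult power_mult_distrib)
  also have "\<dots> = (LINT x|lebesgue_on (ball 0 r). (cmod (g (cx x)))\<^sup>2)"
  proof (rule conformal_change(2)[where f="\<lambda>z. of_real r * z", symmetric, OF open_ball _ _ _ _ ib])
    show "\<And>x. x \<in> udisc \<Longrightarrow> ((\<lambda>z. of_real r * z) has_field_derivative of_real r) (at (cx x))"
      by (auto intro!: derivative_eq_intros)
    show "inj_on (\<lambda>z. of_real r * z) (cx ` udisc)" using r by (auto simp: inj_on_def)
    show "ball 0 r = (\<lambda>x. vx (of_real r * cx x)) ` udisc" using scaling_image[OF r(1), of 1] by simp
  qed auto
  also have "\<dots> = (LINT x|lebesgue. indicator (ball 0 r) x *\<^sub>R (cmod (g (cx x)))\<^sup>2)"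
    by (rule integral_restrict_space) auto
  also have "\<dots> \<le> (LINT x|lebesgue. indicator udisc x *\<^sub>R (cmod (g (cx x)))\<^sup>2)"
    by (rule integral_mono[OF i' i]) (use r in \<open>simp add: indicator_def\<close>)
  also have "\<dots> = nrm2 udisc (\<lambda>x. g (cx x))"
    unfolding nrm2_def by (rule integral_restrict_space[symmetric]) auto
  finally show ?thesis .
qed

section \<open>The strict torsion inequality\<close>

definition taylor :: "(complex \<Rightarrow> complex) \<Rightarrow> nat \<Rightarrow> complex" where
  "taylor f n = (deriv ^^ n) f 0 / fact n"

lemma taylor_sums:
  assumes f: "f holomorphic_on ball 0 1" and w: "w \<in> ball 0 1"
  shows "(\<lambda>n. taylor f n * w ^ n) sums f w"
    and "(\<lambda>n. of_nat (Suc n) * taylor f (Suc n) * w ^ n) sums deriv f w"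
proof -
  show "(\<lambda>n. taylor f n * w ^ n) sums f w" using holomorphic_power_series[OF f w] by (simp add: taylor_def)
  have "taylor (deriv f) n = of_nat (Suc n) * taylor f (Suc n)" for n
    by (simp add: taylor_def funpow_Suc_right field_simps del: funpow.simps of_nat_Suc)
  then show "(\<lambda>n. of_nat (Suc n) * taylor f (Suc n) * w ^ n) sums deriv f w"
    using holomorphic_power_series[OF holomorphic_deriv[OF f open_ball] w] by (simp flip: taylor_def)
qed

text \<open>The power series of \<open>f\<close> and of its derivative converge uniformly on the closed disc of radius \<open>r < 1\<close>.\<close>
lemma taylor_polynomial_close:
  assumes f: "f holomorphic_on ball 0 1" and r: "0 < r" "r < 1" and e: "0 < e"
  shows "\<exists>N\<ge>m. \<forall>x\<in>udisc. cmod (disc_poly (\<lambda>n. taylor f n * of_real r ^ n) N x - f (of_real r * cx x)) \<le> e \<and>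
     cmod (disc_poly' (\<lambda>n. taylor f n * of_real r ^ n) N x - of_real r * deriv f (of_real r * cx x)) \<le> e"
proof -
  have r': "0 \<le> r" "r < 1" using r by auto
  obtain N1 where N1: "\<And>N z. N \<ge> N1 \<Longrightarrow> z \<in> cball 0 r \<Longrightarrow> cmod ((\<Sum>n<N. taylor f n * z ^ n) - f z) < e"
    using power_series_uniform[OF taylor_sums(1)[OF f] r' e] unfolding eventually_sequentially by blast
  obtain N2 where N2: "\<And>N z. N \<ge> N2 \<Longrightarrow> z \<in> cball 0 r \<Longrightarrow> cmod ((\<Sum>n<N. of_nat (Suc n) * taylor f (Suc n) * z ^ n) - deriv f z) < e"
    using power_series_uniform[OF taylor_sums(2)[OF f] r' e] unfolding eventually_sequentially by blast
  define N where "N = max m (max N1 N2)"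
  have Nle: "N1 \<le> Suc N" "N2 \<le> N" "m \<le> N" by (auto simp: N_def)
  show ?thesis
  proof (intro exI[of _ N] conjI ballI)
    fix x :: "real^2" assume x: "x \<in> udisc"
    let ?z = "of_real r * cx x"
    have z: "?z \<in> cball 0 r" using x r by (simp add: norm_mult mult_left_le)
    have "disc_poly (\<lambda>n. taylor f n * of_real r ^ n) N x = (\<Sum>n<Suc N. taylor f n * ?z ^ n)"
      unfolding disc_poly_def lessThan_Suc_atMost by (simp add: mon_def power_mult_distrib mult.assoc)
    then show "cmod (disc_poly (\<lambda>n. taylor f n * of_real r ^ n) N x - f ?z) \<le> e"
      using N1[OF Nle(1) z] by simp
    have "disc_poly' (\<lambda>n. taylor f n * of_real r ^ n) N x = of_real r * (\<Sum>n<N. of_nat (Suc n) * taylor f (Suc n) * ?z ^ n)"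
      unfolding disc_poly'_def sum.atMost_shift sum_distrib_left
      by (simp add: mon_def power_mult_distrib mult_ac del: of_nat_Suc)
    then have "cmod (disc_poly' (\<lambda>n. taylor f n * of_real r ^ n) N x - of_real r * deriv f ?z)
      = r * cmod ((\<Sum>n<N. of_nat (Suc n) * taylor f (Suc n) * ?z ^ n) - deriv f ?z)"
      using r by (simp add: norm_mult flip: right_diff_distrib del: of_nat_Suc)
    also have "\<dots> \<le> 1 * e" using N2[OF Nle(2) z] r e by (intro mult_mono) auto
    finally show "cmod (disc_poly' (\<lambda>n. taylor f n * of_real r ^ n) N x - of_real r * deriv f ?z) \<le> e" by simp
  qed (rule Nle(3))
qed

lemma nrm2_le_of_bound:
  assumes "(h :: real^2 \<Rightarrow> complex) \<in> borel_measurable (lebesgue_on udisc)" "\<And>x. x \<in> udisc \<Longrightarrow> cmod (h x) \<le> K"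
  shows "nrm2 udisc h \<le> K\<^sup>2 * pi"
proof -
  have fin: "udisc \<in> lmeasurable" by simp
  show ?thesis using nrm2_bounded_mult[OF L2_const(1)[OF fin, of 1] assms] L2_const(2)[OF fin, of 1] measure_ball2[of 1 0]
    by simp
qed

text \<open>Apply the inequality for polynomials to Taylor polynomials of the dilations \<open>z \<mapsto> f(r z)\<close> and let \<open>r\<close> tend to 1. The dilations are needed because the Taylor polynomials of \<open>f\<close> itself need not be uniformly bounded. The gap depends on three or four fixed Taylor coefficients only, and it survives the limit.\<close>
lemma strict_torsion_bound:
  fixes f :: "complex \<Rightarrow> complex"
  assumes f: "f holomorphic_on ball 0 1" and M: "\<And>z. z \<in> ball 0 1 \<Longrightarrow> cmod (f z) \<le> M"
    and L: "(\<lambda>x. deriv f (cx x)) \<in> L2 udisc" and pos: "0 < nrm2 udisc (\<lambda>x. deriv f (cx x))"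
    and n0: "4 \<le> n0" and D: "taylor f 1 * taylor f (n0 - 1) \<noteq> taylor f 2 * taylor f (n0 - 2)"
  shows "\<exists>b N. nrm2 udisc (\<lambda>x. cnj (f (cx x)) * deriv f (cx x) - bergman_proj b N x) < (nrm2 udisc (\<lambda>x. deriv f (cx x)))\<^sup>2 / (2 * pi)"
proof -
  let ?V = "nrm2 udisc (\<lambda>x. deriv f (cx x))"
  define F where "F x = f (cx x)" for x
  define F' where "F' x = deriv f (cx x)" for x
  have hd: "deriv f holomorphic_on ball 0 1" by (rule holomorphic_deriv[OF f open_ball])
  have cf: "continuous_on (ball 0 1) f" and cd: "continuous_on (ball 0 1) (deriv f)"
    using f hd by (auto intro: holomorphic_on_imp_continuous_on)
  define \<epsilon> where "\<epsilon> j = inverse (real (Suc j))" for j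
  define r where "r j = 1 - \<epsilon> (Suc j)" for j
  have \<epsilon>0: "\<epsilon> j > 0" "\<epsilon> j \<le> 1" "\<epsilon> (Suc j) < 1" for j by (auto simp: \<epsilon>_def divide_simps)
  have r: "0 < r j" "r j < 1" for j using \<epsilon>0[of "Suc j"] \<epsilon>0(3)[of j] by (auto simp: r_def)
  have \<epsilon>: "\<epsilon> \<longlonglongrightarrow> 0" unfolding \<epsilon>_def by (rule LIMSEQ_inverse_real_of_nat)
  have "r \<longlonglongrightarrow> 1 - 0" unfolding r_def[abs_def] by (intro tendsto_diff tendsto_const LIMSEQ_Suc[OF \<epsilon>])
  then have r1: "r \<longlonglongrightarrow> 1" by simp
  define b where "b j n = taylor f n * of_real (r j) ^ n" for j n
  have "\<forall>j. \<exists>N. N \<ge> n0 \<and> (\<forall>x\<in>udisc. cmod (disc_poly (b j) N x - f (of_real (r j) * cx x)) \<le> \<epsilon> j \<and>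
     cmod (disc_poly' (b j) N x - of_real (r j) * deriv f (of_real (r j) * cx x)) \<le> \<epsilon> j)"
    unfolding b_def[abs_def] using taylor_polynomial_close[OF f r \<epsilon>0(1)] by blast
  then obtain N where N: "\<And>j. N j \<ge> n0"
    "\<And>j x. x \<in> udisc \<Longrightarrow> cmod (disc_poly (b j) (N j) x - f (of_real (r j) * cx x)) \<le> \<epsilon> j"
    "\<And>j x. x \<in> udisc \<Longrightarrow> cmod (disc_poly' (b j) (N j) x - of_real (r j) * deriv f (of_real (r j) * cx x)) \<le> \<epsilon> j"
    using choice[of "\<lambda>j N. N \<ge> n0 \<and> (\<forall>x\<in>udisc. cmod (disc_poly (b j) N x - f (of_real (r j) * cx x)) \<le> \<epsilon> j \<and>
     cmod (disc_poly' (b j) N x - of_real (r j) * deriv f (of_real (r j) * cx x)) \<le> \<epsilon> j)"] by blast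
  define P where "P j = disc_poly (b j) (N j)" for j
  define P' where "P' j = disc_poly' (b j) (N j)" for j
  define g where "g j x = of_real (r j) * deriv f (of_real (r j) * cx x)" for j x
  have rz: "of_real (r j) * cx x \<in> ball 0 1" if "x \<in> udisc" for j x
    using that r[of j] mult_strict_mono[of "r j" 1 "norm x" 1] by (auto simp: norm_mult)
  have cg: "continuous_on udisc (g j)" for j
    unfolding g_def using rz by (intro continuous_intros continuous_on_compose2[OF cd]) auto
  have mc: "h \<in> borel_measurable (lebesgue_on udisc)" if "continuous_on udisc h" for h :: "real^2 \<Rightarrow> complex"
    using that by (intro continuous_imp_measurable_on_sets_lebesgue) auto
  have PL: "P j \<in> L2 udisc" "P' j \<in> L2 udisc" for j unfolding P_def P'_def by (rule disc_poly_L2)+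
  have Pc: "continuous_on udisc (P j)" "continuous_on udisc (P' j)" for j unfolding P_def P'_def by (rule disc_poly_continuous)+
  have dc: "continuous_on udisc (\<lambda>x. P' j x - g j x)" for j by (intro continuous_intros Pc cg)
  have db: "cmod (P' j x - g j x) \<le> \<epsilon> j" if "x \<in> udisc" for j x using N(3)[OF that, of j] by (simp add: P'_def g_def)
  have dL: "(\<lambda>x. P' j x - g j x) \<in> L2 udisc" for j
    by (rule continuous_bounded_L2[OF open_ball bounded_ball dc db])
  have gL: "g j \<in> L2 udisc" for j using L2_diff[OF PL(2)[of j] dL[of j]] by simp
  have gV: "nrm2 udisc (g j) \<le> ?V" for j
    unfolding g_def[abs_def] by (rule nrm2_dilation_le[OF L]) (use r[of j] in auto)
  \<comment> \<open>An upper bound for the squared norm of the derivative that tends to \<open>V\<close>.\<close>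
  define W where "W j = (sqrt ?V + sqrt ((\<epsilon> j)\<^sup>2 * pi))\<^sup>2" for j
  have PW: "nrm2 udisc (P' j) \<le> W j" for j
  proof -
    have "sqrt (nrm2 udisc (P' j)) \<le> sqrt (nrm2 udisc (g j)) + sqrt (nrm2 udisc (\<lambda>x. P' j x - g j x))"
      using nrm2_sqrt_triangle[OF gL[of j] dL[of j]] by simp
    also have "\<dots> \<le> sqrt ?V + sqrt ((\<epsilon> j)\<^sup>2 * pi)"
      by (intro add_mono real_sqrt_le_mono gV nrm2_le_of_bound mc dc db)
    finally have "(sqrt (nrm2 udisc (P' j)))\<^sup>2 \<le> W j" unfolding W_def by (intro power_mono) auto
    then show ?thesis by simp
  qed
  have "W \<longlonglongrightarrow> (sqrt ?V + sqrt (0\<^sup>2 * pi))\<^sup>2" unfolding W_def[abs_def] by (intro tendsto_intros \<epsilon>)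
  then have W: "W \<longlonglongrightarrow> ?V" by simp
  have conv: "(\<lambda>j. h (of_real (r j) * cx x)) \<longlonglongrightarrow> h (cx x)" if "continuous_on (ball 0 1) h" "x \<in> udisc" for h :: "complex \<Rightarrow> complex" and x
  proof (rule continuous_on_tendsto_compose[OF that(1)])
    have "(\<lambda>j. of_real (r j) * cx x) \<longlonglongrightarrow> of_real 1 * cx x" by (intro tendsto_intros r1)
    then show "(\<lambda>j. of_real (r j) * cx x) \<longlonglongrightarrow> cx x" by simp
  qed (use that rz in auto)
  have close: "u \<longlonglongrightarrow> l" if "\<And>j. cmod (u j - v j) \<le> \<epsilon> j" "v \<longlonglongrightarrow> l" for u v :: "nat \<Rightarrow> complex" and l
  proof -
    have "(\<lambda>j. u j - v j) \<longlonglongrightarrow> 0" by (rule Lim_null_comparison[OF _ \<epsilon>]) (use that in simp)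
    from tendsto_add[OF this that(2)] show ?thesis by simp
  qed
  have P1: "(\<lambda>j. P j x) \<longlonglongrightarrow> F x" if "x \<in> udisc" for x
    using close[of "\<lambda>j. P j x", OF _ conv[OF cf that]] N(2)[OF that] by (simp add: P_def F_def)
  have "(\<lambda>j. g j x) \<longlonglongrightarrow> of_real 1 * F' x" if "x \<in> udisc" for x
    unfolding g_def F'_def by (intro tendsto_intros r1 conv[OF cd that])
  then have P2: "(\<lambda>j. P' j x) \<longlonglongrightarrow> F' x" if "x \<in> udisc" for x
    using close[of "\<lambda>j. P' j x" "\<lambda>j. g j x"] db that by simp
  have L': "F' \<in> L2 udisc" using L by (simp add: F'_def[abs_def])
  have V: "nrm2 udisc F' = ?V" by (simp add: F'_def[abs_def])
  have d0: "(\<lambda>j. nrm2 udisc (\<lambda>x. P' j x - F' x)) \<longlonglongrightarrow> 0"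
    by (rule L2_convergence_from_norms[OF _ PL(2) L' _ P2 PW]) (use pos W V in auto)
  have cF: "continuous_on udisc F" and cF': "continuous_on udisc F'"
    unfolding F_def[abs_def] F'_def[abs_def]
    by (rule continuous_on_compose2[OF cf] continuous_on_compose2[OF cd]; auto intro!: continuous_intros)+
  have Mb: "cmod (F x) \<le> M" if "x \<in> udisc" for x using M[of "cx x"] that by (simp add: F_def)
  have Pb: "cmod (P j x) \<le> M + 1" if "x \<in> udisc" for j x
  proof -
    have "cmod (P j x) \<le> cmod (P j x - f (of_real (r j) * cx x)) + cmod (f (of_real (r j) * cx x))"
      using norm_triangle_ineq[of "P j x - f (of_real (r j) * cx x)" "f (of_real (r j) * cx x)"] by simp
    then show ?thesis using N(2)[OF that, of j] \<epsilon>0(2)[of j] M[OF rz[OF that, of j]] by (simp add: P_def)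
  qed
  \<comment> \<open>The error of replacing \<open>cnj F \<cdot> F\'\<close> by \<open>cnj P \<cdot> P\'\<close>, one factor at a time.\<close>
  define T where "T j x = cnj (F x - P j x) * F' x" for j x
  define U where "U j x = cnj (P j x) * (F' x - P' j x)" for j x
  have Tb: "cmod (cnj (F x - P j x)) \<le> 2 * M + 1" if "x \<in> udisc" for j x
  proof -
    have "cmod (cnj (F x - P j x)) \<le> cmod (F x) + cmod (P j x)" by (simp only: complex_mod_cnj norm_triangle_ineq4)
    then show ?thesis using Mb[OF that] Pb[OF that, of j] by linarith
  qed
  have TL: "T j \<in> L2 udisc" for j
    unfolding T_def[abs_def] by (rule L2_bounded_mult[OF L' mc Tb]) (intro continuous_intros cF Pc)+
  have UL: "U j \<in> L2 udisc" for j
    unfolding U_def[abs_def] by (rule L2_bounded_mult[OF L2_diff[OF L' PL(2)] mc, of _ "M + 1"]) (use Pb in \<open>auto intro!: continuous_intros Pc\<close>)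
  have T0: "(\<lambda>j. nrm2 udisc (T j)) \<longlonglongrightarrow> 0"
  proof -
    have "(\<lambda>j. LINT x|lebesgue_on udisc. (cmod (T j x))\<^sup>2) \<longlonglongrightarrow> (LINT x|lebesgue_on udisc. (0::real))"
    proof (rule integral_dominated_convergence[where w="\<lambda>x. (2 * M + 1)\<^sup>2 * (cmod (F' x))\<^sup>2"])
      show "(\<lambda>x. (cmod (T j x))\<^sup>2) \<in> borel_measurable (lebesgue_on udisc)" for j
        by (rule borel_measurable_integrable[OF L2_integrable_sq[OF TL]])
      show "integrable (lebesgue_on udisc) (\<lambda>x. (2 * M + 1)\<^sup>2 * (cmod (F' x))\<^sup>2)"
        by (intro integrable_mult_right L2_integrable_sq[OF L'])
      show "AE x in lebesgue_on udisc. (\<lambda>j. (cmod (T j x))\<^sup>2) \<longlonglongrightarrow> 0"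
      proof (rule AE_I2)
        fix x :: "real^2" assume "x \<in> space (lebesgue_on udisc)"
        then have "x \<in> udisc" by (simp add: space_restrict_space)
        then have "(\<lambda>j. (cmod (T j x))\<^sup>2) \<longlonglongrightarrow> (cmod (cnj (F x - F x) * F' x))\<^sup>2"
          unfolding T_def by (intro tendsto_intros P1)
        then show "(\<lambda>j. (cmod (T j x))\<^sup>2) \<longlonglongrightarrow> 0" by simp
      qed
      show "AE x in lebesgue_on udisc. norm ((cmod (T j x))\<^sup>2) \<le> (2 * M + 1)\<^sup>2 * (cmod (F' x))\<^sup>2" for j
      proof (rule AE_I2)
        fix x :: "real^2" assume "x \<in> space (lebesgue_on udisc)"
        then have "x \<in> udisc" by (simp add: space_restrict_space)
        then have "(cmod (cnj (F x - P j x)))\<^sup>2 \<le> (2 * M + 1)\<^sup>2" by (intro power_mono Tb) auto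
        then show "norm ((cmod (T j x))\<^sup>2) \<le> (2 * M + 1)\<^sup>2 * (cmod (F' x))\<^sup>2"
          unfolding T_def norm_mult power_mult_distrib by (simp add: mult_right_mono)
      qed
    qed simp
    then show ?thesis by (simp add: nrm2_def)
  qed
  have Ub: "nrm2 udisc (U j) \<le> (M + 1)\<^sup>2 * nrm2 udisc (\<lambda>x. P' j x - F' x)" for j
    unfolding U_def[abs_def] nrm2_diff_commute[of _ "P' j"]
    by (rule nrm2_bounded_mult[OF L2_diff[OF L' PL(2)] mc]) (use Pb in \<open>auto intro!: continuous_intros Pc\<close>)
  define \<delta> where "\<delta> = (cmod (taylor f 1 * taylor f (n0 - 1) - taylor f 2 * taylor f (n0 - 2)))\<^sup>2"
  have \<delta>: "\<delta> > 0" using D by (simp add: \<delta>_def)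
  define E where "E j x = cnj (P j x) * P' j x - bergman_proj (b j) (N j) x" for j x
  have EL: "E j \<in> L2 udisc" for j unfolding E_def P_def P'_def by (intro L2_diff disc_poly_L2)
  have Eb: "nrm2 udisc (E j) \<le> (W j)\<^sup>2 / (2 * pi) - (pi / 2) * (((r j) ^ n0)\<^sup>2 * \<delta>)" for j
  proof -
    have "1 \<le> n0" "2 \<le> n0" using n0 by auto
    then have p: "(of_real (r j) :: complex) ^ 1 * of_real (r j) ^ (n0 - 1) = of_real (r j) ^ n0"
      "(of_real (r j) :: complex) ^ 2 * of_real (r j) ^ (n0 - 2) = of_real (r j) ^ n0"
      by (simp_all only: power_add[symmetric] le_add_diff_inverse)
    have "b j 1 * b j (n0 - 1) = of_real (r j) ^ n0 * (taylor f 1 * taylor f (n0 - 1))"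
      unfolding b_def p(1)[symmetric] by (simp only: mult_ac)
    moreover have "b j 2 * b j (n0 - 2) = of_real (r j) ^ n0 * (taylor f 2 * taylor f (n0 - 2))"
      unfolding b_def p(2)[symmetric] by (simp only: mult_ac)
    ultimately have "b j 1 * b j (n0 - 1) - b j 2 * b j (n0 - 2) = of_real ((r j) ^ n0) * (taylor f 1 * taylor f (n0 - 1) - taylor f 2 * taylor f (n0 - 2))"
      by (simp only: of_real_power right_diff_distrib)
    then have "(cmod (b j 1 * b j (n0 - 1) - b j 2 * b j (n0 - 2)))\<^sup>2 = ((r j) ^ n0)\<^sup>2 * \<delta>"
      by (simp only: norm_mult norm_of_real power_mult_distrib power2_abs \<delta>_def)
    moreover have "(nrm2 udisc (P' j))\<^sup>2 \<le> (W j)\<^sup>2" using PW[of j] by (intro power_mono) auto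
    ultimately show ?thesis
      using polynomial_torsion_bound[OF n0 N(1)[of j], of "b j"] divide_right_mono[of "(nrm2 udisc (P' j))\<^sup>2" "(W j)\<^sup>2" "2 * pi"]
      unfolding E_def P_def P'_def by simp
  qed
  define q where "q j x = cnj (F x) * F' x - bergman_proj (b j) (N j) x" for j x
  have qe: "q j x = E j x + (T j x + U j x)" for j x by (simp add: q_def E_def T_def U_def algebra_simps)
  define B where "B j = sqrt ((W j)\<^sup>2 / (2 * pi) - (pi / 2) * (((r j) ^ n0)\<^sup>2 * \<delta>)) + (sqrt (nrm2 udisc (T j)) + sqrt ((M + 1)\<^sup>2 * nrm2 udisc (\<lambda>x. P' j x - F' x)))" for j
  have qB: "sqrt (nrm2 udisc (q j)) \<le> B j" for j
  proof -
    have "sqrt (nrm2 udisc (q j)) \<le> sqrt (nrm2 udisc (E j)) + sqrt (nrm2 udisc (\<lambda>x. T j x + U j x))"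
      unfolding qe[abs_def] by (rule nrm2_sqrt_triangle[OF EL L2_add[OF TL UL]])
    also have "\<dots> \<le> sqrt (nrm2 udisc (E j)) + (sqrt (nrm2 udisc (T j)) + sqrt (nrm2 udisc (U j)))"
      using nrm2_sqrt_triangle[OF TL[of j] UL[of j]] by simp
    also have "\<dots> \<le> B j" unfolding B_def by (intro add_mono real_sqrt_le_mono Eb Ub order_refl)
    finally show ?thesis .
  qed
  have "B \<longlonglongrightarrow> sqrt (?V\<^sup>2 / (2 * pi) - (pi / 2) * ((1 ^ n0)\<^sup>2 * \<delta>)) + (sqrt 0 + sqrt ((M + 1)\<^sup>2 * 0))"
    unfolding B_def[abs_def] by (intro tendsto_intros W r1 T0 d0) simp_all
  moreover have "sqrt (?V\<^sup>2 / (2 * pi) - (pi / 2) * ((1 ^ n0)\<^sup>2 * \<delta>)) + (sqrt 0 + sqrt ((M + 1)\<^sup>2 * 0)) < sqrt (?V\<^sup>2 / (2 * pi))"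
    using \<delta> by simp
  ultimately have "\<forall>\<^sub>F j in sequentially. B j < sqrt (?V\<^sup>2 / (2 * pi))" by (rule order_tendstoD(2))
  then obtain j where "B j < sqrt (?V\<^sup>2 / (2 * pi))" by (auto simp: eventually_sequentially)
  then have "sqrt (nrm2 udisc (q j)) < sqrt (?V\<^sup>2 / (2 * pi))" using qB[of j] by linarith
  then have "nrm2 udisc (q j) < ?V\<^sup>2 / (2 * pi)" by (rule real_sqrt_less_iff[THEN iffD1])
  then show ?thesis unfolding q_def[abs_def] F_def F'_def by blast
qed

section \<open>The equality case and the comparison\<close>

lemma blaschke_identity:
  "(cmod (1 - \<rho> * z))\<^sup>2 - (cmod (z - cnj \<rho>))\<^sup>2 = (1 - (cmod z)\<^sup>2) * (1 - (cmod \<rho>)\<^sup>2)"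
  unfolding cmod_power2 by (simp add: power2_eq_square algebra_simps)

text \<open>Both claims say that \<open>\<bar>z - cnj \<rho>\<bar> < \<bar>1 - \<rho> z\<bar>\<close>, which the identity above shows.\<close>
lemma blaschke_maps_disc:
  assumes \<rho>: "cmod \<rho> < 1" and z: "cmod z < 1"
  shows "cmod (1 - \<rho> * z) > 0" "cmod ((z - cnj \<rho>) / (1 - \<rho> * z)) < 1"
proof -
  have "(cmod z)\<^sup>2 < 1" "(cmod \<rho>)\<^sup>2 < 1" using z \<rho> by (simp_all add: power_less_one_iff abs_square_less_1)
  then have "0 < (1 - (cmod z)\<^sup>2) * (1 - (cmod \<rho>)\<^sup>2)" by simp
  then have lt: "(cmod (z - cnj \<rho>))\<^sup>2 < (cmod (1 - \<rho> * z))\<^sup>2" using blaschke_identity[of \<rho> z] by linarith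
  then have l: "cmod (z - cnj \<rho>) < cmod (1 - \<rho> * z)" by (rule power2_less_imp_less) simp
  then show p: "cmod (1 - \<rho> * z) > 0" using norm_ge_zero[of "z - cnj \<rho>"] by linarith
  show "cmod ((z - cnj \<rho>) / (1 - \<rho> * z)) < 1" using l p by (simp add: norm_divide)
qed

text \<open>The relations make \<open>a\<^sub>n\<^sub>+\<^sub>1 = \<rho> a\<^sub>n\<close> for \<open>n \<ge> 1\<close>, so that \<open>(f(z) - a\<^sub>0)(1 - \<rho> z) = a\<^sub>1 z\<close>. As \<open>f\<close> is bounded, the pole \<open>1/\<rho>\<close> lies outside the closed disc. After an affine map, \<open>f\<close> is then the automorphism \<open>z \<mapsto> (z - cnj \<rho>)/(1 - \<rho> z)\<close> of the disc.\<close>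
lemma geometric_taylor_imp_disc:
  assumes f: "f holomorphic_on ball 0 1" and M: "\<And>z. z \<in> ball 0 1 \<Longrightarrow> cmod (f z) \<le> M"
    and a1: "taylor f 1 \<noteq> 0"
    and eq: "\<And>n. 4 \<le> n \<Longrightarrow> taylor f 1 * taylor f (n - 1) = taylor f 2 * taylor f (n - 2)"
  shows "\<exists>c R. 0 < R \<and> f ` ball 0 1 = ball c R"
proof -
  define a where "a = taylor f"
  define \<rho> where "\<rho> = a 2 / a 1"
  have a1': "a 1 \<noteq> 0" using a1 by (simp add: a_def)
  have rec: "a (n + 2) = \<rho> * a (n + 1)" for n
  proof (cases n)
    case 0 then show ?thesis using a1' by (simp add: \<rho>_def numeral_2_eq_2)
  next
    case (Suc m) then show ?thesis using eq[of "n + 3"] a1' by (simp add: \<rho>_def a_def field_simps numeral_eq_Suc)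
  qed
  have key: "(f z - a 0) * (1 - \<rho> * z) = a 1 * z" if z: "z \<in> ball 0 1" for z
  proof -
    have s0: "(\<lambda>n. a n * z ^ n) sums f z" unfolding a_def by (rule taylor_sums(1)[OF f z])
    have s1: "(\<lambda>n. a (Suc n) * z ^ Suc n) sums (f z - a 0)"
      using s0 by (subst sums_Suc_iff) simp
    then have s2: "(\<lambda>n. a (Suc (Suc n)) * z ^ Suc (Suc n)) sums (f z - a 0 - a 1 * z)"
      by (subst sums_Suc_iff) simp
    have "(\<lambda>n. (\<rho> * z) * (a (Suc n) * z ^ Suc n)) sums ((\<rho> * z) * (f z - a 0))" by (rule sums_mult[OF s1])
    moreover have "(\<rho> * z) * (a (Suc n) * z ^ Suc n) = a (Suc (Suc n)) * z ^ Suc (Suc n)" for n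
      using rec[of n] by (simp add: mult_ac)
    ultimately have "(\<rho> * z) * (f z - a 0) = f z - a 0 - a 1 * z" using s2 by (simp only: sums_unique2)
    then show ?thesis by (simp add: algebra_simps)
  qed
  have \<rho>: "cmod \<rho> < 1"
  proof (rule ccontr)
    assume ge: "\<not> cmod \<rho> < 1"
    then have \<rho>0: "\<rho> \<noteq> 0" by auto
    have "cmod (f 0) \<le> M" by (rule M) simp
    then have M0: "M \<ge> 0" using norm_ge_zero[of "f 0"] by linarith
    \<comment> \<open>Chosen so that at \<open>t/\<rho>\<close>, where \<open>t/(1 - t) = K\<close>, the value of \<open>f\<close> would differ from \<open>a\<^sub>0\<close> by more than \<open>2 M\<close>.\<close>
    define K where "K = 2 * M * cmod \<rho> / cmod (a 1) + 1"
    have K: "K > 0" using M0 a1' by (auto simp: K_def intro!: add_nonneg_pos)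
    define t where "t = K / (1 + K)"
    have t: "0 < t" "t < 1" "t = K * (1 - t)" using K by (auto simp: t_def field_simps)
    define z where "z = of_real t / \<rho>"
    have "cmod z = t / cmod \<rho>" using t by (simp add: z_def norm_divide)
    also have "\<dots> \<le> t" using ge t by (simp add: divide_le_eq mult_le_cancel_left1)
    finally have z: "z \<in> ball 0 1" using t by simp
    have "(f z - a 0) * of_real (1 - t) = a 1 * z" using key[OF z] \<rho>0 by (simp add: z_def)
    then have "cmod (f z - a 0) * (1 - t) = cmod (a 1) * (t / cmod \<rho>)"
      using t \<open>cmod z = t / cmod \<rho>\<close> by (metis norm_mult norm_of_real abs_of_nonneg diff_ge_0_iff_ge less_imp_le)
    also have "\<dots> = cmod (a 1) * K / cmod \<rho> * (1 - t)" using t(3) by (simp add: mult_ac)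
    finally have "cmod (f z - a 0) * (1 - t) = cmod (a 1) * K / cmod \<rho> * (1 - t)" .
    moreover have "1 - t \<noteq> 0" using t(2) by simp
    ultimately have e: "cmod (f z - a 0) = cmod (a 1) * K / cmod \<rho>" by (rule mult_right_cancel[THEN iffD1, rotated])
    have "a 0 = f 0" by (simp add: a_def taylor_def)
    then have "cmod (f z - a 0) \<le> 2 * M"
      using norm_triangle_ineq4[of "f z" "f 0"] M[OF z] \<open>cmod (f 0) \<le> M\<close> by simp
    moreover have "cmod (a 1) * K / cmod \<rho> = 2 * M + cmod (a 1) / cmod \<rho>"
      using a1' \<rho>0 by (simp add: K_def field_simps)
    moreover have "cmod (a 1) / cmod \<rho> > 0" using a1' \<rho>0 by simp
    ultimately show False using e by linarith
  qed
  define s where "s = 1 - (cmod \<rho>)\<^sup>2"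
  have s: "s > 0" using \<rho> by (simp add: s_def power_less_one_iff abs_square_less_1)
  have s': "complex_of_real s = 1 - \<rho> * cnj \<rho>" by (simp add: s_def complex_norm_square[symmetric])
  define c where "c = a 0 + a 1 * cnj \<rho> / of_real s"
  define R where "R = cmod (a 1) / s"
  have R: "R > 0" using s a1' by (simp add: R_def)
  have fz: "f z = c + a 1 / of_real s * ((z - cnj \<rho>) / (1 - \<rho> * z))" if z: "z \<in> ball 0 1" for z
  proof -
    have n: "1 - \<rho> * z \<noteq> 0" using blaschke_maps_disc(1)[OF \<rho>, of z] z by auto
    have sn: "complex_of_real s \<noteq> 0" using s by simp
    have "f z = a 0 + a 1 * z / (1 - \<rho> * z)" using key[OF z] n by (simp add: field_simps)
    moreover have "z / (1 - \<rho> * z) = cnj \<rho> / of_real s + (z - cnj \<rho>) / (of_real s * (1 - \<rho> * z))"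
    proof -
      have "cnj \<rho> / of_real s + (z - cnj \<rho>) / (of_real s * (1 - \<rho> * z)) = (cnj \<rho> * (1 - \<rho> * z) + (z - cnj \<rho>)) / (of_real s * (1 - \<rho> * z))"
        using n sn by (simp add: add_divide_distrib)
      also have "cnj \<rho> * (1 - \<rho> * z) + (z - cnj \<rho>) = of_real s * z" unfolding s' by (simp add: algebra_simps)
      finally show ?thesis using sn by simp
    qed
    ultimately show ?thesis unfolding c_def by (simp add: distrib_left flip: times_divide_eq_right)
  qed
  have "f ` ball 0 1 = ball c R"
  proof (intro equalityI subsetI)
    fix w assume "w \<in> f ` ball 0 1"
    then obtain z where z: "z \<in> ball 0 1" "w = f z" by blast
    have "cmod (w - c) = R * cmod ((z - cnj \<rho>) / (1 - \<rho> * z))"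
      unfolding z(2) fz[OF z(1)] using s by (simp add: norm_mult norm_divide R_def)
    also have "\<dots> < R * 1" using blaschke_maps_disc(2)[OF \<rho>, of z] z(1) R by (intro mult_strict_left_mono) auto
    finally show "w \<in> ball c R" by (simp add: dist_norm norm_minus_commute)
  next
    fix w assume w: "w \<in> ball c R"
    define u where "u = of_real s * (w - c) / a 1"
    have "cmod u = s * cmod (w - c) / cmod (a 1)" using s by (simp add: u_def norm_mult norm_divide)
    also have "\<dots> < 1" using w s a1' by (simp add: R_def dist_norm norm_minus_commute field_simps)
    finally have u: "cmod u < 1" .
    \<comment> \<open>The inverse automorphism of the disc.\<close>
    define z where "z = (u + cnj \<rho>) / (1 + \<rho> * u)"
    have m: "cmod (- \<rho>) < 1" using \<rho> by simp
    have z: "z \<in> ball 0 1" using blaschke_maps_disc(2)[OF m u] by (simp add: z_def)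
    have n: "1 + \<rho> * u \<noteq> 0" using blaschke_maps_disc(1)[OF m u] by auto
    have n': "1 - \<rho> * z \<noteq> 0" using blaschke_maps_disc(1)[OF \<rho>, of z] z by auto
    have "z * (1 + \<rho> * u) = u + cnj \<rho>" using n by (simp add: z_def)
    then have "z - cnj \<rho> = u * (1 - \<rho> * z)" by (simp add: algebra_simps)
    then have "(z - cnj \<rho>) / (1 - \<rho> * z) = u" using n' by simp
    then have "f z = c + a 1 / of_real s * u" using fz[OF z] by simp
    also have "\<dots> = w" using s a1' by (simp add: u_def)
    finally show "w \<in> f ` ball 0 1" using z by blast
  qed
  then show ?thesis using R by blast
qed

theorem proposition3p3:
  fixes \<Omega> :: "(real^2) set"
  assumes "open \<Omega>" and "bounded \<Omega>" and "\<Omega> \<noteq> {}"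
    and "simply_connected \<Omega>" and "smooth_boundary \<Omega>"
  shows "\<exists>B\<^sub>0>0. \<forall>B\<in>{0<..<B\<^sub>0}. lambda1N B \<Omega> \<le> lambda1N B (ball 0 (eq_radius \<Omega>))"
proof -
  note op = assms(1) and bd = assms(2) and ne = assms(3)
  define V where "V = measure lebesgue \<Omega>"
  define R where "R = eq_radius \<Omega>"
  have R: "R > 0" and VR: "V = pi * R\<^sup>2" using eq_radius_props[OF op bd ne] by (simp_all add: R_def V_def area_def)
  have V: "V > 0" using R by (simp add: VR)
  have con: "connected \<Omega>" using assms(4) by (rule simply_connected_imp_connected)
  let ?W = "cx ` \<Omega>"
  have oW: "open ?W" by (rule open_cx_image[OF op])
  have "bounded ?W" using bd bounded_linear_cx by (rule bounded_linear_image)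
  then obtain M where M: "\<And>w. w \<in> ?W \<Longrightarrow> cmod w \<le> M" unfolding bounded_iff by blast
  have "\<Omega> homeomorphic ?W"
    by (rule homeomorphicI[of cx \<Omega> ?W vx]) (auto simp: image_image intro: continuous_intros)
  then have "simply_connected ?W" using assms(4) homeomorphic_simply_connected by blast
  moreover have "?W \<noteq> UNIV" using \<open>bounded ?W\<close> not_bounded_UNIV by metis
  moreover have "?W \<noteq> {}" using ne by blast
  ultimately have "\<exists>G f. G holomorphic_on ?W \<and> f holomorphic_on ball 0 1 \<and>
      (\<forall>w\<in>?W. G w \<in> ball 0 1 \<and> f (G w) = w) \<and> (\<forall>z\<in>ball 0 1. f z \<in> ?W \<and> G (f z) = z)"
    using Riemann_mapping_theorem[THEN iffD1, OF conjI[OF oW]] by blast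
  then obtain G f where G: "G holomorphic_on ?W" and f: "f holomorphic_on ball 0 1"
    and fG: "\<And>w. w \<in> ?W \<Longrightarrow> G w \<in> ball 0 1 \<and> f (G w) = w"
    and Gf: "\<And>z. z \<in> ball 0 1 \<Longrightarrow> f z \<in> ?W \<and> G (f z) = z" by blast
  have inj: "inj_on f (ball 0 1)" using Gf by (metis inj_onI)
  have fW: "f ` ball 0 1 = ?W"
  proof (intro equalityI subsetI)
    fix w assume "w \<in> ?W"
    then have "f (G w) = w" "G w \<in> ball 0 1" using fG by auto
    then show "w \<in> f ` ball 0 1" by (metis image_eqI)
  qed (use Gf in blast)
  have fM: "cmod (f z) \<le> M" if "z \<in> ball 0 1" for z using M Gf[OF that] by blast
  have T: "\<Omega> = (\<lambda>x. vx (f (cx x))) ` udisc"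
  proof -
    have "(\<lambda>x. vx (f (cx x))) ` udisc = vx ` (f ` (cx ` udisc))" by (simp add: image_image)
    also have "\<dots> = \<Omega>" using fW by (simp add: cx_ball cx_0 image_image)
    finally show ?thesis ..
  qed
  have df: "(f has_field_derivative deriv f (cx x)) (at (cx x))" if "x \<in> udisc" for x
    using holomorphic_derivI[OF f open_ball, of "cx x"] that by simp
  have inj': "inj_on f (cx ` udisc)" using inj by (simp add: cx_ball cx_0)
  have fin: "\<Omega> \<in> lmeasurable" by (rule bounded_open_finite_measure[OF op bd])
  have i1: "integrable (lebesgue_on \<Omega>) (\<lambda>x. 1::real)"
    using L2_integrable_sq[OF L2_const(1)[OF fin, of 1]] by simp
  note cc = conformal_change[OF open_ball df inj' T _ i1]
  have L: "(\<lambda>x. deriv f (cx x)) \<in> L2 udisc"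
  proof -
    have "continuous_on (ball 0 1) (deriv f)"
      using holomorphic_deriv[OF f open_ball] by (rule holomorphic_on_imp_continuous_on)
    then have "continuous_on udisc (\<lambda>x. deriv f (cx x))"
      by (rule continuous_on_compose2) (auto intro: continuous_intros)
    then have "(\<lambda>x. deriv f (cx x)) \<in> borel_measurable (lebesgue_on udisc)"
      by (rule continuous_imp_measurable_on_sets_lebesgue) auto
    then show ?thesis using cc(1) fin by (simp add: L2_def fmeasurableD)
  qed
  have nV: "nrm2 udisc (\<lambda>x. deriv f (cx x)) = V"
  proof -
    have "V = (LINT x|lebesgue_on \<Omega>. 1)" using L2_const(2)[OF fin, of 1] by (simp add: nrm2_def V_def)
    then show ?thesis using cc(2) fin by (simp add: nrm2_def fmeasurableD)
  qed
  have a1: "taylor f 1 \<noteq> 0"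
    using holomorphic_injective_imp_regular[OF f open_ball inj, of 0] by (simp add: taylor_def)
  show ?thesis
  proof (cases "\<exists>n\<ge>4. taylor f 1 * taylor f (n - 1) \<noteq> taylor f 2 * taylor f (n - 2)")
    case False
    then obtain c r where r: "r > 0" "f ` ball 0 1 = ball c r"
      using geometric_taylor_imp_disc[OF f fM a1] by blast
    have "vx ` cx ` \<Omega> = vx ` cx ` ball (vx c) r" unfolding fW[symmetric] r(2) cx_ball by simp
    then have \<Omega>: "\<Omega> = ball (vx c) r" by (simp add: image_image)
    then have "V = pi * r\<^sup>2" using measure_ball2[of r "vx c"] r(1) by (simp add: V_def)
    then have "R = r" using VR R r(1) by simp
    then show ?thesis using lambda1N_translated_disc[OF r(1), of "vx c"] \<Omega> unfolding R_def by simp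
  next
    case True
    then obtain n where n: "4 \<le> n" "taylor f 1 * taylor f (n - 1) \<noteq> taylor f 2 * taylor f (n - 2)" by blast
    have "0 < nrm2 udisc (\<lambda>x. deriv f (cx x))" unfolding nV by (rule V)
    note st = strict_torsion_bound[OF f fM L this n, unfolded nV]
    then obtain b N where bN: "nrm2 udisc (\<lambda>x. cnj (f (cx x)) * deriv f (cx x) - bergman_proj b N x) < V\<^sup>2 / (2 * pi)"
      using st by blast
    define \<tau> where "\<tau> = nrm2 udisc (\<lambda>x. cnj (f (cx x)) * deriv f (cx x) - bergman_proj b N x)"
    define q where "q z = (\<Sum>j\<le>N. \<Sum>k\<le>N. of_nat (j - k) * b j * cnj (b k) * z ^ (j - k - 1))" for z
    define Q where "Q z = (\<Sum>j\<le>N. \<Sum>k\<le>N. b j * cnj (b k) * z ^ (j - k))" for z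
    have Qd: "(Q has_field_derivative q z) (at z)" for z
      unfolding Q_def[abs_def] q_def by (intro DERIV_sum) (auto intro!: derivative_eq_intros)
    have qc: "continuous_on UNIV q" unfolding q_def[abs_def] by (intro continuous_intros)
    have pq: "bergman_proj b N x = q (cx x)" for x by (simp add: bergman_proj_def q_def mon_def)
    obtain b1 where b1: "b1 > 0" "\<And>B v h. B \<in> {0<..<b1} \<Longrightarrow> wgrad \<Omega> v h \<Longrightarrow> lambda1N B \<Omega> * nrm2 \<Omega> v \<le> energy B \<Omega> v h"
      using lambda1N_small_field[OF op bd ne poincare_set_domain[OF op bd assms(5) con ne]] by blast
    obtain K b2 where K: "K \<ge> 0" "b2 > 0" "\<And>B. B \<in> {0<..<b2} \<Longrightarrow>
        B\<^sup>2 * (potential_energy (ball 0 R) / measure lebesgue (ball (0::real^2) R)) - K * B ^ 3 \<le> lambda1N B (ball 0 R)"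
      using disc_lower_bound[OF R] by auto
    have pe: "potential_energy (ball 0 R) / measure lebesgue (ball (0::real^2) R) = V / (8 * pi)"
      using R unfolding disc_potential_energy[OF R] measure_ball2[OF less_imp_le[OF R]] VR
      by (simp add: field_simps power2_eq_square power4_eq_xxxx)
    \<comment> \<open>The gap between the quadratic coefficients of the lower bound for the disc and of the upper bound for \<open>\<Omega>\<close>.\<close>
    define \<gamma> where "\<gamma> = V / (8 * pi) - \<tau> / (4 * V)"
    have "\<tau> / (4 * V) < V\<^sup>2 / (2 * pi) / (4 * V)" using bN V by (intro divide_strict_right_mono) (auto simp: \<tau>_def)
    also have "\<dots> = V / (8 * pi)" using V by (simp add: field_simps power2_eq_square)
    finally have \<gamma>: "\<gamma> > 0" by (simp add: \<gamma>_def)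
    define B0 where "B0 = min (min b1 b2) (\<gamma> / (K + 1))"
    have B0: "B0 > 0" using b1(1) K(1,2) \<gamma> by (simp add: B0_def)
    have "lambda1N B \<Omega> \<le> lambda1N B (ball 0 R)" if B: "B \<in> {0<..<B0}" for B
    proof -
      have B': "B \<in> {0<..<b1}" "B \<in> {0<..<b2}" "0 < B" "B < \<gamma> / (K + 1)" using B by (auto simp: B0_def)
      obtain v h where vh: "wgrad \<Omega> v h" "nrm2 \<Omega> v = V" "energy B \<Omega> v h = B\<^sup>2 / 4 * \<tau>"
        using conformal_trial_function[OF op bd f G fG Gf Qd qc, of B] unfolding V_def \<tau>_def pq by blast
      have "lambda1N B \<Omega> * V \<le> B\<^sup>2 / 4 * \<tau>" using b1(2)[OF B'(1) vh(1)] vh by simp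
      then have u: "lambda1N B \<Omega> \<le> B\<^sup>2 * (\<tau> / (4 * V))" using V by (simp add: field_simps)
      have l: "B\<^sup>2 * (V / (8 * pi)) - K * B ^ 3 \<le> lambda1N B (ball 0 R)" using K(3)[OF B'(2)] unfolding pe .
      have "K * B \<le> (K + 1) * B" using B'(3) by simp
      also have "\<dots> \<le> \<gamma>" using B'(4) K(1) by (simp add: field_simps)
      finally have "B\<^sup>2 * (K * B) \<le> B\<^sup>2 * \<gamma>" by (intro mult_left_mono) auto
      then have "B\<^sup>2 * (\<tau> / (4 * V)) \<le> B\<^sup>2 * (V / (8 * pi)) - K * B ^ 3"
        by (simp add: \<gamma>_def right_diff_distrib power2_eq_square power3_eq_cube mult_ac)
      then show ?thesis using u l by linarith
    qed
    then show ?thesis using B0 unfolding R_def by blast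
  qed
qed

end
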